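(* Let $I\subset\mathbb{R}$ be an arbitrary interval, let $\mathbf{f}\in L^\infty(I;H)$, and let $\rho$ be a Vishik-Fursikov measure over $I$. Then $\rho$ is carried by $\mathcal{U}_I$.
   Context: Spaces. Fix $\nu>0$ and one of two cases. Periodic case: $\Omega=\prod_{i=1}^3(0,L_i)$, $L_i>0$, and $\mathcal{V}$ is the set of restrictions to $\Omega$ of fields $\mathbf{w}\in C^\infty(\mathbb{R}^3)^3$ that are divergence-free, periodic with period $L_i$ in each direction $x_i$, and satisfy $\int_\Omega\mathbf{w}\,d\mathbf{x}=0$. No-slip case: $\Omega\subset\mathbb{R}^3$ is a bounded domain with smooth boundary (at least of class $C^2$) and $\mathcal{V}$ is the set of divergence-free fields in $C_c^\infty(\Omega)^3$. $H$ (resp. $V$) is the completion of $\mathcal{V}$ in the $L^2(\Omega)^3$ (resp. $H^1(\Omega)^3$) norm. Write $(\mathbf{u},\mathbf{v})_{L^2}=\int_\Omega\mathbf{u}\cdot\mathbf{v}\,d\mathbf{x}$, $|\mathbf{u}|_{L^2}$ for its norm, $((\mathbf{u},\mathbf{v}))_{H^1}=\int_\Omega\sum_{i=1}^3\partial_{x_i}\mathbf{u}\cdot\partial_{x_i}\mathbf{v}\,d\mathbf{x}$ and $\|\mathbf{u}\|_{H^1}$ for its norm. $H$ is identified with its dual, so $V\subset H\subset V'$, with duality product $\langle\cdot,\cdot\rangle_{V',V}$. Define $A:V\to V'$ by $\langle A\mathbf{u},\mathbf{v}\rangle_{V',V}=((\mathbf{u},\mathbf{v}))_{H^1}$, $b(\mathbf{u},\mathbf{v},\mathbf{w})=\int_\Omega(\mathbf{u}\cdot\nabla)\mathbf{v}\cdot\mathbf{w}\,d\mathbf{x}$,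 and $B:V\times V\to V'$ by $\langle B(\mathbf{u},\mathbf{v}),\mathbf{w}\rangle_{V',V}=b(\mathbf{u},\mathbf{v},\mathbf{w})$. For an interval $I\subset\mathbb{R}$, the subscript "loc" on spaces over $I$ refers to compact subintervals of $I$. $H_{\mathrm{w}}$ is $H$ with its weak topology. $\mathcal{C}_{\mathrm{loc}}(I,H_{\mathrm{w}})$ is the space of weakly continuous functions $I\to H$ with the topology of uniform weak convergence on compact subintervals of $I$. Weak solution (always meaning Leray-Hopf weak solution) on an interval $I$, for a given $\mathbf{f}\in L^\infty(I;H)$: a function $\mathbf{u}:I\to H$ such that (i) $\mathbf{u}\in L^\infty_{\mathrm{loc}}(I;H)\cap L^2_{\mathrm{loc}}(I;V)$; (ii) $\partial_t\mathbf{u}\in L^{4/3}_{\mathrm{loc}}(I;V')$; (iii) $\mathbf{u}\in\mathcal{C}_{\mathrm{loc}}(I,H_{\mathrm{w}})$; (iv) $\frac{d\mathbf{u}}{dt}+\nu A\mathbf{u}+B(\mathbf{u},\mathbf{u})=\mathbf{f}$ in the distribution sense on $I$ with values in $V'$; (v) for almost all $t'\in I$ and all $t\in I$ with $t>t'$, $\frac12|\mathbf{u}(t)|_{L^2}^2+\nu\int_{t'}^t\|\mathbf{u}(s)\|_{H^1}^2ds\le\frac12|\mathbf{u}(t')|_{L^2}^2+\int_{t'}^t(\mathbf{f}(s),\mathbf{u}(s))_{L^2}ds$; (vi) if $I$ is closed and bounded on the left with left end point $t_0$, then $\mathbf{u}(t)\to\mathbf{u}(t_0)$ strongly in $H$ as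 $t\to t_0^+$. $\mathcal{U}_I$ is the set of $\mathbf{u}\in\mathcal{C}_{\mathrm{loc}}(I,H_{\mathrm{w}})$ which are weak solutions on $I$, and $\mathcal{U}_I^\sharp$ is the set of $\mathbf{u}\in\mathcal{C}_{\mathrm{loc}}(I,H_{\mathrm{w}})$ which are weak solutions on the interior $I^\circ$ of $I$. A measure is carried by a measurable set if the complement of that set has measure zero. Vishik-Fursikov measure over $I$: a Borel probability measure $\rho$ on $\mathcal{C}_{\mathrm{loc}}(I,H_{\mathrm{w}})$ such that (i) $\rho$ is carried by $\mathcal{U}_I^\sharp$; (ii) $t\mapsto\int_{\mathcal{U}_I^\sharp}|\mathbf{u}(t)|_{L^2}^2\,d\rho(\mathbf{u})$ belongs to $L^\infty_{\mathrm{loc}}(I)$; (iii) if $I$ is closed and bounded on the left with left end point $t_0$, then for every nonnegative, nondecreasing, continuously differentiable $\psi:[0,\infty)\to\mathbb{R}$ with bounded derivative, $\lim_{t\to t_0^+}\int_{\mathcal{U}_I^\sharp}\psi(|\mathbf{u}(t)|_{L^2}^2)\,d\rho(\mathbf{u})=\int_{\mathcal{U}_I^\sharp}\psi(|\mathbf{u}(t_0)|_{L^2}^2)\,d\rho(\mathbf{u})<\infty$. *)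

theory Defs
  imports "HOL-Probability.Probability"
begin

section \<open>Vector fields of class \<open>L\<^sup>2\<close>\<close>

definition square_integrable :: "(real^3 \<Rightarrow> real^3) \<Rightarrow> bool" where
  "square_integrable w \<longleftrightarrow>
     w \<in> borel_measurable lebesgue \<and> integrable lebesgue (\<lambda>x. (norm (w x))\<^sup>2)"

definition ae_equal :: "(real^3 \<Rightarrow> real^3) \<Rightarrow> (real^3 \<Rightarrow> real^3) \<Rightarrow> bool" where
  "ae_equal v w \<longleftrightarrow>
     square_integrable v \<and> square_integrable w \<and> (AE x in lebesgue. v x = w x)"

lemma square_integrable_zero: "square_integrable (\<lambda>x. 0)"
  by (simp add: square_integrable_def)

lemma square_integrable_scaleR:
  assumes "square_integrable v"
  shows "square_integrable (\<lambda>x. c *\<^sub>R v x)"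
  using assms by (auto simp: square_integrable_def power_mult_distrib)

lemma square_integrable_add:
  assumes v: "square_integrable v" and w: "square_integrable w"
  shows "square_integrable (\<lambda>x. v x + w x)"
  unfolding square_integrable_def
proof
  show m: "(\<lambda>x. v x + w x) \<in> borel_measurable lebesgue"
    using v w by (auto simp: square_integrable_def)
  show "integrable lebesgue (\<lambda>x. (norm (v x + w x))\<^sup>2)"
  proof (rule Bochner_Integration.integrable_bound)
    show "integrable lebesgue (\<lambda>x. 2 * (norm (v x))\<^sup>2 + 2 * (norm (w x))\<^sup>2)"
      using v w by (auto simp: square_integrable_def)
    show "(\<lambda>x. (norm (v x + w x))\<^sup>2) \<in> borel_measurable lebesgue"
      using m by measurable
    have "(norm (a + b))\<^sup>2 \<le> 2 * (norm a)\<^sup>2 + 2 * (norm b)\<^sup>2" for a b :: "real^3"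
    proof -
      have "(norm (a + b))\<^sup>2 \<le> (norm a + norm b)\<^sup>2"
        by (simp add: norm_triangle_ineq power_mono)
      also have "\<dots> \<le> 2 * (norm a)\<^sup>2 + 2 * (norm b)\<^sup>2"
        using sum_squares_bound[of "norm a" "norm b"] by (simp add: power2_sum)
      finally show ?thesis .
    qed
    then show "AE x in lebesgue. norm ((norm (v x + w x))\<^sup>2)
        \<le> norm (2 * (norm (v x))\<^sup>2 + 2 * (norm (w x))\<^sup>2)"
      by (intro AE_I2) simp
  qed
qed

lemma square_integrable_inner:
  assumes v: "square_integrable v" and w: "square_integrable w"
  shows "integrable lebesgue (\<lambda>x. v x \<bullet> w x)"
proof (rule Bochner_Integration.integrable_bound)
  show "integrable lebesgue (\<lambda>x. (norm (v x))\<^sup>2 + (norm (w x))\<^sup>2)"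
    using v w by (auto simp: square_integrable_def)
  show "(\<lambda>x. v x \<bullet> w x) \<in> borel_measurable lebesgue"
    using v w by (auto simp: square_integrable_def)
  have "\<bar>a \<bullet> b\<bar> \<le> (norm a)\<^sup>2 + (norm b)\<^sup>2" for a b :: "real^3"
  proof -
    have "\<bar>a \<bullet> b\<bar> \<le> norm a * norm b"
      by (rule Cauchy_Schwarz_ineq2)
    also have "\<dots> \<le> (norm a)\<^sup>2 + (norm b)\<^sup>2"
      using sum_squares_bound[of "norm a" "norm b"] mult_nonneg_nonneg[OF norm_ge_zero norm_ge_zero, of a b]
      unfolding mult.assoc by linarith
    finally show ?thesis .
  qed
  then show "AE x in lebesgue. norm (v x \<bullet> w x) \<le> norm ((norm (v x))\<^sup>2 + (norm (w x))\<^sup>2)"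
    by (intro AE_I2) simp
qed

text \<open>The type \<open>L2_field\<close> is \<open>L\<^sup>2(\<real>\<^sup>3)\<^sup>3\<close>; for \<open>\<Omega> \<subseteq> \<real>\<^sup>3\<close> the space \<open>L\<^sup>2(\<Omega>)\<^sup>3\<close> is
  identified with its subspace of classes vanishing outside \<open>\<Omega>\<close>.\<close>

quotient_type L2_field = "real^3 \<Rightarrow> real^3" / partial: ae_equal
proof (rule part_equivpI)
  show "\<exists>w. ae_equal w w"
    using square_integrable_zero by (auto simp: ae_equal_def)
  show "symp ae_equal"
    by (auto simp: symp_def ae_equal_def)
  show "transp ae_equal"
    by (rule transpI) (auto simp: ae_equal_def)
qed

instantiation L2_field :: real_inner
begin

lift_definition zero_L2_field :: L2_field is "\<lambda>x. 0"
  by (simp add: ae_equal_def square_integrable_zero)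

lift_definition plus_L2_field :: "L2_field \<Rightarrow> L2_field \<Rightarrow> L2_field" is "\<lambda>v w x. v x + w x"
  by (auto simp: ae_equal_def intro: square_integrable_add)

lift_definition scaleR_L2_field :: "real \<Rightarrow> L2_field \<Rightarrow> L2_field" is "\<lambda>c v x. c *\<^sub>R v x"
  by (auto simp: ae_equal_def intro: square_integrable_scaleR)

lift_definition inner_L2_field :: "L2_field \<Rightarrow> L2_field \<Rightarrow> real"
  is "\<lambda>v w. LINT x|lebesgue. v x \<bullet> w x"
proof -
  fix v v' w w' :: "real^3 \<Rightarrow> real^3"
  assume "ae_equal v v'" "ae_equal w w'"
  then show "(LINT x|lebesgue. v x \<bullet> w x) = (LINT x|lebesgue. v' x \<bullet> w' x)"
    by (intro integral_cong_AE)
      (auto simp: ae_equal_def square_integrable_def)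
qed

definition "uminus (u :: L2_field) = (- 1) *\<^sub>R u"
definition "(u :: L2_field) - v = u + (- v)"
definition "norm (u :: L2_field) = sqrt (u \<bullet> u)"
definition "sgn (u :: L2_field) = inverse (norm u) *\<^sub>R u"
definition "dist (u :: L2_field) v = norm (u - v)"
definition "uniformity = (INF e\<in>{0<..}. principal {(u :: L2_field, v). dist u v < e})"
definition "open (U :: L2_field set) \<longleftrightarrow>
  (\<forall>x\<in>U. eventually (\<lambda>(x', y). x' = x \<longrightarrow> y \<in> U) uniformity)"

instance
proof
  fix u v w :: L2_field and a b :: real
  show "u + v + w = u + (v + w)"
    by transfer (auto simp: ae_equal_def add.assoc intro!: square_integrable_add)
  show "u + v = v + u"
    by transfer (auto simp: ae_equal_def add.commute intro!: square_integrable_add)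
  show "0 + u = u"
    by transfer (auto simp: ae_equal_def)
  have zero: "0 *\<^sub>R u = 0"
    by transfer (auto simp: ae_equal_def square_integrable_zero)
  have add: "(a + b) *\<^sub>R u = a *\<^sub>R u + b *\<^sub>R u" for a b
    by transfer
      (auto simp: ae_equal_def scaleR_add_left
        intro!: square_integrable_add square_integrable_scaleR
          square_integrable_scaleR[of _ "_ + _", unfolded scaleR_add_left])
  have one: "1 *\<^sub>R u = u"
    by transfer (auto simp: ae_equal_def)
  show "(a + b) *\<^sub>R u = a *\<^sub>R u + b *\<^sub>R u"
    by (rule add)
  show "1 *\<^sub>R u = u"
    by (rule one)
  show "- u + u = 0"
    using add[of "- 1" 1] by (simp add: uminus_L2_field_def one zero)
  show "u - v = u + - v"
    by (rule minus_L2_field_def)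
  show "a *\<^sub>R (u + v) = a *\<^sub>R u + a *\<^sub>R v"
    by transfer
      (auto simp: ae_equal_def scaleR_add_right
        intro!: square_integrable_add square_integrable_scaleR)
  show "a *\<^sub>R b *\<^sub>R u = (a * b) *\<^sub>R u"
    by transfer (auto simp: ae_equal_def intro!: square_integrable_scaleR)
  show "dist u v = norm (u - v)"
    by (rule dist_L2_field_def)
  show "sgn u = inverse (norm u) *\<^sub>R u"
    by (rule sgn_L2_field_def)
  show "uniformity = (INF e\<in>{0<..}. principal {(u :: L2_field, v). dist u v < e})"
    by (rule uniformity_L2_field_def)
  show "open U \<longleftrightarrow> (\<forall>x\<in>U. eventually (\<lambda>(x', y). x' = x \<longrightarrow> y \<in> U) uniformity)"
    for U :: "L2_field set"
    by (rule open_L2_field_def)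
  show "u \<bullet> v = v \<bullet> u"
    by transfer (simp add: inner_commute)
  show "(u + v) \<bullet> w = u \<bullet> w + v \<bullet> w"
    by transfer
      (auto simp: ae_equal_def inner_add_left intro!: Bochner_Integration.integral_add square_integrable_inner)
  show "(a *\<^sub>R u) \<bullet> v = a * (u \<bullet> v)"
    by transfer simp
  show "0 \<le> u \<bullet> u"
    by transfer (simp add: Bochner_Integration.integral_nonneg)
  show "u \<bullet> u = 0 \<longleftrightarrow> u = 0"
  proof transfer
    fix u :: "real^3 \<Rightarrow> real^3"
    assume "ae_equal u u"
    then have u: "square_integrable u"
      by (simp add: ae_equal_def)
    have "(LINT x|lebesgue. u x \<bullet> u x) = 0 \<longleftrightarrow> (AE x in lebesgue. u x \<bullet> u x = 0)"
      by (intro integral_nonneg_eq_0_iff_AE square_integrable_inner u) auto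
    then show "(LINT x|lebesgue. u x \<bullet> u x) = 0 \<longleftrightarrow> ae_equal u (\<lambda>x. 0)"
      using u square_integrable_zero by (simp add: ae_equal_def)
  qed
  show "norm u = sqrt (u \<bullet> u)"
    by (rule norm_L2_field_def)
qed

end

definition class_on :: "(real^3) set \<Rightarrow> (real^3 \<Rightarrow> real^3) \<Rightarrow> L2_field" where
  "class_on \<Omega> w = abs_L2_field (\<lambda>x. indicator \<Omega> x *\<^sub>R w x)"

definition L2_on :: "(real^3) set \<Rightarrow> L2_field set" where
  "L2_on \<Omega> = {u. AE x in lebesgue. x \<notin> \<Omega> \<longrightarrow> rep_L2_field u x = 0}"


section \<open>Smooth functions and weak derivatives\<close>

text \<open>\<open>C_diff n S w\<close>: all directional derivatives of \<open>w\<close> up to order \<open>n\<close> exist and are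
  continuous on the open set \<open>S\<close>.\<close>

primrec C_diff ::
  "nat \<Rightarrow> 'a::real_normed_vector set \<Rightarrow> ('a \<Rightarrow> 'b::real_normed_vector) \<Rightarrow> bool" where
  "C_diff 0 S w \<longleftrightarrow> continuous_on S w"
| "C_diff (Suc n) S w \<longleftrightarrow> (\<forall>x\<in>S. w differentiable (at x)) \<and>
     (\<forall>h. C_diff n S (\<lambda>x. frechet_derivative w (at x) h))"

definition smooth :: "('a::real_normed_vector \<Rightarrow> 'b::real_normed_vector) \<Rightarrow> bool" where
  "smooth w \<longleftrightarrow> (\<forall>n. C_diff n UNIV w)"

text \<open>\<open>C\<^sub>c\<^sup>\<infinity>(S)\<close> for open \<open>S\<close>, the functions being extended by zero to the whole space.\<close>

definition test_functions ::
  "'a::real_normed_vector set \<Rightarrow> ('a \<Rightarrow> 'b::real_normed_vector) set" where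
  "test_functions S =
     {w. smooth w \<and> compact (closure {x. w x \<noteq> 0}) \<and> closure {x. w x \<noteq> 0} \<subseteq> S}"

definition partial_deriv :: "3 \<Rightarrow> (real^3 \<Rightarrow> real^3) \<Rightarrow> real^3 \<Rightarrow> real^3" where
  "partial_deriv i w x = frechet_derivative w (at x) (axis i 1)"

definition divergence_free :: "(real^3 \<Rightarrow> real^3) \<Rightarrow> bool" where
  "divergence_free w \<longleftrightarrow> (\<forall>x. (\<Sum>i\<in>UNIV. partial_deriv i w x $ i) = 0)"

definition has_weak_gradient :: "(real^3) set \<Rightarrow> L2_field \<Rightarrow> L2_field^3 \<Rightarrow> bool" where
  "has_weak_gradient \<Omega> u G \<longleftrightarrow>
     (\<forall>i. G $ i \<in> L2_on \<Omega> \<and>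
        (\<forall>\<phi>\<in>test_functions \<Omega>.
           u \<bullet> class_on \<Omega> (partial_deriv i \<phi>) = - (G $ i \<bullet> class_on \<Omega> \<phi>)))"

definition H1_on :: "(real^3) set \<Rightarrow> L2_field set" where
  "H1_on \<Omega> = {u \<in> L2_on \<Omega>. \<exists>G. has_weak_gradient \<Omega> u G}"

definition weak_gradient :: "(real^3) set \<Rightarrow> L2_field \<Rightarrow> L2_field^3" where
  "weak_gradient \<Omega> u = (THE G. has_weak_gradient \<Omega> u G)"


section \<open>The two flow settings\<close>

datatype setting = Periodic "real^3" | No_Slip "(real^3) set"

text \<open>The boundary of \<open>\<Omega>\<close> is locally, in suitable orthonormal coordinates, the graph of a
  \<open>C\<^sup>2\<close> function with \<open>\<Omega>\<close> lying on one side of it.\<close>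

definition C2_boundary :: "(real^3) set \<Rightarrow> bool" where
  "C2_boundary \<Omega> \<longleftrightarrow>
     (\<forall>x0 \<in> frontier \<Omega>. \<exists>r > 0. \<exists>Q :: real^3 \<Rightarrow> real^3. \<exists>\<gamma> :: real \<times> real \<Rightarrow> real.
        orthogonal_transformation Q \<and> C_diff 2 UNIV \<gamma> \<and>
        (\<forall>x \<in> ball x0 r. x \<in> \<Omega> \<longleftrightarrow> Q x $ 3 > \<gamma> (Q x $ 1, Q x $ 2)))"

fun valid_setting :: "setting \<Rightarrow> bool" where
  "valid_setting (Periodic L) \<longleftrightarrow> (\<forall>i. L $ i > 0)"
| "valid_setting (No_Slip \<Omega>) \<longleftrightarrow>
     \<Omega> \<noteq> {} \<and> open \<Omega> \<and> connected \<Omega> \<and> bounded \<Omega> \<and> C2_boundary \<Omega>"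

fun flow_domain :: "setting \<Rightarrow> (real^3) set" where
  "flow_domain (Periodic L) = {x. \<forall>i. 0 < x $ i \<and> x $ i < L $ i}"
| "flow_domain (No_Slip \<Omega>) = \<Omega>"

fun smooth_fields :: "setting \<Rightarrow> (real^3 \<Rightarrow> real^3) set" where
  "smooth_fields (Periodic L) =
     {w. smooth w \<and> divergence_free w \<and> (\<forall>x i. w (x + L $ i *\<^sub>R axis i 1) = w x) \<and>
         (LINT x : flow_domain (Periodic L) | lebesgue. w x) = 0}"
| "smooth_fields (No_Slip \<Omega>) = {w \<in> test_functions \<Omega>. divergence_free w}"


section \<open>Function spaces and operators\<close>

text \<open>The completions of the space of smooth fields are realised as its closures in
  \<open>L\<^sup>2(\<Omega>)\<^sup>3\<close> and in \<open>H\<^sup>1(\<Omega>)\<^sup>3\<close>.\<close>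

definition space_H :: "setting \<Rightarrow> L2_field set" where
  "space_H S = closure (class_on (flow_domain S) ` smooth_fields S)"

abbreviation grad :: "setting \<Rightarrow> L2_field \<Rightarrow> L2_field^3" where
  "grad S \<equiv> weak_gradient (flow_domain S)"

definition space_V :: "setting \<Rightarrow> L2_field set" where
  "space_V S = {u \<in> H1_on (flow_domain S). \<forall>\<epsilon> > 0. \<exists>w \<in> smooth_fields S.
     sqrt ((norm (u - class_on (flow_domain S) w))\<^sup>2 + (norm (grad S (u - class_on (flow_domain S) w)))\<^sup>2) < \<epsilon>}"

text \<open>\<open>V\<close> is normed by the gradient alone; on \<open>V\<close> this is equivalent to the full \<open>H\<^sup>1\<close> norm used
  for the closure above (Poincare inequality).\<close>

definition inner_V :: "setting \<Rightarrow> L2_field \<Rightarrow> L2_field \<Rightarrow> real" where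
  "inner_V S u v = (\<Sum>i\<in>UNIV. grad S u $ i \<bullet> grad S v $ i)"

definition norm_V :: "setting \<Rightarrow> L2_field \<Rightarrow> real" where
  "norm_V S u = sqrt (inner_V S u u)"

text \<open>Elements of \<open>V'\<close> are functionals on \<open>V\<close>, with the value \<^const>\<open>undefined\<close> outside \<open>V\<close>; the
  duality product \<open>\<langle>l, v\<rangle>\<close> is the application \<open>l v\<close>.\<close>

definition dual_V :: "setting \<Rightarrow> (L2_field \<Rightarrow> real) set" where
  "dual_V S = {l \<in> extensional (space_V S).
     (\<forall>v\<in>space_V S. \<forall>w\<in>space_V S. l (v + w) = l v + l w) \<and>
     (\<forall>c. \<forall>v\<in>space_V S. l (c *\<^sub>R v) = c * l v) \<and>
     (\<exists>C. \<forall>v\<in>space_V S. \<bar>l v\<bar> \<le> C * norm_V S v)}"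

definition norm_dual :: "setting \<Rightarrow> (L2_field \<Rightarrow> real) \<Rightarrow> real" where
  "norm_dual S l = Sup {\<bar>l v\<bar> | v. v \<in> space_V S \<and> norm_V S v \<le> 1}"

definition embed_dual :: "setting \<Rightarrow> L2_field \<Rightarrow> L2_field \<Rightarrow> real" where
  "embed_dual S u = (\<lambda>v\<in>space_V S. u \<bullet> v)"

definition op_A :: "setting \<Rightarrow> L2_field \<Rightarrow> L2_field \<Rightarrow> real" where
  "op_A S u = (\<lambda>v\<in>space_V S. inner_V S u v)"

definition form_b :: "setting \<Rightarrow> L2_field \<Rightarrow> L2_field \<Rightarrow> L2_field \<Rightarrow> real" where
  "form_b S u v w = (LINT x : flow_domain S | lebesgue.
     (\<Sum>i\<in>UNIV. rep_L2_field u x $ i *\<^sub>R rep_L2_field (grad S v $ i) x) \<bullet> rep_L2_field w x)"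

definition op_B :: "setting \<Rightarrow> L2_field \<Rightarrow> L2_field \<Rightarrow> L2_field \<Rightarrow> real" where
  "op_B S u v = (\<lambda>w\<in>space_V S. form_b S u v w)"


section \<open>Lebesgue-Bochner spaces on an interval\<close>

text \<open>A normed space is given here by a carrier \<open>X\<close> and a norm \<open>N\<close> on it; \<open>J\<close> is an interval.
  Measurability is strong (Bochner) measurability.\<close>

definition bochner_measurable_on ::
  "'x::minus set \<Rightarrow> ('x \<Rightarrow> real) \<Rightarrow> real set \<Rightarrow> (real \<Rightarrow> 'x) \<Rightarrow> bool" where
  "bochner_measurable_on X N J g \<longleftrightarrow>
     (AE t in lebesgue_on J. g t \<in> X) \<and>
     (\<exists>s :: nat \<Rightarrow> real \<Rightarrow> 'x.
        (\<forall>n. simple_function (lebesgue_on J) (s n) \<and> s n ` J \<subseteq> X) \<and>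
        (AE t in lebesgue_on J. (\<lambda>n. N (s n t - g t)) \<longlonglongrightarrow> 0))"

definition L_p :: "real \<Rightarrow> 'x::minus set \<Rightarrow> ('x \<Rightarrow> real) \<Rightarrow> real set \<Rightarrow> (real \<Rightarrow> 'x) set" where
  "L_p p X N J = {g. bochner_measurable_on X N J g \<and>
     (\<integral>\<^sup>+ t. ennreal (N (g t) powr p) \<partial>lebesgue_on J) < \<infinity>}"

definition L_infinity :: "'x::minus set \<Rightarrow> ('x \<Rightarrow> real) \<Rightarrow> real set \<Rightarrow> (real \<Rightarrow> 'x) set" where
  "L_infinity X N J = {g. bochner_measurable_on X N J g \<and>
     (\<exists>C. AE t in lebesgue_on J. N (g t) \<le> C)}"

definition loc :: "(real set \<Rightarrow> (real \<Rightarrow> 'x) set) \<Rightarrow> real set \<Rightarrow> (real \<Rightarrow> 'x) set" where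
  "loc F I = {g. \<forall>a b. {a..b} \<subseteq> I \<longrightarrow> g \<in> F {a..b}}"

text \<open>The distribution on \<open>I\<close> with values in \<open>V'\<close> given by \<open>F : I \<rightarrow> V'\<close>, tested with \<open>\<phi>\<close> and
  evaluated at \<open>v \<in> V\<close>, and its derivative; the evaluation at \<open>v\<close> has been taken inside the
  \<open>V'\<close>-valued integral.\<close>

definition dual_distribution ::
  "real set \<Rightarrow> (real \<Rightarrow> L2_field \<Rightarrow> real) \<Rightarrow> (real \<Rightarrow> real) \<Rightarrow> L2_field \<Rightarrow> real"
  where "dual_distribution I F \<phi> v = (LINT t : interior I | lebesgue. \<phi> t * F t v)"

definition dual_distribution_deriv ::
  "real set \<Rightarrow> (real \<Rightarrow> L2_field \<Rightarrow> real) \<Rightarrow> (real \<Rightarrow> real) \<Rightarrow> L2_field \<Rightarrow> real"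
  where "dual_distribution_deriv I F \<phi> v = - dual_distribution I F (deriv \<phi>) v"


section \<open>The space of weakly continuous paths\<close>

definition H_weak :: "setting \<Rightarrow> L2_field topology" where
  "H_weak S = topology_generated_by
     {{x \<in> space_H S. x \<bullet> w \<in> U} | w U. w \<in> space_H S \<and> open U}"

text \<open>A function on \<open>I\<close> is a function on \<open>\<real>\<close> with the value \<^const>\<open>undefined\<close> outside \<open>I\<close>.\<close>

definition paths :: "setting \<Rightarrow> real set \<Rightarrow> (real \<Rightarrow> L2_field) set" where
  "paths S I = {u \<in> extensional I. continuous_map (top_of_set I) (H_weak S) u}"

text \<open>Since \<open>{a..b}\<close> is compact, the generating sets below are open for uniform weak convergence
  on compact subintervals, and they form a subbasis of that topology.\<close>

definition path_topology :: "setting \<Rightarrow> real set \<Rightarrow> (real \<Rightarrow> L2_field) topology" where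
  "path_topology S I = topology_generated_by
     {{v \<in> paths S I. \<forall>t\<in>{a..b}. \<bar>(v t - u t) \<bullet> w\<bar> < \<epsilon>} | u a b w \<epsilon>.
        u \<in> paths S I \<and> {a..b} \<subseteq> I \<and> w \<in> space_H S \<and> \<epsilon> > 0}"


section \<open>Leray-Hopf weak solutions\<close>

definition left_endpoint :: "real set \<Rightarrow> real \<Rightarrow> bool" where
  "left_endpoint I t0 \<longleftrightarrow> t0 \<in> I \<and> (\<forall>t\<in>I. t0 \<le> t)"

definition energy_inequality ::
  "real \<Rightarrow> setting \<Rightarrow> (real \<Rightarrow> L2_field) \<Rightarrow> (real \<Rightarrow> L2_field) \<Rightarrow> real \<Rightarrow> real \<Rightarrow> bool" where
  "energy_inequality \<nu> S f u t' t \<longleftrightarrow>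
     1/2 * (norm (u t))\<^sup>2 + \<nu> * (LINT s : {t'..t} | lebesgue. (norm_V S (u s))\<^sup>2)
       \<le> 1/2 * (norm (u t'))\<^sup>2 + (LINT s : {t'..t} | lebesgue. f s \<bullet> u s)"

definition weak_solution ::
  "real \<Rightarrow> setting \<Rightarrow> (real \<Rightarrow> L2_field) \<Rightarrow> real set \<Rightarrow> (real \<Rightarrow> L2_field) \<Rightarrow> bool" where
  "weak_solution \<nu> S f I u \<longleftrightarrow>
     u \<in> loc (L_infinity (space_H S) norm) I \<and>
     u \<in> loc (L_p 2 (space_V S) (norm_V S)) I \<and>
     (\<exists>g \<in> loc (L_p (4/3) (dual_V S) (norm_dual S)) I.
        \<forall>\<phi>\<in>test_functions (interior I). \<forall>v\<in>space_V S.
          dual_distribution_deriv I (\<lambda>t. embed_dual S (u t)) \<phi> v = dual_distribution I g \<phi> v) \<and>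
     continuous_map (top_of_set I) (H_weak S) u \<and>
     (\<forall>\<phi>\<in>test_functions (interior I). \<forall>v\<in>space_V S.
        dual_distribution_deriv I (\<lambda>t. embed_dual S (u t)) \<phi> v
          + \<nu> * dual_distribution I (\<lambda>t. op_A S (u t)) \<phi> v
          + dual_distribution I (\<lambda>t. op_B S (u t) (u t)) \<phi> v
          = dual_distribution I (\<lambda>t. embed_dual S (f t)) \<phi> v) \<and>
     (AE t' in lebesgue_on I. \<forall>t\<in>I. t' < t \<longrightarrow> energy_inequality \<nu> S f u t' t) \<and>
     (\<forall>t0. left_endpoint I t0 \<longrightarrow> (u \<longlongrightarrow> u t0) (at t0 within I))"

definition solutions ::
  "real \<Rightarrow> setting \<Rightarrow> (real \<Rightarrow> L2_field) \<Rightarrow> real set \<Rightarrow> (real \<Rightarrow> L2_field) set" where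
  "solutions \<nu> S f I = {u \<in> paths S I. weak_solution \<nu> S f I u}"

definition solutions_sharp ::
  "real \<Rightarrow> setting \<Rightarrow> (real \<Rightarrow> L2_field) \<Rightarrow> real set \<Rightarrow> (real \<Rightarrow> L2_field) set" where
  "solutions_sharp \<nu> S f I = {u \<in> paths S I. weak_solution \<nu> S f (interior I) u}"


section \<open>Vishik-Fursikov measures\<close>

definition borel_probability :: "'a topology \<Rightarrow> 'a measure \<Rightarrow> bool" where
  "borel_probability T \<rho> \<longleftrightarrow> prob_space \<rho> \<and> space \<rho> = topspace T \<and>
     sets \<rho> = sigma_sets (topspace T) {U. openin T U}"

definition carried_by :: "'a measure \<Rightarrow> 'a set \<Rightarrow> bool" where
  "carried_by \<rho> E \<longleftrightarrow> E \<in> sets \<rho> \<and> emeasure \<rho> (space \<rho> - E) = 0"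

definition admissible_psi :: "(real \<Rightarrow> real) \<Rightarrow> bool" where
  "admissible_psi \<psi> \<longleftrightarrow> (\<forall>x\<ge>0. \<psi> x \<ge> 0) \<and> mono_on {0..} \<psi> \<and>
     (\<exists>\<psi>'. (\<forall>x\<ge>0. (\<psi> has_real_derivative \<psi>' x) (at x within {0..})) \<and>
           continuous_on {0..} \<psi>' \<and> bounded (\<psi>' ` {0..}))"

definition Vishik_Fursikov_measure ::
  "real \<Rightarrow> setting \<Rightarrow> (real \<Rightarrow> L2_field) \<Rightarrow> real set \<Rightarrow> (real \<Rightarrow> L2_field) measure \<Rightarrow> bool" where
  "Vishik_Fursikov_measure \<nu> S f I \<rho> \<longleftrightarrow>
     borel_probability (path_topology S I) \<rho> \<and>
     carried_by \<rho> (solutions_sharp \<nu> S f I) \<and>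
     (let E = (\<lambda>t. \<integral>\<^sup>+ u \<in> solutions_sharp \<nu> S f I. ennreal ((norm (u t))\<^sup>2) \<partial>\<rho>) in
        \<forall>a b. {a..b} \<subseteq> I \<longrightarrow> E \<in> borel_measurable (lebesgue_on {a..b}) \<and>
          (\<exists>C::real. AE t in lebesgue_on {a..b}. E t \<le> ennreal C)) \<and>
     (\<forall>t0 \<psi>. left_endpoint I t0 \<longrightarrow> admissible_psi \<psi> \<longrightarrow>
        (let E = (\<lambda>t. \<integral>\<^sup>+ u \<in> solutions_sharp \<nu> S f I. ennreal (\<psi> ((norm (u t))\<^sup>2)) \<partial>\<rho>) in
           (E \<longlongrightarrow> E t0) (at t0 within I) \<and> E t0 < \<infinity>))"

end

theory Submission imports Defs begin

text \<open>On \<open>I\<close> with closed left end point \<open>t0\<close>, an element of \<open>\<U>\<^sub>I\<^sup>\<sharp>\<close> fails to be a weak solution on \<open>I\<close> only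
  through lack of strong right continuity at \<open>t0\<close>: the energy inequality bounds \<open>|u|\<close> and the time
  integral of \<open>\<parallel>u\<parallel>\<^sup>2\<close> up to the end points, and the residual \<open>f - \<nu>Au - B(u,u)\<close>, which represents
  the time derivative, is bounded in \<open>L^(4/3)\<close> through the Sobolev embedding.

  The energy inequality also yields \<open>|u(t)| \<le> |u(s)| + 2C(t - s)\<close> for almost all \<open>s < t\<close>, so strong
  right continuity follows once some times \<open>s\<close> close to \<open>t0\<close> have \<open>|u(s)|\<close> close to \<open>|u(t0)|\<close>. By weak
  lower semicontinuity \<open>|u(t0)|\<close> is at most the lower limit of \<open>|u(s)|\<close>, and condition (iii) with
  \<open>\<psi>(x) = x / (1 + x)\<close>, averaged over shrinking time intervals, forces equality for almost every
  \<open>u\<close> by Fatou's lemma: the lower limit of the averages of \<open>\<psi>(|u(s)|\<^sup>2)\<close> is \<open>\<psi>(|u(t0)|\<^sup>2)\<close>.\<close>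

section \<open>The space of square integrable fields\<close>

text \<open>Two obstacles shape the proof. The null set of times from which the energy inequality
  cannot be started depends on the path, so a fixed sequence of times tending to t0 need not be
  usable for almost every path; averages over time intervals ignore null sets, at the price of
  measurability in time and path jointly. And a set that carries a measure must itself be
  measurable: right continuity at t0 has to be rewritten as a condition at countably many rational
  times, which weak lower semicontinuity of the norm makes possible.

  V is a closure of smooth fields, so the Poincare and Sobolev inequalities are proved for smooth
  fields on a box, by integration along lines parallel to the axes, and then passed to the limit.
  The exponent 4/3 comes from |b(u,u,v)| \<le> K |u|^(1/2) \<parallel>u\<parallel>^(3/2)
  \<parallel>v\<parallel>: while |u| stays bounded, the power 4/3 of the dual norm of B(u,u) grows
  like \<parallel>u\<parallel>^2, which is integrable in time.\<close>

lemma square_integrable_rep: "square_integrable (rep_L2_field u)"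
  using Quotient3_rep_reflp[OF Quotient3_L2_field, of u] by (simp add: ae_equal_def)

lemma measurable_rep [measurable]: "rep_L2_field u \<in> borel_measurable lebesgue"
  using square_integrable_rep by (simp add: square_integrable_def)

lemma rep_abs_AE:
  assumes "square_integrable w"
  shows "AE x in lebesgue. rep_L2_field (abs_L2_field w) x = w x"
proof -
  have "ae_equal (rep_L2_field (abs_L2_field w)) w"
    by (rule rep_abs_rsp_left[OF Quotient3_L2_field]) (use assms in \<open>simp add: ae_equal_def\<close>)
  then show ?thesis by (simp add: ae_equal_def)
qed

lemma abs_rep_L2: "abs_L2_field (rep_L2_field u) = u"
  by (rule Quotient3_abs_rep[OF Quotient3_L2_field])

lemma abs_L2_eqI:
  assumes "square_integrable v" "square_integrable w" "AE x in lebesgue. v x = w x"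
  shows "abs_L2_field v = abs_L2_field w"
  using Quotient3_rel[OF Quotient3_L2_field, of v w] assms by (auto simp: ae_equal_def)

lemma L2_eqI:
  assumes "AE x in lebesgue. rep_L2_field u x = rep_L2_field v x"
  shows "u = v"
  using abs_L2_eqI[OF square_integrable_rep square_integrable_rep assms] by (simp add: abs_rep_L2)

lemma abs_L2_add:
  assumes "square_integrable v" "square_integrable w"
  shows "abs_L2_field v + abs_L2_field w = abs_L2_field (\<lambda>x. v x + w x)"
  by (rule plus_L2_field.abs_eq) (use assms in \<open>auto simp: ae_equal_def\<close>)

lemma abs_L2_scaleR:
  assumes "square_integrable v"
  shows "c *\<^sub>R abs_L2_field v = abs_L2_field (\<lambda>x. c *\<^sub>R v x)"
  by (rule scaleR_L2_field.abs_eq) (use assms in \<open>auto simp: ae_equal_def\<close>)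

lemma abs_L2_zero: "abs_L2_field (\<lambda>x. 0) = 0"
  by (simp add: zero_L2_field_def)

lemma abs_L2_inner:
  assumes "square_integrable v" "square_integrable w"
  shows "abs_L2_field v \<bullet> abs_L2_field w = (LINT x|lebesgue. v x \<bullet> w x)"
  by (rule inner_L2_field.abs_eq) (use assms in \<open>auto simp: ae_equal_def\<close>)

lemma inner_L2_rep: "u \<bullet> v = (LINT x|lebesgue. rep_L2_field u x \<bullet> rep_L2_field v x)"
  using abs_L2_inner[OF square_integrable_rep square_integrable_rep, of u v] by (simp add: abs_rep_L2)

lemma rep_add_AE:
  "AE x in lebesgue. rep_L2_field (u + v) x = rep_L2_field u x + rep_L2_field v x"
  using rep_abs_AE[OF square_integrable_add[OF square_integrable_rep square_integrable_rep], of u v]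
    abs_L2_add[OF square_integrable_rep square_integrable_rep, of u v]
  by (simp add: abs_rep_L2)

lemma rep_scaleR_AE:
  "AE x in lebesgue. rep_L2_field (c *\<^sub>R u) x = c *\<^sub>R rep_L2_field u x"
  using rep_abs_AE[OF square_integrable_scaleR[OF square_integrable_rep], of c u]
    abs_L2_scaleR[OF square_integrable_rep, of c u]
  by (simp add: abs_rep_L2)

lemma rep_zero_AE: "AE x in lebesgue. rep_L2_field 0 x = 0"
  using rep_abs_AE[OF square_integrable_zero] by (simp add: abs_L2_zero)

lemma rep_diff_AE:
  "AE x in lebesgue. rep_L2_field (u - v) x = rep_L2_field u x - rep_L2_field v x"
proof -
  have "AE x in lebesgue. rep_L2_field (u + (- 1) *\<^sub>R v) x
      = rep_L2_field u x + rep_L2_field ((- 1) *\<^sub>R v) x"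
    by (rule rep_add_AE)
  then show ?thesis
    using rep_scaleR_AE[of "- 1" v] by eventually_elim simp
qed

lemma norm_L2_square: "(norm u)\<^sup>2 = (LINT x|lebesgue. (norm (rep_L2_field u x))\<^sup>2)"
  by (simp add: power2_norm_eq_inner inner_L2_rep)

lemma integrable_rep_square: "integrable lebesgue (\<lambda>x. (norm (rep_L2_field u x))\<^sup>2)"
  using square_integrable_rep by (simp add: square_integrable_def)

lemma nn_integral_rep_square:
  "(\<integral>\<^sup>+x. ennreal (norm (rep_L2_field u x))^2 \<partial>lebesgue) = ennreal ((norm u)\<^sup>2)"
  using nn_integral_eq_integral[OF integrable_rep_square, of u]
  by (simp add: norm_L2_square ennreal_power)

text \<open>Needed to carry the L^6 bound from smooth fields to \<open>space_V\<close> by Fatou's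
  lemma, which works with pointwise limits of representatives.\<close>

lemma L2_AE_subseq:
  assumes "(\<lambda>n. norm (X n - u)) \<longlonglongrightarrow> 0"
  obtains r :: "nat \<Rightarrow> nat" where "strict_mono r"
    "AE x in lebesgue. (\<lambda>n. rep_L2_field (X (r n)) x) \<longlonglongrightarrow> rep_L2_field u x"
proof -
  let ?f = "\<lambda>n x. (norm (rep_L2_field (X n - u) x))\<^sup>2"
  have "(\<lambda>n. (norm (X n - u))\<^sup>2) \<longlonglongrightarrow> 0"
    using tendsto_power[OF assms, of 2] by simp
  then have "(\<lambda>n. LINT x|lebesgue. norm (?f n x)) \<longlonglongrightarrow> 0"
    by (simp add: norm_L2_square)
  then obtain r :: "nat \<Rightarrow> nat" where r: "strict_mono r"
    "AE x in lebesgue. (\<lambda>n. ?f (r n) x) \<longlonglongrightarrow> 0"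
    using tendsto_L1_AE_subseq[of lebesgue ?f] integrable_rep_square by blast
  have "AE x in lebesgue. \<forall>n. rep_L2_field (X (r n) - u) x = rep_L2_field (X (r n)) x - rep_L2_field u x"
    by (simp add: AE_all_countable rep_diff_AE)
  with r(2) have "AE x in lebesgue. (\<lambda>n. rep_L2_field (X (r n)) x) \<longlonglongrightarrow> rep_L2_field u x"
  proof eventually_elim
    case (elim x)
    then have "(\<lambda>n. sqrt ((norm (rep_L2_field (X (r n)) x - rep_L2_field u x))\<^sup>2)) \<longlonglongrightarrow> sqrt 0"
      by (intro tendsto_real_sqrt) simp
    then show ?case
      by (simp add: tendsto_norm_zero_iff LIM_zero_iff)
  qed
  with r(1) show ?thesis by (rule that)
qed

section \<open>Fields supported in \<Omega> and classes of cut-off fields\<close>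

lemma L2_on_add: "u \<in> L2_on \<Omega> \<Longrightarrow> v \<in> L2_on \<Omega> \<Longrightarrow> u + v \<in> L2_on \<Omega>"
  unfolding L2_on_def using rep_add_AE[of u v] by (auto elim: eventually_elim2)

lemma L2_on_scaleR: "u \<in> L2_on \<Omega> \<Longrightarrow> c *\<^sub>R u \<in> L2_on \<Omega>"
  unfolding L2_on_def using rep_scaleR_AE[of c u] by (auto elim: eventually_elim2)

text \<open>A nonzero periodic field is not square integrable over the whole space; only its cut-off
  to \<Omega> is. \<open>class_on\<close> takes the class of the cut-off, and this is the condition
  under which that class is meaningful.\<close>

definition cut_square_integrable :: "(real^3) set \<Rightarrow> (real^3 \<Rightarrow> real^3) \<Rightarrow> bool" where
  "cut_square_integrable \<Omega> w \<longleftrightarrow> square_integrable (\<lambda>x. indicator \<Omega> x *\<^sub>R w x)"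

lemma class_on_L2_on:
  assumes "cut_square_integrable \<Omega> w"
  shows "class_on \<Omega> w \<in> L2_on \<Omega>"
  using rep_abs_AE[OF assms[unfolded cut_square_integrable_def]] unfolding class_on_def L2_on_def
  by (auto simp: elim!: eventually_mono)

lemma rep_class_on_AE:
  assumes "cut_square_integrable \<Omega> w"
  shows "AE x in lebesgue. rep_L2_field (class_on \<Omega> w) x = indicator \<Omega> x *\<^sub>R w x"
  using rep_abs_AE[OF assms[unfolded cut_square_integrable_def]] unfolding class_on_def .

lemma class_on_add:
  "cut_square_integrable \<Omega> v \<Longrightarrow> cut_square_integrable \<Omega> w \<Longrightarrow>
    class_on \<Omega> (\<lambda>x. v x + w x) = class_on \<Omega> v + class_on \<Omega> w"
  unfolding cut_square_integrable_def class_on_def scaleR_add_right by (simp add: abs_L2_add)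

lemma class_on_scaleR:
  assumes "cut_square_integrable \<Omega> v"
  shows "class_on \<Omega> (\<lambda>x. c *\<^sub>R v x) = c *\<^sub>R class_on \<Omega> v"
  using assms unfolding cut_square_integrable_def class_on_def
  by (simp add: abs_L2_scaleR mult.commute)

lemma inner_class_on:
  assumes "cut_square_integrable \<Omega> w"
  shows "u \<bullet> class_on \<Omega> w = (LINT x|lebesgue. indicator \<Omega> x * (rep_L2_field u x \<bullet> w x))"
proof -
  have "u \<bullet> class_on \<Omega> w = (LINT x|lebesgue. rep_L2_field u x \<bullet> (indicator \<Omega> x *\<^sub>R w x))"
    using abs_L2_inner[OF square_integrable_rep assms[unfolded cut_square_integrable_def], of u]
    by (simp add: abs_rep_L2 class_on_def)
  then show ?thesis by simp
qed

lemma inner_class_on_class_on: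
  assumes "cut_square_integrable \<Omega> v" "cut_square_integrable \<Omega> w"
  shows "class_on \<Omega> v \<bullet> class_on \<Omega> w = (LINT x|lebesgue. indicator \<Omega> x * (v x \<bullet> w x))"
proof -
  have "class_on \<Omega> v \<bullet> class_on \<Omega> w
      = (LINT x|lebesgue. (indicator \<Omega> x *\<^sub>R v x) \<bullet> (indicator \<Omega> x *\<^sub>R w x))"
    using abs_L2_inner[OF assms[unfolded cut_square_integrable_def]] by (simp add: class_on_def)
  also have "\<dots> = (LINT x|lebesgue. indicator \<Omega> x * (v x \<bullet> w x))"
    by (intro Bochner_Integration.integral_cong) (auto simp: indicator_def)
  finally show ?thesis .
qed

text \<open>The closure of \<Omega> is compact, so the field is bounded on \<Omega>, which has
  finite measure.\<close>

lemma cut_square_integrable_continuous: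
  fixes w :: "real^3 \<Rightarrow> real^3"
  assumes w: "continuous_on UNIV w" and bd: "bounded \<Omega>" and op: "open \<Omega>"
  shows "cut_square_integrable \<Omega> w"
proof -
  have [measurable]: "w \<in> borel_measurable lebesgue"
    using w by (simp add: borel_measurable_continuous_onI measurable_completion)
  have [measurable]: "\<Omega> \<in> sets lebesgue" using op by auto
  obtain B where B: "\<And>x. x \<in> \<Omega> \<Longrightarrow> norm (w x) \<le> B"
  proof -
    have "compact (w ` closure \<Omega>)"
      using bd w by (intro compact_continuous_image) (auto simp: compact_closure intro: continuous_on_subset)
    then obtain B where "\<forall>y\<in>w ` closure \<Omega>. norm y \<le> B"
      using compact_imp_bounded bounded_iff by metis
    then have "\<And>x. x \<in> \<Omega> \<Longrightarrow> norm (w x) \<le> B"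
      using closure_subset by (meson image_eqI subsetD)
    then show ?thesis by (rule that)
  qed
  have "\<Omega> \<in> lmeasurable" using bd op by (rule lmeasurable_open)
  then have "emeasure lebesgue \<Omega> < \<infinity>" by (simp add: fmeasurable_def)
  then have "integrable lebesgue (\<lambda>x. (norm (indicator \<Omega> x *\<^sub>R w x))\<^sup>2)"
    by (intro integrableI_bounded_set[where A=\<Omega> and B="B\<^sup>2"])
       (auto simp: indicator_def intro!: power_mono B)
  then show ?thesis unfolding cut_square_integrable_def square_integrable_def by simp
qed

section \<open>Calculus for continuously differentiable functions\<close>

text \<open>\<open>C_diff\<close> speaks of \<open>frechet_derivative\<close>; by uniqueness of the
  derivative any explicitly known w' may replace it. This turns the closure properties below into
  inductions on n.\<close>

lemma C_diff_SucI:
  assumes "\<And>x. (w has_derivative w' x) (at x)" "\<And>h. C_diff n UNIV (\<lambda>x. w' x h)"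
  shows "C_diff (Suc n) UNIV w"
proof -
  have "frechet_derivative w (at x) = w' x" for x
    using frechet_derivative_at[OF assms(1)] by simp
  then show ?thesis
    using assms by (auto simp: differentiable_def)
qed

lemma C_diff_Suc_D:
  assumes "C_diff (Suc n) UNIV w"
  shows "(w has_derivative frechet_derivative w (at x)) (at x)"
    and "C_diff n UNIV (\<lambda>x. frechet_derivative w (at x) h)"
  using assms frechet_derivative_works by auto

lemma C_diff_Suc_imp: "C_diff (Suc n) UNIV w \<Longrightarrow> C_diff n UNIV w"
proof (induction n arbitrary: w)
  case 0
  then have "w differentiable_on UNIV"
    by (auto simp: differentiable_on_def)
  then show ?case by (simp add: differentiable_imp_continuous_on)
next
  case (Suc n)
  show ?case
    by (rule C_diff_SucI[OF C_diff_Suc_D(1)[OF Suc.prems]])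
      (rule Suc.IH, rule C_diff_Suc_D(2)[OF Suc.prems])
qed

lemma C_diff_const: "C_diff n UNIV (\<lambda>x. c)"
proof (induction n arbitrary: c)
  case (Suc n)
  show ?case by (rule C_diff_SucI[where w'="\<lambda>x h. 0"]) (auto intro: Suc.IH)
qed simp

lemma C_diff_add: "C_diff n UNIV v \<Longrightarrow> C_diff n UNIV w \<Longrightarrow> C_diff n UNIV (\<lambda>x. v x + w x)"
proof (induction n arbitrary: v w)
  case (Suc n)
  show ?case
    by (rule C_diff_SucI[OF has_derivative_add[OF C_diff_Suc_D(1)[OF Suc.prems(1)] C_diff_Suc_D(1)[OF Suc.prems(2)]]])
      (intro Suc.IH C_diff_Suc_D(2) Suc.prems)
qed (auto intro: continuous_intros)

lemma C_diff_scaleR: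
  fixes f :: "'a::real_normed_vector \<Rightarrow> real"
  shows "C_diff n UNIV f \<Longrightarrow> C_diff n UNIV w \<Longrightarrow> C_diff n UNIV (\<lambda>x. f x *\<^sub>R w x)"
proof (induction n arbitrary: f w)
  case (Suc n)
  \<comment> \<open>By the product rule the derivative is a sum of products of the same kind in
    which one factor is left undifferentiated; that factor enters at the lower order n, hence
    \<open>C_diff_Suc_imp\<close>.\<close>
  show ?case
    by (rule C_diff_SucI[OF has_derivative_scaleR[OF C_diff_Suc_D(1)[OF Suc.prems(1)] C_diff_Suc_D(1)[OF Suc.prems(2)]]])
      (intro C_diff_add Suc.IH C_diff_Suc_D(2)[OF Suc.prems(1)] C_diff_Suc_D(2)[OF Suc.prems(2)]
        C_diff_Suc_imp[OF Suc.prems(1)] C_diff_Suc_imp[OF Suc.prems(2)])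
qed (auto intro: continuous_intros)

lemma C_diff_prod:
  fixes f :: "'i \<Rightarrow> 'a::real_normed_vector \<Rightarrow> real"
  assumes "finite A" "\<And>i. i \<in> A \<Longrightarrow> C_diff n UNIV (f i)"
  shows "C_diff n UNIV (\<lambda>x. \<Prod>i\<in>A. f i x)"
  using assms
proof (induction A rule: finite_induct)
  case (insert i A)
  then show ?case using C_diff_scaleR[of n "f i" "\<lambda>x. \<Prod>i\<in>A. f i x"] by simp
qed (simp add: C_diff_const)

lemma smooth_C_diff: "smooth w \<Longrightarrow> C_diff n UNIV w"
  by (simp add: smooth_def)

lemma smooth_has_derivative:
  "smooth w \<Longrightarrow> (w has_derivative frechet_derivative w (at x)) (at x)"
  using C_diff_Suc_D(1) smooth_C_diff by blast

lemma smooth_continuous: "smooth w \<Longrightarrow> continuous_on UNIV w"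
  using smooth_C_diff[of w 0] by simp

lemma smooth_continuous_derivative:
  "smooth w \<Longrightarrow> continuous_on UNIV (\<lambda>x. frechet_derivative w (at x) h)"
  using C_diff_Suc_D(2)[of 0 w h] smooth_C_diff by (metis C_diff.simps(1))

lemma frechet_derivative_eq_0:
  assumes "open U" "x \<in> U" "\<And>y. y \<in> U \<Longrightarrow> w y = 0"
  shows "frechet_derivative w (at x) h = 0"
proof -
  have "((\<lambda>y. 0) has_derivative (\<lambda>h. 0)) (at x)" by simp
  then have "(w has_derivative (\<lambda>h. 0)) (at x)"
    by (rule has_derivative_transform_within_open[OF _ assms(1,2)]) (simp add: assms(3))
  then show ?thesis using frechet_derivative_at by metis
qed

lemma frechet_derivative_outside_support:
  assumes "x \<notin> closure {y. w y \<noteq> 0}"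
  shows "frechet_derivative w (at x) h = 0"
  by (rule frechet_derivative_eq_0[of "- closure {y. w y \<noteq> 0}"])
    (use assms closure_subset[of "{y. w y \<noteq> 0}"] in auto)

section \<open>Integrals of compactly supported functions\<close>

lemma integrable_continuous_compact_support:
  fixes f :: "real^3 \<Rightarrow> 'b::{banach, second_countable_topology}"
  assumes f: "continuous_on UNIV f" and K: "compact K" "\<And>x. x \<notin> K \<Longrightarrow> f x = 0"
  shows "integrable lebesgue f"
proof -
  have "integrable lborel (\<lambda>x. indicator K x *\<^sub>R f x)"
    using K f by (intro borel_integrable_compact) (auto intro: continuous_on_subset)
  moreover have "(\<lambda>x. indicator K x *\<^sub>R f x) = f"
    using K(2) by (auto simp: indicator_def fun_eq_iff)
  ultimately show ?thesis
    using integrable_completion[of f lborel] f by (simp add: borel_measurable_continuous_onI)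
qed

text \<open>The integral of each difference quotient vanishes because Lebesgue measure is
  translation invariant, and dominated convergence passes to the derivative. Applied to an inner
  product of two fields, this is integration by parts.\<close>

lemma integral_derivative_compact_support:
  fixes h :: "real^3 \<Rightarrow> real"
  assumes h: "\<And>x. (h has_derivative h' x) (at x)" and c: "continuous_on UNIV (\<lambda>x. h' x v)"
    and K: "compact K" "\<And>x. x \<notin> K \<Longrightarrow> h x = 0"
  shows "(LINT x|lebesgue. h' x v) = 0"
proof -
  have hc: "continuous_on UNIV h"
    by (intro continuous_at_imp_continuous_on ballI has_derivative_continuous[OF h])
  have z: "h' x v = 0" if "x \<notin> K" for x
    using frechet_derivative_eq_0[of "- K" x h v] frechet_derivative_at[OF h, of x] K that
    by (auto simp: open_Compl compact_imp_closed)
  obtain R where R: "\<And>x. x \<in> K \<Longrightarrow> norm x \<le> R"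
    using compact_imp_bounded[OF K(1)] bounded_iff by metis
  obtain B where B: "\<And>x. \<bar>h' x v\<bar> \<le> B"
  proof -
    have "compact ((\<lambda>x. h' x v) ` K)"
      using c K by (intro compact_continuous_image) (auto intro: continuous_on_subset)
    then obtain B where "\<forall>y\<in>(\<lambda>x. h' x v) ` K. norm y \<le> B"
      using compact_imp_bounded bounded_iff by metis
    then have "\<bar>h' x v\<bar> \<le> max B 0" for x using z[of x] by (cases "x \<in> K") force+
    then show ?thesis by (rule that)
  qed
  \<comment> \<open>Step sizes of the difference quotients. They are at most 1, so x + e n v stays
    within distance |v| of x and all quotients are supported in one ball.\<close>
  define e :: "nat \<Rightarrow> real" where "e n = inverse (real (Suc n))" for n
  have e: "0 < e n" "e n \<le> 1" for n by (auto simp: e_def field_simps)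
  have e0: "e \<longlonglongrightarrow> 0" unfolding e_def by (rule LIMSEQ_inverse_real_of_nat)
  have line: "((\<lambda>s. h (x + s *\<^sub>R v)) has_real_derivative h' (x + s *\<^sub>R v) v) (at s)" for x s
  proof -
    have "((\<lambda>s. h (x + s *\<^sub>R v)) has_derivative (\<lambda>t. h' (x + s *\<^sub>R v) (t *\<^sub>R v))) (at s)"
      by (rule has_derivative_compose[OF _ h]) (auto intro!: derivative_eq_intros)
    moreover have "h' (x + s *\<^sub>R v) (t *\<^sub>R v) = h' (x + s *\<^sub>R v) v * t" for t
      using has_derivative_linear[OF h] by (simp add: linear_cmul)
    ultimately show ?thesis by (simp add: has_field_derivative_def)
  qed
  define q where "q n x = (h (x + e n *\<^sub>R v) - h x) / e n" for n x
  have lim: "(\<lambda>n. q n x) \<longlonglongrightarrow> h' x v" for x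
  proof -
    have "((\<lambda>s. (h (x + s *\<^sub>R v) - h x) / s) \<longlongrightarrow> h' x v) (at 0)"
      using line[of x 0] by (simp add: DERIV_def)
    then show ?thesis unfolding q_def
      by (rule filterlim_compose) (use e0 e(1) in \<open>auto simp: filterlim_at intro!: eventuallyI less_imp_neq[symmetric]\<close>)
  qed
  \<comment> \<open>On the ball the mean value theorem turns the quotient into a value of the
    derivative; off the ball neither x nor x + e n v lies in K.\<close>
  have bound: "\<bar>q n x\<bar> \<le> B * indicator (cball 0 (R + norm v)) x" for n x
  proof (cases "x \<in> cball 0 (R + norm v)")
    case True
    obtain s where "h (x + e n *\<^sub>R v) - h (x + 0 *\<^sub>R v) = (e n - 0) * h' (x + s *\<^sub>R v) v"
      using MVT2[OF e(1)[of n], of "\<lambda>s. h (x + s *\<^sub>R v)" "\<lambda>s. h' (x + s *\<^sub>R v) v"] line by blast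
    then show ?thesis using B[of "x + s *\<^sub>R v"] True e(1)[of n] by (simp add: q_def)
  next
    case False
    have "norm (e n *\<^sub>R v) \<le> 1 * norm v" using e[of n] by (simp add: mult_left_le_one_le)
    then have "norm x \<le> norm (x + e n *\<^sub>R v) + norm v"
      using norm_triangle_ineq4[of "x + e n *\<^sub>R v" "e n *\<^sub>R v"] by simp
    then have "x \<notin> K" "x + e n *\<^sub>R v \<notin> K"
      using False R[of x] R[of "x + e n *\<^sub>R v"] norm_ge_zero[of v] by auto
    then show ?thesis using K(2) False by (simp add: q_def)
  qed
  have hb[measurable]: "h \<in> borel_measurable lborel" "(\<lambda>x. h' x v) \<in> borel_measurable lborel"
    using hc c by (simp_all add: borel_measurable_continuous_onI)
  have hi: "integrable lborel h"
    using integrable_continuous_compact_support[OF hc K] by (simp add: integrable_completion)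
  have hti: "integrable lborel (\<lambda>x. h (x + a))" and ht: "(LINT x|lborel. h (x + a)) = (LINT x|lborel. h x)" for a
  proof -
    have "integrable (distr lborel borel ((+) a)) h" by (subst lborel_distr_plus) (rule hi)
    then show "integrable lborel (\<lambda>x. h (x + a))"
      by (subst (asm) integrable_distr_eq) (auto simp: add.commute)
    have "(LINT x|distr lborel borel ((+) a). h x) = (LINT x|lborel. h (a + x))"
      by (rule integral_distr) auto
    then show "(LINT x|lborel. h (x + a)) = (LINT x|lborel. h x)"
      by (simp add: lborel_distr_plus add.commute)
  qed
  have qi: "(LINT x|lborel. q n x) = 0" for n
    using hti ht hi by (simp add: q_def)
  have "(\<lambda>n. LINT x|lborel. q n x) \<longlonglongrightarrow> (LINT x|lborel. h' x v)"
  proof (rule integral_dominated_convergence)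
    show "integrable lborel (\<lambda>x. B * indicator (cball 0 (R + norm v)) x)"
      using emeasure_bounded_finite[OF bounded_cball, of 0 "R + norm v"]
      by (intro integrable_mult_right integrable_real_indicator) auto
    show "(\<lambda>x. q n x) \<in> borel_measurable lborel" for n unfolding q_def by measurable
  qed (use lim bound in auto)
  then have "(LINT x|lborel. h' x v) = 0" by (simp add: qi LIMSEQ_const_iff)
  then show ?thesis by (simp add: integral_completion)
qed

section \<open>Bump functions\<close>

text \<open>Admitting every polynomial p makes this family closed under differentiation, so that
  smoothness is a single induction with p arbitrary. The constant c is sent to 0 later: for p = 1
  the profile then tends to the indicator of t > 0.\<close>

definition bump_profile :: "real \<Rightarrow> real poly \<Rightarrow> real \<Rightarrow> real" where
  "bump_profile c p t = (if t > 0 then poly p (1 / t) * exp (- c / t) else 0)"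

lemma tendsto_poly_times_exp:
  fixes c :: real
  assumes "c > 0"
  shows "((\<lambda>x. poly p x * exp (- c * x)) \<longlongrightarrow> 0) at_top"
proof -
  have "((\<lambda>x. x ^ k * exp (- c * x)) \<longlongrightarrow> 0) at_top" for k
  proof -
    have "((\<lambda>x :: real. (x ^ k / exp x)) \<longlongrightarrow> 0) at_top" by (rule tendsto_power_div_exp_0)
    then have "((\<lambda>x. ((c * x) ^ k / exp (c * x))) \<longlongrightarrow> 0) at_top"
      by (rule filterlim_compose)
        (rule filterlim_tendsto_pos_mult_at_top[OF tendsto_const assms filterlim_ident])
    then have "((\<lambda>x. (1 / c) ^ k * ((c * x) ^ k / exp (c * x))) \<longlongrightarrow> (1 / c) ^ k * 0) at_top"
      by (intro tendsto_mult tendsto_const)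
    moreover have "(1 / c) ^ k * ((c * x) ^ k / exp (c * x)) = x ^ k * exp (- c * x)" for x
      using assms by (simp add: power_mult_distrib exp_minus divide_inverse flip: power_mult_distrib mult.assoc)
    ultimately show ?thesis by simp
  qed
  then have "((\<lambda>x. \<Sum>i\<le>degree p. coeff p i * (x ^ i * exp (- c * x))) \<longlongrightarrow> (\<Sum>i\<le>degree p. coeff p i * 0)) at_top"
    by (intro tendsto_sum tendsto_mult tendsto_const)
  then show ?thesis by (simp add: poly_altdef sum_distrib_right mult.assoc)
qed

lemma bump_profile_tendsto_0:
  assumes "c > 0"
  shows "(bump_profile c p \<longlongrightarrow> 0) (at 0)"
  unfolding filterlim_at_split
proof
  have "eventually (\<lambda>t. bump_profile c p t = 0) (at_left 0)"
    by (auto simp: bump_profile_def eventually_at intro!: exI[of _ 1])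
  then show "(bump_profile c p \<longlongrightarrow> 0) (at_left 0)"
    by (rule tendsto_eventually)
  have "((\<lambda>t. poly p (inverse t) * exp (- c * inverse t)) \<longlongrightarrow> 0) (at_right 0)"
    by (rule filterlim_compose[OF tendsto_poly_times_exp[OF assms] filterlim_inverse_at_top_right])
  moreover have "eventually (\<lambda>t. poly p (inverse t) * exp (- c * inverse t) = bump_profile c p t) (at_right 0)"
    by (auto simp: bump_profile_def eventually_at inverse_eq_divide intro!: exI[of _ 1])
  ultimately show "(bump_profile c p \<longlongrightarrow> 0) (at_right 0)"
    by (rule Lim_transform_eventually)
qed

text \<open>For t > 0, differentiating p(1/t) exp(-c/t) produces the polynomial X^2 (c p - p'). At 0
  the difference quotient is the profile of X p, which tends to 0 by
  \<open>bump_profile_tendsto_0\<close>.\<close>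

lemma bump_profile_has_derivative:
  assumes "c > 0"
  shows "(bump_profile c p has_real_derivative
    bump_profile c ([:0, 0, 1:] * ([:c:] * p - pderiv p)) t) (at t)"
proof (cases t "0::real" rule: linorder_cases)
  case less
  have "((\<lambda>t. 0) has_real_derivative 0) (at t)" by simp
  then have "(bump_profile c p has_real_derivative 0) (at t)"
    by (rule has_field_derivative_transform_within_open[of _ _ _ "{..<0}"])
      (use less in \<open>auto simp: bump_profile_def\<close>)
  then show ?thesis using less by (simp add: bump_profile_def)
next
  case equal
  have "((\<lambda>h. bump_profile c ([:0, 1:] * p) h) \<longlongrightarrow> 0) (at 0)"
    by (rule bump_profile_tendsto_0[OF assms])
  moreover have "bump_profile c ([:0, 1:] * p) h = bump_profile c p h / h" for h
    by (simp add: bump_profile_def)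
  ultimately show ?thesis using equal
    by (simp add: DERIV_def bump_profile_def)
next
  case greater
  have "((\<lambda>t. poly p (1 / t) * exp (- c / t)) has_real_derivative
      poly ([:0, 0, 1:] * ([:c:] * p - pderiv p)) (1 / t) * exp (- c / t)) (at t)"
  proof -
    have 1: "((\<lambda>t. poly p (1 / t)) has_real_derivative poly (pderiv p) (1 / t) * (- (1 / t\<^sup>2))) (at t)"
      by (rule DERIV_chain2[OF poly_DERIV])
        (use greater in \<open>auto intro!: derivative_eq_intros simp: power2_eq_square\<close>)
    have 2: "((\<lambda>t. exp (- c / t)) has_real_derivative exp (- c / t) * (c / t\<^sup>2)) (at t)"
      by (rule DERIV_chain2[OF DERIV_exp])
        (use greater in \<open>auto intro!: derivative_eq_intros simp: power2_eq_square\<close>)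
    have "poly (pderiv p) (1 / t) * (- (1 / t\<^sup>2)) * exp (- c / t) + exp (- c / t) * (c / t\<^sup>2) * poly p (1 / t)
      = poly ([:0, 0, 1:] * ([:c:] * p - pderiv p)) (1 / t) * exp (- c / t)"
      by (simp add: algebra_simps power2_eq_square)
    then show ?thesis using DERIV_mult[OF 1 2] by simp
  qed
  then have "(bump_profile c p has_real_derivative
      poly ([:0, 0, 1:] * ([:c:] * p - pderiv p)) (1 / t) * exp (- c / t)) (at t)"
    by (rule has_field_derivative_transform_within_open[of _ _ _ "{0<..}"])
      (use greater in \<open>auto simp: bump_profile_def\<close>)
  then show ?thesis using greater by (simp add: bump_profile_def)
qed

lemma C_diff_bump_profile:
  fixes l :: "'a::real_normed_vector \<Rightarrow> real"
  assumes "c > 0" and l: "\<And>x. (l has_derivative l') (at x)"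
  shows "C_diff n UNIV (\<lambda>x. bump_profile c p (l x))"
proof (induction n arbitrary: p)
  case 0
  have "isCont (bump_profile c p) t" for t
    using bump_profile_has_derivative[OF assms(1)] DERIV_isCont by blast
  then have "continuous_on UNIV (bump_profile c p)"
    by (simp add: continuous_on_eq_continuous_at)
  moreover have "continuous_on UNIV l"
    by (intro continuous_at_imp_continuous_on ballI has_derivative_continuous[OF l])
  ultimately show ?case
    using continuous_on_compose2[of UNIV "bump_profile c p" UNIV l] by simp
next
  case (Suc n)
  let ?q = "[:0, 0, 1:] * ([:c:] * p - pderiv p)"
  show ?case
  proof (rule C_diff_SucI)
    show "((\<lambda>x. bump_profile c p (l x)) has_derivative (\<lambda>h. bump_profile c ?q (l x) *\<^sub>R l' h)) (at x)" for x
      using has_derivative_compose[OF l[of x] bump_profile_has_derivative[OF assms(1), of p, unfolded has_field_derivative_def]]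
      by simp
    show "C_diff n UNIV (\<lambda>x. bump_profile c ?q (l x) *\<^sub>R l' h)" for h
      by (intro C_diff_scaleR C_diff_const Suc.IH)
  qed
qed

text \<open>A product of one-sided profiles, two for each coordinate, so that it is positive exactly
  on the open box. As c tends to 0 it tends to the indicator of that box.\<close>

definition box_bump :: "real \<Rightarrow> real^3 \<Rightarrow> real^3 \<Rightarrow> real^3 \<Rightarrow> real" where
  "box_bump c a b x = (\<Prod>i\<in>UNIV. bump_profile c 1 (x $ i - a $ i) * bump_profile c 1 (b $ i - x $ i))"

lemma box_bump_C_diff:
  assumes "c > 0"
  shows "C_diff n UNIV (box_bump c a b)"
proof -
  have 1: "((\<lambda>x :: real^3. x $ i - a $ i) has_derivative (\<lambda>x. x $ i)) (at x)" for i x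
    by (auto intro!: derivative_eq_intros bounded_linear.has_derivative[OF bounded_linear_vec_nth])
  have 2: "((\<lambda>x :: real^3. b $ i - x $ i) has_derivative (\<lambda>x. - x $ i)) (at x)" for i x
    by (auto intro!: derivative_eq_intros bounded_linear.has_derivative[OF bounded_linear_vec_nth])
  show ?thesis unfolding box_bump_def
    using C_diff_scaleR[OF C_diff_bump_profile[OF assms 1] C_diff_bump_profile[OF assms 2]]
    by (intro C_diff_prod finite) simp
qed

lemma box_bump_outside:
  assumes "x \<notin> box a b"
  shows "box_bump c a b x = 0"
proof -
  obtain i where "\<not> (a $ i < x $ i \<and> x $ i < b $ i)"
    using assms by (auto simp: mem_box_cart)
  then have "bump_profile c 1 (x $ i - a $ i) * bump_profile c 1 (b $ i - x $ i) = 0"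
    by (auto simp: bump_profile_def)
  then show ?thesis
    unfolding box_bump_def by (intro prod_zero finite) blast
qed

lemma box_bump_bounds: "c > 0 \<Longrightarrow> 0 \<le> box_bump c a b x \<and> box_bump c a b x \<le> 1"
  unfolding box_bump_def
  by (intro conjI prod_nonneg prod_le_1 ballI mult_nonneg_nonneg mult_le_one) (simp_all add: bump_profile_def)

lemma box_bump_tendsto:
  "(\<lambda>n. box_bump (inverse (real (Suc n))) a b x) \<longlonglongrightarrow> indicator (box a b) x"
proof (cases "x \<in> box a b")
  case True
  have p: "(\<lambda>n. bump_profile (inverse (real (Suc n))) 1 t) \<longlonglongrightarrow> 1" if "t > 0" for t
  proof -
    have "(\<lambda>n. exp (- inverse (real (Suc n)) / t)) \<longlonglongrightarrow> exp (- 0 / t)"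
      using that by (intro tendsto_intros LIMSEQ_inverse_real_of_nat) auto
    then show ?thesis using that by (simp add: bump_profile_def)
  qed
  have "(\<lambda>n. box_bump (inverse (real (Suc n))) a b x) \<longlonglongrightarrow> (\<Prod>i\<in>(UNIV::3 set). 1 * 1)"
    unfolding box_bump_def using True
    by (intro tendsto_prod tendsto_mult p) (auto simp: mem_box_cart)
  then show ?thesis using True by simp
qed (simp add: box_bump_outside)

lemma box_bump_test_function:
  assumes "c > 0" "cbox a b \<subseteq> \<Omega>"
  shows "(\<lambda>x. box_bump c a b x *\<^sub>R v) \<in> test_functions \<Omega>"
proof -
  have "{x. box_bump c a b x *\<^sub>R v \<noteq> 0} \<subseteq> cbox a b"
    using box_bump_outside[of _ a b c] box_subset_cbox[of a b]
    by (metis (mono_tags, lifting) mem_Collect_eq scaleR_zero_left subsetD subsetI)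
  then have s: "closure {x. box_bump c a b x *\<^sub>R v \<noteq> 0} \<subseteq> cbox a b"
    by (rule closure_minimal) (rule closed_cbox)
  then have "compact (closure {x. box_bump c a b x *\<^sub>R v \<noteq> 0})"
    using bounded_subset[OF bounded_cbox] unfolding compact_eq_bounded_closed by blast
  moreover have "smooth (\<lambda>x. box_bump c a b x *\<^sub>R v)"
    unfolding smooth_def
    by (rule allI, rule C_diff_scaleR[OF box_bump_C_diff[OF assms(1)] C_diff_const])
  ultimately show ?thesis
    unfolding test_functions_def using order_trans[OF s assms(2)] by blast
qed

section \<open>The weak gradient\<close>

text \<open>Dynkin's lemma: boxes generate the Borel sets and are closed under intersection, while
  the sets over which g integrates to 0 are closed under countable disjoint unions and, because the
  total integral vanishes, under complements. A function whose integral over every Borel set is 0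
  vanishes almost everywhere.\<close>

lemma AE_zero_of_box_integrals_lborel:
  fixes g :: "'a::euclidean_space \<Rightarrow> real"
  assumes g: "integrable lborel g" and t: "(LINT x|lborel. g x) = 0"
    and z: "\<And>c d. (LINT x|lborel. indicator (box c d) x * g x) = 0"
  shows "AE x in lborel. g x = 0"
proof (rule sigma_finite_measure.density_zero[OF sigma_finite_lborel g])
  fix A :: "'a set" assume "A \<in> sets lborel"
  then have A: "A \<in> sigma_sets UNIV (range (\<lambda>(c, d). box c d :: 'a set))"
    by (simp add: borel_eq_box)
  have st: "Int_stable (range (\<lambda>(c, d). box c d :: 'a set))"
    by (auto simp: Int_stable_def box_Int_box)
  have s: "B \<in> sets borel" if "B \<in> sigma_sets UNIV (range (\<lambda>(c, d). box c d :: 'a set))" for B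
    using that by (simp add: borel_eq_box)
  have subset_Pow: "range (\<lambda>(c, d). box c d :: 'a set) \<subseteq> Pow UNIV" by simp
  show "set_lebesgue_integral lborel A g = 0"
    using st subset_Pow A
  proof (induction A rule: sigma_sets_induct_disjoint)
    case (compl A)
    have "(\<lambda>x. indicator (UNIV - A) x * g x) = (\<lambda>x. g x - indicator A x * g x)"
      by (auto simp: fun_eq_iff indicator_def)
    then show ?case
      using compl(2) g t s[OF compl(1)] integrable_mult_indicator[of A lborel g]
      unfolding set_lebesgue_integral_def by simp
  next
    case (union A)
    have m: "A i \<in> sets lborel" for i
      using s[of "A i"] union(2) by auto
    have "set_integrable lborel (\<Union>i. A i) g"
      unfolding set_integrable_def using m g by (intro integrable_mult_indicator) auto
    then have "set_lebesgue_integral lborel (\<Union>i. A i) g = (\<Sum>i. set_lebesgue_integral lborel (A i) g)"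
      using union(1) m by (intro lebesgue_integral_countable_add) (auto simp: disjoint_family_on_def)
    then show ?case using union(3) by simp
  qed (use z in \<open>auto simp: set_lebesgue_integral_def\<close>)
qed

text \<open>Reduction to the Borel case: g agrees almost everywhere with a Borel function.\<close>

lemma AE_zero_of_box_integrals:
  fixes g :: "'a::euclidean_space \<Rightarrow> real"
  assumes g: "integrable lebesgue g" and t: "(LINT x|lebesgue. g x) = 0"
    and z: "\<And>c d. (LINT x|lebesgue. indicator (box c d) x * g x) = 0"
  shows "AE x in lebesgue. g x = 0"
proof -
  obtain g' where g': "g' \<in> borel_measurable lborel" "AE x in lborel. g x = g' x"
    using completion_ex_borel_measurable_real[OF borel_measurable_integrable[OF g]] by blast
  have ae: "AE x in lebesgue. g x = g' x" using g'(2) by (rule AE_completion)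
  have [measurable]: "g \<in> borel_measurable lebesgue" "g' \<in> borel_measurable lebesgue" "g' \<in> borel_measurable borel"
    using g g'(1) by (auto simp: measurable_completion)
  have "integrable lebesgue g'"
    using g by (rule integrable_cong_AE_imp) (use ae in auto)
  then have i: "integrable lborel g'"
    using g'(1) by (simp add: integrable_completion)
  have "AE x in lborel. g' x = 0"
  proof (rule AE_zero_of_box_integrals_lborel[OF i])
    have "(LINT x|lebesgue. g x) = (LINT x|lebesgue. g' x)"
      by (rule integral_cong_AE) (use ae in auto)
    then show "(LINT x|lborel. g' x) = 0"
      using t g'(1) by (simp add: integral_completion)
    show "(LINT x|lborel. indicator (box c d) x * g' x) = 0" for c d
    proof -
      have "(LINT x|lebesgue. indicator (box c d) x * g x) = (LINT x|lebesgue. indicator (box c d) x * g' x)"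
        by (rule integral_cong_AE) (use ae in \<open>auto elim!: eventually_mono intro!: borel_measurable_times borel_measurable_indicator\<close>)
      moreover have "(LINT x|lebesgue. indicator (box c d) x * g' x) = (LINT x|lborel. indicator (box c d) x * g' x)"
        by (rule integral_completion) measurable
      ultimately show ?thesis using z by simp
    qed
  qed
  then have "AE x in lebesgue. g' x = 0" by (rule AE_completion)
  with ae show ?thesis by eventually_elim simp
qed

lemma integrable_indicator_rep:
  assumes [measurable]: "A \<in> sets lebesgue" and A: "emeasure lebesgue A < \<infinity>"
  shows "integrable lebesgue (\<lambda>x. indicator A x * (rep_L2_field G x \<bullet> v))"
proof (rule Bochner_Integration.integrable_bound)
  show "integrable lebesgue (\<lambda>x. norm v * (indicator A x + (norm (rep_L2_field G x))\<^sup>2))"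
    using A by (intro integrable_mult_right Bochner_Integration.integrable_add integrable_rep_square integrable_real_indicator) auto
  have "\<bar>a \<bullet> v\<bar> \<le> norm v * (1 + (norm a)\<^sup>2)" for a :: "real^3"
  proof -
    have "norm a \<le> 1 + (norm a)\<^sup>2"
      using zero_le_power2[of "norm a - 1/2"] by (simp add: power2_eq_square algebra_simps)
    then show ?thesis
      using Cauchy_Schwarz_ineq2[of a v] mult_left_mono[of "norm a" "1 + (norm a)\<^sup>2" "norm v"]
      by (simp add: mult.commute)
  qed
  then show "AE x in lebesgue. norm (indicator A x * (rep_L2_field G x \<bullet> v))
      \<le> norm (norm v * (indicator A x + (norm (rep_L2_field G x))\<^sup>2))"
    by (intro AE_I2) (auto simp: indicator_def)
qed measurable

text \<open>The fundamental lemma of the calculus of variations. Bump functions with c tending to 0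
  turn the orthogonality to all test functions into vanishing integrals over open boxes whose closed
  box lies in \<Omega>, and \<Omega> is a countable union of such closed boxes.\<close>

lemma L2_eq_0_of_test_functions:
  assumes G: "G \<in> L2_on \<Omega>" and op: "open \<Omega>" and bd: "bounded \<Omega>"
    and z: "\<And>\<phi>. \<phi> \<in> test_functions \<Omega> \<Longrightarrow> G \<bullet> class_on \<Omega> \<phi> = 0"
  shows "G = 0"
proof -
  have fin: "emeasure lebesgue (box a b) < \<infinity>" for a b :: "real^3"
    using emeasure_bounded_finite[OF bounded_box, of a b] by simp
  have box0: "(LINT x|lebesgue. indicator (box a b) x * (rep_L2_field G x \<bullet> v)) = 0"
    if ab: "cbox a b \<subseteq> \<Omega>" for a b v
  proof -
    define \<phi> where "\<phi> n x = box_bump (inverse (real (Suc n))) a b x *\<^sub>R v" for n x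
    have c: "0 < inverse (real (Suc n))" for n by simp
    have \<phi>: "\<phi> n \<in> test_functions \<Omega>" for n
      unfolding \<phi>_def by (rule box_bump_test_function[OF c ab])
    have [measurable]: "(\<lambda>x. box_bump (inverse (real (Suc n))) a b x) \<in> borel_measurable lebesgue" for n
      using C_diff.simps(1)[of UNIV "box_bump (inverse (real (Suc n))) a b"] box_bump_C_diff[OF c, of 0]
      by (simp add: borel_measurable_continuous_onI measurable_completion)
    have "G \<bullet> class_on \<Omega> (\<phi> n)
        = (LINT x|lebesgue. box_bump (inverse (real (Suc n))) a b x * (rep_L2_field G x \<bullet> v))" for n
    proof -
      have "continuous_on UNIV (\<phi> n)"
        using \<phi>[of n] by (auto simp: test_functions_def intro: smooth_continuous)
      then have "G \<bullet> class_on \<Omega> (\<phi> n) = (LINT x|lebesgue. indicator \<Omega> x * (rep_L2_field G x \<bullet> \<phi> n x))"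
        by (intro inner_class_on cut_square_integrable_continuous bd op)
      also have "\<dots> = (LINT x|lebesgue. box_bump (inverse (real (Suc n))) a b x * (rep_L2_field G x \<bullet> v))"
      proof (intro Bochner_Integration.integral_cong refl)
        fix x
        have "x \<in> \<Omega> \<or> box_bump (inverse (real (Suc n))) a b x = 0"
          using box_bump_outside[of x a b "inverse (real (Suc n))"] box_subset_cbox[of a b] ab by blast
        then show "indicator \<Omega> x * (rep_L2_field G x \<bullet> \<phi> n x)
            = box_bump (inverse (real (Suc n))) a b x * (rep_L2_field G x \<bullet> v)"
          by (elim disjE) (simp_all add: \<phi>_def)
      qed
      finally show ?thesis .
    qed
    then have "(LINT x|lebesgue. box_bump (inverse (real (Suc n))) a b x * (rep_L2_field G x \<bullet> v)) = 0" for n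
      using z[OF \<phi>] by simp
    moreover have "(\<lambda>n. LINT x|lebesgue. box_bump (inverse (real (Suc n))) a b x * (rep_L2_field G x \<bullet> v))
      \<longlonglongrightarrow> (LINT x|lebesgue. indicator (box a b) x * (rep_L2_field G x \<bullet> v))"
    proof (rule integral_dominated_convergence)
      show "integrable lebesgue (\<lambda>x. \<bar>indicator (box a b) x * (rep_L2_field G x \<bullet> v)\<bar>)"
        using fin by (intro integrable_abs integrable_indicator_rep) auto
      show "AE x in lebesgue. (\<lambda>n. box_bump (inverse (real (Suc n))) a b x * (rep_L2_field G x \<bullet> v))
          \<longlonglongrightarrow> indicator (box a b) x * (rep_L2_field G x \<bullet> v)"
        by (intro AE_I2 tendsto_mult tendsto_const box_bump_tendsto)
      show "AE x in lebesgue. norm (box_bump (inverse (real (Suc n))) a b x * (rep_L2_field G x \<bullet> v))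
          \<le> \<bar>indicator (box a b) x * (rep_L2_field G x \<bullet> v)\<bar>" for n
      proof (rule AE_I2)
        fix x
        show "norm (box_bump (inverse (real (Suc n))) a b x * (rep_L2_field G x \<bullet> v))
          \<le> \<bar>indicator (box a b) x * (rep_L2_field G x \<bullet> v)\<bar>"
          using box_bump_bounds[OF c[of n], of a b x] box_bump_outside[of x a b "inverse (real (Suc n))"]
          by (cases "x \<in> box a b") (auto simp: abs_mult mult_left_le_one_le)
      qed
      show "(\<lambda>x. indicator (box a b) x * (rep_L2_field G x \<bullet> v)) \<in> borel_measurable lebesgue"
        using borel_measurable_integrable[OF integrable_indicator_rep[of "box a b" G v]] fin by auto
      show "(\<lambda>x. box_bump (inverse (real (Suc n))) a b x * (rep_L2_field G x \<bullet> v)) \<in> borel_measurable lebesgue" for n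
        by (intro borel_measurable_times borel_measurable_inner) measurable
    qed
    ultimately show ?thesis by (simp add: LIMSEQ_const_iff)
  qed
  have ae: "AE x in lebesgue. x \<in> cbox a b \<longrightarrow> rep_L2_field G x = 0" if ab: "cbox a b \<subseteq> \<Omega>" for a b
  proof -
    have "AE x in lebesgue. indicator (box a b) x * (rep_L2_field G x \<bullet> v) = 0" for v
    proof (rule AE_zero_of_box_integrals)
      show "integrable lebesgue (\<lambda>x. indicator (box a b) x * (rep_L2_field G x \<bullet> v))"
        using fin by (intro integrable_indicator_rep) auto
      show "(LINT x|lebesgue. indicator (box a b) x * (rep_L2_field G x \<bullet> v)) = 0"
        by (rule box0[OF ab])
      fix c d :: "real^3"
      \<comment> \<open>The corners of the intersection of the two boxes. Its closed box lies in
        \<open>cbox a b\<close>, hence in \<Omega>, so \<open>box0\<close> applies to it even where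
        \<open>box c d\<close> leaves \<Omega>.\<close>
      define a' where "a' = (\<Sum>i\<in>Basis. max (a\<bullet>i) (c\<bullet>i) *\<^sub>R i)"
      define b' where "b' = (\<Sum>i\<in>Basis. min (b\<bullet>i) (d\<bullet>i) *\<^sub>R i)"
      have I: "box a b \<inter> box c d = box a' b'"
        unfolding a'_def b'_def by (rule box_Int_box)
      have "a' \<bullet> i = max (a \<bullet> i) (c \<bullet> i)" "b' \<bullet> i = min (b \<bullet> i) (d \<bullet> i)" if "i \<in> Basis" for i
        using that by (simp_all add: a'_def b'_def)
      then have sub: "cbox a' b' \<subseteq> cbox a b"
        by (simp add: subset_iff mem_box)
      have "(\<lambda>x. indicator (box c d) x * (indicator (box a b) x * (rep_L2_field G x \<bullet> v)))
          = (\<lambda>x. indicator (box a' b') x * (rep_L2_field G x \<bullet> v))"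
        unfolding I[symmetric] by (auto simp: fun_eq_iff indicator_def)
      then show "(LINT x|lebesgue. indicator (box c d) x * (indicator (box a b) x * (rep_L2_field G x \<bullet> v))) = 0"
        using box0[of a' b' v] sub ab by simp
    qed
    then have "AE x in lebesgue. \<forall>v\<in>Basis. indicator (box a b) x * (rep_L2_field G x \<bullet> v) = 0"
      by (intro AE_finite_allI) auto
    moreover have "cbox a b - box a b \<in> null_sets lebesgue"
      using negligible_frontier_interval negligible_iff_null_sets by blast
    then have "AE x in lebesgue. x \<notin> cbox a b - box a b"
      by (rule AE_not_in)
    ultimately show ?thesis
    proof eventually_elim
      case (elim x)
      show ?case
      proof
        assume "x \<in> cbox a b"
        then have "x \<in> box a b" using elim by blast
        then have "\<forall>v\<in>Basis. rep_L2_field G x \<bullet> v = 0" using elim by simp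
        then show "rep_L2_field G x = 0" by (subst euclidean_eq_iff) simp
      qed
    qed
  qed
  obtain \<D> where D: "countable \<D>" "\<D> \<subseteq> Pow \<Omega>" "\<And>X. X \<in> \<D> \<Longrightarrow> \<exists>a b. X = cbox a b" "\<Union>\<D> = \<Omega>"
    by (rule open_countable_Union_open_cbox[OF op]) (rule that)
  have "AE x in lebesgue. \<forall>X\<in>\<D>. x \<in> X \<longrightarrow> rep_L2_field G x = 0"
    unfolding AE_ball_countable[OF D(1)]
  proof
    fix X assume "X \<in> \<D>"
    then obtain a b where "X = cbox a b" "cbox a b \<subseteq> \<Omega>"
      using D(2,3) by blast
    then show "AE x in lebesgue. x \<in> X \<longrightarrow> rep_L2_field G x = 0"
      using ae by simp
  qed
  moreover have "AE x in lebesgue. x \<notin> \<Omega> \<longrightarrow> rep_L2_field G x = 0"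
    using G by (simp add: L2_on_def)
  ultimately have "AE x in lebesgue. rep_L2_field G x = 0"
  proof eventually_elim
    case (elim x)
    show ?case
    proof (cases "x \<in> \<Omega>")
      case True
      then obtain X where "X \<in> \<D>" "x \<in> X" using D(4) by blast
      then show ?thesis using elim(1) by blast
    qed (use elim(2) in simp)
  qed
  then have "AE x in lebesgue. rep_L2_field G x = rep_L2_field 0 x"
    using rep_zero_AE by eventually_elim simp
  then show ?thesis by (rule L2_eqI)
qed

text \<open>This is what gives the definite description in \<open>weak_gradient\<close> its
  value.\<close>

lemma weak_gradient_unique:
  assumes "open \<Omega>" "bounded \<Omega>" "has_weak_gradient \<Omega> u G" "has_weak_gradient \<Omega> u G'"
  shows "G = G'"
proof -
  have "G $ i - G' $ i = 0" for i
  proof (rule L2_eq_0_of_test_functions[OF _ assms(1,2)])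
    show "G $ i - G' $ i \<in> L2_on \<Omega>"
      using L2_on_add[of "G $ i" \<Omega> "(- 1) *\<^sub>R G' $ i"] L2_on_scaleR[of "G' $ i" \<Omega> "- 1"] assms(3,4)
      by (simp add: has_weak_gradient_def)
    show "(G $ i - G' $ i) \<bullet> class_on \<Omega> \<phi> = 0" if "\<phi> \<in> test_functions \<Omega>" for \<phi>
      using assms(3,4) that by (simp add: has_weak_gradient_def inner_diff_left)
  qed
  then show ?thesis by (simp add: vec_eq_iff)
qed

lemma weak_gradient_eqI:
  "open \<Omega> \<Longrightarrow> bounded \<Omega> \<Longrightarrow> has_weak_gradient \<Omega> u G \<Longrightarrow> weak_gradient \<Omega> u = G"
  unfolding weak_gradient_def using weak_gradient_unique by blast

lemma has_weak_gradient_weak_gradient: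
  "open \<Omega> \<Longrightarrow> bounded \<Omega> \<Longrightarrow> u \<in> H1_on \<Omega> \<Longrightarrow> has_weak_gradient \<Omega> u (weak_gradient \<Omega> u)"
  unfolding H1_on_def using weak_gradient_eqI by auto

lemma has_weak_gradient_add:
  "has_weak_gradient \<Omega> u G \<Longrightarrow> has_weak_gradient \<Omega> v G' \<Longrightarrow> has_weak_gradient \<Omega> (u + v) (G + G')"
  by (auto simp: has_weak_gradient_def inner_add_left L2_on_add)

lemma has_weak_gradient_scaleR:
  "has_weak_gradient \<Omega> u G \<Longrightarrow> has_weak_gradient \<Omega> (c *\<^sub>R u) (c *\<^sub>R G)"
  by (auto simp: has_weak_gradient_def L2_on_scaleR)

lemma H1_on_add: "u \<in> H1_on \<Omega> \<Longrightarrow> v \<in> H1_on \<Omega> \<Longrightarrow> u + v \<in> H1_on \<Omega>"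
  unfolding H1_on_def using has_weak_gradient_add L2_on_add by blast

lemma H1_on_scaleR: "u \<in> H1_on \<Omega> \<Longrightarrow> c *\<^sub>R u \<in> H1_on \<Omega>"
  unfolding H1_on_def using has_weak_gradient_scaleR L2_on_scaleR by blast

text \<open>The product of w with a test function has compact support in \<Omega>, so no boundary
  term arises, whatever w does at the boundary.\<close>

lemma has_weak_gradient_smooth:
  assumes w: "smooth w" and op: "open \<Omega>" and bd: "bounded \<Omega>"
  shows "has_weak_gradient \<Omega> (class_on \<Omega> w) (\<chi> i. class_on \<Omega> (partial_deriv i w))"
proof -
  have csi: "cut_square_integrable \<Omega> v" "cut_square_integrable \<Omega> (partial_deriv i v)" if "smooth v" for v i
    using smooth_continuous[OF that] smooth_continuous_derivative[OF that, of "axis i 1"] op bd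
    by (auto intro!: cut_square_integrable_continuous simp: partial_deriv_def[abs_def])
  have "class_on \<Omega> w \<bullet> class_on \<Omega> (partial_deriv i \<phi>) = - (class_on \<Omega> (partial_deriv i w) \<bullet> class_on \<Omega> \<phi>)"
    if "\<phi> \<in> test_functions \<Omega>" for i \<phi>
  proof -
    define K where "K = closure {x. \<phi> x \<noteq> 0}"
    have \<phi>: "smooth \<phi>" and K: "compact K" "K \<subseteq> \<Omega>"
      using that by (auto simp: test_functions_def K_def)
    have o: "\<phi> x = 0" "partial_deriv i \<phi> x = 0" if "x \<notin> K" for x
      using that closure_subset[of "{x. \<phi> x \<noteq> 0}"] frechet_derivative_outside_support[of x \<phi>]
      by (auto simp: K_def partial_deriv_def)
    have c: "continuous_on UNIV w" "continuous_on UNIV \<phi>"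
      "continuous_on UNIV (partial_deriv i w)" "continuous_on UNIV (partial_deriv i \<phi>)"
      using smooth_continuous w \<phi> smooth_continuous_derivative by (auto simp: partial_deriv_def[abs_def])
    have "((\<lambda>x. w x \<bullet> \<phi> x) has_derivative
        (\<lambda>h. w x \<bullet> frechet_derivative \<phi> (at x) h + frechet_derivative w (at x) h \<bullet> \<phi> x)) (at x)" for x
      by (intro has_derivative_inner smooth_has_derivative w \<phi>)
    then have "(LINT x|lebesgue. w x \<bullet> partial_deriv i \<phi> x + partial_deriv i w x \<bullet> \<phi> x) = 0"
      unfolding partial_deriv_def
      by (rule integral_derivative_compact_support[where K=K])
        (use c o K in \<open>auto intro!: continuous_intros simp: partial_deriv_def[abs_def]\<close>)
    moreover have "integrable lebesgue (\<lambda>x. w x \<bullet> partial_deriv i \<phi> x)" "integrable lebesgue (\<lambda>x. partial_deriv i w x \<bullet> \<phi> x)"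
      by (rule integrable_continuous_compact_support[where K=K];
        use c o K in \<open>auto intro!: continuous_intros\<close>)+
    ultimately have "(LINT x|lebesgue. w x \<bullet> partial_deriv i \<phi> x) = - (LINT x|lebesgue. partial_deriv i w x \<bullet> \<phi> x)"
      by simp
    moreover have "(\<lambda>x. indicator \<Omega> x * (w x \<bullet> partial_deriv i \<phi> x)) = (\<lambda>x. w x \<bullet> partial_deriv i \<phi> x)"
      "(\<lambda>x. indicator \<Omega> x * (partial_deriv i w x \<bullet> \<phi> x)) = (\<lambda>x. partial_deriv i w x \<bullet> \<phi> x)"
      using o K(2) by (force simp: fun_eq_iff indicator_def)+
    ultimately show ?thesis
      using csi[OF w] csi[OF \<phi>] by (simp add: inner_class_on_class_on)
  qed
  then show ?thesis
    using csi[OF w] by (auto simp: has_weak_gradient_def class_on_L2_on)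
qed

section \<open>Inequalities on boxes\<close>

definition vec3 :: "real \<Rightarrow> real \<Rightarrow> real \<Rightarrow> real^3" where
  "vec3 x y z = (\<chi> i. if i = 1 then x else if i = 2 then y else z)"

lemma vec3_nth [simp]: "vec3 x y z $ 1 = x" "vec3 x y z $ 2 = y" "vec3 x y z $ 3 = z"
  by (simp_all add: vec3_def)

lemma measurable_vec3 [measurable (raw)]:
  assumes [measurable]: "f \<in> borel_measurable M" "g \<in> borel_measurable M" "h \<in> borel_measurable M"
  shows "(\<lambda>x. vec3 (f x) (g x) (h x)) \<in> borel_measurable M"
proof -
  have "continuous_on UNIV (\<lambda>p::real \<times> real \<times> real. vec3 (fst p) (fst (snd p)) (snd (snd p)))"
    unfolding vec3_def
  proof (rule continuous_on_vec_lambda)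
    show "continuous_on UNIV (\<lambda>p::real \<times> real \<times> real. if i = 1 then fst p else if i = 2 then fst (snd p) else snd (snd p))"
      for i :: 3
      by (cases "i = 1"; cases "i = 2") (auto intro!: continuous_intros)
  qed
  then have "(\<lambda>p::real \<times> real \<times> real. vec3 (fst p) (fst (snd p)) (snd (snd p))) \<in> borel_measurable borel"
    by (rule borel_measurable_continuous_onI)
  from measurable_compose[OF _ this, of "\<lambda>x. (f x, g x, h x)" M]
  show ?thesis by simp
qed

text \<open>Both sides give every box the same volume, and this determines the measure. It makes
  Tonelli's theorem available coordinate by coordinate.\<close>

lemma lborel_eq_distr_vec3:
  "lborel = distr (lborel \<Otimes>\<^sub>M (lborel \<Otimes>\<^sub>M lborel)) borel (\<lambda>(x, y, z). vec3 x y z)"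
proof (rule lborel_eqI)
  fix l u :: "real^3" assume lu: "\<And>b. b \<in> Basis \<Longrightarrow> l \<bullet> b \<le> u \<bullet> b"
  have le: "l $ i \<le> u $ i" for i
    using lu[of "axis i 1"] by (simp add: axis_in_Basis_iff cart_eq_inner_axis)
  have v: "(\<lambda>(x, y, z). vec3 x y z) -` box l u
      = box (l $ 1) (u $ 1) \<times> (box (l $ 2) (u $ 2) \<times> box (l $ 3) (u $ 3))"
    by (auto simp: mem_box_cart forall_3)
  have "emeasure (distr (lborel \<Otimes>\<^sub>M (lborel \<Otimes>\<^sub>M lborel)) borel (\<lambda>(x, y, z). vec3 x y z)) (box l u)
      = emeasure (lborel \<Otimes>\<^sub>M (lborel \<Otimes>\<^sub>M lborel)) (box (l $ 1) (u $ 1) \<times> (box (l $ 2) (u $ 2) \<times> box (l $ 3) (u $ 3)))"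
    by (subst emeasure_distr) (auto simp: v space_pair_measure)
  also have "\<dots> = ennreal ((u $ 1 - l $ 1) * ((u $ 2 - l $ 2) * (u $ 3 - l $ 3)))"
    using le by (simp add: lborel.emeasure_pair_measure_Times
        sigma_finite_measure.emeasure_pair_measure_Times[OF sigma_finite_pair_measure[OF sigma_finite_lborel sigma_finite_lborel]]
        flip: ennreal_mult)
  also have "(u $ 1 - l $ 1) * ((u $ 2 - l $ 2) * (u $ 3 - l $ 3)) = (\<Prod>b\<in>Basis. (u - l) \<bullet> b)"
  proof -
    have B: "(Basis :: (real^3) set) = (\<lambda>i. axis i 1) ` UNIV"
      by (auto simp: Basis_vec_def)
    have "inj (\<lambda>i::3. axis i (1::real))" by (rule injI) (simp add: axis_eq_axis)
    then have "(\<Prod>b\<in>Basis. (u - l) \<bullet> b) = (\<Prod>i\<in>UNIV. (u - l) \<bullet> axis i 1)"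
      unfolding B by (simp add: prod.reindex)
    also have "\<dots> = (u $ 1 - l $ 1) * ((u $ 2 - l $ 2) * (u $ 3 - l $ 3))"
      unfolding UNIV_3 by (simp add: inner_axis mult.assoc)
    finally show ?thesis by (rule sym)
  qed
  finally show "emeasure (distr (lborel \<Otimes>\<^sub>M (lborel \<Otimes>\<^sub>M lborel)) borel (\<lambda>(x, y, z). vec3 x y z)) (box l u)
      = ennreal (\<Prod>b\<in>Basis. (u - l) \<bullet> b)" .
qed simp

text \<open>A density, instead of a restricted space, keeps the space equal to \<open>UNIV\<close>
  and the measurable sets equal to the Borel sets, so measurability does not depend on the end
  points.\<close>

definition seg :: "real \<Rightarrow> real \<Rightarrow> real measure" where
  "seg a b = density lborel (indicator {a..b})"

lemma sets_seg [simp, measurable_cong]: "sets (seg a b) = sets borel"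
  by (simp add: seg_def)

lemma space_seg [simp]: "space (seg a b) = UNIV"
  by (simp add: seg_def)

lemma nn_integral_seg:
  "f \<in> borel_measurable borel \<Longrightarrow> (\<integral>\<^sup>+x. f x \<partial>seg a b) = (\<integral>\<^sup>+x. indicator {a..b} x * f x \<partial>lborel)"
  unfolding seg_def by (subst nn_integral_density) auto

lemma AE_seg: "AE x in seg a b. x \<in> {a..b}"
  unfolding seg_def by (subst AE_density) (auto simp: indicator_def)

lemma emeasure_seg: "a \<le> b \<Longrightarrow> emeasure (seg a b) UNIV = ennreal (b - a)"
  using nn_integral_seg[of "\<lambda>_. 1" a b] by simp

lemma finite_measure_seg: "finite_measure (seg a b)"
proof
  have "emeasure (seg a b) UNIV = emeasure lborel {a..b}"
    using nn_integral_seg[of "\<lambda>_. 1" a b] by simp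
  then show "emeasure (seg a b) (space (seg a b)) \<noteq> \<infinity>"
    by (simp add: emeasure_lborel_Icc_eq)
qed

interpretation seg: finite_measure "seg a b" for a b
  by (rule finite_measure_seg)

interpretation seg_pair: pair_sigma_finite "seg a b" "seg c d" for a b c d ..

lemma nn_integral_cbox:
  assumes [measurable]: "f \<in> borel_measurable borel"
  shows "(\<integral>\<^sup>+v. indicator (cbox a b) v * f v \<partial>lborel)
    = (\<integral>\<^sup>+x. \<integral>\<^sup>+y. \<integral>\<^sup>+z. f (vec3 x y z) \<partial>seg (a $ 3) (b $ 3) \<partial>seg (a $ 2) (b $ 2) \<partial>seg (a $ 1) (b $ 1))"
proof -
  have i: "indicator (cbox a b) (vec3 x y z)
     = (indicator {a $ 1..b $ 1} x * (indicator {a $ 2..b $ 2} y * indicator {a $ 3..b $ 3} z) :: ennreal)" for x y z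
    by (auto simp: indicator_def mem_box_cart forall_3)
  have "(\<integral>\<^sup>+v. indicator (cbox a b) v * f v \<partial>lborel)
      = (\<integral>\<^sup>+p. (case p of (x, y, z) \<Rightarrow> indicator (cbox a b) (vec3 x y z) * f (vec3 x y z)) \<partial>(lborel \<Otimes>\<^sub>M (lborel \<Otimes>\<^sub>M lborel)))"
    unfolding case_prod_beta by (subst (1) lborel_eq_distr_vec3, subst nn_integral_distr) (auto simp: case_prod_beta)
  also have "\<dots> = (\<integral>\<^sup>+x. \<integral>\<^sup>+y. \<integral>\<^sup>+z. indicator (cbox a b) (vec3 x y z) * f (vec3 x y z) \<partial>lborel \<partial>lborel \<partial>lborel)"
    by (subst sigma_finite_measure.nn_integral_fst[OF sigma_finite_pair_measure[OF sigma_finite_lborel sigma_finite_lborel], symmetric])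
      (auto simp: case_prod_beta lborel.nn_integral_fst[symmetric] intro!: nn_integral_cong)
  also have "\<dots> = (\<integral>\<^sup>+x. indicator {a $ 1..b $ 1} x * (\<integral>\<^sup>+y. indicator {a $ 2..b $ 2} y *
       (\<integral>\<^sup>+z. indicator {a $ 3..b $ 3} z * f (vec3 x y z) \<partial>lborel) \<partial>lborel) \<partial>lborel)"
    by (simp add: i nn_integral_cmult mult.assoc)
  also have "\<dots> = (\<integral>\<^sup>+x. \<integral>\<^sup>+y. \<integral>\<^sup>+z. f (vec3 x y z) \<partial>seg (a $ 3) (b $ 3) \<partial>seg (a $ 2) (b $ 2) \<partial>seg (a $ 1) (b $ 1))"
    by (simp add: nn_integral_seg)
  finally show ?thesis .
qed

text \<open>Cauchy-Schwarz in (x, y) splits off \<gamma>. What remains is the square of the inner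
  z-integral \<open>P\<close>; Cauchy-Schwarz in z bounds it by a function of y times a function of
  x, whose double integral factorises.\<close>

lemma loomis_whitney:
  fixes \<alpha> \<beta> \<gamma> :: "real \<times> real \<Rightarrow> ennreal"
  assumes [measurable]: "\<alpha> \<in> borel_measurable borel" "\<beta> \<in> borel_measurable borel" "\<gamma> \<in> borel_measurable borel"
    and M: "sets M1 = sets borel" "sets M2 = sets borel" "sets M3 = sets borel"
      "finite_measure M1" "finite_measure M2" "finite_measure M3"
  shows "(\<integral>\<^sup>+x. \<integral>\<^sup>+y. \<integral>\<^sup>+z. \<alpha> (y, z) * \<beta> (x, z) * \<gamma> (x, y) \<partial>M3 \<partial>M2 \<partial>M1)\<^sup>2
    \<le> (\<integral>\<^sup>+y. \<integral>\<^sup>+z. \<alpha> (y, z) ^ 2 \<partial>M3 \<partial>M2) * (\<integral>\<^sup>+x. \<integral>\<^sup>+z. \<beta> (x, z) ^ 2 \<partial>M3 \<partial>M1)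
      * (\<integral>\<^sup>+x. \<integral>\<^sup>+y. \<gamma> (x, y) ^ 2 \<partial>M2 \<partial>M1)"
proof -
  note [measurable_cong] = M(1-3)
  have [measurable]: "\<alpha> \<in> borel_measurable (borel \<Otimes>\<^sub>M borel)" "\<beta> \<in> borel_measurable (borel \<Otimes>\<^sub>M borel)"
    "\<gamma> \<in> borel_measurable (borel \<Otimes>\<^sub>M borel)" by (simp_all add: borel_prod)
  interpret M1: finite_measure M1 by (rule M)
  interpret M2: finite_measure M2 by (rule M)
  interpret M3: finite_measure M3 by (rule M)
  interpret M12: pair_sigma_finite M1 M2 ..
  interpret M13: pair_sigma_finite M1 M3 ..
  interpret M23: pair_sigma_finite M2 M3 ..
  define P where "P = (\<lambda>(x, y). \<integral>\<^sup>+z. \<alpha> (y, z) * \<beta> (x, z) \<partial>M3)"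
  have [measurable]: "P \<in> borel_measurable (M1 \<Otimes>\<^sub>M M2)" unfolding P_def by measurable
  have "(\<integral>\<^sup>+x. \<integral>\<^sup>+y. \<integral>\<^sup>+z. \<alpha> (y, z) * \<beta> (x, z) * \<gamma> (x, y) \<partial>M3 \<partial>M2 \<partial>M1)
      = (\<integral>\<^sup>+x. \<integral>\<^sup>+y. P (x, y) * \<gamma> (x, y) \<partial>M2 \<partial>M1)"
    by (simp add: P_def nn_integral_multc)
  also have "\<dots> = (\<integral>\<^sup>+p. P p * \<gamma> p \<partial>(M1 \<Otimes>\<^sub>M M2))"
    by (subst M2.nn_integral_fst[symmetric]) auto
  also have "\<dots>\<^sup>2 \<le> (\<integral>\<^sup>+p. P p ^ 2 \<partial>(M1 \<Otimes>\<^sub>M M2)) * (\<integral>\<^sup>+p. \<gamma> p ^ 2 \<partial>(M1 \<Otimes>\<^sub>M M2))"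
    by (rule Cauchy_Schwarz_nn_integral) auto
  also have "(\<integral>\<^sup>+p. P p ^ 2 \<partial>(M1 \<Otimes>\<^sub>M M2)) \<le>
     (\<integral>\<^sup>+p. (\<integral>\<^sup>+z. \<alpha> (snd p, z) ^ 2 \<partial>M3) * (\<integral>\<^sup>+z. \<beta> (fst p, z) ^ 2 \<partial>M3) \<partial>(M1 \<Otimes>\<^sub>M M2))"
    unfolding P_def case_prod_beta by (intro nn_integral_mono Cauchy_Schwarz_nn_integral) measurable
  also have "\<dots> = (\<integral>\<^sup>+x. \<integral>\<^sup>+y. (\<integral>\<^sup>+z. \<alpha> (y, z) ^ 2 \<partial>M3) * (\<integral>\<^sup>+z. \<beta> (x, z) ^ 2 \<partial>M3) \<partial>M2 \<partial>M1)"
    by (subst M2.nn_integral_fst[symmetric]) auto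
  also have "\<dots> = (\<integral>\<^sup>+y. \<integral>\<^sup>+z. \<alpha> (y, z) ^ 2 \<partial>M3 \<partial>M2) * (\<integral>\<^sup>+x. \<integral>\<^sup>+z. \<beta> (x, z) ^ 2 \<partial>M3 \<partial>M1)"
    by (simp add: nn_integral_multc nn_integral_cmult)
  also have "(\<integral>\<^sup>+p. \<gamma> p ^ 2 \<partial>(M1 \<Otimes>\<^sub>M M2)) = (\<integral>\<^sup>+x. \<integral>\<^sup>+y. \<gamma> (x, y) ^ 2 \<partial>M2 \<partial>M1)"
    by (subst M2.nn_integral_fst[symmetric]) auto
  finally show ?thesis by (simp add: mult_right_mono)
qed

section \<open>Sobolev inequality on a box\<close>

lemma norm_diff_le_nn_integral_derivative:
  fixes F :: "real \<Rightarrow> 'a::euclidean_space"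
  assumes d: "\<And>t. (F has_vector_derivative f t) (at t)" and c: "continuous_on UNIV f"
    and s: "s \<in> {a..b}" and x: "x \<in> {a..b}"
  shows "ennreal (norm (F x - F s)) \<le> (\<integral>\<^sup>+t. ennreal (norm (f t)) \<partial>seg a b)"
proof -
  have [measurable]: "f \<in> borel_measurable borel" using c by (rule borel_measurable_continuous_onI)
  have *: "ennreal (norm (F v - F u)) \<le> (\<integral>\<^sup>+t. ennreal (norm (f t)) \<partial>seg a b)"
    if "u \<le> v" "u \<in> {a..b}" "v \<in> {a..b}" for u v
  proof -
    have i: "integrable lborel (\<lambda>t. indicator {u..v} t *\<^sub>R f t)"
      by (rule borel_integrable_compact) (use c in \<open>auto intro: continuous_on_subset\<close>)
    have "F v - F u = (LINT t|lborel. indicator {u..v} t *\<^sub>R f t)"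
      by (rule integral_FTC_Icc[symmetric])
        (use that c d in \<open>auto intro: continuous_on_subset has_vector_derivative_at_within\<close>)
    then have "ennreal (norm (F v - F u)) \<le> (\<integral>\<^sup>+t. norm (indicator {u..v} t *\<^sub>R f t) \<partial>lborel)"
      using integral_norm_bound_ennreal[OF i] by simp
    also have "\<dots> \<le> (\<integral>\<^sup>+t. indicator {a..b} t * ennreal (norm (f t)) \<partial>lborel)"
      using that by (intro nn_integral_mono) (auto simp: indicator_def)
    finally show ?thesis by (simp add: nn_integral_seg)
  qed
  show ?thesis
    using *[of s x] *[of x s] s x by (cases "s \<le> x") (auto simp: norm_minus_commute)
qed

text \<open>F x is compared with F s for every s, and the comparison is averaged over s. The term F
  t / (b - a) takes the place of vanishing boundary values, so periodic fields are covered as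
  well.\<close>

lemma le_nn_integral_average_derivative:
  fixes F :: "real \<Rightarrow> real"
  assumes d: "\<And>t. (F has_vector_derivative f t) (at t)" and c: "continuous_on UNIV f"
    and pos: "\<And>t. 0 \<le> F t" and x: "x \<in> {a..b}" and ab: "a < b"
  shows "ennreal (F x) \<le> (\<integral>\<^sup>+t. ennreal (F t / (b - a) + \<bar>f t\<bar>) \<partial>seg a b)"
proof -
  have [measurable]: "f \<in> borel_measurable borel" using c by (rule borel_measurable_continuous_onI)
  have "continuous_on UNIV F"
    using d by (intro continuous_at_imp_continuous_on ballI has_vector_derivative_continuous) auto
  then have [measurable]: "F \<in> borel_measurable borel" by (rule borel_measurable_continuous_onI)
  define J where "J = (\<integral>\<^sup>+t. ennreal \<bar>f t\<bar> \<partial>seg a b)"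
  have J: "ennreal (F x) \<le> ennreal (F s) + J" if "s \<in> {a..b}" for s
  proof -
    have "ennreal (F x) \<le> ennreal (F s + \<bar>F x - F s\<bar>)"
      using pos[of s] by (intro ennreal_leI) auto
    also have "\<dots> = ennreal (F s) + ennreal (norm (F x - F s))"
      using pos[of s] by (simp add: ennreal_plus)
    also have "\<dots> \<le> ennreal (F s) + J"
      unfolding J_def using norm_diff_le_nn_integral_derivative[OF d c that x]
      by (intro add_left_mono) simp
    finally show ?thesis .
  qed
  \<comment> \<open>Averaging a constant over the interval returns it, because the mass of
    \<open>seg a b\<close> is b - a.\<close>
  have u: "(\<integral>\<^sup>+t. ennreal (1 / (b - a)) * c' \<partial>seg a b) = c'" for c' :: ennreal
    using ab by (simp add: emeasure_seg mult.assoc mult.commute[of c'] flip: ennreal_mult)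
      (simp add: mult.assoc[symmetric] flip: ennreal_mult)
  have "ennreal (F x) = (\<integral>\<^sup>+t. ennreal (1 / (b - a)) * ennreal (F x) \<partial>seg a b)"
    by (simp only: u)
  also have "\<dots> \<le> (\<integral>\<^sup>+t. ennreal (1 / (b - a)) * (ennreal (F t) + J) \<partial>seg a b)"
  proof (rule nn_integral_mono_AE)
    show "AE t in seg a b. ennreal (1 / (b - a)) * ennreal (F x) \<le> ennreal (1 / (b - a)) * (ennreal (F t) + J)"
      using AE_seg[of a b] by eventually_elim (intro mult_left_mono J, auto)
  qed
  also have "\<dots> = (\<integral>\<^sup>+t. ennreal (1 / (b - a)) * ennreal (F t) \<partial>seg a b) + (\<integral>\<^sup>+t. ennreal (1 / (b - a)) * J \<partial>seg a b)"
    by (subst nn_integral_add[symmetric]) (auto simp: distrib_left)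
  also have "\<dots> = (\<integral>\<^sup>+t. ennreal (F t / (b - a)) \<partial>seg a b) + J"
    using ab pos by (simp only: u) (simp flip: ennreal_mult)
  also have "\<dots> = (\<integral>\<^sup>+t. ennreal (F t / (b - a) + \<bar>f t\<bar>) \<partial>seg a b)"
    unfolding J_def using ab pos by (subst nn_integral_add[symmetric]) (auto simp: ennreal_plus)
  finally show ?thesis .
qed

lemma vec3_axis:
  "vec3 t y z = vec3 0 y z + t *\<^sub>R axis 1 1"
  "vec3 x t z = vec3 x 0 z + t *\<^sub>R axis 2 1"
  "vec3 x y t = vec3 x y 0 + t *\<^sub>R axis 3 1"
  by (simp_all add: vec_eq_iff forall_3 axis_def)

lemma smooth_line:
  assumes "smooth w"
  shows "((\<lambda>t. w (p + t *\<^sub>R axis i 1)) has_vector_derivative partial_deriv i w (p + t *\<^sub>R axis i 1)) (at t)"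
proof -
  have "((\<lambda>t. w (p + t *\<^sub>R axis i 1)) has_derivative
      (\<lambda>h. frechet_derivative w (at (p + t *\<^sub>R axis i 1)) (h *\<^sub>R axis i 1))) (at t)"
    by (rule has_derivative_compose[OF _ smooth_has_derivative[OF assms]]) (auto intro!: derivative_eq_intros)
  then show ?thesis
    using has_derivative_linear[OF smooth_has_derivative[OF assms]]
    by (simp add: has_vector_derivative_def partial_deriv_def linear_cmul)
qed

lemma smooth_line_vec3:
  assumes "smooth w"
  shows "((\<lambda>t. w (vec3 t y z)) has_vector_derivative partial_deriv 1 w (vec3 t y z)) (at t)"
    "((\<lambda>t. w (vec3 x t z)) has_vector_derivative partial_deriv 2 w (vec3 x t z)) (at t)"
    "((\<lambda>t. w (vec3 x y t)) has_vector_derivative partial_deriv 3 w (vec3 x y t)) (at t)"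
  using smooth_line[OF assms, of "vec3 0 y z" 1 t] smooth_line[OF assms, of "vec3 x 0 z" 2 t]
    smooth_line[OF assms, of "vec3 x y 0" 3 t]
  by (simp_all flip: vec3_axis)

lemma continuous_partial_deriv: "smooth w \<Longrightarrow> continuous_on UNIV (partial_deriv i w)"
  using smooth_continuous_derivative[of w "axis i 1"] by (simp add: partial_deriv_def[abs_def])

lemma continuous_line_vec3:
  assumes "continuous_on UNIV f"
  shows "continuous_on UNIV (\<lambda>t. f (vec3 t y z))" "continuous_on UNIV (\<lambda>t. f (vec3 x t z))"
    "continuous_on UNIV (\<lambda>t. f (vec3 x y t))"
  by (subst vec3_axis, rule continuous_on_compose2[OF assms], auto intro!: continuous_intros)+

lemma nn_integral_seg_continuous_finite:
  assumes "continuous_on UNIV f"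
  shows "(\<integral>\<^sup>+t. ennreal (f t) \<partial>seg a b) < \<infinity>"
proof -
  have "compact (f ` {a..b})"
    using assms by (intro compact_continuous_image) (auto intro: continuous_on_subset)
  then obtain B where "\<forall>y\<in>f ` {a..b}. norm y \<le> B"
    using compact_imp_bounded bounded_iff by metis
  then have B: "\<And>t. t \<in> {a..b} \<Longrightarrow> norm (f t) \<le> B" by blast
  have "(\<integral>\<^sup>+t. ennreal (f t) \<partial>seg a b) \<le> (\<integral>\<^sup>+t. ennreal B \<partial>seg a b)"
  proof (rule nn_integral_mono_AE)
    show "AE t in seg a b. ennreal (f t) \<le> ennreal B"
      using AE_seg[of a b] by eventually_elim (use B in \<open>fastforce intro!: ennreal_leI\<close>)
  qed
  also have "\<dots> < \<infinity>"
    using seg.emeasure_finite[of a b UNIV] by (simp add: ennreal_mult_eq_top_iff less_top[symmetric])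
  finally show ?thesis .
qed

lemma nn_integral_cbox_continuous_finite:
  assumes "continuous_on UNIV (f :: real^3 \<Rightarrow> real)"
  shows "(\<integral>\<^sup>+v. indicator (cbox a b) v * ennreal (f v) \<partial>lborel) < \<infinity>"
proof -
  have "compact (f ` cbox a b)"
    using assms by (intro compact_continuous_image) (auto intro: continuous_on_subset)
  then obtain B where "\<forall>y\<in>f ` cbox a b. norm y \<le> B"
    using compact_imp_bounded bounded_iff by metis
  then have B: "\<And>t. t \<in> cbox a b \<Longrightarrow> norm (f t) \<le> B" by blast
  have "indicator (cbox a b) v * ennreal (f v) \<le> ennreal B * indicator (cbox a b) v" for v
    using B[of v] by (auto simp: indicator_def intro!: ennreal_leI)
  then have "(\<integral>\<^sup>+v. indicator (cbox a b) v * ennreal (f v) \<partial>lborel)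
      \<le> (\<integral>\<^sup>+v. ennreal B * indicator (cbox a b) v \<partial>lborel)"
    by (intro nn_integral_mono)
  also have "\<dots> < \<infinity>"
    using emeasure_bounded_finite[OF bounded_cbox, of a b]
    by (simp add: nn_integral_cmult ennreal_mult_less_top)
  finally show ?thesis .
qed

lemma nn_integral_cbox_permute:
  fixes a b :: "real^3"
  assumes [measurable]: "f \<in> borel_measurable borel"
  shows "(\<integral>\<^sup>+x. \<integral>\<^sup>+z. \<integral>\<^sup>+y. f (vec3 x y z) \<partial>seg (a $ 2) (b $ 2) \<partial>seg (a $ 3) (b $ 3) \<partial>seg (a $ 1) (b $ 1))
      = (\<integral>\<^sup>+v. indicator (cbox a b) v * f v \<partial>lborel)" (is ?xzy)
    and "(\<integral>\<^sup>+z. \<integral>\<^sup>+x. \<integral>\<^sup>+y. f (vec3 x y z) \<partial>seg (a $ 2) (b $ 2) \<partial>seg (a $ 1) (b $ 1) \<partial>seg (a $ 3) (b $ 3))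
      = (\<integral>\<^sup>+v. indicator (cbox a b) v * f v \<partial>lborel)" (is ?zxy)
    and "(\<integral>\<^sup>+y. \<integral>\<^sup>+z. \<integral>\<^sup>+x. f (vec3 x y z) \<partial>seg (a $ 1) (b $ 1) \<partial>seg (a $ 3) (b $ 3) \<partial>seg (a $ 2) (b $ 2))
      = (\<integral>\<^sup>+v. indicator (cbox a b) v * f v \<partial>lborel)" (is ?yzx)
proof -
  have "(\<integral>\<^sup>+z. \<integral>\<^sup>+y. f (vec3 x y z) \<partial>seg (a $ 2) (b $ 2) \<partial>seg (a $ 3) (b $ 3))
      = (\<integral>\<^sup>+y. \<integral>\<^sup>+z. f (vec3 x y z) \<partial>seg (a $ 3) (b $ 3) \<partial>seg (a $ 2) (b $ 2))" for x
    by (rule seg_pair.Fubini') measurable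
  then show A: ?xzy by (simp add: nn_integral_cbox)
  show ?zxy
    unfolding A[symmetric] by (rule seg_pair.Fubini') measurable
  have "(\<integral>\<^sup>+z. \<integral>\<^sup>+x. f (vec3 x y z) \<partial>seg (a $ 1) (b $ 1) \<partial>seg (a $ 3) (b $ 3))
      = (\<integral>\<^sup>+x. \<integral>\<^sup>+z. f (vec3 x y z) \<partial>seg (a $ 3) (b $ 3) \<partial>seg (a $ 1) (b $ 1))" for y
    by (rule seg_pair.Fubini') measurable
  then have "(\<integral>\<^sup>+y. \<integral>\<^sup>+z. \<integral>\<^sup>+x. f (vec3 x y z) \<partial>seg (a $ 1) (b $ 1) \<partial>seg (a $ 3) (b $ 3) \<partial>seg (a $ 2) (b $ 2))
     = (\<integral>\<^sup>+y. \<integral>\<^sup>+x. \<integral>\<^sup>+z. f (vec3 x y z) \<partial>seg (a $ 3) (b $ 3) \<partial>seg (a $ 1) (b $ 1) \<partial>seg (a $ 2) (b $ 2))"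
    by simp
  also have "\<dots> = (\<integral>\<^sup>+x. \<integral>\<^sup>+y. \<integral>\<^sup>+z. f (vec3 x y z) \<partial>seg (a $ 3) (b $ 3) \<partial>seg (a $ 2) (b $ 2) \<partial>seg (a $ 1) (b $ 1))"
    by (rule seg_pair.Fubini') measurable
  finally show ?yzx by (simp add: nn_integral_cbox)
qed

text \<open>The averaged comparison applied to |F|^4, whose derivative is at most 4 |F|^3 |F'| in
  modulus. The number l is to be a common lower bound of the edges, so that the weight 1 / l is the
  same in all three directions.\<close>

lemma fourth_power_le_nn_integral:
  fixes F :: "real \<Rightarrow> 'a::euclidean_space"
  assumes d: "\<And>t. (F has_vector_derivative F' t) (at t)" and c: "continuous_on UNIV F'"
    and x: "x \<in> {a..b}" and ab: "a < b" and l: "0 < l" "l \<le> b - a"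
  shows "ennreal (norm (F x) ^ 4) \<le> (\<integral>\<^sup>+t. ennreal (norm (F t) ^ 3 * (norm (F t) / l + 4 * norm (F' t))) \<partial>seg a b)"
proof -
  have cF: "continuous_on UNIV F"
    using d by (intro continuous_at_imp_continuous_on ballI has_vector_derivative_continuous) auto
  define f where "f t = 4 * (F t \<bullet> F t) * (F t \<bullet> F' t)" for t
  \<comment> \<open>As a polynomial in F \<bullet> F, the fourth power is differentiable also where
    F vanishes.\<close>
  have four: "norm v ^ 4 = (v \<bullet> v)\<^sup>2" for v :: 'a
    by (simp add: dot_square_norm)
  have "((\<lambda>t. norm (F t) ^ 4) has_vector_derivative f t) (at t)" for t
  proof -
    have "((\<lambda>t. (F t \<bullet> F t)\<^sup>2) has_derivative
        (\<lambda>h. of_nat 2 * (F t \<bullet> (h *\<^sub>R F' t) + (h *\<^sub>R F' t) \<bullet> F t) * (F t \<bullet> F t) ^ (2 - 1))) (at t)"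
      using d[of t] unfolding has_vector_derivative_def
      by (intro has_derivative_power has_derivative_inner)
    then show ?thesis
      by (simp add: has_vector_derivative_def four f_def inner_commute algebra_simps)
  qed
  moreover have "continuous_on UNIV f" unfolding f_def by (intro continuous_intros cF c)
  ultimately have "ennreal (norm (F x) ^ 4) \<le> (\<integral>\<^sup>+t. ennreal (norm (F t) ^ 4 / (b - a) + \<bar>f t\<bar>) \<partial>seg a b)"
    using x ab by (intro le_nn_integral_average_derivative) auto
  also have "\<dots> \<le> (\<integral>\<^sup>+t. ennreal (norm (F t) ^ 3 * (norm (F t) / l + 4 * norm (F' t))) \<partial>seg a b)"
  proof (intro nn_integral_mono ennreal_leI)
    fix t
    have "norm (F t) ^ 4 / (b - a) \<le> norm (F t) ^ 4 / l"
      using l by (intro divide_left_mono) auto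
    moreover have "\<bar>f t\<bar> \<le> 4 * (norm (F t))\<^sup>2 * (norm (F t) * norm (F' t))"
      unfolding f_def abs_mult using Cauchy_Schwarz_ineq2[of "F t" "F' t"]
      by (simp add: dot_square_norm mult_left_mono)
    ultimately show "norm (F t) ^ 4 / (b - a) + \<bar>f t\<bar> \<le> norm (F t) ^ 3 * (norm (F t) / l + 4 * norm (F' t))"
      by (simp add: algebra_simps power2_eq_square power3_eq_cube power4_eq_xxxx)
  qed
  finally show ?thesis .
qed

text \<open>The argument of Gagliardo and Nirenberg. Put \<open>k\<close> = |w|^3 h, and let N, K
  and A be the integrals of |w|^6, \<open>k\<close> and h^2. For each axis, |w|^2 is at most the
  square root of the integral of \<open>k\<close> along the line in that direction; multiplying the
  three bounds, \<open>loomis_whitney\<close> gives N^2 \<le> K^3, and Cauchy-Schwarz gives K^2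
  \<le> N A. Hence N^4 \<le> K^6 \<le> N^3 A^3, and N^3 cancels.\<close>

lemma sobolev_box:
  fixes w :: "real^3 \<Rightarrow> real^3"
  assumes w: "smooth w" and ab: "\<And>i. l \<le> b $ i - a $ i" and l: "0 < l"
  defines "h \<equiv> \<lambda>x. norm (w x) / l + 4 * (\<Sum>i\<in>UNIV. norm (partial_deriv i w x))"
  shows "(\<integral>\<^sup>+v. indicator (cbox a b) v * ennreal (norm (w v) ^ 6) \<partial>lborel)
    \<le> (\<integral>\<^sup>+v. indicator (cbox a b) v * ennreal ((h v)\<^sup>2) \<partial>lborel) ^ 3"
proof -
  have cw: "continuous_on UNIV w" and cd: "continuous_on UNIV (partial_deriv i w)" for i
    using w by (auto intro: smooth_continuous continuous_partial_deriv)
  define k where "k x = norm (w x) ^ 3 * h x" for x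
  have ch: "continuous_on UNIV h"
    unfolding h_def using l by (intro continuous_intros cw cd) auto
  have ck: "continuous_on UNIV k"
    unfolding k_def by (intro continuous_intros cw ch)
  have [measurable]: "w \<in> borel_measurable borel" "h \<in> borel_measurable borel" "k \<in> borel_measurable borel"
    using cw ch ck by (auto intro: borel_measurable_continuous_onI)
  have h0: "0 \<le> h x" for x unfolding h_def using l by (auto intro!: add_nonneg_nonneg sum_nonneg)
  have k0: "0 \<le> k x" for x unfolding k_def using h0 by simp
  have k: "norm (w x) ^ 3 * (norm (w x) / l + 4 * norm (partial_deriv i w x)) \<le> k x" for x i
    unfolding k_def h_def by (intro mult_left_mono add_left_mono member_le_sum) auto
  define N where "N = (\<integral>\<^sup>+v. indicator (cbox a b) v * ennreal (norm (w v) ^ 6) \<partial>lborel)"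
  define A where "A = (\<integral>\<^sup>+v. indicator (cbox a b) v * ennreal ((h v)\<^sup>2) \<partial>lborel)"
  define K where "K = (\<integral>\<^sup>+v. indicator (cbox a b) v * ennreal (k v) \<partial>lborel)"
  define \<alpha>' where "\<alpha>' = (\<lambda>(y, z). \<integral>\<^sup>+x. ennreal (k (vec3 x y z)) \<partial>seg (a $ 1) (b $ 1))"
  define \<beta>' where "\<beta>' = (\<lambda>(x, z). \<integral>\<^sup>+y. ennreal (k (vec3 x y z)) \<partial>seg (a $ 2) (b $ 2))"
  define \<gamma>' where "\<gamma>' = (\<lambda>(x, y). \<integral>\<^sup>+z. ennreal (k (vec3 x y z)) \<partial>seg (a $ 3) (b $ 3))"
  have fin: "\<alpha>' p < \<infinity>" "\<beta>' p < \<infinity>" "\<gamma>' p < \<infinity>" for p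
    unfolding \<alpha>'_def \<beta>'_def \<gamma>'_def case_prod_beta
    by (intro nn_integral_seg_continuous_finite continuous_line_vec3 ck)+
  have [measurable]: "\<alpha>' \<in> borel_measurable borel" "\<beta>' \<in> borel_measurable borel" "\<gamma>' \<in> borel_measurable borel"
    unfolding \<alpha>'_def \<beta>'_def \<gamma>'_def borel_prod[symmetric] by measurable
  \<comment> \<open>A square root on \<open>ennreal\<close> by way of \<open>enn2real\<close>. It
    squares back only for finite arguments, which is why \<open>fin\<close> shows the line integrals
    to be finite.\<close>
  define r where "r = (\<lambda>c :: ennreal. ennreal (sqrt (enn2real c)))"
  have [measurable]: "r \<in> borel_measurable borel" unfolding r_def by measurable
  have r2: "r c ^ 2 = c" if "c < \<infinity>" for c
    using that by (simp add: r_def ennreal_power)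
  have rle: "ennreal ((norm (w x))\<^sup>2) \<le> r c" if "c < \<infinity>" "ennreal (norm (w x) ^ 4) \<le> c" for x c
  proof -
    have "norm (w x) ^ 4 \<le> enn2real c"
      using that enn2real_mono[of "ennreal (norm (w x) ^ 4)" c] by simp
    then have "(norm (w x))\<^sup>2 \<le> sqrt (enn2real c)"
      by (intro real_le_rsqrt) simp
    then show ?thesis unfolding r_def by (intro ennreal_leI)
  qed
  have lt: "a $ i < b $ i" for i using ab[of i] l by simp
  have "N = (\<integral>\<^sup>+x. \<integral>\<^sup>+y. \<integral>\<^sup>+z. ennreal (norm (w (vec3 x y z)) ^ 6) \<partial>seg (a $ 3) (b $ 3) \<partial>seg (a $ 2) (b $ 2) \<partial>seg (a $ 1) (b $ 1))"
    unfolding N_def by (rule nn_integral_cbox) measurable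
  also have "\<dots> \<le> (\<integral>\<^sup>+x. \<integral>\<^sup>+y. \<integral>\<^sup>+z. r (\<alpha>' (y, z)) * r (\<beta>' (x, z)) * r (\<gamma>' (x, y))
      \<partial>seg (a $ 3) (b $ 3) \<partial>seg (a $ 2) (b $ 2) \<partial>seg (a $ 1) (b $ 1))"
  proof -
    have "ennreal (norm (w (vec3 x y z)) ^ 6) \<le> r (\<alpha>' (y, z)) * r (\<beta>' (x, z)) * r (\<gamma>' (x, y))"
      if "x \<in> {a $ 1..b $ 1}" "y \<in> {a $ 2..b $ 2}" "z \<in> {a $ 3..b $ 3}" for x y z
    proof -
      have "ennreal (norm (w (vec3 x y z)) ^ 4) \<le> \<alpha>' (y, z)"
        unfolding \<alpha>'_def prod.case
        by (rule order_trans[OF fourth_power_le_nn_integral[OF smooth_line_vec3(1)[OF w] continuous_line_vec3(1)[OF cd] that(1) lt l ab]])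
          (intro nn_integral_mono ennreal_leI k)
      then have 1: "ennreal ((norm (w (vec3 x y z)))\<^sup>2) \<le> r (\<alpha>' (y, z))" by (rule rle[OF fin(1)])
      have "ennreal (norm (w (vec3 x y z)) ^ 4) \<le> \<beta>' (x, z)"
        unfolding \<beta>'_def prod.case
        by (rule order_trans[OF fourth_power_le_nn_integral[OF smooth_line_vec3(2)[OF w] continuous_line_vec3(2)[OF cd] that(2) lt l ab]])
          (intro nn_integral_mono ennreal_leI k)
      then have 2: "ennreal ((norm (w (vec3 x y z)))\<^sup>2) \<le> r (\<beta>' (x, z))" by (rule rle[OF fin(2)])
      have "ennreal (norm (w (vec3 x y z)) ^ 4) \<le> \<gamma>' (x, y)"
        unfolding \<gamma>'_def prod.case
        by (rule order_trans[OF fourth_power_le_nn_integral[OF smooth_line_vec3(3)[OF w] continuous_line_vec3(3)[OF cd] that(3) lt l ab]])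
          (intro nn_integral_mono ennreal_leI k)
      then have 3: "ennreal ((norm (w (vec3 x y z)))\<^sup>2) \<le> r (\<gamma>' (x, y))" by (rule rle[OF fin(3)])
      have "ennreal (norm (w (vec3 x y z)) ^ 6)
          = ennreal ((norm (w (vec3 x y z)))\<^sup>2) * ennreal ((norm (w (vec3 x y z)))\<^sup>2) * ennreal ((norm (w (vec3 x y z)))\<^sup>2)"
        by (simp flip: ennreal_mult power_add)
      also have "\<dots> \<le> r (\<alpha>' (y, z)) * r (\<beta>' (x, z)) * r (\<gamma>' (x, y))"
        by (intro mult_mono 1 2 3) auto
      finally show ?thesis .
    qed
    note P = this
    show ?thesis
    proof (rule nn_integral_mono_AE, use AE_seg in eventually_elim)
      case (elim x)
      show ?case
      proof (rule nn_integral_mono_AE, use AE_seg in eventually_elim)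
        case (elim y)
        show ?case
          by (rule nn_integral_mono_AE, use AE_seg in eventually_elim)
            (rule P, use \<open>x \<in> {a $ 1..b $ 1}\<close> elim in auto)
      qed
    qed
  qed
  finally have "N\<^sup>2 \<le> (\<integral>\<^sup>+x. \<integral>\<^sup>+y. \<integral>\<^sup>+z. r (\<alpha>' (y, z)) * r (\<beta>' (x, z)) * r (\<gamma>' (x, y))
      \<partial>seg (a $ 3) (b $ 3) \<partial>seg (a $ 2) (b $ 2) \<partial>seg (a $ 1) (b $ 1))\<^sup>2"
    by (rule power_mono) simp
  also have "\<dots> \<le> (\<integral>\<^sup>+y. \<integral>\<^sup>+z. r (\<alpha>' (y, z)) ^ 2 \<partial>seg (a $ 3) (b $ 3) \<partial>seg (a $ 2) (b $ 2))
      * (\<integral>\<^sup>+x. \<integral>\<^sup>+z. r (\<beta>' (x, z)) ^ 2 \<partial>seg (a $ 3) (b $ 3) \<partial>seg (a $ 1) (b $ 1))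
      * (\<integral>\<^sup>+x. \<integral>\<^sup>+y. r (\<gamma>' (x, y)) ^ 2 \<partial>seg (a $ 2) (b $ 2) \<partial>seg (a $ 1) (b $ 1))"
    by (rule loomis_whitney[of "\<lambda>p. r (\<alpha>' p)" "\<lambda>p. r (\<beta>' p)" "\<lambda>p. r (\<gamma>' p)"]) (auto intro: finite_measure_seg)
  also have "\<dots> = K * K * K"
    unfolding r2[OF fin(1)] r2[OF fin(2)] r2[OF fin(3)]
    unfolding \<alpha>'_def \<beta>'_def \<gamma>'_def prod.case K_def
    using nn_integral_cbox_permute(1,3)[of "\<lambda>v. ennreal (k v)" a b] nn_integral_cbox[of "\<lambda>v. ennreal (k v)" a b]
    by simp
  finally have N2: "N\<^sup>2 \<le> K ^ 3" by (simp add: power3_eq_cube)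
  have K2: "K\<^sup>2 \<le> N * A"
  proof -
    have "K = (\<integral>\<^sup>+v. (indicator (cbox a b) v * ennreal (norm (w v) ^ 3)) * (indicator (cbox a b) v * ennreal (h v)) \<partial>lborel)"
      unfolding K_def k_def by (intro nn_integral_cong) (auto simp: indicator_def ennreal_mult h0)
    also have "\<dots>\<^sup>2 \<le> (\<integral>\<^sup>+v. (indicator (cbox a b) v * ennreal (norm (w v) ^ 3))\<^sup>2 \<partial>lborel)
      * (\<integral>\<^sup>+v. (indicator (cbox a b) v * ennreal (h v))\<^sup>2 \<partial>lborel)"
      by (rule Cauchy_Schwarz_nn_integral) measurable
    also have "(\<integral>\<^sup>+v. (indicator (cbox a b) v * ennreal (norm (w v) ^ 3))\<^sup>2 \<partial>lborel) = N"
      unfolding N_def by (intro nn_integral_cong) (auto simp: indicator_def ennreal_power simp flip: power_mult)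
    also have "(\<integral>\<^sup>+v. (indicator (cbox a b) v * ennreal (h v))\<^sup>2 \<partial>lborel) = A"
      unfolding A_def by (intro nn_integral_cong) (auto simp: indicator_def ennreal_power h0)
    finally show ?thesis .
  qed
  \<comment> \<open>Cancelling N^3 requires N to be finite; the smooth field w is bounded on the
    closed box.\<close>
  have "N < \<infinity>" unfolding N_def
    by (rule nn_integral_cbox_continuous_finite) (intro continuous_intros cw)
  have "N ^ 3 * N = (N\<^sup>2)\<^sup>2" by (simp add: power2_eq_square power3_eq_cube mult.assoc)
  also have "\<dots> \<le> (K ^ 3)\<^sup>2" by (intro power_mono N2) simp
  also have "\<dots> = (K\<^sup>2) ^ 3" by (simp flip: power_mult)
  also have "\<dots> \<le> (N * A) ^ 3" by (intro power_mono K2) simp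
  also have "\<dots> = N ^ 3 * A ^ 3" by (rule power_mult_distrib)
  finally have *: "N ^ 3 * N \<le> N ^ 3 * A ^ 3" .
  have "N \<le> A ^ 3"
  proof (cases "N = 0")
    case False
    then have "N ^ 3 \<noteq> 0" "N ^ 3 \<noteq> \<top>"
      using \<open>N < \<infinity>\<close> by (auto simp: power_eq_top_ennreal)
    then show ?thesis using * by (subst (asm) ennreal_mult_le_mult_iff) auto
  qed simp
  then show ?thesis by (simp add: N_def A_def)
qed

section \<open>Poincare inequalities on a box\<close>

lemma square_norm_diff_le_nn_integral_derivative:
  fixes F :: "real \<Rightarrow> 'a::euclidean_space"
  assumes d: "\<And>t. (F has_vector_derivative f t) (at t)" and c: "continuous_on UNIV f"
    and s: "s \<in> {a..b}" and x: "x \<in> {a..b}"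
  shows "ennreal ((norm (F x - F s))\<^sup>2) \<le> ennreal (b - a) * (\<integral>\<^sup>+t. ennreal ((norm (f t))\<^sup>2) \<partial>seg a b)"
proof -
  have [measurable]: "f \<in> borel_measurable borel" using c by (rule borel_measurable_continuous_onI)
  have ab: "a \<le> b" using s by simp
  have "ennreal ((norm (F x - F s))\<^sup>2) = (ennreal (norm (F x - F s)))\<^sup>2"
    by (simp add: ennreal_power)
  also have "\<dots> \<le> (\<integral>\<^sup>+t. 1 * ennreal (norm (f t)) \<partial>seg a b)\<^sup>2"
    using norm_diff_le_nn_integral_derivative[OF assms] by (intro power_mono) auto
  also have "\<dots> \<le> (\<integral>\<^sup>+t. 1\<^sup>2 \<partial>seg a b) * (\<integral>\<^sup>+t. (ennreal (norm (f t)))\<^sup>2 \<partial>seg a b)"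
    by (rule Cauchy_Schwarz_nn_integral) auto
  also have "\<dots> = ennreal (b - a) * (\<integral>\<^sup>+t. ennreal ((norm (f t))\<^sup>2) \<partial>seg a b)"
    using ab by (simp add: emeasure_seg ennreal_power)
  finally show ?thesis .
qed

text \<open>Along each line in the first direction the field starts from 0, so its square is at most
  the edge length times the integral of the squared derivative over that line. Integrating this
  constant bound over x gives the second factor of the edge length.\<close>

lemma poincare_box_face:
  fixes w :: "real^3 \<Rightarrow> real^3"
  assumes w: "smooth w" and ab: "a $ 1 \<le> b $ 1" and z: "\<And>y z. w (vec3 (a $ 1) y z) = 0"
  shows "(\<integral>\<^sup>+v. indicator (cbox a b) v * ennreal ((norm (w v))\<^sup>2) \<partial>lborel)
    \<le> ennreal ((b $ 1 - a $ 1)\<^sup>2) * (\<integral>\<^sup>+v. indicator (cbox a b) v * ennreal ((norm (partial_deriv 1 w v))\<^sup>2) \<partial>lborel)"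
proof -
  have cd: "continuous_on UNIV (partial_deriv 1 w)"
    using w by (rule continuous_partial_deriv)
  have [measurable]: "w \<in> borel_measurable borel" "partial_deriv 1 w \<in> borel_measurable borel"
    using smooth_continuous[OF w] cd by (auto intro: borel_measurable_continuous_onI)
  let ?T = "\<lambda>y z. \<integral>\<^sup>+x. ennreal ((norm (partial_deriv 1 w (vec3 x y z)))\<^sup>2) \<partial>seg (a $ 1) (b $ 1)"
  let ?L = "ennreal (b $ 1 - a $ 1)"
  have "(\<integral>\<^sup>+v. indicator (cbox a b) v * ennreal ((norm (w v))\<^sup>2) \<partial>lborel)
     = (\<integral>\<^sup>+x. \<integral>\<^sup>+y. \<integral>\<^sup>+z. ennreal ((norm (w (vec3 x y z)))\<^sup>2) \<partial>seg (a $ 3) (b $ 3) \<partial>seg (a $ 2) (b $ 2) \<partial>seg (a $ 1) (b $ 1))"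
    by (rule nn_integral_cbox) measurable
  also have "\<dots> \<le> (\<integral>\<^sup>+x. \<integral>\<^sup>+y. \<integral>\<^sup>+z. ?L * ?T y z \<partial>seg (a $ 3) (b $ 3) \<partial>seg (a $ 2) (b $ 2) \<partial>seg (a $ 1) (b $ 1))"
  proof (rule nn_integral_mono_AE, use AE_seg in eventually_elim)
    case (elim x)
    show ?case
    proof (intro nn_integral_mono)
      fix y z
      show "ennreal ((norm (w (vec3 x y z)))\<^sup>2) \<le> ?L * ?T y z"
        using square_norm_diff_le_nn_integral_derivative[OF smooth_line_vec3(1)[OF w, of y z]
          continuous_line_vec3(1)[OF cd], of "a $ 1" "a $ 1" "b $ 1" x] ab elim z by simp
    qed
  qed
  also have "\<dots> = ?L * ?L * (\<integral>\<^sup>+y. \<integral>\<^sup>+z. ?T y z \<partial>seg (a $ 3) (b $ 3) \<partial>seg (a $ 2) (b $ 2))"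
    using ab by (simp add: nn_integral_cmult emeasure_seg mult_ac)
  also have "(\<integral>\<^sup>+y. \<integral>\<^sup>+z. ?T y z \<partial>seg (a $ 3) (b $ 3) \<partial>seg (a $ 2) (b $ 2))
      = (\<integral>\<^sup>+v. indicator (cbox a b) v * ennreal ((norm (partial_deriv 1 w v))\<^sup>2) \<partial>lborel)"
    by (rule nn_integral_cbox_permute) measurable
  also have "?L * ?L = ennreal ((b $ 1 - a $ 1)\<^sup>2)"
    using ab by (simp add: power2_eq_square flip: ennreal_mult)
  finally show ?thesis .
qed

text \<open>Each summand depends on two of the six variables only, and every other integration
  contributes an edge length. The integral over pairs of points in
  \<open>poincare_box_mean_zero\<close> is of this form.\<close>

lemma nn_integral_six_fold:
  fixes a b :: "real^3" and A B C :: "real \<Rightarrow> real \<Rightarrow> ennreal"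
  assumes ab: "\<And>i. a $ i \<le> b $ i"
    and [measurable]: "case_prod A \<in> borel_measurable (borel \<Otimes>\<^sub>M borel)" "case_prod B \<in> borel_measurable (borel \<Otimes>\<^sub>M borel)"
      "case_prod C \<in> borel_measurable (borel \<Otimes>\<^sub>M borel)"
  defines "M \<equiv> \<lambda>i. seg (a $ i) (b $ i)" and "E \<equiv> \<lambda>i. ennreal (b $ i - a $ i)"
  shows "(\<integral>\<^sup>+x. \<integral>\<^sup>+y. \<integral>\<^sup>+z. \<integral>\<^sup>+x'. \<integral>\<^sup>+y'. \<integral>\<^sup>+z'. (A y z + B x' z + C x' y') \<partial>M 3 \<partial>M 2 \<partial>M 1 \<partial>M 3 \<partial>M 2 \<partial>M 1)
    = (E 1 * E 2 * E 3) * (E 1 * (\<integral>\<^sup>+y. \<integral>\<^sup>+z. A y z \<partial>M 3 \<partial>M 2) + E 2 * (\<integral>\<^sup>+z. \<integral>\<^sup>+x'. B x' z \<partial>M 1 \<partial>M 3)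
      + E 3 * (\<integral>\<^sup>+x'. \<integral>\<^sup>+y'. C x' y' \<partial>M 2 \<partial>M 1))"
proof -
  have [measurable_cong]: "sets (M i) = sets borel" for i by (simp add: M_def)
  have sp: "space (M i) = UNIV" for i by (simp add: M_def)
  have em: "emeasure (M i) UNIV = E i" for i using ab by (simp add: M_def E_def emeasure_seg)
  have [measurable (raw)]: "(\<lambda>x. \<integral>\<^sup>+ y. f x y \<partial>M i) \<in> borel_measurable N"
    if "case_prod f \<in> borel_measurable (N \<Otimes>\<^sub>M M i)" for f i and N :: "'b measure"
    using that unfolding M_def by (rule seg.borel_measurable_nn_integral)
  have "(\<integral>\<^sup>+x'. \<integral>\<^sup>+y'. \<integral>\<^sup>+z'. (A y z + B x' z + C x' y') \<partial>M 3 \<partial>M 2 \<partial>M 1)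
    = E 1 * E 2 * E 3 * A y z + E 2 * E 3 * (\<integral>\<^sup>+x'. B x' z \<partial>M 1) + E 3 * (\<integral>\<^sup>+x'. \<integral>\<^sup>+y'. C x' y' \<partial>M 2 \<partial>M 1)" for y z
    by (simp add: nn_integral_add nn_integral_cmult nn_integral_multc sp em distrib_left distrib_right mult_ac)
  then show ?thesis
    by (simp add: nn_integral_add nn_integral_cmult nn_integral_multc sp em distrib_left distrib_right mult_ac)
qed

text \<open>For a field of mean zero, the volume times |w p|^2 is at most the integral over q of |w
  p - w q|^2, so the L^2 norm is controlled by an integral over pairs of points. The two points are
  joined by three segments parallel to the axes, along which the difference is an integral of one
  partial derivative.\<close>

lemma poincare_box_mean_zero:
  fixes w :: "real^3 \<Rightarrow> real^3"
  assumes w: "smooth w" and ab: "\<And>i. a $ i < b $ i"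
    and mean: "(LINT x|lborel. indicator (cbox a b) x *\<^sub>R w x) = 0"
  shows "(\<integral>\<^sup>+v. indicator (cbox a b) v * ennreal ((norm (w v))\<^sup>2) \<partial>lborel)
    \<le> (\<Sum>i\<in>UNIV. 3 * ennreal ((b $ i - a $ i)\<^sup>2)
        * (\<integral>\<^sup>+v. indicator (cbox a b) v * ennreal ((norm (partial_deriv i w v))\<^sup>2) \<partial>lborel))"
proof -
  have cw: "continuous_on UNIV w" and cd: "continuous_on UNIV (partial_deriv i w)" for i
    using w by (auto intro: smooth_continuous continuous_partial_deriv)
  have [measurable]: "w \<in> borel_measurable borel" "partial_deriv i w \<in> borel_measurable borel" for i
    using cw cd by (auto intro: borel_measurable_continuous_onI)
  define E where "E i = b $ i - a $ i" for i
  have E: "0 < E i" for i using ab[of i] by (simp add: E_def)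
  define I where "I i = (\<integral>\<^sup>+v. indicator (cbox a b) v * ennreal ((norm (partial_deriv i w v))\<^sup>2) \<partial>lborel)" for i
  define N where "N = (\<integral>\<^sup>+v. indicator (cbox a b) v * ennreal ((norm (w v))\<^sup>2) \<partial>lborel)"
  define A where "A y z = 3 * ennreal (E 1) * (\<integral>\<^sup>+x. ennreal ((norm (partial_deriv 1 w (vec3 x y z)))\<^sup>2) \<partial>seg (a $ 1) (b $ 1))" for y z
  define B where "B x z = 3 * ennreal (E 2) * (\<integral>\<^sup>+y. ennreal ((norm (partial_deriv 2 w (vec3 x y z)))\<^sup>2) \<partial>seg (a $ 2) (b $ 2))" for x z
  define C where "C x y = 3 * ennreal (E 3) * (\<integral>\<^sup>+z. ennreal ((norm (partial_deriv 3 w (vec3 x y z)))\<^sup>2) \<partial>seg (a $ 3) (b $ 3))" for x y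
  have [measurable]: "case_prod A \<in> borel_measurable (borel \<Otimes>\<^sub>M borel)" "case_prod B \<in> borel_measurable (borel \<Otimes>\<^sub>M borel)"
      "case_prod C \<in> borel_measurable (borel \<Otimes>\<^sub>M borel)"
    unfolding A_def B_def C_def by measurable
  define V where "V = E 1 * E 2 * E 3"
  have V: "0 < V" using E by (simp add: V_def)
  have mV: "measure lborel (cbox a b) = V"
  proof -
    have "a \<le> b" using ab by (simp add: less_eq_vec_def less_imp_le)
    moreover have "(\<Prod>i\<in>UNIV. b $ i - a $ i) = V"
      unfolding UNIV_3 V_def E_def by (simp add: mult.assoc)
    ultimately show ?thesis
      using content_cbox_cart[of a b] by (simp add: interval_eq_empty_cart ab not_less less_imp_le)
  qed
  \<comment> \<open>On expanding the square, the cross term pairs p with the integral of w, which is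
    0, and the term |w q|^2 is dropped.\<close>
  have vol: "ennreal V * ennreal ((norm p)\<^sup>2) \<le> (\<integral>\<^sup>+q. indicator (cbox a b) q * ennreal ((norm (p - w q))\<^sup>2) \<partial>lborel)" for p
  proof -
    have i: "integrable lborel (\<lambda>q. indicator (cbox a b) q *\<^sub>R f q)" if "continuous_on UNIV f" for f :: "real^3 \<Rightarrow> 'c::euclidean_space"
      by (rule borel_integrable_compact) (use that in \<open>auto intro: continuous_on_subset\<close>)
    have i1: "integrable lborel (\<lambda>q. indicator (cbox a b) q *\<^sub>R w q)" by (rule i[OF cw])
    have i2: "integrable lborel (\<lambda>q. indicator (cbox a b) q * (norm (w q))\<^sup>2)"
      using i[of "\<lambda>q. (norm (w q))\<^sup>2", OF continuous_on_power[OF continuous_on_norm[OF cw]]] by simp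
    have i3: "integrable lborel (\<lambda>q. indicator (cbox a b) q * (norm (p - w q))\<^sup>2)"
      using i[of "\<lambda>q. (norm (p - w q))\<^sup>2",
          OF continuous_on_power[OF continuous_on_norm[OF continuous_on_diff[OF continuous_on_const cw]]]] by simp
    have i4: "integrable lborel (\<lambda>q. (norm p)\<^sup>2 * indicator (cbox a b) q)"
      using i[of "\<lambda>q. (norm p)\<^sup>2", OF continuous_on_const] by (simp add: mult.commute)
    have eq: "indicator (cbox a b) q * (norm (p - w q))\<^sup>2
      = (norm p)\<^sup>2 * indicator (cbox a b) q - 2 * (p \<bullet> (indicator (cbox a b) q *\<^sub>R w q)) + indicator (cbox a b) q * (norm (w q))\<^sup>2" for q
      by (simp add: power2_norm_eq_inner inner_diff_left inner_diff_right inner_commute algebra_simps)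
    have "(LINT q|lborel. indicator (cbox a b) q * (norm (p - w q))\<^sup>2)
      = (LINT q|lborel. (norm p)\<^sup>2 * indicator (cbox a b) q) - 2 * (p \<bullet> (LINT q|lborel. indicator (cbox a b) q *\<^sub>R w q))
        + (LINT q|lborel. indicator (cbox a b) q * (norm (w q))\<^sup>2)"
      unfolding eq
      by (subst Bochner_Integration.integral_add, intro Bochner_Integration.integrable_diff i4 integrable_mult_right integrable_inner_right i1 impI, rule i2,
          subst Bochner_Integration.integral_diff, rule i4, intro integrable_mult_right integrable_inner_right i1 impI,
          subst integral_mult_right_zero, subst integral_inner_right, rule i1, rule refl)
    also have "\<dots> \<ge> V * (norm p)\<^sup>2"
      by (simp add: mean mV mult.commute)
    finally have "ennreal (V * (norm p)\<^sup>2) \<le> ennreal (LINT q|lborel. indicator (cbox a b) q * (norm (p - w q))\<^sup>2)"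
      by (rule ennreal_leI)
    also have "\<dots> = (\<integral>\<^sup>+q. ennreal (indicator (cbox a b) q * (norm (p - w q))\<^sup>2) \<partial>lborel)"
      by (rule nn_integral_eq_integral[symmetric, OF i3]) auto
    also have "\<dots> = (\<integral>\<^sup>+q. indicator (cbox a b) q * ennreal ((norm (p - w q))\<^sup>2) \<partial>lborel)"
      by (intro nn_integral_cong) (auto simp: indicator_def)
    finally show ?thesis using V by (simp flip: ennreal_mult)
  qed
  \<comment> \<open>The path changes first x, then y, then z; so \<open>A\<close> is taken at (y,
    z), \<open>B\<close> at (x', z) and \<open>C\<close> at (x', y'). The factor 3 in these
    functions comes from squaring a sum of three terms.\<close>
  have pt: "ennreal ((norm (w (vec3 x y z) - w (vec3 x' y' z')))\<^sup>2) \<le> A y z + B x' z + C x' y'"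
    if "x \<in> {a $ 1..b $ 1}" "y \<in> {a $ 2..b $ 2}" "z \<in> {a $ 3..b $ 3}"
      "x' \<in> {a $ 1..b $ 1}" "y' \<in> {a $ 2..b $ 2}" "z' \<in> {a $ 3..b $ 3}" for x y z x' y' z'
  proof -
    let ?u = "w (vec3 x y z) - w (vec3 x' y z)" and ?v = "w (vec3 x' y z) - w (vec3 x' y' z)"
      and ?t = "w (vec3 x' y' z) - w (vec3 x' y' z')"
    have "norm (?u + ?v + ?t) \<le> norm ?u + norm ?v + norm ?t"
      using norm_triangle_ineq[of "?u + ?v" ?t] norm_triangle_ineq[of ?u ?v] by linarith
    then have "(norm (?u + ?v + ?t))\<^sup>2 \<le> (norm ?u + norm ?v + norm ?t)\<^sup>2"
      by (intro power_mono) auto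
    also have "\<dots> \<le> 3 * (norm ?u)\<^sup>2 + 3 * (norm ?v)\<^sup>2 + 3 * (norm ?t)\<^sup>2"
      using sum_squares_bound[of "norm ?u" "norm ?v"] sum_squares_bound[of "norm ?u" "norm ?t"]
        sum_squares_bound[of "norm ?v" "norm ?t"]
      by (simp add: power2_eq_square algebra_simps)
    finally have "ennreal ((norm (w (vec3 x y z) - w (vec3 x' y' z')))\<^sup>2)
        \<le> ennreal (3 * (norm ?u)\<^sup>2 + 3 * (norm ?v)\<^sup>2 + 3 * (norm ?t)\<^sup>2)"
      by (intro ennreal_leI) simp
    also have "\<dots> = 3 * ennreal ((norm ?u)\<^sup>2) + 3 * ennreal ((norm ?v)\<^sup>2) + 3 * ennreal ((norm ?t)\<^sup>2)"
      by (simp add: ennreal_mult ennreal_plus)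
    also have "\<dots> \<le> A y z + B x' z + C x' y'"
      unfolding A_def B_def C_def E_def mult.assoc
      by (intro add_mono mult_left_mono
          square_norm_diff_le_nn_integral_derivative[OF smooth_line_vec3(1)[OF w] continuous_line_vec3(1)[OF cd]]
          square_norm_diff_le_nn_integral_derivative[OF smooth_line_vec3(2)[OF w] continuous_line_vec3(2)[OF cd]]
          square_norm_diff_le_nn_integral_derivative[OF smooth_line_vec3(3)[OF w] continuous_line_vec3(3)[OF cd]] that) auto
    finally show ?thesis .
  qed
  let ?M = "\<lambda>i. seg (a $ i) (b $ i)"
  have "ennreal V * N = (\<integral>\<^sup>+v. indicator (cbox a b) v * (ennreal V * ennreal ((norm (w v))\<^sup>2)) \<partial>lborel)"
    unfolding N_def by (subst nn_integral_cmult[symmetric]) (auto simp: mult_ac)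
  also have "\<dots> = (\<integral>\<^sup>+x. \<integral>\<^sup>+y. \<integral>\<^sup>+z. ennreal V * ennreal ((norm (w (vec3 x y z)))\<^sup>2) \<partial>?M 3 \<partial>?M 2 \<partial>?M 1)"
    by (rule nn_integral_cbox) measurable
  also have "\<dots> \<le> (\<integral>\<^sup>+x. \<integral>\<^sup>+y. \<integral>\<^sup>+z. \<integral>\<^sup>+x'. \<integral>\<^sup>+y'. \<integral>\<^sup>+z'. ennreal ((norm (w (vec3 x y z) - w (vec3 x' y' z')))\<^sup>2)
      \<partial>?M 3 \<partial>?M 2 \<partial>?M 1 \<partial>?M 3 \<partial>?M 2 \<partial>?M 1)"
    using vol by (intro nn_integral_mono) (simp add: nn_integral_cbox)
  also have "\<dots> \<le> (\<integral>\<^sup>+x. \<integral>\<^sup>+y. \<integral>\<^sup>+z. \<integral>\<^sup>+x'. \<integral>\<^sup>+y'. \<integral>\<^sup>+z'. (A y z + B x' z + C x' y') \<partial>?M 3 \<partial>?M 2 \<partial>?M 1 \<partial>?M 3 \<partial>?M 2 \<partial>?M 1)"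
  proof (rule nn_integral_mono_AE, use AE_seg in eventually_elim)
    case x: (elim x)
    show ?case
    proof (rule nn_integral_mono_AE, use AE_seg in eventually_elim)
      case y: (elim y)
      show ?case
      proof (rule nn_integral_mono_AE, use AE_seg in eventually_elim)
        case z: (elim z)
        show ?case
        proof (rule nn_integral_mono_AE, use AE_seg in eventually_elim)
          case x': (elim x')
          show ?case
          proof (rule nn_integral_mono_AE, use AE_seg in eventually_elim)
            case y': (elim y')
            show ?case
              by (rule nn_integral_mono_AE, use AE_seg in eventually_elim) (rule pt[OF x y z x' y'])
          qed
        qed
      qed
    qed
  qed
  also have "\<dots> = (ennreal (E 1) * ennreal (E 2) * ennreal (E 3)) * (ennreal (E 1) * (\<integral>\<^sup>+y. \<integral>\<^sup>+z. A y z \<partial>?M 3 \<partial>?M 2)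
      + ennreal (E 2) * (\<integral>\<^sup>+z. \<integral>\<^sup>+x'. B x' z \<partial>?M 1 \<partial>?M 3) + ennreal (E 3) * (\<integral>\<^sup>+x'. \<integral>\<^sup>+y'. C x' y' \<partial>?M 2 \<partial>?M 1))"
    unfolding E_def by (rule nn_integral_six_fold) (use ab less_imp_le in auto)
  also have "(\<integral>\<^sup>+y. \<integral>\<^sup>+z. A y z \<partial>?M 3 \<partial>?M 2) = 3 * ennreal (E 1) * I 1"
    unfolding A_def I_def
    using nn_integral_cbox_permute(3)[of "\<lambda>v. ennreal ((norm (partial_deriv 1 w v))\<^sup>2)" a b]
    by (simp add: nn_integral_cmult)
  also have "(\<integral>\<^sup>+z. \<integral>\<^sup>+x'. B x' z \<partial>?M 1 \<partial>?M 3) = 3 * ennreal (E 2) * I 2"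
    unfolding B_def I_def
    using nn_integral_cbox_permute(2)[of "\<lambda>v. ennreal ((norm (partial_deriv 2 w v))\<^sup>2)" a b]
    by (simp add: nn_integral_cmult)
  also have "(\<integral>\<^sup>+x'. \<integral>\<^sup>+y'. C x' y' \<partial>?M 2 \<partial>?M 1) = 3 * ennreal (E 3) * I 3"
    unfolding C_def I_def by (simp add: nn_integral_cmult nn_integral_cbox)
  also have "ennreal (E 1) * ennreal (E 2) * ennreal (E 3) = ennreal V"
    using E by (simp add: V_def less_imp_le flip: ennreal_mult)
  also have "ennreal (E 1) * (3 * ennreal (E 1) * I 1) + ennreal (E 2) * (3 * ennreal (E 2) * I 2) + ennreal (E 3) * (3 * ennreal (E 3) * I 3)
      = (\<Sum>i\<in>UNIV. 3 * ennreal ((E i)\<^sup>2) * I i)"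
    unfolding UNIV_3 using E by (simp add: power2_eq_square ennreal_mult less_imp_le mult_ac add.assoc)
  finally have "ennreal V * N \<le> ennreal V * (\<Sum>i\<in>UNIV. 3 * ennreal ((E i)\<^sup>2) * I i)" .
  then have "N \<le> (\<Sum>i\<in>UNIV. 3 * ennreal ((E i)\<^sup>2) * I i)"
    using V by (subst (asm) ennreal_mult_le_mult_iff) auto
  then show ?thesis by (simp add: N_def E_def I_def)
qed

section \<open>The spaces of the flow problem\<close>

lemma flow_domain_periodic: "flow_domain (Periodic L) = box 0 L"
  by (auto simp: mem_box_cart)

lemma flow_domain_open: "valid_setting S \<Longrightarrow> open (flow_domain S)"
  by (cases S) (auto simp: flow_domain_periodic simp del: flow_domain.simps(1))

lemma flow_domain_bounded: "valid_setting S \<Longrightarrow> bounded (flow_domain S)"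
  by (cases S) (auto simp: flow_domain_periodic simp del: flow_domain.simps(1))

lemma smooth_fields_smooth: "w \<in> smooth_fields S \<Longrightarrow> smooth w"
  by (cases S) (auto simp: test_functions_def)

lemma norm_square_class_on:
  assumes "cut_square_integrable \<Omega> w"
  shows "ennreal ((norm (class_on \<Omega> w))\<^sup>2) = (\<integral>\<^sup>+x. indicator \<Omega> x * ennreal ((norm (w x))\<^sup>2) \<partial>lebesgue)"
proof -
  have "ennreal ((norm (class_on \<Omega> w))\<^sup>2) = (\<integral>\<^sup>+x. ennreal (norm (rep_L2_field (class_on \<Omega> w) x))^2 \<partial>lebesgue)"
    by (rule nn_integral_rep_square[symmetric])
  also have "\<dots> = (\<integral>\<^sup>+x. indicator \<Omega> x * ennreal ((norm (w x))\<^sup>2) \<partial>lebesgue)"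
    using rep_class_on_AE[OF assms]
    by (intro nn_integral_cong_AE) (auto elim!: eventually_mono simp: indicator_def ennreal_power)
  finally show ?thesis .
qed

lemma smooth_fields_support:
  assumes "w \<in> smooth_fields (No_Slip \<Omega>)" "x \<notin> \<Omega>"
  shows "w x = 0" "partial_deriv i w x = 0"
proof -
  have "x \<notin> closure {x. w x \<noteq> 0}" using assms by (auto simp: test_functions_def)
  then show "w x = 0" "partial_deriv i w x = 0"
    using closure_subset[of "{x. w x \<noteq> 0}"] frechet_derivative_outside_support[of x w]
    by (auto simp: partial_deriv_def)
qed

lemma sum_three_square_le: "(\<Sum>i\<in>(UNIV::3 set). f i)\<^sup>2 \<le> 3 * (\<Sum>i\<in>UNIV. (f i :: real)\<^sup>2)"
  unfolding sum_3 using sum_squares_bound[of "f 1" "f 2"] sum_squares_bound[of "f 1" "f 3"] sum_squares_bound[of "f 2" "f 3"]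
  by (simp add: power2_eq_square algebra_simps)

text \<open>The two settings meet here: a box that contains \<open>\<Omega>\<close> up to null sets (periodic case) or up to a
  region where the fields vanish (no-slip case).\<close>

lemma smooth_fields_box:
  assumes S: "valid_setting S"
  obtains a b :: "real^3" and l c :: real where "0 < l" "\<And>i. l \<le> b $ i - a $ i" "0 \<le> c"
    "\<And>w n. w \<in> smooth_fields S \<Longrightarrow> 0 < n \<Longrightarrow>
      (\<integral>\<^sup>+x. indicator (cbox a b) x * ennreal (norm (w x) ^ n) \<partial>lborel)
       = (\<integral>\<^sup>+x. indicator (flow_domain S) x * ennreal (norm (w x) ^ n) \<partial>lborel)"
    "\<And>w i. w \<in> smooth_fields S \<Longrightarrow>
      (\<integral>\<^sup>+x. indicator (cbox a b) x * ennreal ((norm (partial_deriv i w x))\<^sup>2) \<partial>lborel)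
       = (\<integral>\<^sup>+x. indicator (flow_domain S) x * ennreal ((norm (partial_deriv i w x))\<^sup>2) \<partial>lborel)"
    "\<And>w. w \<in> smooth_fields S \<Longrightarrow>
      (\<integral>\<^sup>+x. indicator (cbox a b) x * ennreal ((norm (w x))\<^sup>2) \<partial>lborel)
       \<le> ennreal c * (\<Sum>i\<in>UNIV. \<integral>\<^sup>+x. indicator (cbox a b) x * ennreal ((norm (partial_deriv i w x))\<^sup>2) \<partial>lborel)"
proof (cases S)
  case (Periodic L)
  have L: "0 < L $ i" for i using S Periodic by simp
  \<comment> \<open>\<Omega> is the open box, while the inequalities were proved on the closed one;
    the two differ by faces, a null set.\<close>
  have "cbox 0 L - box 0 L \<in> null_sets lborel"
  proof -
    have "cbox 0 L - box 0 L \<in> null_sets lebesgue"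
      using negligible_frontier_interval negligible_iff_null_sets by blast
    then show ?thesis by (simp add: null_sets_completion_iff)
  qed
  then have "AE x in lborel. x \<notin> cbox 0 L - box 0 L" by (rule AE_not_in)
  then have "AE x in lborel. x \<in> cbox 0 L \<longleftrightarrow> x \<in> box 0 L"
    by eventually_elim (use box_subset_cbox[of 0 L] in blast)
  then have ae: "AE x in lborel. x \<in> cbox 0 L \<longleftrightarrow> x \<in> flow_domain S"
    unfolding Periodic flow_domain_periodic .
  have cong: "(\<integral>\<^sup>+x. indicator (cbox 0 L) x * f x \<partial>lborel) = (\<integral>\<^sup>+x. indicator (flow_domain S) x * f x \<partial>lborel)" for f
    using ae by (intro nn_integral_cong_AE) (auto elim!: eventually_mono simp: indicator_def)
  define l where "l = Min (range (\<lambda>i. L $ i))"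
  define c where "c = (\<Sum>i\<in>UNIV. 3 * (L $ i)\<^sup>2)"
  show ?thesis
  proof (rule that[of l L 0 c])
    show "0 < l" unfolding l_def using L by (subst Min_gr_iff) auto
    show "l \<le> L $ i - 0 $ i" for i unfolding l_def by (simp add: Min_le)
    show "0 \<le> c" unfolding c_def by (intro sum_nonneg) simp
    fix w assume w: "w \<in> smooth_fields S"
    have sm: "smooth w" using w by (rule smooth_fields_smooth)
    have [measurable]: "w \<in> borel_measurable borel"
      using smooth_continuous[OF sm] by (rule borel_measurable_continuous_onI)
    have "(LINT x|lebesgue. indicator (flow_domain S) x *\<^sub>R w x) = 0"
      using w Periodic by (simp add: set_lebesgue_integral_def del: flow_domain.simps)
    also have "(LINT x|lebesgue. indicator (flow_domain S) x *\<^sub>R w x) = (LINT x|lborel. indicator (flow_domain S) x *\<^sub>R w x)"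
      using flow_domain_open[OF S] by (intro integral_completion) measurable
    also have "\<dots> = (LINT x|lborel. indicator (cbox 0 L) x *\<^sub>R w x)"
    proof (rule integral_cong_AE)
      show "AE x in lborel. indicator (flow_domain S) x *\<^sub>R w x = indicator (cbox 0 L) x *\<^sub>R w x"
        using ae by eventually_elim (simp add: indicator_def)
    qed (use flow_domain_open[OF S] in \<open>auto intro!: borel_measurable_scaleR borel_measurable_indicator\<close>)
    finally have mean: "(LINT x|lborel. indicator (cbox 0 L) x *\<^sub>R w x) = 0" .
    have "(\<integral>\<^sup>+x. indicator (cbox 0 L) x * ennreal ((norm (w x))\<^sup>2) \<partial>lborel)
      \<le> (\<Sum>i\<in>UNIV. 3 * ennreal ((L $ i - 0 $ i)\<^sup>2)
        * (\<integral>\<^sup>+v. indicator (cbox 0 L) v * ennreal ((norm (partial_deriv i w v))\<^sup>2) \<partial>lborel))"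
      by (rule poincare_box_mean_zero[OF sm _ mean]) (simp add: L)
    also have "\<dots> \<le> (\<Sum>i\<in>UNIV. ennreal c
        * (\<integral>\<^sup>+v. indicator (cbox 0 L) v * ennreal ((norm (partial_deriv i w v))\<^sup>2) \<partial>lborel))"
    proof (intro sum_mono mult_right_mono)
      fix i
      have "3 * (L $ i)\<^sup>2 \<le> c" unfolding c_def by (rule member_le_sum) auto
      then have "ennreal (3 * (L $ i)\<^sup>2) \<le> ennreal c" by (rule ennreal_leI)
      then show "3 * ennreal ((L $ i - 0 $ i)\<^sup>2) \<le> ennreal c" by (simp add: ennreal_mult)
    qed simp
    finally show "(\<integral>\<^sup>+x. indicator (cbox 0 L) x * ennreal ((norm (w x))\<^sup>2) \<partial>lborel)
       \<le> ennreal c * (\<Sum>i\<in>UNIV. \<integral>\<^sup>+x. indicator (cbox 0 L) x * ennreal ((norm (partial_deriv i w x))\<^sup>2) \<partial>lborel)"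
      by (simp add: sum_distrib_left)
  qed (rule cong)+
next
  case (No_Slip \<Omega>)
  have bd: "bounded \<Omega>" and ne: "\<Omega> \<noteq> {}" using S No_Slip by auto
  obtain b where b: "\<Omega> \<subseteq> box (- b) b" using bounded_subset_box_symmetric[OF bd] by blast
  then have "box (- b) b \<noteq> {}" using ne by blast
  then have pos: "0 < b $ i" for i
    by (auto simp: interval_eq_empty_cart not_le dest: spec[of _ i])
  define l where "l = Min (range (\<lambda>i. 2 * b $ i))"
  define c where "c = (b $ 1 - (- b) $ 1)\<^sup>2"
  have sub: "\<Omega> \<subseteq> cbox (- b) b" using b box_subset_cbox by blast
  have z: "w x = 0" "partial_deriv i w x = 0" if "w \<in> smooth_fields S" "x \<notin> \<Omega>" for w x i
    using smooth_fields_support[of w \<Omega> x] that No_Slip by auto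
  show ?thesis
  proof (rule that[of l b "- b" c])
    show "0 < l" unfolding l_def using pos by (subst Min_gr_iff) auto
    show "l \<le> b $ i - (- b) $ i" for i unfolding l_def by (simp add: Min_le)
    show "0 \<le> c" unfolding c_def by simp
    fix w assume w: "w \<in> smooth_fields S"
    \<comment> \<open>For n = 0 the integrand would be 1 also where w vanishes, hence the
      restriction to positive n.\<close>
    show "(\<integral>\<^sup>+x. indicator (cbox (- b) b) x * ennreal (norm (w x) ^ n) \<partial>lborel)
       = (\<integral>\<^sup>+x. indicator (flow_domain S) x * ennreal (norm (w x) ^ n) \<partial>lborel)" if "0 < n" for n
      using z(1)[OF w] sub that No_Slip by (intro nn_integral_cong) (auto simp: indicator_def)
    show "(\<integral>\<^sup>+x. indicator (cbox (- b) b) x * ennreal ((norm (partial_deriv i w x))\<^sup>2) \<partial>lborel)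
       = (\<integral>\<^sup>+x. indicator (flow_domain S) x * ennreal ((norm (partial_deriv i w x))\<^sup>2) \<partial>lborel)" for i
      using z(2)[OF w] sub No_Slip by (intro nn_integral_cong) (auto simp: indicator_def)
    \<comment> \<open>\<Omega> lies in the open box, so the whole plane through its left face misses
      \<Omega>, and the field vanishes there.\<close>
    have "w (vec3 ((- b) $ 1) y z) = 0" for y z
    proof (rule z(1)[OF w])
      have "vec3 ((- b) $ 1) y z \<notin> box (- b) b"
        by (auto simp: mem_box_cart intro!: exI[of _ 1])
      then show "vec3 ((- b) $ 1) y z \<notin> \<Omega>" using b by blast
    qed
    then have "(\<integral>\<^sup>+x. indicator (cbox (- b) b) x * ennreal ((norm (w x))\<^sup>2) \<partial>lborel)
      \<le> ennreal c * (\<integral>\<^sup>+x. indicator (cbox (- b) b) x * ennreal ((norm (partial_deriv 1 w x))\<^sup>2) \<partial>lborel)"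
      unfolding c_def using pos[of 1]
      by (intro poincare_box_face smooth_fields_smooth[OF w]) auto
    also have "\<dots> \<le> ennreal c * (\<Sum>i\<in>UNIV. \<integral>\<^sup>+x. indicator (cbox (- b) b) x * ennreal ((norm (partial_deriv i w x))\<^sup>2) \<partial>lborel)"
      by (intro mult_left_mono member_le_sum) auto
    finally show "(\<integral>\<^sup>+x. indicator (cbox (- b) b) x * ennreal ((norm (w x))\<^sup>2) \<partial>lborel)
       \<le> ennreal c * (\<Sum>i\<in>UNIV. \<integral>\<^sup>+x. indicator (cbox (- b) b) x * ennreal ((norm (partial_deriv i w x))\<^sup>2) \<partial>lborel)" .
  qed
qed

lemma norm_V_eq: "norm_V S u = norm (grad S u)"
  by (simp add: norm_V_def inner_V_def norm_eq_sqrt_inner inner_vec_def)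

lemma inner_V_eq: "inner_V S u v = grad S u \<bullet> grad S v"
  by (simp add: inner_V_def inner_vec_def)

lemma norm_V_nonneg [simp]: "0 \<le> norm_V S u"
  by (simp add: norm_V_eq)

lemma norm_V_square: "(norm_V S u)\<^sup>2 = (\<Sum>i\<in>UNIV. (norm (grad S u $ i))\<^sup>2)"
  by (simp add: norm_V_eq power2_norm_eq_inner inner_vec_def)

lemma cut_square_integrable_smooth:
  assumes "valid_setting S" "smooth w"
  shows "cut_square_integrable (flow_domain S) w" "cut_square_integrable (flow_domain S) (partial_deriv i w)"
  using assms smooth_continuous continuous_partial_deriv flow_domain_open flow_domain_bounded
  by (auto intro!: cut_square_integrable_continuous)

lemma class_on_smooth:
  assumes S: "valid_setting S" and w: "smooth w"
  shows "class_on (flow_domain S) w \<in> H1_on (flow_domain S)"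
    and "grad S (class_on (flow_domain S) w) $ i = class_on (flow_domain S) (partial_deriv i w)"
  using has_weak_gradient_smooth[OF w flow_domain_open[OF S] flow_domain_bounded[OF S]]
    weak_gradient_eqI[OF flow_domain_open[OF S] flow_domain_bounded[OF S]]
    class_on_L2_on[OF cut_square_integrable_smooth(1)[OF S w]]
  by (auto simp: H1_on_def)

text \<open>The function h of \<open>sobolev_box\<close> contains |w| itself. Poincare's inequality
  bounds this part by the gradient, so that both estimates have only \<open>norm_V\<close> on the
  right.\<close>

lemma smooth_fields_estimates:
  assumes S: "valid_setting S"
  obtains C where "0 < C"
    "\<And>w. w \<in> smooth_fields S \<Longrightarrow> norm (class_on (flow_domain S) w) \<le> C * norm_V S (class_on (flow_domain S) w)"
    "\<And>w. w \<in> smooth_fields S \<Longrightarrow> (\<integral>\<^sup>+x. ennreal (norm (rep_L2_field (class_on (flow_domain S) w) x) ^ 6) \<partial>lebesgue)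
      \<le> ennreal ((C * norm_V S (class_on (flow_domain S) w)) ^ 6)"
proof -
  obtain a b :: "real^3" and l c :: real where l: "0 < l" "\<And>i. l \<le> b $ i - a $ i" and c: "0 \<le> c"
    and B: "\<And>w n. w \<in> smooth_fields S \<Longrightarrow> 0 < n \<Longrightarrow>
      (\<integral>\<^sup>+x. indicator (cbox a b) x * ennreal (norm (w x) ^ n) \<partial>lborel)
       = (\<integral>\<^sup>+x. indicator (flow_domain S) x * ennreal (norm (w x) ^ n) \<partial>lborel)"
    "\<And>w i. w \<in> smooth_fields S \<Longrightarrow>
      (\<integral>\<^sup>+x. indicator (cbox a b) x * ennreal ((norm (partial_deriv i w x))\<^sup>2) \<partial>lborel)
       = (\<integral>\<^sup>+x. indicator (flow_domain S) x * ennreal ((norm (partial_deriv i w x))\<^sup>2) \<partial>lborel)"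
    and P: "\<And>w. w \<in> smooth_fields S \<Longrightarrow>
      (\<integral>\<^sup>+x. indicator (cbox a b) x * ennreal ((norm (w x))\<^sup>2) \<partial>lborel)
       \<le> ennreal c * (\<Sum>i\<in>UNIV. \<integral>\<^sup>+x. indicator (cbox a b) x * ennreal ((norm (partial_deriv i w x))\<^sup>2) \<partial>lborel)"
    by (rule smooth_fields_box[OF S]) (rule that)
  \<comment> \<open>h^2 is at most d |w|^2 + 96 times the squared gradient, where 96 = 2 * 16 * 3
    collects the square of a sum of two, the factor 4 in h and the sum over three directions.
    Poincare's inequality turns this into c' = d c + 96. C^2 dominates both c and c', and the
    summand 1 makes C positive.\<close>
  define d where "d = 2 / l\<^sup>2"
  have d: "0 \<le> d" by (simp add: d_def)
  define c' where "c' = d * c + 96"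
  define C where "C = sqrt (c + c' + 1)"
  have c': "0 \<le> c'" using c d by (simp add: c'_def)
  have C2: "C\<^sup>2 = c + c' + 1" using c c' by (simp add: C_def)
  have C0: "0 < C" using c c' by (simp add: C_def)
  have op: "flow_domain S \<in> sets borel" using flow_domain_open[OF S] by simp
  have *: "norm (class_on (flow_domain S) w) \<le> C * norm_V S (class_on (flow_domain S) w)
    \<and> (\<integral>\<^sup>+x. ennreal (norm (rep_L2_field (class_on (flow_domain S) w) x) ^ 6) \<partial>lebesgue)
      \<le> ennreal ((C * norm_V S (class_on (flow_domain S) w)) ^ 6)" if w: "w \<in> smooth_fields S" for w
  proof -
    have sm: "smooth w" using w by (rule smooth_fields_smooth)
    define u where "u = class_on (flow_domain S) w"
    have cw: "continuous_on UNIV w" "continuous_on UNIV (partial_deriv i w)" for i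
      using sm smooth_continuous continuous_partial_deriv by auto
    have m[measurable]: "w \<in> borel_measurable borel" "partial_deriv i w \<in> borel_measurable borel" for i
      using cw by (auto intro: borel_measurable_continuous_onI)
    have csi: "cut_square_integrable (flow_domain S) w" "cut_square_integrable (flow_domain S) (partial_deriv i w)" for i
      using cut_square_integrable_smooth[OF S sm] by auto
    have I: "(\<integral>\<^sup>+x. indicator (cbox a b) x * ennreal ((norm (partial_deriv i w x))\<^sup>2) \<partial>lborel)
       = ennreal ((norm (grad S u $ i))\<^sup>2)" for i
      unfolding u_def class_on_smooth(2)[OF S sm] norm_square_class_on[OF csi(2)] B(2)[OF w]
      by (rule nn_integral_completion[symmetric])
    have sI: "(\<Sum>i\<in>UNIV. \<integral>\<^sup>+x. indicator (cbox a b) x * ennreal ((norm (partial_deriv i w x))\<^sup>2) \<partial>lborel)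
        = ennreal ((norm_V S u)\<^sup>2)"
      by (simp add: I norm_V_square)
    have N: "(\<integral>\<^sup>+x. indicator (cbox a b) x * ennreal ((norm (w x))\<^sup>2) \<partial>lborel) = ennreal ((norm u)\<^sup>2)"
      unfolding u_def norm_square_class_on[OF csi(1)] B(1)[OF w, of 2, simplified]
      by (rule nn_integral_completion[symmetric])
    have "ennreal ((norm u)\<^sup>2) \<le> ennreal c * ennreal ((norm_V S u)\<^sup>2)"
      using P[OF w] by (simp add: N sI)
    then have n2: "(norm u)\<^sup>2 \<le> c * (norm_V S u)\<^sup>2" using c by (simp flip: ennreal_mult)
    also have "\<dots> \<le> (C * norm_V S u)\<^sup>2"
      using c c' by (simp add: power_mult_distrib C2 mult_right_mono)
    finally have 1: "norm u \<le> C * norm_V S u"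
      by (rule power2_le_imp_le) (simp add: C0 less_imp_le)
    let ?h = "\<lambda>x. norm (w x) / l + 4 * (\<Sum>i\<in>UNIV. norm (partial_deriv i w x))"
    have h: "(?h x)\<^sup>2 \<le> d * (norm (w x))\<^sup>2 + 96 * (\<Sum>i\<in>UNIV. (norm (partial_deriv i w x))\<^sup>2)" for x
    proof -
      have "(?h x)\<^sup>2 \<le> 2 * (norm (w x) / l)\<^sup>2 + 2 * (4 * (\<Sum>i\<in>UNIV. norm (partial_deriv i w x)))\<^sup>2"
        unfolding power2_sum using sum_squares_bound[of "norm (w x) / l" "4 * (\<Sum>i\<in>UNIV. norm (partial_deriv i w x))"]
        by linarith
      also have "\<dots> = d * (norm (w x))\<^sup>2 + 32 * (\<Sum>i\<in>UNIV. norm (partial_deriv i w x))\<^sup>2"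
        by (simp add: power_divide power_mult_distrib d_def)
      also have "\<dots> \<le> d * (norm (w x))\<^sup>2 + 96 * (\<Sum>i\<in>UNIV. (norm (partial_deriv i w x))\<^sup>2)"
        using sum_three_square_le[of "\<lambda>i. norm (partial_deriv i w x)"] by linarith
      finally show ?thesis .
    qed
    have "(\<integral>\<^sup>+x. indicator (cbox a b) x * ennreal ((?h x)\<^sup>2) \<partial>lborel)
      \<le> (\<integral>\<^sup>+x. ennreal (d) * (indicator (cbox a b) x * ennreal ((norm (w x))\<^sup>2))
          + 96 * (\<Sum>i\<in>UNIV. indicator (cbox a b) x * ennreal ((norm (partial_deriv i w x))\<^sup>2)) \<partial>lborel)"
    proof (intro nn_integral_mono)
      fix x
      have "ennreal ((?h x)\<^sup>2) \<le> ennreal (d * (norm (w x))\<^sup>2 + 96 * (\<Sum>i\<in>UNIV. (norm (partial_deriv i w x))\<^sup>2))"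
        by (rule ennreal_leI[OF h])
      also have "\<dots> = ennreal (d) * ennreal ((norm (w x))\<^sup>2) + 96 * (\<Sum>i\<in>UNIV. ennreal ((norm (partial_deriv i w x))\<^sup>2))"
        using d by (simp add: ennreal_mult ennreal_plus sum_nonneg)
      finally show "indicator (cbox a b) x * ennreal ((?h x)\<^sup>2)
          \<le> ennreal (d) * (indicator (cbox a b) x * ennreal ((norm (w x))\<^sup>2))
          + 96 * (\<Sum>i\<in>UNIV. indicator (cbox a b) x * ennreal ((norm (partial_deriv i w x))\<^sup>2))"
        by (auto simp: indicator_def)
    qed
    also have "\<dots> = ennreal (d) * ennreal ((norm u)\<^sup>2) + 96 * ennreal ((norm_V S u)\<^sup>2)"
    proof -
      have "(\<integral>\<^sup>+x. ennreal d * (indicator (cbox a b) x * ennreal ((norm (w x))\<^sup>2)) \<partial>lborel) = ennreal d * ennreal ((norm u)\<^sup>2)"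
        by (subst nn_integral_cmult) (auto simp: N)
      moreover have "(\<integral>\<^sup>+x. 96 * (\<Sum>i\<in>UNIV. indicator (cbox a b) x * ennreal ((norm (partial_deriv i w x))\<^sup>2)) \<partial>lborel)
          = 96 * ennreal ((norm_V S u)\<^sup>2)"
        by (subst nn_integral_cmult, measurable, subst nn_integral_sum, measurable, simp only: sI)
      ultimately show ?thesis
        by (subst nn_integral_add) simp_all
    qed
    also have "\<dots> = ennreal (d * (norm u)\<^sup>2 + 96 * (norm_V S u)\<^sup>2)"
      using d by (simp add: ennreal_mult ennreal_plus)
    also have "\<dots> \<le> ennreal (c' * (norm_V S u)\<^sup>2)"
      using mult_left_mono[OF n2 d] by (intro ennreal_leI) (simp add: c'_def algebra_simps)
    finally have h2: "(\<integral>\<^sup>+x. indicator (cbox a b) x * ennreal ((?h x)\<^sup>2) \<partial>lborel) \<le> ennreal (c' * (norm_V S u)\<^sup>2)" .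
    have "(\<integral>\<^sup>+x. ennreal (norm (rep_L2_field u x) ^ 6) \<partial>lebesgue)
        = (\<integral>\<^sup>+x. indicator (flow_domain S) x * ennreal (norm (w x) ^ 6) \<partial>lebesgue)"
      unfolding u_def using rep_class_on_AE[OF csi(1)]
      by (intro nn_integral_cong_AE) (auto elim!: eventually_mono simp: indicator_def)
    also have "\<dots> = (\<integral>\<^sup>+x. indicator (cbox a b) x * ennreal (norm (w x) ^ 6) \<partial>lborel)"
      unfolding B(1)[OF w, of 6, simplified] by (rule nn_integral_completion)
    also have "\<dots> \<le> (\<integral>\<^sup>+x. indicator (cbox a b) x * ennreal ((?h x)\<^sup>2) \<partial>lborel) ^ 3"
      by (rule sobolev_box[OF sm l(2) l(1)])
    also have "\<dots> \<le> (ennreal (c' * (norm_V S u)\<^sup>2)) ^ 3"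
      by (intro power_mono h2) simp
    also have "\<dots> = ennreal ((c' * (norm_V S u)\<^sup>2) ^ 3)"
      using c' by (simp add: ennreal_power)
    also have "\<dots> \<le> ennreal ((C * norm_V S u) ^ 6)"
    proof (rule ennreal_leI)
      have "(c' * (norm_V S u)\<^sup>2) ^ 3 \<le> (C\<^sup>2 * (norm_V S u)\<^sup>2) ^ 3"
        using c c' by (intro power_mono mult_right_mono) (auto simp: C2)
      also have "\<dots> = (C * norm_V S u) ^ 6"
        by (simp add: power_mult_distrib flip: power_mult)
      finally show "(c' * (norm_V S u)\<^sup>2) ^ 3 \<le> (C * norm_V S u) ^ 6" .
    qed
    finally show ?thesis using 1 by (simp add: u_def)
  qed
  show ?thesis by (rule that[of C]) (use C0 * in auto)
qed

section \<open>The space V and the trilinear form\<close>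

lemma smooth_fields_add:
  assumes S: "valid_setting S" and v: "v \<in> smooth_fields S" and w: "w \<in> smooth_fields S"
  shows "(\<lambda>x. v x + w x) \<in> smooth_fields S"
proof -
  have sv: "smooth v" and sw: "smooth w" using v w by (auto intro: smooth_fields_smooth)
  have s: "smooth (\<lambda>x. v x + w x)"
    unfolding smooth_def using sv sw by (simp add: smooth_def C_diff_add)
  have p: "partial_deriv i (\<lambda>x. v x + w x) x = partial_deriv i v x + partial_deriv i w x" for i x
    unfolding partial_deriv_def
    by (rule fun_cong[OF frechet_derivative_at[OF has_derivative_add[OF smooth_has_derivative[OF sv]
      smooth_has_derivative[OF sw]], symmetric], THEN trans]) simp
  have dv: "divergence_free (\<lambda>x. v x + w x)" if "divergence_free v" "divergence_free w"
    using that by (simp add: divergence_free_def p sum.distrib)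
  show ?thesis
  proof (cases S)
    case (Periodic L)
    have i: "set_integrable lebesgue (flow_domain S) f" if "smooth f" for f :: "real^3 \<Rightarrow> real^3"
      unfolding set_integrable_def
    proof (rule Bochner_Integration.integrable_bound)
      let ?g = "\<lambda>x. indicator (flow_domain S) x *\<^sub>R f x"
      have fin: "emeasure lebesgue (flow_domain S) < \<infinity>"
        using emeasure_bounded_finite[OF flow_domain_bounded[OF S]] flow_domain_open[OF S] by simp
      show "integrable lebesgue (\<lambda>x. indicator (flow_domain S) x + (norm (?g x))\<^sup>2)"
        using cut_square_integrable_smooth(1)[OF S that] fin flow_domain_open[OF S]
        by (intro Bochner_Integration.integrable_add integrable_real_indicator)
          (auto simp: cut_square_integrable_def square_integrable_def)
      show "?g \<in> borel_measurable lebesgue"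
        using cut_square_integrable_smooth(1)[OF S that] by (auto simp: cut_square_integrable_def square_integrable_def)
      have "norm a \<le> 1 + (norm a)\<^sup>2" for a :: "real^3"
        using zero_le_power2[of "norm a - 1/2"] by (simp add: power2_eq_square algebra_simps)
      then show "AE x in lebesgue. norm (?g x) \<le> norm (indicator (flow_domain S) x + (norm (?g x))\<^sup>2)"
        by (intro AE_I2) (simp add: indicator_def)
    qed
    show ?thesis using v w Periodic s dv set_integral_add[OF i[OF sv] i[OF sw]]
      by (simp del: flow_domain.simps)
  next
    case (No_Slip \<Omega>)
    let ?s = "\<lambda>f. closure {x. f x \<noteq> (0 :: real^3)}"
    have "{x. v x + w x \<noteq> 0} \<subseteq> {x. v x \<noteq> 0} \<union> {x. w x \<noteq> 0}" by auto
    then have sub: "?s (\<lambda>x. v x + w x) \<subseteq> ?s v \<union> ?s w"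
      unfolding closure_Un[symmetric] by (rule closure_mono)
    have cp: "compact (?s v \<union> ?s w)" and "?s v \<union> ?s w \<subseteq> \<Omega>"
      using v w No_Slip by (auto simp: test_functions_def)
    then have "?s (\<lambda>x. v x + w x) \<subseteq> \<Omega>" using sub by blast
    moreover have "compact (?s (\<lambda>x. v x + w x))"
      using bounded_subset[OF compact_imp_bounded[OF cp] sub] unfolding compact_eq_bounded_closed by simp
    ultimately have "compact (?s (\<lambda>x. v x + w x))" "?s (\<lambda>x. v x + w x) \<subseteq> \<Omega>"
      by blast+
    then show ?thesis using v w No_Slip s dv by (simp add: test_functions_def)
  qed
qed

lemma smooth_fields_scaleR:
  assumes S: "valid_setting S" and w: "w \<in> smooth_fields S"
  shows "(\<lambda>x. c *\<^sub>R w x) \<in> smooth_fields S"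
proof -
  have sw: "smooth w" using w by (auto intro: smooth_fields_smooth)
  have s: "smooth (\<lambda>x. c *\<^sub>R w x)"
    unfolding smooth_def by (intro allI C_diff_scaleR[OF C_diff_const] smooth_C_diff sw)
  have p: "partial_deriv i (\<lambda>x. c *\<^sub>R w x) x = c *\<^sub>R partial_deriv i w x" for i x
    unfolding partial_deriv_def
    by (rule fun_cong[OF frechet_derivative_at[OF has_derivative_scaleR_right[OF smooth_has_derivative[OF sw]], symmetric], THEN trans]) simp
  have dv: "divergence_free (\<lambda>x. c *\<^sub>R w x)" if "divergence_free w"
    using that by (simp add: divergence_free_def p flip: sum_distrib_left)
  show ?thesis
  proof (cases S)
    case (Periodic L)
    show ?thesis using w Periodic s dv by (simp del: flow_domain.simps)
  next
    case (No_Slip \<Omega>)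
    show ?thesis
    proof (cases "c = 0")
      case True
      then show ?thesis using w No_Slip s dv by (simp add: test_functions_def)
    next
      case False
      then show ?thesis using w No_Slip s dv by (simp add: test_functions_def)
    qed
  qed
qed

lemma grad_add:
  assumes S: "valid_setting S" and "u \<in> H1_on (flow_domain S)" "v \<in> H1_on (flow_domain S)"
  shows "grad S (u + v) = grad S u + grad S v"
  using assms flow_domain_open[OF S] flow_domain_bounded[OF S]
  by (intro weak_gradient_eqI has_weak_gradient_add has_weak_gradient_weak_gradient)

lemma grad_scaleR:
  assumes S: "valid_setting S" and "u \<in> H1_on (flow_domain S)"
  shows "grad S (c *\<^sub>R u) = c *\<^sub>R grad S u"
  using assms flow_domain_open[OF S] flow_domain_bounded[OF S]
  by (intro weak_gradient_eqI has_weak_gradient_scaleR has_weak_gradient_weak_gradient)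

lemma H1_on_diff: "u \<in> H1_on \<Omega> \<Longrightarrow> v \<in> H1_on \<Omega> \<Longrightarrow> u - v \<in> H1_on \<Omega>"
  using H1_on_add[of u \<Omega> "(- 1) *\<^sub>R v"] H1_on_scaleR[of v \<Omega> "- 1"] by simp

lemma grad_diff:
  assumes S: "valid_setting S" and u: "u \<in> H1_on (flow_domain S)" and v: "v \<in> H1_on (flow_domain S)"
  shows "grad S (u - v) = grad S u - grad S v"
  using grad_add[OF S u H1_on_scaleR[OF v, of "- 1"]] grad_scaleR[OF S v, of "- 1"] by simp

lemma space_V_H1: "u \<in> space_V S \<Longrightarrow> u \<in> H1_on (flow_domain S)"
  by (simp add: space_V_def)

lemma space_V_approx:
  assumes "u \<in> space_V S" "0 < \<epsilon>"
  obtains w where "w \<in> smooth_fields S" "norm (u - class_on (flow_domain S) w) < \<epsilon>"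
    "norm_V S (u - class_on (flow_domain S) w) < \<epsilon>"
proof -
  obtain w where w: "w \<in> smooth_fields S" and
    "sqrt ((norm (u - class_on (flow_domain S) w))\<^sup>2 + (norm (grad S (u - class_on (flow_domain S) w)))\<^sup>2) < \<epsilon>"
    using assms by (auto simp: space_V_def)
  moreover have "norm (u - class_on (flow_domain S) w)
      \<le> sqrt ((norm (u - class_on (flow_domain S) w))\<^sup>2 + (norm (grad S (u - class_on (flow_domain S) w)))\<^sup>2)"
    "norm (grad S (u - class_on (flow_domain S) w))
      \<le> sqrt ((norm (u - class_on (flow_domain S) w))\<^sup>2 + (norm (grad S (u - class_on (flow_domain S) w)))\<^sup>2)"
    by (intro real_le_rsqrt; simp)+
  ultimately show ?thesis
    unfolding norm_V_eq[symmetric] using w by (intro that[of w]) linarith+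
qed

lemma space_VI:
  assumes S: "valid_setting S" and u: "u \<in> H1_on (flow_domain S)"
    and e: "\<And>\<epsilon>. 0 < \<epsilon> \<Longrightarrow> \<exists>w\<in>smooth_fields S. norm (u - class_on (flow_domain S) w) < \<epsilon> \<and> norm_V S (u - class_on (flow_domain S) w) < \<epsilon>"
  shows "u \<in> space_V S"
  unfolding space_V_def
proof (intro CollectI conjI u allI impI)
  fix \<epsilon> :: real assume "0 < \<epsilon>"
  then obtain w where w: "w \<in> smooth_fields S" "norm (u - class_on (flow_domain S) w) < \<epsilon> / 2"
    "norm_V S (u - class_on (flow_domain S) w) < \<epsilon> / 2"
    using e[of "\<epsilon> / 2"] by auto
  have "sqrt ((norm (u - class_on (flow_domain S) w))\<^sup>2 + (norm (grad S (u - class_on (flow_domain S) w)))\<^sup>2)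
      \<le> norm (u - class_on (flow_domain S) w) + norm (grad S (u - class_on (flow_domain S) w))"
    by (rule sqrt_sum_squares_le_sum) auto
  also have "\<dots> < \<epsilon>" using w by (simp add: norm_V_eq)
  finally show "\<exists>w\<in>smooth_fields S. sqrt ((norm (u - class_on (flow_domain S) w))\<^sup>2
      + (norm (grad S (u - class_on (flow_domain S) w)))\<^sup>2) < \<epsilon>" using w(1) by blast
qed

lemma space_V_add:
  assumes S: "valid_setting S" and u: "u \<in> space_V S" and v: "v \<in> space_V S"
  shows "u + v \<in> space_V S"
proof (rule space_VI[OF S])
  show "u + v \<in> H1_on (flow_domain S)" using u v space_V_H1 H1_on_add by blast
  fix \<epsilon> :: real assume "0 < \<epsilon>"
  then have e: "0 < \<epsilon> / 2" by simp
  let ?c = "class_on (flow_domain S)"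
  obtain w where w: "w \<in> smooth_fields S" "norm (u - ?c w) < \<epsilon> / 2" "norm_V S (u - ?c w) < \<epsilon> / 2"
    by (rule space_V_approx[OF u e])
  obtain z where z: "z \<in> smooth_fields S" "norm (v - ?c z) < \<epsilon> / 2" "norm_V S (v - ?c z) < \<epsilon> / 2"
    by (rule space_V_approx[OF v e])
  have c: "?c (\<lambda>x. w x + z x) = ?c w + ?c z"
    using w z by (intro class_on_add cut_square_integrable_smooth(1)[OF S] smooth_fields_smooth)
  have d: "u + v - ?c (\<lambda>x. w x + z x) = (u - ?c w) + (v - ?c z)" by (simp add: c)
  have H: "u - ?c w \<in> H1_on (flow_domain S)" "v - ?c z \<in> H1_on (flow_domain S)"
    by (rule H1_on_diff[OF space_V_H1[OF u] class_on_smooth(1)[OF S smooth_fields_smooth[OF w(1)]]])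
      (rule H1_on_diff[OF space_V_H1[OF v] class_on_smooth(1)[OF S smooth_fields_smooth[OF z(1)]]])
  have "norm (u + v - ?c (\<lambda>x. w x + z x)) < \<epsilon>"
    unfolding d using norm_triangle_ineq[of "u - ?c w" "v - ?c z"] w z by linarith
  moreover have "norm_V S (u + v - ?c (\<lambda>x. w x + z x)) < \<epsilon>"
    unfolding d norm_V_eq grad_add[OF S H]
    using norm_triangle_ineq[of "grad S (u - ?c w)" "grad S (v - ?c z)"] w z unfolding norm_V_eq by linarith
  ultimately show "\<exists>w\<in>smooth_fields S. norm (u + v - ?c w) < \<epsilon> \<and> norm_V S (u + v - ?c w) < \<epsilon>"
    using smooth_fields_add[OF S w(1) z(1)] by blast
qed

lemma space_V_scaleR:
  assumes S: "valid_setting S" and u: "u \<in> space_V S"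
  shows "c *\<^sub>R u \<in> space_V S"
proof (rule space_VI[OF S])
  show "c *\<^sub>R u \<in> H1_on (flow_domain S)" using u space_V_H1 H1_on_scaleR by blast
  fix \<epsilon> :: real assume "0 < \<epsilon>"
  then have e: "0 < \<epsilon> / (1 + \<bar>c\<bar>)" by (simp add: add_pos_nonneg)
  let ?c = "class_on (flow_domain S)"
  obtain w where w: "w \<in> smooth_fields S" "norm (u - ?c w) < \<epsilon> / (1 + \<bar>c\<bar>)" "norm_V S (u - ?c w) < \<epsilon> / (1 + \<bar>c\<bar>)"
    by (rule space_V_approx[OF u e])
  have "?c (\<lambda>x. c *\<^sub>R w x) = c *\<^sub>R ?c w"
    using w by (intro class_on_scaleR cut_square_integrable_smooth(1)[OF S] smooth_fields_smooth)
  then have d: "c *\<^sub>R u - ?c (\<lambda>x. c *\<^sub>R w x) = c *\<^sub>R (u - ?c w)" by (simp add: scaleR_diff_right)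
  have H: "u - ?c w \<in> H1_on (flow_domain S)"
    by (rule H1_on_diff[OF space_V_H1[OF u] class_on_smooth(1)[OF S smooth_fields_smooth[OF w(1)]]])
  have lt: "\<bar>c\<bar> * r < \<epsilon>" if "0 \<le> r" "r < \<epsilon> / (1 + \<bar>c\<bar>)" for r
  proof -
    have "\<bar>c\<bar> * r \<le> (1 + \<bar>c\<bar>) * r" using that by (intro mult_right_mono) auto
    also have "\<dots> < \<epsilon>" using that(2) by (simp add: pos_less_divide_eq mult.commute add_pos_nonneg)
    finally show ?thesis .
  qed
  have "norm (c *\<^sub>R u - ?c (\<lambda>x. c *\<^sub>R w x)) < \<epsilon>" "norm_V S (c *\<^sub>R u - ?c (\<lambda>x. c *\<^sub>R w x)) < \<epsilon>"
    unfolding d norm_V_eq grad_scaleR[OF S H] norm_scaleR using w by (auto intro!: lt simp: norm_V_eq)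
  then show "\<exists>w\<in>smooth_fields S. norm (c *\<^sub>R u - ?c w) < \<epsilon> \<and> norm_V S (c *\<^sub>R u - ?c w) < \<epsilon>"
    using smooth_fields_scaleR[OF S w(1)] by blast
qed

lemma space_V_diff:
  assumes S: "valid_setting S" and u: "u \<in> space_V S" and v: "v \<in> space_V S"
  shows "u - v \<in> space_V S"
  using space_V_add[OF S u space_V_scaleR[OF S v, of "- 1"]] by simp

lemma zero_smooth_fields: "(\<lambda>x. 0) \<in> smooth_fields S"
proof -
  have "partial_deriv i (\<lambda>x. 0) x = 0" for i x
    unfolding partial_deriv_def by (rule frechet_derivative_eq_0[of UNIV]) auto
  then show ?thesis
    by (cases S) (simp_all add: test_functions_def smooth_def C_diff_const divergence_free_def set_lebesgue_integral_def)
qed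

lemma class_on_space_V:
  assumes S: "valid_setting S" and w: "w \<in> smooth_fields S"
  shows "class_on (flow_domain S) w \<in> space_V S"
proof (rule space_VI[OF S])
  have H: "class_on (flow_domain S) w \<in> H1_on (flow_domain S)"
    by (rule class_on_smooth(1)[OF S smooth_fields_smooth[OF w]])
  then show "class_on (flow_domain S) w \<in> H1_on (flow_domain S)" .
  fix \<epsilon> :: real assume "0 < \<epsilon>"
  then show "\<exists>v\<in>smooth_fields S. norm (class_on (flow_domain S) w - class_on (flow_domain S) v) < \<epsilon>
      \<and> norm_V S (class_on (flow_domain S) w - class_on (flow_domain S) v) < \<epsilon>"
    using w grad_diff[OF S H H] by (intro bexI[of _ w]) (auto simp: norm_V_eq)
qed

lemma zero_space_V:
  assumes S: "valid_setting S"
  shows "0 \<in> space_V S"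
proof -
  show ?thesis
    using space_V_scaleR[OF S class_on_space_V[OF S zero_smooth_fields], of 0] by simp
qed

lemma abs_norm_V_diff_le:
  assumes S: "valid_setting S" and u: "u \<in> space_V S" and v: "v \<in> space_V S"
  shows "\<bar>norm_V S u - norm_V S v\<bar> \<le> norm_V S (u - v)"
  unfolding norm_V_eq grad_diff[OF S space_V_H1[OF u] space_V_H1[OF v]] by (rule norm_triangle_ineq3)

text \<open>In the first bound both sides converge along a sequence of smooth fields that
  approximates u in the H^1 norm. For the L^6 integral no continuity is available beforehand;
  Fatou's lemma along an almost everywhere convergent subsequence gives the inequality.\<close>

lemma space_V_estimates:
  assumes S: "valid_setting S"
  obtains C where "0 < C" "\<And>u. u \<in> space_V S \<Longrightarrow> norm u \<le> C * norm_V S u"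
    "\<And>u. u \<in> space_V S \<Longrightarrow> (\<integral>\<^sup>+x. ennreal (norm (rep_L2_field u x) ^ 6) \<partial>lebesgue) \<le> ennreal ((C * norm_V S u) ^ 6)"
proof -
  obtain C where C: "0 < C"
    and 1: "\<And>w. w \<in> smooth_fields S \<Longrightarrow> norm (class_on (flow_domain S) w) \<le> C * norm_V S (class_on (flow_domain S) w)"
    and 2: "\<And>w. w \<in> smooth_fields S \<Longrightarrow> (\<integral>\<^sup>+x. ennreal (norm (rep_L2_field (class_on (flow_domain S) w) x) ^ 6) \<partial>lebesgue)
      \<le> ennreal ((C * norm_V S (class_on (flow_domain S) w)) ^ 6)"
    by (rule smooth_fields_estimates[OF S]) (rule that)
  have *: "norm u \<le> C * norm_V S u
    \<and> (\<integral>\<^sup>+x. ennreal (norm (rep_L2_field u x) ^ 6) \<partial>lebesgue) \<le> ennreal ((C * norm_V S u) ^ 6)"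
    if u: "u \<in> space_V S" for u
  proof -
    let ?c = "class_on (flow_domain S)"
    have "\<exists>w. w \<in> smooth_fields S \<and> norm (u - ?c w) < inverse (real (Suc n)) \<and> norm_V S (u - ?c w) < inverse (real (Suc n))" for n
      by (rule space_V_approx[OF u, of "inverse (real (Suc n))"]) auto
    then obtain W where W: "\<And>n. W n \<in> smooth_fields S" "\<And>n. norm (u - ?c (W n)) < inverse (real (Suc n))"
      "\<And>n. norm_V S (u - ?c (W n)) < inverse (real (Suc n))"
      by metis
    define X where "X n = ?c (W n)" for n
    have XV: "X n \<in> space_V S" for n unfolding X_def by (rule class_on_space_V[OF S W(1)])
    have "norm (norm (X n - u)) \<le> inverse (real (Suc n))" for n
      using W(2)[of n] by (simp add: X_def norm_minus_commute less_imp_le)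
    then have X0: "(\<lambda>n. norm (X n - u)) \<longlonglongrightarrow> 0"
      by (intro Lim_null_comparison[OF _ LIMSEQ_inverse_real_of_nat] always_eventually allI) auto
    have "norm (norm_V S (X n) - norm_V S u) \<le> inverse (real (Suc n))" for n
      using abs_norm_V_diff_le[OF S u XV[of n]] W(3)[of n] by (simp add: X_def abs_minus_commute)
    then have "(\<lambda>n. norm_V S (X n) - norm_V S u) \<longlonglongrightarrow> 0"
      by (intro Lim_null_comparison[OF _ LIMSEQ_inverse_real_of_nat] always_eventually allI)
    then have XV0: "(\<lambda>n. norm_V S (X n)) \<longlonglongrightarrow> norm_V S u" by (rule LIM_zero_cancel)
    have "X \<longlonglongrightarrow> u" using X0 tendsto_norm_zero_iff LIM_zero_iff by blast
    then have "(\<lambda>n. norm (X n)) \<longlonglongrightarrow> norm u" by (rule tendsto_norm)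
    moreover have "(\<lambda>n. C * norm_V S (X n)) \<longlonglongrightarrow> C * norm_V S u"
      by (intro tendsto_mult tendsto_const XV0)
    ultimately have n: "norm u \<le> C * norm_V S u"
      by (rule LIMSEQ_le) (use 1[OF W(1)] in \<open>auto simp: X_def\<close>)
    obtain r :: "nat \<Rightarrow> nat" where r: "strict_mono r"
      "AE x in lebesgue. (\<lambda>n. rep_L2_field (X (r n)) x) \<longlonglongrightarrow> rep_L2_field u x"
      by (rule L2_AE_subseq[OF X0])
    have "(\<integral>\<^sup>+x. ennreal (norm (rep_L2_field u x) ^ 6) \<partial>lebesgue)
        = (\<integral>\<^sup>+x. liminf (\<lambda>n. ennreal (norm (rep_L2_field (X (r n)) x) ^ 6)) \<partial>lebesgue)"
    proof (rule nn_integral_cong_AE)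
      show "AE x in lebesgue. ennreal (norm (rep_L2_field u x) ^ 6) = liminf (\<lambda>n. ennreal (norm (rep_L2_field (X (r n)) x) ^ 6))"
        using r(2)
      proof eventually_elim
        case (elim x)
        have "(\<lambda>n. ennreal (norm (rep_L2_field (X (r n)) x) ^ 6)) \<longlonglongrightarrow> ennreal (norm (rep_L2_field u x) ^ 6)"
          by (intro tendsto_ennrealI tendsto_power tendsto_norm elim)
        then show ?case by (rule lim_imp_Liminf[symmetric, rotated]) simp
      qed
    qed
    also have "\<dots> \<le> liminf (\<lambda>n. \<integral>\<^sup>+x. ennreal (norm (rep_L2_field (X (r n)) x) ^ 6) \<partial>lebesgue)"
      by (rule nn_integral_liminf) measurable
    also have "\<dots> \<le> liminf (\<lambda>n. ennreal ((C * norm_V S (X (r n))) ^ 6))"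
      using 2[OF W(1)] by (intro Liminf_mono always_eventually allI) (simp add: X_def)
    also have "\<dots> = ennreal ((C * norm_V S u) ^ 6)"
    proof (rule lim_imp_Liminf)
      show "(\<lambda>n. ennreal ((C * norm_V S (X (r n))) ^ 6)) \<longlonglongrightarrow> ennreal ((C * norm_V S u) ^ 6)"
        using LIMSEQ_subseq_LIMSEQ[OF XV0 r(1)] by (intro tendsto_ennrealI tendsto_intros) (simp add: o_def)
    qed simp
    finally show ?thesis using n by simp
  qed
  show ?thesis by (rule that[of C]) (use C * in auto)
qed

section \<open>Estimates for the trilinear form\<close>

lemma norm_power4_sandwich:
  assumes "P ^ 4 \<le> ennreal (X ^ 4)" "0 \<le> X"
  shows "P \<le> ennreal X"
proof -
  have "P \<noteq> \<top>"
  proof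
    assume "P = \<top>"
    then have "P ^ 4 = \<top>" by (simp add: power_eq_top_ennreal)
    then show False using assms(1) by (simp add: top_unique)
  qed
  then obtain p where p: "P = ennreal p" "0 \<le> p" by (cases P) auto
  then have "ennreal (p ^ 4) \<le> ennreal (X ^ 4)" using assms by (simp add: ennreal_power)
  then have "p ^ 4 \<le> X ^ 4" using assms by (subst (asm) ennreal_le_iff) auto
  then have "p \<le> X" using assms(2) by (rule power_le_imp_le_base[of _ 3, simplified])
  then show ?thesis using p by (simp add: ennreal_leI)
qed

text \<open>Cauchy-Schwarz twice: for the integral P, P^2 \<le> |g|^2 R, where R integrates |u|^2
  |w|^2, and R^2 \<le> |u|^2 Q, where Q integrates |u|^2 |w|^4 and is bounded through L^6. Spending
  one factor u in L^2 produces the square root of |u| on which the exponent 4/3 later rests.\<close>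

lemma trilinear_integral_estimate:
  assumes S: "valid_setting S"
  obtains K where "0 \<le> K" "\<And>u g w. u \<in> space_V S \<Longrightarrow> w \<in> space_V S \<Longrightarrow>
    (\<integral>\<^sup>+x. ennreal (norm (rep_L2_field u x) * norm (rep_L2_field g x) * norm (rep_L2_field w x)) \<partial>lebesgue)
      \<le> ennreal (K * sqrt (norm u * norm_V S u) * norm g * norm_V S w)"
proof -
  obtain C where C: "0 < C" "\<And>u. u \<in> space_V S \<Longrightarrow> norm u \<le> C * norm_V S u"
    and L6: "\<And>u. u \<in> space_V S \<Longrightarrow> (\<integral>\<^sup>+x. ennreal (norm (rep_L2_field u x) ^ 6) \<partial>lebesgue) \<le> ennreal ((C * norm_V S u) ^ 6)"
    by (rule space_V_estimates[OF S]) (rule that)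
  \<comment> \<open>A fourth root, because the bounds are obtained for P^4; the factor 2 C^6 is that
    of the bound of Q below.\<close>
  define K where "K = sqrt (sqrt (2 * C ^ 6))"
  have K4: "K ^ 4 = 2 * C ^ 6"
  proof -
    have "K ^ 4 = (K\<^sup>2)\<^sup>2" by simp
    also have "\<dots> = 2 * C ^ 6" using C(1) by (simp add: K_def)
    finally show ?thesis .
  qed
  have K0: "0 \<le> K" using C(1) by (simp add: K_def)
  have *: "(\<integral>\<^sup>+x. ennreal (norm (rep_L2_field u x) * norm (rep_L2_field g x) * norm (rep_L2_field w x)) \<partial>lebesgue)
      \<le> ennreal (K * sqrt (norm u * norm_V S u) * norm g * norm_V S w)"
    if u: "u \<in> space_V S" and w: "w \<in> space_V S" for u g w
  proof -
    let ?u = "\<lambda>x. norm (rep_L2_field u x)" and ?g = "\<lambda>x. norm (rep_L2_field g x)" and ?w = "\<lambda>x. norm (rep_L2_field w x)"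
    define P where "P = (\<integral>\<^sup>+x. ennreal (?u x * ?g x * ?w x) \<partial>lebesgue)"
    define R where "R = (\<integral>\<^sup>+x. ennreal ((?u x)\<^sup>2 * (?w x)\<^sup>2) \<partial>lebesgue)"
    define Q where "Q = (\<integral>\<^sup>+x. ennreal ((?u x)\<^sup>2 * ?w x ^ 4) \<partial>lebesgue)"
    \<comment> \<open>The bound of Q divides by both gradient norms. If one of them is 0, the field
      itself is 0 by Poincare's inequality.\<close>
    show ?thesis
    proof (cases "norm_V S u = 0 \<or> norm_V S w = 0")
      case True
      then have "u = 0 \<or> w = 0" using C(2)[OF u] C(2)[OF w] by auto
      then have "AE x in lebesgue. ?u x * ?g x * ?w x = 0"
        using rep_zero_AE by (elim disjE) (auto elim: eventually_mono)
      then have "P = (\<integral>\<^sup>+x. 0 \<partial>(lebesgue :: (real^3) measure))"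
        unfolding P_def by (intro nn_integral_cong_AE) (auto elim: eventually_mono)
      then show ?thesis by (simp add: P_def)
    next
      case False
      define s where "s = norm_V S u"
      define t where "t = norm_V S w"
      have st: "0 < s" "0 < t" using False by (auto simp: s_def t_def less_le)
      \<comment> \<open>Takes the part of Hoelder's inequality with exponents 3 and 3/2. It is
        applied after u and w have been scaled by their gradient norms, which restores the
        homogeneity lost in the sum.\<close>
      have pq: "p\<^sup>2 * q ^ 4 \<le> p ^ 6 + q ^ 6" if "0 \<le> p" "0 \<le> q" for p q :: real
      proof (cases "p \<le> q")
        case True
        then have "p\<^sup>2 * q ^ 4 \<le> q\<^sup>2 * q ^ 4" using that by (intro mult_right_mono power_mono) auto
        then show ?thesis using that by (simp flip: power_add add: add_increasing)
      next
        case False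
        then have "p\<^sup>2 * q ^ 4 \<le> p\<^sup>2 * p ^ 4" using that by (intro mult_left_mono power_mono) auto
        then show ?thesis using that by (simp flip: power_add add: add_increasing2)
      qed
      have "Q \<le> (\<integral>\<^sup>+x. ennreal (t ^ 4 / s ^ 4) * ennreal (?u x ^ 6) + ennreal (s\<^sup>2 / t\<^sup>2) * ennreal (?w x ^ 6) \<partial>lebesgue)"
        unfolding Q_def
      proof (intro nn_integral_mono)
        fix x
        have "(?u x)\<^sup>2 * ?w x ^ 4 = s\<^sup>2 * t ^ 4 * ((?u x / s)\<^sup>2 * (?w x / t) ^ 4)"
          using st by (simp add: power_divide)
        also have "\<dots> \<le> s\<^sup>2 * t ^ 4 * ((?u x / s) ^ 6 + (?w x / t) ^ 6)"
          using st by (intro mult_left_mono pq) auto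
        also have "\<dots> = t ^ 4 / s ^ 4 * ?u x ^ 6 + s\<^sup>2 / t\<^sup>2 * ?w x ^ 6"
          using st by (simp add: power_divide field_simps eval_nat_numeral)
        finally have "ennreal ((?u x)\<^sup>2 * ?w x ^ 4) \<le> ennreal (t ^ 4 / s ^ 4 * ?u x ^ 6 + s\<^sup>2 / t\<^sup>2 * ?w x ^ 6)"
          by (rule ennreal_leI)
        then show "ennreal ((?u x)\<^sup>2 * ?w x ^ 4) \<le> ennreal (t ^ 4 / s ^ 4) * ennreal (?u x ^ 6) + ennreal (s\<^sup>2 / t\<^sup>2) * ennreal (?w x ^ 6)"
          by (simp flip: ennreal_mult ennreal_plus)
      qed
      also have "\<dots> = ennreal (t ^ 4 / s ^ 4) * (\<integral>\<^sup>+x. ennreal (?u x ^ 6) \<partial>lebesgue)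
          + ennreal (s\<^sup>2 / t\<^sup>2) * (\<integral>\<^sup>+x. ennreal (?w x ^ 6) \<partial>lebesgue)"
        by (subst nn_integral_add) (auto simp: nn_integral_cmult)
      also have "\<dots> \<le> ennreal (t ^ 4 / s ^ 4) * ennreal ((C * s) ^ 6) + ennreal (s\<^sup>2 / t\<^sup>2) * ennreal ((C * t) ^ 6)"
        unfolding s_def t_def by (intro add_mono mult_left_mono L6 u w) auto
      also have "\<dots> = ennreal (2 * C ^ 6 * s\<^sup>2 * t ^ 4)"
      proof -
        have "t ^ 4 / s ^ 4 * (C * s) ^ 6 + s\<^sup>2 / t\<^sup>2 * (C * t) ^ 6 = 2 * C ^ 6 * s\<^sup>2 * t ^ 4"
          using st by (simp add: field_simps eval_nat_numeral)
        then show ?thesis using C(1) st by (simp flip: ennreal_mult ennreal_plus)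
      qed
      finally have Q: "Q \<le> ennreal (2 * C ^ 6 * s\<^sup>2 * t ^ 4)" .
      have "R\<^sup>2 = (\<integral>\<^sup>+x. ennreal (?u x) * ennreal (?u x * (?w x)\<^sup>2) \<partial>lebesgue)\<^sup>2"
        unfolding R_def by (simp add: power2_eq_square mult.assoc flip: ennreal_mult)
      also have "\<dots> \<le> (\<integral>\<^sup>+x. (ennreal (?u x))\<^sup>2 \<partial>lebesgue) * (\<integral>\<^sup>+x. (ennreal (?u x * (?w x)\<^sup>2))\<^sup>2 \<partial>lebesgue)"
        by (rule Cauchy_Schwarz_nn_integral) measurable
      also have "\<dots> = ennreal ((norm u)\<^sup>2) * Q"
        by (simp add: nn_integral_rep_square[unfolded ennreal_power[OF norm_ge_zero]] Q_def ennreal_power power_mult_distrib flip: power_mult)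
      also have "\<dots> \<le> ennreal ((norm u)\<^sup>2) * ennreal (2 * C ^ 6 * s\<^sup>2 * t ^ 4)"
        by (intro mult_left_mono Q) simp
      finally have R: "R\<^sup>2 \<le> ennreal ((norm u)\<^sup>2) * ennreal (2 * C ^ 6 * s\<^sup>2 * t ^ 4)" .
      have "P\<^sup>2 = (\<integral>\<^sup>+x. ennreal (?g x) * ennreal (?u x * ?w x) \<partial>lebesgue)\<^sup>2"
        unfolding P_def by (simp add: mult_ac flip: ennreal_mult)
      also have "\<dots> \<le> (\<integral>\<^sup>+x. (ennreal (?g x))\<^sup>2 \<partial>lebesgue) * (\<integral>\<^sup>+x. (ennreal (?u x * ?w x))\<^sup>2 \<partial>lebesgue)"
        by (rule Cauchy_Schwarz_nn_integral) measurable
      also have "\<dots> = ennreal ((norm g)\<^sup>2) * R"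
        by (simp add: nn_integral_rep_square[unfolded ennreal_power[OF norm_ge_zero]] R_def ennreal_power power_mult_distrib)
      finally have "P\<^sup>2 \<le> ennreal ((norm g)\<^sup>2) * R" .
      then have "(P\<^sup>2)\<^sup>2 \<le> (ennreal ((norm g)\<^sup>2) * R)\<^sup>2" by (rule power_mono) simp
      also have "\<dots> = ennreal (norm g ^ 4) * R\<^sup>2"
        by (simp add: power_mult_distrib ennreal_power flip: power_mult)
      also have "\<dots> \<le> ennreal (norm g ^ 4) * (ennreal ((norm u)\<^sup>2) * ennreal (2 * C ^ 6 * s\<^sup>2 * t ^ 4))"
        by (intro mult_left_mono R) simp
      also have "\<dots> = ennreal (norm g ^ 4 * ((norm u)\<^sup>2 * (2 * C ^ 6 * s\<^sup>2 * t ^ 4)))"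
        using C(1) st by (simp flip: ennreal_mult)
      also have "norm g ^ 4 * ((norm u)\<^sup>2 * (2 * C ^ 6 * s\<^sup>2 * t ^ 4)) = (K * sqrt (norm u * s) * norm g * t) ^ 4"
      proof -
        have "sqrt (norm u * s) ^ 4 = ((sqrt (norm u * s))\<^sup>2)\<^sup>2" by simp
        also have "\<dots> = (norm u)\<^sup>2 * s\<^sup>2" using st by (simp add: power_mult_distrib)
        finally show ?thesis by (simp add: power_mult_distrib K4)
      qed
      finally have "P ^ 4 \<le> ennreal ((K * sqrt (norm u * s) * norm g * t) ^ 4)"
        by simp
      then have "P \<le> ennreal (K * sqrt (norm u * s) * norm g * t)"
        by (rule norm_power4_sandwich) (use K0 st in auto)
      then show ?thesis by (simp add: P_def s_def t_def)
    qed
  qed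
  show ?thesis by (rule that[of K]) (use K0 * in auto)
qed

text \<open>The integrand of b with an arbitrary G in the place of the gradient: bounds and
  integrability can be proved for every triple of L^2 fields, before \<open>grad\<close>
  enters.\<close>

definition convection :: "L2_field \<Rightarrow> L2_field^3 \<Rightarrow> L2_field \<Rightarrow> real^3 \<Rightarrow> real" where
  "convection u G w x = (\<Sum>i\<in>UNIV. rep_L2_field u x $ i *\<^sub>R rep_L2_field (G $ i) x) \<bullet> rep_L2_field w x"

lemma form_b_convection:
  "form_b S u v w = (LINT x|lebesgue. indicator (flow_domain S) x * convection u (grad S v) w x)"
  by (simp add: form_b_def convection_def set_lebesgue_integral_def)

lemma measurable_convection [measurable]: "convection u G w \<in> borel_measurable lebesgue"
proof -
  have [measurable]: "(\<lambda>x. rep_L2_field u x $ i) \<in> borel_measurable lebesgue" for i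
    unfolding cart_eq_inner_axis by measurable
  show ?thesis unfolding convection_def[abs_def] by measurable
qed

lemma abs_convection_le:
  "\<bar>convection u G w x\<bar> \<le> (\<Sum>i\<in>UNIV. norm (rep_L2_field u x) * norm (rep_L2_field (G $ i) x) * norm (rep_L2_field w x))"
proof -
  have "\<bar>convection u G w x\<bar> \<le> norm (\<Sum>i\<in>UNIV. rep_L2_field u x $ i *\<^sub>R rep_L2_field (G $ i) x) * norm (rep_L2_field w x)"
    unfolding convection_def by (rule Cauchy_Schwarz_ineq2)
  also have "\<dots> \<le> (\<Sum>i\<in>UNIV. norm (rep_L2_field u x) * norm (rep_L2_field (G $ i) x)) * norm (rep_L2_field w x)"
    by (intro mult_right_mono sum_norm_le) (simp_all add: mult_right_mono component_le_norm_cart)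
  finally show ?thesis by (simp add: sum_distrib_right)
qed

lemma convection_estimate:
  assumes S: "valid_setting S"
  obtains K where "0 \<le> K" "\<And>u G w. u \<in> space_V S \<Longrightarrow> w \<in> space_V S \<Longrightarrow>
    (\<integral>\<^sup>+x. ennreal \<bar>indicator (flow_domain S) x * convection u G w x\<bar> \<partial>lebesgue)
      \<le> ennreal (K * sqrt (norm u * norm_V S u) * norm G * norm_V S w)"
proof -
  obtain K where K: "0 \<le> K" "\<And>u g w. u \<in> space_V S \<Longrightarrow> w \<in> space_V S \<Longrightarrow>
    (\<integral>\<^sup>+x. ennreal (norm (rep_L2_field u x) * norm (rep_L2_field g x) * norm (rep_L2_field w x)) \<partial>lebesgue)
      \<le> ennreal (K * sqrt (norm u * norm_V S u) * norm g * norm_V S w)"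
    by (rule trilinear_integral_estimate[OF S]) (rule that)
  have "(\<integral>\<^sup>+x. ennreal \<bar>indicator (flow_domain S) x * convection u G w x\<bar> \<partial>lebesgue)
      \<le> ennreal (3 * K * sqrt (norm u * norm_V S u) * norm G * norm_V S w)"
    if u: "u \<in> space_V S" and w: "w \<in> space_V S" for u G w
  proof -
    have "(\<integral>\<^sup>+x. ennreal \<bar>indicator (flow_domain S) x * convection u G w x\<bar> \<partial>lebesgue)
      \<le> (\<integral>\<^sup>+x. (\<Sum>i\<in>UNIV. ennreal (norm (rep_L2_field u x) * norm (rep_L2_field (G $ i) x) * norm (rep_L2_field w x))) \<partial>lebesgue)"
    proof (intro nn_integral_mono)
      fix x
      have "\<bar>indicator (flow_domain S) x * convection u G w x\<bar> \<le> \<bar>convection u G w x\<bar>"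
        by (simp add: indicator_def)
      also have "\<dots> \<le> (\<Sum>i\<in>UNIV. norm (rep_L2_field u x) * norm (rep_L2_field (G $ i) x) * norm (rep_L2_field w x))"
        by (rule abs_convection_le)
      finally show "ennreal \<bar>indicator (flow_domain S) x * convection u G w x\<bar>
        \<le> (\<Sum>i\<in>UNIV. ennreal (norm (rep_L2_field u x) * norm (rep_L2_field (G $ i) x) * norm (rep_L2_field w x)))"
        by (subst sum_ennreal) (auto intro: ennreal_leI)
    qed
    also have "\<dots> = (\<Sum>i\<in>UNIV. \<integral>\<^sup>+x. ennreal (norm (rep_L2_field u x) * norm (rep_L2_field (G $ i) x) * norm (rep_L2_field w x)) \<partial>lebesgue)"
      by (rule nn_integral_sum) measurable
    also have "\<dots> \<le> (\<Sum>i\<in>(UNIV :: 3 set). ennreal (K * sqrt (norm u * norm_V S u) * norm G * norm_V S w))"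
    proof (rule sum_mono)
      fix i
      have "K * sqrt (norm u * norm_V S u) * norm (G $ i) * norm_V S w \<le> K * sqrt (norm u * norm_V S u) * norm G * norm_V S w"
        using K(1) by (intro mult_right_mono mult_left_mono Finite_Cartesian_Product.norm_nth_le) auto
      with K(2)[OF u w, of "G $ i"] show "(\<integral>\<^sup>+x. ennreal (norm (rep_L2_field u x) * norm (rep_L2_field (G $ i) x) * norm (rep_L2_field w x)) \<partial>lebesgue)
        \<le> ennreal (K * sqrt (norm u * norm_V S u) * norm G * norm_V S w)"
        by (meson ennreal_leI order_trans)
    qed
    also have "\<dots> = ennreal (3 * K * sqrt (norm u * norm_V S u) * norm G * norm_V S w)"
      using K(1) by (subst sum_ennreal) (auto simp: sum_3 mult_ac)
    finally show ?thesis .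
  qed
  then show ?thesis using K(1) by (intro that[of "3 * K"]) auto
qed

lemma integrable_convection:
  assumes S: "valid_setting S" and u: "u \<in> space_V S" and w: "w \<in> space_V S"
  shows "integrable lebesgue (\<lambda>x. indicator (flow_domain S) x * convection u G w x)"
proof -
  obtain K where K: "0 \<le> K" "\<And>u G w. u \<in> space_V S \<Longrightarrow> w \<in> space_V S \<Longrightarrow>
    (\<integral>\<^sup>+x. ennreal \<bar>indicator (flow_domain S) x * convection u G w x\<bar> \<partial>lebesgue)
      \<le> ennreal (K * sqrt (norm u * norm_V S u) * norm G * norm_V S w)"
    by (rule convection_estimate[OF S]) (rule that)
  have "flow_domain S \<in> sets lebesgue" using flow_domain_open[OF S] by auto
  then have "(\<lambda>x. indicator (flow_domain S) x * convection u G w x) \<in> borel_measurable lebesgue"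
    by (intro borel_measurable_times borel_measurable_indicator measurable_convection)
  then show ?thesis
    using K(2)[OF u w, of G] by (intro integrableI_bounded) (auto intro: le_less_trans)
qed

lemma form_b_estimate:
  assumes S: "valid_setting S"
  obtains K where "0 \<le> K" "\<And>u v w. u \<in> space_V S \<Longrightarrow> w \<in> space_V S \<Longrightarrow>
    \<bar>form_b S u v w\<bar> \<le> K * sqrt (norm u * norm_V S u) * norm_V S v * norm_V S w"
proof -
  obtain K where K: "0 \<le> K" "\<And>u G w. u \<in> space_V S \<Longrightarrow> w \<in> space_V S \<Longrightarrow>
    (\<integral>\<^sup>+x. ennreal \<bar>indicator (flow_domain S) x * convection u G w x\<bar> \<partial>lebesgue)
      \<le> ennreal (K * sqrt (norm u * norm_V S u) * norm G * norm_V S w)"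
    by (rule convection_estimate[OF S]) (rule that)
  have "\<bar>form_b S u v w\<bar> \<le> K * sqrt (norm u * norm_V S u) * norm_V S v * norm_V S w"
    if u: "u \<in> space_V S" and w: "w \<in> space_V S" for u v w
  proof -
    have "ennreal \<bar>form_b S u v w\<bar> \<le> (\<integral>\<^sup>+x. ennreal \<bar>indicator (flow_domain S) x * convection u (grad S v) w x\<bar> \<partial>lebesgue)"
      unfolding form_b_convection
      using integral_norm_bound_ennreal[OF integrable_convection[OF S u w, of "grad S v"]] by simp
    also have "\<dots> \<le> ennreal (K * sqrt (norm u * norm_V S u) * norm (grad S v) * norm_V S w)"
      by (rule K(2)[OF u w])
    finally show ?thesis
      using K(1) by (subst (asm) ennreal_le_iff) (auto simp: norm_V_eq)
  qed
  then show ?thesis using K(1) by (intro that[of K]) auto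
qed

lemma form_b_diff_first:
  assumes S: "valid_setting S" and u: "u \<in> space_V S" "u' \<in> space_V S" and w: "w \<in> space_V S"
  shows "form_b S (u - u') v w = form_b S u v w - form_b S u' v w"
proof -
  have "form_b S (u - u') v w = (LINT x|lebesgue. indicator (flow_domain S) x * convection u (grad S v) w x
      - indicator (flow_domain S) x * convection u' (grad S v) w x)"
    unfolding form_b_convection
  proof (rule integral_cong_AE)
    show "AE x in lebesgue. indicator (flow_domain S) x * convection (u - u') (grad S v) w x
      = indicator (flow_domain S) x * convection u (grad S v) w x - indicator (flow_domain S) x * convection u' (grad S v) w x"
      using rep_diff_AE[of u u']
      by eventually_elim (simp add: convection_def scaleR_left_diff_distrib right_diff_distrib inner_diff_left sum_subtractf)
    show "(\<lambda>x. indicator (flow_domain S) x * convection (u - u') (grad S v) w x) \<in> borel_measurable lebesgue"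
      by (rule borel_measurable_integrable[OF integrable_convection[OF S space_V_diff[OF S u] w]])
    show "(\<lambda>x. indicator (flow_domain S) x * convection u (grad S v) w x - indicator (flow_domain S) x * convection u' (grad S v) w x) \<in> borel_measurable lebesgue"
      by (intro borel_measurable_diff borel_measurable_integrable[OF integrable_convection[OF S _ w]] u)
  qed
  then show ?thesis
    using integrable_convection[OF S u(1) w] integrable_convection[OF S u(2) w] by (simp add: form_b_convection)
qed

lemma form_b_diff_second:
  assumes S: "valid_setting S" and u: "u \<in> space_V S" and v: "v \<in> space_V S" "v' \<in> space_V S" and w: "w \<in> space_V S"
  shows "form_b S u (v - v') w = form_b S u v w - form_b S u v' w"
proof -
  have g: "grad S (v - v') = grad S v - grad S v'" by (intro grad_diff[OF S] space_V_H1 v)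
  have "form_b S u (v - v') w = (LINT x|lebesgue. indicator (flow_domain S) x * convection u (grad S v) w x
      - indicator (flow_domain S) x * convection u (grad S v') w x)"
    unfolding form_b_convection g
  proof (rule integral_cong_AE)
    have "AE x in lebesgue. \<forall>i\<in>UNIV. rep_L2_field (grad S v $ i - grad S v' $ i) x
        = rep_L2_field (grad S v $ i) x - rep_L2_field (grad S v' $ i) x"
      by (intro AE_finite_allI finite rep_diff_AE)
    then show "AE x in lebesgue. indicator (flow_domain S) x * convection u (grad S v - grad S v') w x
      = indicator (flow_domain S) x * convection u (grad S v) w x - indicator (flow_domain S) x * convection u (grad S v') w x"
      by eventually_elim (simp add: convection_def scaleR_right_diff_distrib right_diff_distrib inner_diff_left sum_subtractf)
    show "(\<lambda>x. indicator (flow_domain S) x * convection u (grad S v - grad S v') w x) \<in> borel_measurable lebesgue"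
      by (rule borel_measurable_integrable[OF integrable_convection[OF S u w]])
    show "(\<lambda>x. indicator (flow_domain S) x * convection u (grad S v) w x - indicator (flow_domain S) x * convection u (grad S v') w x) \<in> borel_measurable lebesgue"
      by (intro borel_measurable_diff borel_measurable_integrable[OF integrable_convection[OF S u w]])
  qed
  then show ?thesis
    using integrable_convection[OF S u w] by (simp add: form_b_convection)
qed

lemma form_b_linear_third:
  assumes S: "valid_setting S" and u: "u \<in> space_V S" and w: "w \<in> space_V S" "w' \<in> space_V S"
  shows "form_b S u v (w + w') = form_b S u v w + form_b S u v w'"
    and "form_b S u v (c *\<^sub>R w) = c * form_b S u v w"
proof -
  have "form_b S u v (w + w') = (LINT x|lebesgue. indicator (flow_domain S) x * convection u (grad S v) w x
      + indicator (flow_domain S) x * convection u (grad S v) w' x)"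
    unfolding form_b_convection
  proof (rule integral_cong_AE)
    show "AE x in lebesgue. indicator (flow_domain S) x * convection u (grad S v) (w + w') x
      = indicator (flow_domain S) x * convection u (grad S v) w x + indicator (flow_domain S) x * convection u (grad S v) w' x"
      using rep_add_AE[of w w'] by eventually_elim (simp add: convection_def inner_add_right distrib_left)
    show "(\<lambda>x. indicator (flow_domain S) x * convection u (grad S v) (w + w') x) \<in> borel_measurable lebesgue"
      by (rule borel_measurable_integrable[OF integrable_convection[OF S u space_V_add[OF S w]]])
    show "(\<lambda>x. indicator (flow_domain S) x * convection u (grad S v) w x + indicator (flow_domain S) x * convection u (grad S v) w' x) \<in> borel_measurable lebesgue"
      by (intro borel_measurable_add borel_measurable_integrable[OF integrable_convection[OF S u]] w)
  qed
  then show "form_b S u v (w + w') = form_b S u v w + form_b S u v w'"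
    using integrable_convection[OF S u w(1)] integrable_convection[OF S u w(2)] by (simp add: form_b_convection)
  have "form_b S u v (c *\<^sub>R w) = (LINT x|lebesgue. c * (indicator (flow_domain S) x * convection u (grad S v) w x))"
    unfolding form_b_convection
  proof (rule integral_cong_AE)
    show "AE x in lebesgue. indicator (flow_domain S) x * convection u (grad S v) (c *\<^sub>R w) x
      = c * (indicator (flow_domain S) x * convection u (grad S v) w x)"
      using rep_scaleR_AE[of c w] by eventually_elim (simp add: convection_def)
    show "(\<lambda>x. indicator (flow_domain S) x * convection u (grad S v) (c *\<^sub>R w) x) \<in> borel_measurable lebesgue"
      by (rule borel_measurable_integrable[OF integrable_convection[OF S u space_V_scaleR[OF S w(1)]]])
    show "(\<lambda>x. c * (indicator (flow_domain S) x * convection u (grad S v) w x)) \<in> borel_measurable lebesgue"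
      by (intro borel_measurable_times borel_measurable_const borel_measurable_integrable[OF integrable_convection[OF S u w(1)]])
  qed
  then show "form_b S u v (c *\<^sub>R w) = c * form_b S u v w"
    by (simp add: form_b_convection)
qed

text \<open>\<open>norm_dual\<close> is a real supremum, which is informative only for a nonempty
  bounded set; the set contains |l 0| and is bounded by c. The functional l is arbitrary because the
  bounds are applied also to pointwise differences of functionals, which need not be
  \<open>extensional\<close>.\<close>

lemma norm_dual_bounds:
  assumes S: "valid_setting S" and c: "0 \<le> c" and l: "\<And>v. v \<in> space_V S \<Longrightarrow> \<bar>l v\<bar> \<le> c * norm_V S v"
  shows "0 \<le> norm_dual S l" "norm_dual S l \<le> c"
proof -
  let ?A = "{\<bar>l v\<bar> | v. v \<in> space_V S \<and> norm_V S v \<le> 1}"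
  have z: "\<bar>l 0\<bar> \<in> ?A"
    using zero_space_V[OF S] grad_scaleR[OF S space_V_H1[OF zero_space_V[OF S]], of 0] by (auto simp: norm_V_eq)
  have ub: "y \<le> c" if "y \<in> ?A" for y
  proof -
    obtain v where v: "y = \<bar>l v\<bar>" "v \<in> space_V S" "norm_V S v \<le> 1" using \<open>y \<in> ?A\<close> by blast
    then have "y \<le> c * norm_V S v" using l by simp
    also have "\<dots> \<le> c" using c v(3) by (simp add: mult_left_le)
    finally show ?thesis .
  qed
  show "norm_dual S l \<le> c" unfolding norm_dual_def using z ub by (intro cSup_least) blast+
  have "\<bar>l 0\<bar> \<le> norm_dual S l" unfolding norm_dual_def using z ub by (intro cSup_upper bdd_aboveI[of _ c])
  then show "0 \<le> norm_dual S l" by linarith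
qed

section \<open>Bochner measurability\<close>

lemma AE_lebesgue_on_iff:
  "J \<in> sets lebesgue \<Longrightarrow> (AE t in lebesgue_on J. P t) \<longleftrightarrow> (AE t in lebesgue. t \<in> J \<longrightarrow> P t)"
  by (rule AE_restrict_space_iff) simp

lemma AE_lebesgue_on_subset:
  assumes "J \<in> sets lebesgue" "J' \<in> sets lebesgue" "J' \<subseteq> J" "AE t in lebesgue_on J. P t"
  shows "AE t in lebesgue_on J'. P t"
  using assms by (auto simp: AE_lebesgue_on_iff elim!: eventually_mono)

lemma interval_sets_lebesgue: "is_interval (J :: real set) \<Longrightarrow> J \<in> sets lebesgue"
  using real_interval_borel_measurable by auto

lemma AE_limit_measurable:
  fixes G :: "'a::euclidean_space \<Rightarrow> real"
  assumes F: "\<And>n. F n \<in> borel_measurable lebesgue" and l: "AE x in lebesgue. (\<lambda>n. F n x) \<longlonglongrightarrow> G x"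
  shows "G \<in> borel_measurable lebesgue"
proof -
  have "(\<lambda>x. lim (\<lambda>n. F n x)) \<in> borel_measurable lebesgue"
    by (rule borel_measurable_lim_metric) (rule F)
  moreover have "AE x in lebesgue. lim (\<lambda>n. F n x) = G x"
    using l by eventually_elim (rule limI)
  ultimately show ?thesis by (rule borel_measurable_AE)
qed

text \<open>With a simple function in the place of g the composition is a finite sum over its
  values, and the general case is an almost everywhere limit of these. \<Phi> may depend on t as
  well, as required for f(t) \<bullet> u(t), where f is Bochner measurable and u enters by its weak
  continuity.\<close>

lemma bochner_measurable_compose:
  fixes \<Phi> :: "real \<Rightarrow> 'x::minus \<Rightarrow> real"
  assumes b: "bochner_measurable_on X N J g" and J: "J \<in> sets lebesgue"
    and m: "\<And>y. y \<in> X \<Longrightarrow> (\<lambda>t. indicator J t * \<Phi> t y) \<in> borel_measurable lebesgue"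
    and lim: "\<And>t s y. t \<in> J \<Longrightarrow> (\<And>n. s n \<in> X) \<Longrightarrow> y \<in> X \<Longrightarrow> (\<lambda>n. N (s n - y)) \<longlonglongrightarrow> 0 \<Longrightarrow> (\<lambda>n. \<Phi> t (s n)) \<longlonglongrightarrow> \<Phi> t y"
  shows "(\<lambda>t. indicator J t * \<Phi> t (g t)) \<in> borel_measurable lebesgue"
proof -
  obtain s :: "nat \<Rightarrow> real \<Rightarrow> 'x" where s: "\<And>n. simple_function (lebesgue_on J) (s n)" "\<And>n. s n ` J \<subseteq> X"
    "AE t in lebesgue_on J. (\<lambda>n. N (s n t - g t)) \<longlonglongrightarrow> 0"
    using b by (auto simp: bochner_measurable_on_def)
  have gX: "AE t in lebesgue_on J. g t \<in> X" using b by (simp add: bochner_measurable_on_def)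
  show ?thesis
  proof (rule AE_limit_measurable)
    show "AE t in lebesgue. (\<lambda>n. indicator J t * \<Phi> t (s n t)) \<longlonglongrightarrow> indicator J t * \<Phi> t (g t)"
      using s(3) gX unfolding AE_lebesgue_on_iff[OF J]
    proof eventually_elim
      case (elim t)
      show ?case
      proof (cases "t \<in> J")
        case True
        then have "(\<lambda>n. \<Phi> t (s n t)) \<longlonglongrightarrow> \<Phi> t (g t)"
          using elim s(2) by (intro lim) auto
        then show ?thesis by (intro tendsto_mult tendsto_const)
      qed simp
    qed
    fix n
    have sp: "space (lebesgue_on J) = J" by (simp add: space_restrict_space)
    have fin: "finite (s n ` J)" using s(1)[of n] by (simp add: simple_function_def sp)
    have ms: "s n -` {y} \<inter> J \<in> sets lebesgue" if "y \<in> s n ` J" for y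
    proof -
      have "s n -` {y} \<inter> J \<in> sets (lebesgue_on J)"
        using s(1)[of n] that unfolding simple_function_def sp by blast
      then show ?thesis using J by (simp add: sets_restrict_space_iff)
    qed
    have eq: "indicator J t * \<Phi> t (s n t)
        = (\<Sum>y\<in>s n ` J. indicator (s n -` {y} \<inter> J) t * (indicator J t * \<Phi> t y))" for t
    proof (cases "t \<in> J")
      case True
      have "(\<Sum>y\<in>s n ` J. indicator (s n -` {y} \<inter> J) t * (indicator J t * \<Phi> t y))
          = (\<Sum>y\<in>s n ` J. if s n t = y then \<Phi> t y else 0)"
        using True by (intro sum.cong) (auto simp: indicator_def)
      also have "\<dots> = \<Phi> t (s n t)" using True fin by (simp add: sum.delta')
      finally show ?thesis using True by simp
    qed simp
    show "(\<lambda>t. indicator J t * \<Phi> t (s n t)) \<in> borel_measurable lebesgue"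
      unfolding eq
    proof (rule borel_measurable_sum)
      fix y assume y: "y \<in> s n ` J"
      then have "y \<in> X" using s(2) by blast
      then show "(\<lambda>t. indicator (s n -` {y} \<inter> J) t * (indicator J t * \<Phi> t y)) \<in> borel_measurable lebesgue"
        by (intro borel_measurable_times[OF borel_measurable_indicator[OF ms[OF y]] m])
    qed
  qed
qed

lemma bochner_measurable_subset:
  assumes b: "bochner_measurable_on X N J g" and J: "J \<in> sets lebesgue" "J' \<in> sets lebesgue" "J' \<subseteq> J"
  shows "bochner_measurable_on X N J' g"
proof -
  obtain s where s: "\<And>n. simple_function (lebesgue_on J) (s n)" "\<And>n. s n ` J \<subseteq> X"
    "AE t in lebesgue_on J. (\<lambda>n. N (s n t - g t)) \<longlonglongrightarrow> 0"
    using b by (auto simp: bochner_measurable_on_def)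
  have "simple_function (lebesgue_on J') (s n)" for n
    unfolding simple_function_def
  proof
    have sp: "space (lebesgue_on A) = A" for A :: "real set" by (simp add: space_restrict_space)
    have "finite (s n ` J)" using s(1)[of n] by (simp add: simple_function_def sp)
    then show "finite (s n ` space (lebesgue_on J'))" unfolding sp using J(3) by (meson finite_subset image_mono)
    show "\<forall>x\<in>s n ` space (lebesgue_on J'). s n -` {x} \<inter> space (lebesgue_on J') \<in> sets (lebesgue_on J')"
    proof
      fix x assume "x \<in> s n ` space (lebesgue_on J')"
      then have "x \<in> s n ` J" using J(3) by (auto simp: sp)
      then have "s n -` {x} \<inter> J \<in> sets (lebesgue_on J)"
        using s(1)[of n] unfolding simple_function_def sp by blast
      then have "s n -` {x} \<inter> J \<in> sets lebesgue" using J(1) by (simp add: sets_restrict_space_iff)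
      then have "(s n -` {x} \<inter> J) \<inter> J' \<in> sets lebesgue" using J(2) by blast
      moreover have "(s n -` {x} \<inter> J) \<inter> J' = s n -` {x} \<inter> J'" using J(3) by blast
      ultimately show "s n -` {x} \<inter> space (lebesgue_on J') \<in> sets (lebesgue_on J')"
        unfolding sp using J(2) by (simp add: sets_restrict_space_iff)
    qed
  qed
  then show ?thesis
    using b s AE_lebesgue_on_subset[OF J] J(3) unfolding bochner_measurable_on_def by (intro conjI exI[of _ s]) blast+
qed

lemma null_sets_Icc_degenerate:
  assumes "b \<le> (a :: real)"
  shows "AE t in lebesgue_on {a..b}. P t"
proof -
  have "{a..b} \<subseteq> {a}" using assms by auto
  then have "{a..b} \<in> null_sets lebesgue"
    using negligible_subset[of "{a}" "{a..b}"] negligible_iff_null_sets by auto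
  then show ?thesis by (auto simp: AE_lebesgue_on_iff dest!: AE_not_in elim!: eventually_mono)
qed

text \<open>Used to reach the end points: a weak solution on the interior of I comes with
  measurability on compact subintervals of the open interval only. These pieces are glued along an
  exhaustion \<open>D n\<close> of the open interval; the end points form a null set.\<close>

lemma bochner_glue:
  assumes z: "z \<in> X" and b: "\<And>c d. a < c \<Longrightarrow> c \<le> d \<Longrightarrow> d < b \<Longrightarrow> bochner_measurable_on X N {c..d} g"
  shows "bochner_measurable_on X N {a..b} g"
proof (cases "b \<le> a")
  case True
  show ?thesis unfolding bochner_measurable_on_def
    by (intro conjI exI[of _ "\<lambda>n t. z"] null_sets_Icc_degenerate[OF True]) (auto simp: z)
next
  case False
  \<comment> \<open>With n + 3 in the denominator the margin is at most a third of the length, so no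
    \<open>D n\<close> is empty.\<close>
  define e where "e n = (b - a) / real (n + 3)" for n
  have e: "0 < e n" "e n \<le> (b - a) / 3" for n
    using False divide_left_mono[of 3 "real (n + 3)" "b - a"] by (simp_all add: e_def)
  define D where "D n = {a + e n..b - e n}" for n
  have D: "D n \<in> sets lebesgue" "D n \<subseteq> {a..b}" for n using e(1)[of n] by (auto simp: D_def)
  have bD: "bochner_measurable_on X N (D n) g" for n
    unfolding D_def using e[of n] False by (intro b) (auto simp: field_simps)
  then have ex: "\<forall>n. \<exists>s. (\<forall>k. simple_function (lebesgue_on (D n)) (s k) \<and> s k ` D n \<subseteq> X) \<and>
      (AE t in lebesgue_on (D n). (\<lambda>k. N (s k t - g t)) \<longlonglongrightarrow> 0)"
    unfolding bochner_measurable_on_def by blast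
  obtain s where S: "\<forall>n. (\<forall>k. simple_function (lebesgue_on (D n)) (s n k) \<and> s n k ` D n \<subseteq> X) \<and>
      (AE t in lebesgue_on (D n). (\<lambda>k. N (s n k t - g t)) \<longlonglongrightarrow> 0)"
    using choice[OF ex] by blast
  have s: "\<And>n k. simple_function (lebesgue_on (D n)) (s n k)" "\<And>n k. s n k ` D n \<subseteq> X"
    "\<And>n. AE t in lebesgue_on (D n). (\<lambda>k. N (s n k t - g t)) \<longlonglongrightarrow> 0"
    using S by blast+
  \<comment> \<open>The first interval of the exhaustion that contains t. It does not depend on k,
    so at a fixed t the values \<open>r k t\<close> eventually follow a single approximating
    sequence.\<close>
  define m where "m t = (LEAST n. t \<in> D n)" for t
  have m: "t \<in> D (m t)" if "t \<in> D n" for t n unfolding m_def using that by (rule LeastI)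
  have ml: "m t \<le> n" if "t \<in> D n" for t n unfolding m_def using that by (rule Least_le)
  \<comment> \<open>Stage k uses only the intervals with n \<le> k, which keeps the number of values
    finite; elsewhere the value is z, an element of X.\<close>
  define r where "r k t = (if \<exists>n\<le>k. t \<in> D n then s (m t) k t else z)" for k t
  have cover: "\<exists>n. t \<in> D n" if "a < t" "t < b" for t
  proof -
    have "e \<longlonglongrightarrow> 0" unfolding e_def
      by (rule LIMSEQ_ignore_initial_segment[OF lim_const_over_n])
    then have "eventually (\<lambda>n. e n < min (t - a) (b - t)) sequentially"
      using that by (intro order_tendstoD(2)) auto
    then obtain n where "e n < min (t - a) (b - t)" using eventually_happens' by (metis sequentially_bot)
    then show ?thesis by (intro exI[of _ n]) (auto simp: D_def)
  qed
  have inn: "AE t in lebesgue. t \<in> {a..b} \<longrightarrow> (\<exists>n. t \<in> D n)"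
  proof -
    have "{a, b} \<in> null_sets lebesgue" using negligible_finite[of "{a, b}"] negligible_iff_null_sets by blast
    then have "AE t in lebesgue. t \<notin> {a, b}" by (rule AE_not_in)
    then show ?thesis by eventually_elim (use cover in auto)
  qed
  have sp: "space (lebesgue_on A) = A" for A :: "real set" by (simp add: space_restrict_space)
  have "simple_function (lebesgue_on {a..b}) (r k)" for k
    unfolding simple_function_def
  proof
    have sub: "r k ` {a..b} \<subseteq> (\<Union>n\<le>k. s n k ` D n) \<union> {z}"
    proof
      fix y assume "y \<in> r k ` {a..b}"
      then obtain t where t: "y = r k t" by blast
      show "y \<in> (\<Union>n\<le>k. s n k ` D n) \<union> {z}"
      proof (cases "\<exists>n\<le>k. t \<in> D n")
        case True
        then obtain n where n: "n \<le> k" "t \<in> D n" by blast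
        have "m t \<le> k" using ml[OF n(2)] n(1) by simp
        moreover have "y = s (m t) k t" using True by (simp add: t r_def)
        ultimately show ?thesis using m[OF n(2)] by blast
      next
        case False
        have "r k t = z" unfolding r_def by (rule if_not_P[OF False])
        then show ?thesis by (simp add: t)
      qed
    qed
    have "finite (s n k ` D n)" for n using s(1)[of n k] by (simp add: simple_function_def sp)
    then show "finite (r k ` space (lebesgue_on {a..b}))"
      unfolding sp by (intro finite_subset[OF sub]) auto
    show "\<forall>y\<in>r k ` space (lebesgue_on {a..b}). r k -` {y} \<inter> space (lebesgue_on {a..b}) \<in> sets (lebesgue_on {a..b})"
      unfolding sp
    proof
      fix y
      have ms: "s n k -` {y} \<inter> D n \<in> sets lebesgue" for n
      proof (cases "y \<in> s n k ` D n")
        case True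
        then have "s n k -` {y} \<inter> D n \<in> sets (lebesgue_on (D n))"
          using s(1)[of n k] unfolding simple_function_def sp by blast
        then show ?thesis using D by (simp add: sets_restrict_space_iff)
      next
        case False
        then have "s n k -` {y} \<inter> D n = {}" by blast
        then show ?thesis by (metis sets.empty_sets)
      qed
      have mn: "t \<in> D n - (\<Union>j<n. D j) \<longleftrightarrow> (\<exists>j. t \<in> D j) \<and> m t = n" for t n
      proof
        assume t: "t \<in> D n - (\<Union>j<n. D j)"
        then have "m t \<le> n" "t \<in> D (m t)" using m[of t n] ml[of t n] by auto
        moreover have "\<not> m t < n" using t \<open>t \<in> D (m t)\<close> by blast
        ultimately have "m t = n" by simp
        then show "(\<exists>j. t \<in> D j) \<and> m t = n" using t by blast
      next
        assume t: "(\<exists>j. t \<in> D j) \<and> m t = n"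
        then have "t \<in> D n" using m by blast
        moreover have "t \<notin> D j" if "j < n" for j using ml[of t j] t that by auto
        ultimately show "t \<in> D n - (\<Union>j<n. D j)" by blast
      qed
      have "r k -` {y} \<inter> {a..b} = (\<Union>n\<le>k. (s n k -` {y} \<inter> D n) \<inter> (D n - (\<Union>j<n. D j)))
          \<union> (if y = z then {a..b} - (\<Union>n\<le>k. D n) else {})" (is "?L = ?R")
      proof (intro set_eqI iffI)
        fix t assume t: "t \<in> ?L"
        show "t \<in> ?R"
        proof (cases "\<exists>n\<le>k. t \<in> D n")
          case True
          then obtain n where n: "n \<le> k" "t \<in> D n" by blast
          have "m t \<le> k" using ml[OF n(2)] n(1) by simp
          moreover have "s (m t) k t = y" using True t by (simp add: r_def)
          moreover have "t \<in> D (m t) - (\<Union>j<m t. D j)" using mn n(2) by blast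
          ultimately show ?thesis by blast
        next
          case False
          then show ?thesis using t by (auto simp: r_def)
        qed
      next
        fix t assume "t \<in> ?R"
        then consider n where "n \<le> k" "s n k t = y" "t \<in> D n - (\<Union>j<n. D j)" | "y = z" "t \<in> {a..b}" "\<not> (\<exists>n\<le>k. t \<in> D n)"
          by (auto split: if_splits)
        then show "t \<in> ?L"
        proof cases
          case (1 n)
          then have "m t = n" using mn by blast
          then show ?thesis using 1 D(2)[of n] by (auto simp: r_def)
        next
          case 2
          have "r k t = z" unfolding r_def by (rule if_not_P[OF 2(3)])
          then show ?thesis using 2 by simp
        qed
      qed
      also have "\<dots> \<in> sets lebesgue"
      proof -
        have "(\<Union>n\<le>k. (s n k -` {y} \<inter> D n) \<inter> (D n - (\<Union>j<n. D j))) \<in> sets lebesgue"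
          by (intro sets.finite_UN finite_atMost finite_lessThan sets.Int[OF ms] sets.Diff D(1))
        moreover have "{a..b} - (\<Union>n\<le>k. D n) \<in> sets lebesgue"
          by (intro sets.finite_UN finite_atMost sets.Diff D(1)) auto
        ultimately show ?thesis by (cases "y = z") simp_all
      qed
      finally show "r k -` {y} \<inter> {a..b} \<in> sets (lebesgue_on {a..b})"
        by (simp add: sets_restrict_space_iff)
    qed
  qed
  moreover have "r k ` {a..b} \<subseteq> X" for k
  proof
    fix y assume "y \<in> r k ` {a..b}"
    then obtain t where t: "y = r k t" by blast
    show "y \<in> X"
    proof (cases "\<exists>n\<le>k. t \<in> D n")
      case True
      then have "y = s (m t) k t" by (simp add: t r_def)
      moreover have "t \<in> D (m t)" using True m by blast
      ultimately show ?thesis using s(2) by blast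
    next
      case False
      have "r k t = z" unfolding r_def by (rule if_not_P[OF False])
      then show ?thesis using z by (simp add: t)
    qed
  qed
  moreover have "AE t in lebesgue_on {a..b}. (\<lambda>k. N (r k t - g t)) \<longlonglongrightarrow> 0"
  proof -
    have "AE t in lebesgue. \<forall>n. t \<in> D n \<longrightarrow> (\<lambda>k. N (s n k t - g t)) \<longlonglongrightarrow> 0"
      using s(3) D(1) by (simp add: AE_all_countable AE_lebesgue_on_iff)
    with inn have "AE t in lebesgue. t \<in> {a..b} \<longrightarrow> (\<lambda>k. N (r k t - g t)) \<longlonglongrightarrow> 0"
    proof eventually_elim
      case (elim t)
      show ?case
      proof
        assume "t \<in> {a..b}"
        then obtain n where n: "t \<in> D n" using elim by blast
        have "(\<lambda>k. N (s (m t) k t - g t)) \<longlonglongrightarrow> 0" using elim m[OF n] by blast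
        moreover have "eventually (\<lambda>k. N (s (m t) k t - g t) = N (r k t - g t)) sequentially"
          using eventually_ge_at_top[of n] by eventually_elim (use n in \<open>auto simp: r_def\<close>)
        ultimately show "(\<lambda>k. N (r k t - g t)) \<longlonglongrightarrow> 0" by (rule Lim_transform_eventually)
      qed
    qed
    then show ?thesis by (simp add: AE_lebesgue_on_iff)
  qed
  moreover have "AE t in lebesgue_on {a..b}. g t \<in> X"
  proof -
    have "AE t in lebesgue. t \<in> D n \<longrightarrow> g t \<in> X" for n
    proof -
      have "AE t in lebesgue_on (D n). g t \<in> X" using bD[of n] unfolding bochner_measurable_on_def by (rule conjunct1)
      then show ?thesis by (simp only: AE_lebesgue_on_iff[OF D(1)])
    qed
    then have "AE t in lebesgue. \<forall>n. t \<in> D n \<longrightarrow> g t \<in> X" unfolding AE_all_countable by blast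
    with inn have "AE t in lebesgue. t \<in> {a..b} \<longrightarrow> g t \<in> X" by eventually_elim blast
    then show ?thesis by (simp add: AE_lebesgue_on_iff)
  qed
  ultimately show ?thesis unfolding bochner_measurable_on_def by blast
qed

section \<open>Weakly continuous paths\<close>

lemma openin_H_weak:
  "w \<in> space_H S \<Longrightarrow> open U \<Longrightarrow> openin (H_weak S) {x \<in> space_H S. x \<bullet> w \<in> U}"
  unfolding H_weak_def openin_topology_generated_by_iff by (rule generate_topology_on.Basis) blast

lemma topspace_H_weak_subset: "topspace (H_weak S) \<subseteq> space_H S"
  unfolding H_weak_def topology_generated_by_topspace by blast

lemma weak_continuous_in_H:
  "continuous_map (top_of_set I) (H_weak S) u \<Longrightarrow> t \<in> I \<Longrightarrow> u t \<in> space_H S"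
  using topspace_H_weak_subset continuous_map_image_subset_topspace by fastforce

lemma weak_continuous_inner:
  assumes c: "continuous_map (top_of_set I) (H_weak S) u" and w: "w \<in> space_H S"
  shows "continuous_on I (\<lambda>t. u t \<bullet> w)"
proof (subst continuous_openin_preimage_eq, intro allI impI)
  fix U :: "real set" assume "open U"
  then have "openin (top_of_set I) {t \<in> topspace (top_of_set I). u t \<in> {x \<in> space_H S. x \<bullet> w \<in> U}}"
    by (intro openin_continuous_map_preimage[OF c] openin_H_weak w)
  moreover have "{t \<in> topspace (top_of_set I). u t \<in> {x \<in> space_H S. x \<bullet> w \<in> U}} = I \<inter> (\<lambda>t. u t \<bullet> w) -` U"
    using weak_continuous_in_H[OF c] by auto
  ultimately show "openin (top_of_set I) (I \<inter> (\<lambda>t. u t \<bullet> w) -` U)" by simp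
qed

text \<open>Weak lower semicontinuity of the norm, by testing with u t itself: u s \<bullet> u t
  tends to |u t|^2 and is at most |u s| |u t|.\<close>

lemma weak_continuous_norm_lower:
  assumes c: "continuous_map (top_of_set I) (H_weak S) u" and t: "t \<in> I" and r: "r < norm (u t)"
  shows "eventually (\<lambda>s. r < norm (u s)) (at t within I)"
proof (cases "r < 0")
  case True
  then show ?thesis by (intro always_eventually allI) (meson less_le_trans norm_ge_zero)
next
  case False
  then have pos: "0 < norm (u t)" using r by linarith
  have "((\<lambda>s. u s \<bullet> u t) \<longlongrightarrow> u t \<bullet> u t) (at t within I)"
    using weak_continuous_inner[OF c weak_continuous_in_H[OF c t]] t by (simp add: continuous_on_def)
  moreover have "r * norm (u t) < u t \<bullet> u t"
    using r pos by (simp add: dot_square_norm power2_eq_square)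
  ultimately have "eventually (\<lambda>s. r * norm (u t) < u s \<bullet> u t) (at t within I)"
    by (rule order_tendstoD(1))
  then show ?thesis
  proof eventually_elim
    case (elim s)
    also have "u s \<bullet> u t \<le> norm (u s) * norm (u t)" by (rule norm_cauchy_schwarz)
    finally show ?case using pos by simp
  qed
qed

lemma AE_Ioo_obtains:
  fixes p q :: real
  assumes "AE t in lebesgue_on J. P t" "J \<in> sets lebesgue" "{p<..<q} \<subseteq> J" "p < q"
  obtains t where "p < t" "t < q" "P t"
proof -
  have ae: "AE t in lebesgue. t \<in> J \<longrightarrow> P t" using assms by (simp add: AE_lebesgue_on_iff)
  have "\<exists>t\<in>{p<..<q}. P t"
  proof (rule ccontr)
    assume "\<not> ?thesis"
    with ae assms(3) have "AE t in lebesgue. t \<notin> {p<..<q}" by (auto elim!: eventually_mono)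
    then have "{p<..<q} \<in> null_sets lebesgue" by (simp add: AE_iff_null_sets)
    then have "emeasure lebesgue {p<..<q} = 0" by auto
    then show False using assms(4) by simp
  qed
  then show ?thesis using that by auto
qed

lemma weak_norm_le_of_frequently:
  assumes c: "continuous_map (top_of_set I) (H_weak S) u" and t: "t \<in> I"
    and f: "frequently (\<lambda>s. norm (u s) \<le> r) (at t within I)"
  shows "norm (u t) \<le> r"
proof (rule ccontr)
  assume "\<not> ?thesis"
  then have "eventually (\<lambda>s. r < norm (u s)) (at t within I)"
    by (intro weak_continuous_norm_lower[OF c t]) simp
  then show False using f by (simp add: frequently_def not_le)
qed

text \<open>A bound at almost every time holds at times arbitrarily close to t, hence at t by lower
  semicontinuity. Essential bounds thus become bounds everywhere.\<close>

lemma weak_norm_le_of_AE: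
  fixes a b t :: real
  assumes c: "continuous_map (top_of_set I) (H_weak S) u" and ab: "a < b" "{a..b} \<subseteq> I"
    and ae: "AE t in lebesgue_on {a..b}. norm (u t) \<le> r" and t: "t \<in> {a..b}"
  shows "norm (u t) \<le> r"
proof (rule weak_norm_le_of_frequently[OF c])
  show "t \<in> I" using t ab by blast
  show "frequently (\<lambda>s. norm (u s) \<le> r) (at t within I)"
    unfolding frequently_def eventually_at
  proof clarify
    fix d :: real assume d: "0 < d" "\<forall>x\<in>I. x \<noteq> t \<and> dist x t < d \<longrightarrow> \<not> norm (u x) \<le> r"
    \<comment> \<open>An open interval inside [a, b] adjacent to t, on its right if t < b and
      otherwise on its left. It has positive measure and so contains a time at which the bound
      holds.\<close>
    obtain p q where pq: "p < q" "{p<..<q} \<subseteq> {a..b}" "\<And>s. p < s \<Longrightarrow> s < q \<Longrightarrow> s \<noteq> t \<and> dist s t < d"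
    proof (cases "t < b")
      case True
      show ?thesis by (rule that[of t "min b (t + d)"]) (use True t d in \<open>auto simp: dist_real_def\<close>)
    next
      case False
      show ?thesis by (rule that[of "max a (t - d)" t]) (use False t ab d in \<open>auto simp: dist_real_def\<close>)
    qed
    obtain s where "p < s" "s < q" "norm (u s) \<le> r"
      by (rule AE_Ioo_obtains[OF ae _ pq(2,1)]) auto
    then show False using d(2) pq ab(2) by (metis greaterThanLessThan_iff subsetD)
  qed
qed

section \<open>Extension of weak solutions to the end points\<close>

lemma borel_measurable_indicator_continuous:
  fixes g :: "real \<Rightarrow> real"
  assumes "continuous_on I g" "J \<subseteq> I" "J \<in> sets lebesgue"
  shows "(\<lambda>t. indicator J t * g t) \<in> borel_measurable lebesgue"
proof -
  have "g \<in> borel_measurable (lebesgue_on J)"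
    using assms by (intro continuous_imp_measurable_on_sets_lebesgue continuous_on_subset[OF assms(1)])
  then show ?thesis
    using assms(3) borel_measurable_restrict_space_iff[of J lebesgue g] by simp
qed

lemma set_integrable_bounded_Icc:
  fixes g :: "real \<Rightarrow> real"
  assumes m: "(\<lambda>t. indicator {a..b} t * g t) \<in> borel_measurable lebesgue"
    and B: "AE t in lebesgue. t \<in> {a..b} \<longrightarrow> \<bar>g t\<bar> \<le> B"
  shows "set_integrable lebesgue {a..b} g"
    and "a \<le> b \<Longrightarrow> (LINT t:{a..b}|lebesgue. g t) \<le> B * (b - a)"
proof -
  have iB: "integrable lebesgue (\<lambda>t. B * indicator {a..b} t)"
    by (intro integrable_mult_right integrable_real_indicator) (auto simp: emeasure_lborel_Icc_eq)
  show i: "set_integrable lebesgue {a..b} g"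
    unfolding set_integrable_def
    by (rule Bochner_Integration.integrable_bound[OF iB])
      (use m B in \<open>auto elim!: eventually_mono simp: indicator_def\<close>)
  assume "a \<le> b"
  have "(LINT t:{a..b}|lebesgue. g t) \<le> (LINT t|lebesgue. B * indicator {a..b} t)"
    unfolding set_lebesgue_integral_def
    by (rule integral_mono_AE[OF i[unfolded set_integrable_def] iB]) (use B in \<open>auto elim!: eventually_mono simp: indicator_def\<close>)
  also have "\<dots> = B * (b - a)" using \<open>a \<le> b\<close> by simp
  finally show "(LINT t:{a..b}|lebesgue. g t) \<le> B * (b - a)" .
qed

lemma tendsto_set_integral_Icc:
  fixes h :: "real \<Rightarrow> real"
  assumes h: "set_integrable lebesgue {p..t} h" and r: "r \<longlonglongrightarrow> t" "\<And>n. r n < t"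
  shows "(\<lambda>n. LINT s:{p..r n}|lebesgue. h s) \<longlonglongrightarrow> (LINT s:{p..t}|lebesgue. h s)"
  unfolding set_lebesgue_integral_def
proof (rule integral_dominated_convergence)
  have hm: "(\<lambda>s. indicator {p..t} s *\<^sub>R h s) \<in> borel_measurable lebesgue"
    using h by (auto simp: set_integrable_def)
  then show "(\<lambda>s. indicator {p..t} s *\<^sub>R h s) \<in> borel_measurable lebesgue" .
  have eq: "indicator {p..r n} s *\<^sub>R h s = indicator {p..r n} s * (indicator {p..t} s *\<^sub>R h s)" for n s
    using r(2)[of n] by (auto simp: indicator_def)
  show "(\<lambda>s. indicator {p..r n} s *\<^sub>R h s) \<in> borel_measurable lebesgue" for n
    unfolding eq by (intro borel_measurable_times[OF borel_measurable_indicator hm]) auto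
  show "integrable lebesgue (\<lambda>s. \<bar>indicator {p..t} s *\<^sub>R h s\<bar>)"
    using h by (auto simp: set_integrable_def)
  show "AE s in lebesgue. norm (indicator {p..r n} s *\<^sub>R h s) \<le> \<bar>indicator {p..t} s *\<^sub>R h s\<bar>" for n
    using r(2)[of n] by (intro AE_I2) (auto simp: indicator_def)
  have "{t} \<in> null_sets lebesgue" using negligible_iff_null_sets negligible_sing by blast
  then have "AE s in lebesgue. s \<notin> {t}" by (rule AE_not_in)
  then show "AE s in lebesgue. (\<lambda>n. indicator {p..r n} s *\<^sub>R h s) \<longlonglongrightarrow> indicator {p..t} s *\<^sub>R h s"
  proof eventually_elim
    case (elim s)
    show ?case
    proof (cases "s < t")
      case True
      have "eventually (\<lambda>n. s < r n) sequentially" using r(1) True by (rule order_tendstoD(1))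
      then have "eventually (\<lambda>n. indicator {p..r n} s *\<^sub>R h s = indicator {p..t} s *\<^sub>R h s) sequentially"
        by eventually_elim (use True in \<open>auto simp: indicator_def\<close>)
      then show ?thesis by (rule tendsto_eventually)
    next
      case False
      then have "s \<notin> {p..t}" "s \<notin> {p..r n}" for n using elim r(2)[of n] by auto
      then show ?thesis by simp
    qed
  qed
qed

section \<open>Estimates for the residual functional\<close>

definition residual_functional :: "real \<Rightarrow> setting \<Rightarrow> L2_field \<Rightarrow> L2_field \<Rightarrow> L2_field \<Rightarrow> real" where
  "residual_functional \<nu> S f u = (\<lambda>v\<in>space_V S. f \<bullet> v - \<nu> * inner_V S u v - form_b S u u v)"

lemma inner_V_le: "\<bar>inner_V S u v\<bar> \<le> norm_V S u * norm_V S v"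
  unfolding inner_V_eq norm_V_eq by (rule Cauchy_Schwarz_ineq2)

text \<open>Two kinds of bounds on b are kept. The growth bound retains the square root of |u|, on
  which the exponent 4/3 rests. For differences, Poincare's inequality trades |u| for
  \<open>norm_V\<close>: cruder, but enough for the convergence of approximations in V.\<close>

lemma residual_functional_estimates:
  assumes S: "valid_setting S" and nu: "0 < \<nu>"
  obtains C K where "0 \<le> C" "0 \<le> K"
    "\<And>f u. u \<in> space_V S \<Longrightarrow> residual_functional \<nu> S f u \<in> dual_V S"
    "\<And>f u. u \<in> space_V S \<Longrightarrow> norm_dual S (residual_functional \<nu> S f u)
      \<le> C * norm f + \<nu> * norm_V S u + K * sqrt (norm u * norm_V S u) * norm_V S u"
    "\<And>f u. u \<in> space_V S \<Longrightarrow> 0 \<le> norm_dual S (residual_functional \<nu> S f u)"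
    "\<And>f f' u u'. u \<in> space_V S \<Longrightarrow> u' \<in> space_V S \<Longrightarrow>
      0 \<le> norm_dual S (residual_functional \<nu> S f' u' - residual_functional \<nu> S f u) \<and>
      norm_dual S (residual_functional \<nu> S f' u' - residual_functional \<nu> S f u)
        \<le> C * norm (f' - f) + \<nu> * norm_V S (u' - u) + K * sqrt C * norm_V S (u' - u) * (norm_V S u' + norm_V S u)"
    "\<And>u v. u \<in> space_V S \<Longrightarrow> v \<in> space_V S \<Longrightarrow> \<bar>form_b S u u v\<bar> \<le> K * sqrt C * (norm_V S u)\<^sup>2 * norm_V S v"
    "\<And>u u' v. u \<in> space_V S \<Longrightarrow> u' \<in> space_V S \<Longrightarrow> v \<in> space_V S \<Longrightarrow>
      \<bar>form_b S u' u' v - form_b S u u v\<bar> \<le> K * sqrt C * norm_V S (u' - u) * (norm_V S u' + norm_V S u) * norm_V S v"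
proof -
  obtain C where C: "0 < C" "\<And>u. u \<in> space_V S \<Longrightarrow> norm u \<le> C * norm_V S u"
    by (rule space_V_estimates[OF S]) (rule that)
  obtain K where K: "0 \<le> K" "\<And>u v w. u \<in> space_V S \<Longrightarrow> w \<in> space_V S \<Longrightarrow>
    \<bar>form_b S u v w\<bar> \<le> K * sqrt (norm u * norm_V S u) * norm_V S v * norm_V S w"
    by (rule form_b_estimate[OF S]) (rule that)
  have sq: "sqrt (norm u * norm_V S u) \<le> sqrt C * norm_V S u" if "u \<in> space_V S" for u
  proof -
    have "sqrt (norm u * norm_V S u) \<le> sqrt (C * norm_V S u * norm_V S u)"
      using C(2)[OF that] by (intro real_sqrt_le_mono mult_right_mono) auto
    also have "\<dots> = sqrt C * norm_V S u" by (simp add: real_sqrt_mult)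
    finally show ?thesis .
  qed
  have b3: "\<bar>form_b S u v w\<bar> \<le> K * sqrt C * norm_V S u * norm_V S v * norm_V S w"
    if "u \<in> space_V S" "w \<in> space_V S" for u v w
  proof -
    have "\<bar>form_b S u v w\<bar> \<le> K * sqrt (norm u * norm_V S u) * norm_V S v * norm_V S w" by (rule K(2)[OF that])
    also have "\<dots> \<le> K * (sqrt C * norm_V S u) * norm_V S v * norm_V S w"
      using sq[OF that(1)] K(1) by (intro mult_right_mono mult_left_mono) auto
    finally show ?thesis by (simp add: mult.assoc)
  qed
  have bdiff: "\<bar>form_b S u' u' v - form_b S u u v\<bar> \<le> K * sqrt C * norm_V S (u' - u) * (norm_V S u' + norm_V S u) * norm_V S v"
    if u: "u \<in> space_V S" "u' \<in> space_V S" "v \<in> space_V S" for u u' v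
  proof -
    have d: "u' - u \<in> space_V S" using space_V_diff[OF S] u by blast
    have "form_b S u' u' v - form_b S u u v = form_b S (u' - u) u' v + form_b S u (u' - u) v"
      by (simp add: form_b_diff_first[OF S u(2,1,3)] form_b_diff_second[OF S u(1) u(2,1,3)])
    then have "\<bar>form_b S u' u' v - form_b S u u v\<bar> \<le> \<bar>form_b S (u' - u) u' v\<bar> + \<bar>form_b S u (u' - u) v\<bar>"
      by linarith
    also have "\<dots> \<le> K * sqrt C * norm_V S (u' - u) * norm_V S u' * norm_V S v + K * sqrt C * norm_V S u * norm_V S (u' - u) * norm_V S v"
      by (intro add_mono b3 d u)
    finally show ?thesis by (simp add: algebra_simps)
  qed
  have bd: "\<bar>residual_functional \<nu> S f u v\<bar> \<le> (C * norm f + \<nu> * norm_V S u + K * sqrt (norm u * norm_V S u) * norm_V S u) * norm_V S v"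
    if u: "u \<in> space_V S" and v: "v \<in> space_V S" for f u v
  proof -
    have "\<bar>f \<bullet> v\<bar> \<le> norm f * norm v" by (rule Cauchy_Schwarz_ineq2)
    also have "\<dots> \<le> norm f * (C * norm_V S v)" by (intro mult_left_mono C(2) v) auto
    finally have 1: "\<bar>f \<bullet> v\<bar> \<le> C * norm f * norm_V S v" by (simp add: mult_ac)
    have 2: "\<bar>\<nu> * inner_V S u v\<bar> \<le> \<nu> * norm_V S u * norm_V S v"
      using nu inner_V_le[of S u v] by (simp add: abs_mult mult.assoc)
    show ?thesis
      using 1 2 K(2)[OF u v, of u] v by (simp add: residual_functional_def algebra_simps)
  qed
  have dbd: "\<bar>(residual_functional \<nu> S f' u' - residual_functional \<nu> S f u) v\<bar>
      \<le> (C * norm (f' - f) + \<nu> * norm_V S (u' - u) + K * sqrt C * norm_V S (u' - u) * (norm_V S u' + norm_V S u)) * norm_V S v"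
    if u: "u \<in> space_V S" "u' \<in> space_V S" and v: "v \<in> space_V S" for f f' u u' v
  proof -
    have "\<bar>(f' - f) \<bullet> v\<bar> \<le> norm (f' - f) * norm v" by (rule Cauchy_Schwarz_ineq2)
    also have "\<dots> \<le> norm (f' - f) * (C * norm_V S v)" by (intro mult_left_mono C(2) v) auto
    finally have 1: "\<bar>(f' - f) \<bullet> v\<bar> \<le> C * norm (f' - f) * norm_V S v" by (simp add: mult_ac)
    have 2: "\<bar>\<nu> * inner_V S (u' - u) v\<bar> \<le> \<nu> * norm_V S (u' - u) * norm_V S v"
      using nu inner_V_le[of S "u' - u" v] by (simp add: abs_mult mult.assoc)
    have i: "inner_V S (u' - u) v = inner_V S u' v - inner_V S u v"
      unfolding inner_V_eq grad_diff[OF S space_V_H1[OF u(2)] space_V_H1[OF u(1)]] by (rule inner_diff_left)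
    have "(residual_functional \<nu> S f' u' - residual_functional \<nu> S f u) v
        = (f' - f) \<bullet> v - \<nu> * inner_V S (u' - u) v - (form_b S u' u' v - form_b S u u v)"
      using v by (simp add: residual_functional_def i inner_diff_left algebra_simps)
    then have "\<bar>(residual_functional \<nu> S f' u' - residual_functional \<nu> S f u) v\<bar>
        \<le> \<bar>(f' - f) \<bullet> v\<bar> + \<bar>\<nu> * inner_V S (u' - u) v\<bar> + \<bar>form_b S u' u' v - form_b S u u v\<bar>"
      by linarith
    also have "\<dots> \<le> C * norm (f' - f) * norm_V S v + \<nu> * norm_V S (u' - u) * norm_V S v
        + K * sqrt C * norm_V S (u' - u) * (norm_V S u' + norm_V S u) * norm_V S v"
      by (intro add_mono 1 2 bdiff u v)
    finally show ?thesis by (simp add: distrib_right)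
  qed
  have nn: "0 \<le> C * norm f + \<nu> * norm_V S u + K * sqrt (norm u * norm_V S u) * norm_V S u" for f u
    using C(1) nu K(1) by (intro add_nonneg_nonneg mult_nonneg_nonneg) auto
  have nn': "0 \<le> C * norm (f' - f) + \<nu> * norm_V S (u' - u) + K * sqrt C * norm_V S (u' - u) * (norm_V S u' + norm_V S u)" for f f' u u'
    using C(1) nu K(1) by (intro add_nonneg_nonneg mult_nonneg_nonneg) auto
  show ?thesis
  proof (rule that[of C K])
    show "residual_functional \<nu> S f u \<in> dual_V S" if u: "u \<in> space_V S" for f u
      unfolding dual_V_def
    proof (intro CollectI conjI ballI allI)
      show "residual_functional \<nu> S f u \<in> extensional (space_V S)" by (simp add: residual_functional_def)
      fix v assume v: "v \<in> space_V S"
      show "residual_functional \<nu> S f u (v + w) = residual_functional \<nu> S f u v + residual_functional \<nu> S f u w"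
        if w: "w \<in> space_V S" for w
        using v w space_V_add[OF S v w] form_b_linear_third(1)[OF S u v w]
          grad_add[OF S space_V_H1[OF v] space_V_H1[OF w]]
        by (simp add: residual_functional_def inner_add_right inner_V_eq algebra_simps)
      show "residual_functional \<nu> S f u (c *\<^sub>R v) = c * residual_functional \<nu> S f u v" for c
        using v space_V_scaleR[OF S v] form_b_linear_third(2)[OF S u v v]
          grad_scaleR[OF S space_V_H1[OF v]]
        by (simp add: residual_functional_def inner_V_eq algebra_simps)
    next
      show "\<exists>c. \<forall>v\<in>space_V S. \<bar>residual_functional \<nu> S f u v\<bar> \<le> c * norm_V S v"
        using bd[OF u] by blast
    qed
    show "norm_dual S (residual_functional \<nu> S f u) \<le> C * norm f + \<nu> * norm_V S u + K * sqrt (norm u * norm_V S u) * norm_V S u"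
      "0 \<le> norm_dual S (residual_functional \<nu> S f u)" if u: "u \<in> space_V S" for f u
      using norm_dual_bounds[OF S nn bd[OF u]] by auto
    show "0 \<le> norm_dual S (residual_functional \<nu> S f' u' - residual_functional \<nu> S f u) \<and>
      norm_dual S (residual_functional \<nu> S f' u' - residual_functional \<nu> S f u)
        \<le> C * norm (f' - f) + \<nu> * norm_V S (u' - u) + K * sqrt C * norm_V S (u' - u) * (norm_V S u' + norm_V S u)"
      if u: "u \<in> space_V S" "u' \<in> space_V S" for f f' u u'
      by (intro conjI norm_dual_bounds[OF S nn' dbd[OF u]])
    show "\<bar>form_b S u u v\<bar> \<le> K * sqrt C * (norm_V S u)\<^sup>2 * norm_V S v" if "u \<in> space_V S" "v \<in> space_V S" for u v
      using b3[OF that, of u] by (simp add: power2_eq_square mult.assoc)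
  qed (use C(1) K(1) bdiff in auto)
qed

text \<open>Facts about every element of \<open>solutions_sharp\<close>, before anything is known at
  a left end point. \<open>norm_growth\<close> is proved here because the proof of right continuity
  relies on it.\<close>

locale interior_solution =
  fixes \<nu> :: real and S :: setting and I :: "real set" and f u :: "real \<Rightarrow> L2_field"
  assumes nu: "0 < \<nu>" and S: "valid_setting S" and I: "is_interval I"
    and f: "f \<in> L_infinity (space_H S) norm I"
    and u: "u \<in> paths S I"
    and sol: "weak_solution \<nu> S f (interior I) u"
begin

lemma cont: "continuous_map (top_of_set I) (H_weak S) u"
  using u by (simp add: paths_def)

lemma I_lebesgue: "I \<in> sets lebesgue" "interior I \<in> sets lebesgue"
  using interval_sets_lebesgue[OF I] by auto

lemma Ioo_interior:
  assumes "a \<in> I" "b \<in> I"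
  shows "{a<..<b} \<subseteq> interior I"
proof (rule interior_maximal)
  show "{a<..<b} \<subseteq> I"
    using I assms unfolding is_interval_1 by (meson greaterThanLessThan_iff less_imp_le subsetI)
qed simp

lemma Icc_interior:
  assumes "{a..b} \<subseteq> I" "a < c" "d < b"
  shows "{c..d} \<subseteq> interior I"
proof (cases "a \<le> b")
  case True
  then have "{a<..<b} \<subseteq> interior I" using assms by (intro Ioo_interior) auto
  then show ?thesis using assms(2,3) by force
qed (use assms in auto)

definition good :: "real \<Rightarrow> bool" where
  "good s \<longleftrightarrow> s \<in> interior I \<and> (\<forall>t\<in>interior I. s < t \<longrightarrow> energy_inequality \<nu> S f u s t)"

lemma AE_good: "AE s in lebesgue_on (interior I). good s"
proof -
  have "AE s in lebesgue_on (interior I). \<forall>t\<in>interior I. s < t \<longrightarrow> energy_inequality \<nu> S f u s t"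
    using sol by (simp add: weak_solution_def)
  then show ?thesis
    unfolding AE_lebesgue_on_iff[OF I_lebesgue(2)] good_def by (auto elim!: eventually_mono)
qed

lemma good_between:
  assumes "p < q" "{p<..<q} \<subseteq> interior I"
  obtains s where "p < s" "s < q" "good s"
  by (rule AE_Ioo_obtains[OF AE_good I_lebesgue(2) assms(2,1)]) (rule that)

lemma f_bound:
  obtains C where "0 \<le> C" "AE t in lebesgue. t \<in> I \<longrightarrow> norm (f t) \<le> C"
proof -
  obtain C where "AE t in lebesgue_on I. norm (f t) \<le> C" using f by (auto simp: L_infinity_def)
  then have "AE t in lebesgue. t \<in> I \<longrightarrow> norm (f t) \<le> C" by (simp add: AE_lebesgue_on_iff[OF I_lebesgue(1)])
  then have "AE t in lebesgue. t \<in> I \<longrightarrow> norm (f t) \<le> max C 0" by (auto elim!: eventually_mono)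
  then show ?thesis by (rule that[rotated]) simp
qed

lemma bochner_f:
  assumes "J \<subseteq> I" "J \<in> sets lebesgue"
  shows "bochner_measurable_on (space_H S) norm J f"
proof (rule bochner_measurable_subset[OF _ I_lebesgue(1) assms(2,1)])
  show "bochner_measurable_on (space_H S) norm I f" using f by (simp add: L_infinity_def)
qed

lemma tendsto_of_norm_diff: "(\<lambda>n. norm (s n - y)) \<longlonglongrightarrow> 0 \<Longrightarrow> s \<longlonglongrightarrow> (y :: L2_field)"
  by (simp add: tendsto_norm_zero_iff LIM_zero_iff)

lemma fu_measurable:
  assumes "{a..b} \<subseteq> I"
  shows "(\<lambda>t. indicator {a..b} t * (f t \<bullet> u t)) \<in> borel_measurable lebesgue"
proof (rule bochner_measurable_compose[where \<Phi>="\<lambda>t y. y \<bullet> u t", OF bochner_f[OF assms]])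
  fix y assume "y \<in> space_H S"
  from borel_measurable_indicator_continuous[OF weak_continuous_inner[OF cont this] assms]
  show "(\<lambda>t. indicator {a..b} t * (y \<bullet> u t)) \<in> borel_measurable lebesgue"
    by (simp add: inner_commute)
qed (auto intro!: tendsto_inner tendsto_of_norm_diff)

lemma fu_integrable:
  assumes ab: "{a..b} \<subseteq> I" and C: "0 \<le> C" "AE t in lebesgue. t \<in> I \<longrightarrow> norm (f t) \<le> C"
    and M: "\<And>t. t \<in> {a..b} \<Longrightarrow> norm (u t) \<le> M"
  shows "set_integrable lebesgue {a..b} (\<lambda>t. f t \<bullet> u t)"
    and "a \<le> b \<Longrightarrow> (LINT t:{a..b}|lebesgue. f t \<bullet> u t) \<le> C * M * (b - a)"
proof -
  have "AE t in lebesgue. t \<in> {a..b} \<longrightarrow> \<bar>f t \<bullet> u t\<bar> \<le> C * M"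
    using C(2)
  proof eventually_elim
    case (elim t)
    show ?case
    proof
      assume t: "t \<in> {a..b}"
      have "\<bar>f t \<bullet> u t\<bar> \<le> norm (f t) * norm (u t)" by (rule Cauchy_Schwarz_ineq2)
      also have "\<dots> \<le> C * M" using elim t ab M[OF t] C(1) by (intro mult_mono) auto
      finally show "\<bar>f t \<bullet> u t\<bar> \<le> C * M" .
    qed
  qed
  from set_integrable_bounded_Icc[OF fu_measurable[OF ab] this]
  show "set_integrable lebesgue {a..b} (\<lambda>t. f t \<bullet> u t)"
    "a \<le> b \<Longrightarrow> (LINT t:{a..b}|lebesgue. f t \<bullet> u t) \<le> C * M * (b - a)" by auto
qed

lemma bounded_interior:
  assumes cd: "{c..d} \<subseteq> interior I"
  obtains M where "0 \<le> M" "\<And>t. t \<in> {c..d} \<Longrightarrow> norm (u t) \<le> M"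
proof (cases "c < d")
  case True
  have "u \<in> L_infinity (space_H S) norm {c..d}" using sol cd by (simp add: weak_solution_def loc_def)
  then obtain C where "AE t in lebesgue_on {c..d}. norm (u t) \<le> C" by (auto simp: L_infinity_def)
  then have "norm (u t) \<le> C" if "t \<in> {c..d}" for t
    using True cd interior_subset that by (intro weak_norm_le_of_AE[OF cont True]) auto
  moreover from this have "0 \<le> C" using True by (meson atLeastAtMost_iff less_imp_le norm_ge_zero order_refl order_trans)
  ultimately show ?thesis using that by blast
next
  case False
  then have "t = c" if "t \<in> {c..d}" for t using that by auto
  then show ?thesis by (intro that[of "norm (u c)"]) auto
qed

lemma interval_interior: "is_interval (interior I)"
  using I by (simp add: is_interval_convex_1 convex_interior)

text \<open>A substitute for Gronwall's lemma. For the supremum M of |u| on [s, t] the energy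
  inequality gives M^2 \<le> |u s|^2 + 2 C M (t - s). Since |u s| \<le> M, one factor M can be
  cancelled.\<close>

lemma norm_growth:
  assumes s: "good s" and t: "t \<in> interior I" and st: "s < t"
    and C: "0 \<le> C" "AE t in lebesgue. t \<in> I \<longrightarrow> norm (f t) \<le> C"
  shows "norm (u t) \<le> norm (u s) + 2 * C * (t - s)"
proof -
  have sub: "{s..t} \<subseteq> interior I"
    using s t interval_interior unfolding good_def is_interval_1 by (meson atLeastAtMost_iff subsetI)
  obtain M0 where "0 \<le> M0" and M0: "\<And>r. r \<in> {s..t} \<Longrightarrow> norm (u r) \<le> M0"
    by (rule bounded_interior[OF sub]) (rule that)
  define M where "M = Sup ((\<lambda>r. norm (u r)) ` {s..t})"
  have bdd: "bdd_above ((\<lambda>r. norm (u r)) ` {s..t})" using M0 by (intro bdd_aboveI2)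
  have M: "norm (u r) \<le> M" if "r \<in> {s..t}" for r
    unfolding M_def using that bdd by (rule cSUP_upper)
  have M_pos: "0 \<le> M" using M[of s] st norm_ge_zero[of "u s"] by (simp del: norm_ge_zero)
  define X where "X = (norm (u s))\<^sup>2 + 2 * C * M * (t - s)"
  have X: "(norm (u r))\<^sup>2 \<le> X" if r: "r \<in> {s..t}" for r
  proof (cases "s < r")
    case True
    have rI: "r \<in> interior I" using sub r by blast
    have sr: "{s..r} \<subseteq> I" using sub r interior_subset by fastforce
    have "1/2 * (norm (u r))\<^sup>2 + \<nu> * (LINT q : {s..r} | lebesgue. (norm_V S (u q))\<^sup>2)
       \<le> 1/2 * (norm (u s))\<^sup>2 + (LINT q : {s..r} | lebesgue. f q \<bullet> u q)"
      using s True rI by (simp add: good_def energy_inequality_def)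
    moreover have "0 \<le> \<nu> * (LINT q : {s..r} | lebesgue. (norm_V S (u q))\<^sup>2)"
      unfolding set_lebesgue_integral_def using nu
      by (intro mult_nonneg_nonneg Bochner_Integration.integral_nonneg) auto
    moreover have "(LINT q : {s..r} | lebesgue. f q \<bullet> u q) \<le> C * M * (r - s)"
      using True r by (intro fu_integrable(2)[OF sr C]) (auto intro: M)
    moreover have "C * M * (r - s) \<le> C * M * (t - s)"
      using r C(1) M_pos by (intro mult_left_mono) auto
    ultimately show ?thesis by (simp add: X_def)
  next
    case False
    then have "r = s" using r by simp
    then show ?thesis using st C(1) M_pos by (simp add: X_def)
  qed
  have "norm (u r) \<le> sqrt X" if "r \<in> {s..t}" for r
    using X[OF that] by (rule real_le_rsqrt)
  then have "M \<le> sqrt X" unfolding M_def using st by (intro cSUP_least) auto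
  then have "M\<^sup>2 \<le> (sqrt X)\<^sup>2" using M_pos by (intro power_mono)
  also have "(sqrt X)\<^sup>2 = X" using C(1) M_pos st by (simp add: X_def)
  finally have q: "M\<^sup>2 \<le> (norm (u s))\<^sup>2 + 2 * C * M * (t - s)" by (simp add: X_def)
  have "M \<le> norm (u s) + 2 * C * (t - s)"
  proof (rule ccontr)
    assume n: "\<not> ?thesis"
    have sM: "norm (u s) \<le> M" using M[of s] st by simp
    have c: "0 \<le> 2 * C * (t - s)" using C(1) st by simp
    then have "0 < M" using n norm_ge_zero[of "u s"] by linarith
    then have "M * norm (u s) < M * (M - 2 * C * (t - s))" using n by (intro mult_strict_left_mono) auto
    moreover have "norm (u s) * norm (u s) \<le> M * norm (u s)" using sM by (intro mult_right_mono) auto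
    ultimately show False using q by (simp add: power2_eq_square algebra_simps)
  qed
  then show ?thesis using M[of t] st by simp
qed

end

text \<open>In this locale the solution property is carried from the interior to I itself, ending in
  \<open>weak_solution_closed\<close>.\<close>

locale right_continuous_solution = interior_solution +
  assumes right_cont: "\<And>t0. left_endpoint I t0 \<Longrightarrow> (u \<longlongrightarrow> u t0) (at t0 within I)"
begin

text \<open>A good time s before b starts \<open>norm_growth\<close>, which bounds u after s and
  before b; weak lower semicontinuity adds b. Up to s the bound comes from right continuity if a is
  the left end point of I; otherwise s can be taken before a.\<close>

lemma bounded_Icc:
  assumes ab: "{a..b} \<subseteq> I"
  obtains M where "0 \<le> M" "\<And>t. t \<in> {a..b} \<Longrightarrow> norm (u t) \<le> M"
proof (cases "a < b")
  case False
  then have "t = a" if "t \<in> {a..b}" for t using that by auto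
  then show ?thesis by (intro that[of "norm (u a)"]) auto
next
  case True
  have aI: "a \<in> I" and bI: "b \<in> I" using ab True by auto
  have Ioo: "{a<..<b} \<subseteq> interior I" by (rule Ioo_interior[OF aI bI])
  obtain C where C: "0 \<le> C" "AE t in lebesgue. t \<in> I \<longrightarrow> norm (f t) \<le> C" by (rule f_bound)
  obtain s M0 where s: "good s" "s < b" and M0: "0 \<le> M0" "\<And>t. t \<in> {a..b} \<Longrightarrow> t \<le> s \<Longrightarrow> norm (u t) \<le> M0"
  proof (cases "left_endpoint I a")
    case True
    have "(u \<longlongrightarrow> u a) (at a within I)" by (rule right_cont[OF True])
    then have "eventually (\<lambda>t. dist (u t) (u a) < 1) (at a within I)"
      by (rule tendstoD) simp
    then obtain d where d: "0 < d" "\<And>t. t \<in> I \<Longrightarrow> t \<noteq> a \<Longrightarrow> dist t a < d \<Longrightarrow> dist (u t) (u a) < 1"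
      unfolding eventually_at by blast
    have lt: "a < min b (a + d)" using \<open>a < b\<close> d(1) by simp
    have sub: "{a<..<min b (a + d)} \<subseteq> interior I" using Ioo by auto
    obtain s where s: "a < s" "s < min b (a + d)" "good s"
      by (rule good_between[OF lt sub]) (rule that)
    show ?thesis
    proof (rule that[of s "norm (u a) + 1"])
      fix t assume t: "t \<in> {a..b}" "t \<le> s"
      have "norm (u t - u a) \<le> 1"
      proof (cases "t = a")
        case False
        have "dist (u t) (u a) < 1"
          using t False s ab by (intro d(2)) (auto simp: dist_real_def)
        then show ?thesis by (simp add: dist_norm)
      qed simp
      then show "norm (u t) \<le> norm (u a) + 1" using norm_triangle_ineq2[of "u t" "u a"] by linarith
    qed (use s in auto)
  next
    case False
    then obtain x where x: "x \<in> I" "x < a" using aI by (auto simp: left_endpoint_def not_le)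
    have sub: "{x<..<a} \<subseteq> interior I" by (rule Ioo_interior[OF x(1) aI])
    obtain s where s: "x < s" "s < a" "good s" by (rule good_between[OF x(2) sub]) (rule that)
    \<comment> \<open>No time of [a, b] is at most s, so the bound 0 is vacuous.\<close>
    show ?thesis by (rule that[of s 0]) (use s True in auto)
  qed
  define M where "M = max M0 (norm (u s) + 2 * C * (b - s))"
  have M: "norm (u t) \<le> M" if t: "t \<in> {a..<b}" for t
  proof (cases "t \<le> s")
    case True
    then show ?thesis using M0(2)[of t] t by (simp add: M_def)
  next
    case False
    \<comment> \<open>t = a can occur only if s lies before a, and then a is strictly between two
      points of I.\<close>
    have "t \<in> interior I"
    proof (cases "t = a")
      case True
      have "s \<in> I" using s(1) interior_subset by (auto simp: good_def)
      then have "{s<..<b} \<subseteq> interior I" using bI by (rule Ioo_interior)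
      then show ?thesis using False t by auto
    next
      case False
      then show ?thesis using Ioo t by auto
    qed
    then have "norm (u t) \<le> norm (u s) + 2 * C * (t - s)"
      using False by (intro norm_growth[OF s(1) _ _ C]) auto
    also have "\<dots> \<le> norm (u s) + 2 * C * (b - s)" using t C(1) by (intro add_left_mono mult_left_mono) auto
    finally show ?thesis by (simp add: M_def)
  qed
  have "AE t in lebesgue_on {a..b}. norm (u t) \<le> M"
  proof -
    have "{b} \<in> null_sets lebesgue" using negligible_iff_null_sets negligible_sing by blast
    then have "AE t in lebesgue. t \<notin> {b}" by (rule AE_not_in)
    then have "AE t in lebesgue. t \<in> {a..b} \<longrightarrow> norm (u t) \<le> M"
      by eventually_elim (use M in auto)
    then show ?thesis by (simp add: AE_lebesgue_on_iff)
  qed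
  then have "norm (u t) \<le> M" if "t \<in> {a..b}" for t
    using that by (rule weak_norm_le_of_AE[OF cont True ab])
  then show ?thesis using M0(1) by (intro that[of M]) (auto simp: M_def)
qed

lemma bochner_H: "{a..b} \<subseteq> I \<Longrightarrow> bochner_measurable_on (space_H S) norm {a..b} u"
proof (rule bochner_glue[where z=0])
  show "0 \<in> space_H S"
  proof -
    have "class_on (flow_domain S) (\<lambda>x. 0) = 0"
      by (simp add: class_on_def abs_L2_zero)
    then show ?thesis
      unfolding space_H_def using zero_smooth_fields[of S] closure_subset by (metis image_eqI subsetD)
  qed
  fix c d assume "{a..b} \<subseteq> I" "a < c" "d < b"
  then have "{c..d} \<subseteq> interior I" by (rule Icc_interior)
  then have "u \<in> L_infinity (space_H S) norm {c..d}" using sol by (simp add: weak_solution_def loc_def)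
  then show "bochner_measurable_on (space_H S) norm {c..d} u" by (simp add: L_infinity_def)
qed

lemma L_p_interior:
  assumes "{c..d} \<subseteq> interior I"
  shows "u \<in> L_p 2 (space_V S) (norm_V S) {c..d}"
  using sol assms by (simp add: weak_solution_def loc_def)

lemma bochner_V: "{a..b} \<subseteq> I \<Longrightarrow> bochner_measurable_on (space_V S) (norm_V S) {a..b} u"
proof (rule bochner_glue[OF zero_space_V[OF S]])
  fix c d assume "{a..b} \<subseteq> I" "a < c" "d < b"
  then have "{c..d} \<subseteq> interior I" by (rule Icc_interior)
  from L_p_interior[OF this] show "bochner_measurable_on (space_V S) (norm_V S) {c..d} u"
    by (simp add: L_p_def)
qed

lemma AE_in_V: "{a..b} \<subseteq> I \<Longrightarrow> AE t in lebesgue. t \<in> {a..b} \<longrightarrow> u t \<in> space_V S"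
  using bochner_V[of a b] by (simp add: bochner_measurable_on_def AE_lebesgue_on_iff)

lemma norm_V_tendsto:
  assumes "\<And>n. s n \<in> space_V S" "y \<in> space_V S" "(\<lambda>n. norm_V S (s n - y)) \<longlonglongrightarrow> 0"
  shows "(\<lambda>n. norm_V S (s n)) \<longlonglongrightarrow> norm_V S y"
proof -
  have "(\<lambda>n. norm_V S (s n) - norm_V S y) \<longlonglongrightarrow> 0"
    by (rule Lim_null_comparison[OF _ assms(3)])
      (use abs_norm_V_diff_le[OF S assms(1,2)] in \<open>auto intro!: always_eventually\<close>)
  then show ?thesis by (rule LIM_zero_cancel)
qed

lemma norm_V_measurable:
  assumes "{a..b} \<subseteq> I"
  shows "(\<lambda>t. indicator {a..b} t * (norm_V S (u t))\<^sup>2) \<in> borel_measurable lebesgue"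
  by (rule bochner_measurable_compose[where \<Phi>="\<lambda>t y. (norm_V S y)\<^sup>2", OF bochner_V[OF assms]])
    (auto intro!: tendsto_power norm_V_tendsto borel_measurable_times borel_measurable_indicator)

lemma norm_V_integrable_interior:
  assumes cd: "{c..d} \<subseteq> interior I"
  shows "set_integrable lebesgue {c..d} (\<lambda>t. (norm_V S (u t))\<^sup>2)"
  unfolding set_integrable_def
proof (rule integrableI_bounded)
  have "{c..d} \<subseteq> I" using cd interior_subset by blast
  then show "(\<lambda>t. indicator {c..d} t *\<^sub>R (norm_V S (u t))\<^sup>2) \<in> borel_measurable lebesgue"
    using norm_V_measurable by simp
  have "(\<integral>\<^sup>+t. ennreal (norm (indicator {c..d} t *\<^sub>R (norm_V S (u t))\<^sup>2)) \<partial>lebesgue)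
      = (\<integral>\<^sup>+t. ennreal (norm_V S (u t) powr 2) * indicator {c..d} t \<partial>lebesgue)"
    by (intro nn_integral_cong) (auto simp: indicator_def powr_numeral)
  also have "\<dots> = (\<integral>\<^sup>+t. ennreal (norm_V S (u t) powr 2) \<partial>lebesgue_on {c..d})"
    by (subst nn_integral_restrict_space) auto
  also have "\<dots> < \<infinity>" using L_p_interior[OF cd] by (simp add: L_p_def)
  finally show "(\<integral>\<^sup>+t. ennreal (norm (indicator {c..d} t *\<^sub>R (norm_V S (u t))\<^sup>2)) \<partial>lebesgue) < \<infinity>" .
qed

text \<open>The energy inequality bounds the integral over every [c, d] inside the open interval by
  one number B; Fatou's lemma along an exhaustion extends the bound to [a, b].\<close>

lemma norm_V_integrable:
  assumes ab: "{a..b} \<subseteq> I"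
  shows "set_integrable lebesgue {a..b} (\<lambda>t. (norm_V S (u t))\<^sup>2)"
proof (cases "a < b")
  case False
  then have "b \<le> a" by simp
  then have "AE t in lebesgue_on {a..b}. (norm_V S (u t))\<^sup>2 = 0"
    by (rule null_sets_Icc_degenerate)
  then have "AE t in lebesgue. t \<in> {a..b} \<longrightarrow> (norm_V S (u t))\<^sup>2 = 0"
    by (subst (asm) AE_lebesgue_on_iff) auto
  then have "AE t in lebesgue. 0 = indicator {a..b} t *\<^sub>R (norm_V S (u t))\<^sup>2"
    by eventually_elim (auto simp: indicator_def)
  moreover have "(\<lambda>t. indicator {a..b} t *\<^sub>R (norm_V S (u t))\<^sup>2) \<in> borel_measurable lebesgue"
    using norm_V_measurable[OF ab] by simp
  ultimately show ?thesis
    unfolding set_integrable_def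
    by (intro integrable_cong_AE_imp[OF integrable_zero])
next
  case True
  obtain C where C: "0 \<le> C" "AE t in lebesgue. t \<in> I \<longrightarrow> norm (f t) \<le> C" by (rule f_bound)
  obtain M where M: "0 \<le> M" "\<And>t. t \<in> {a..b} \<Longrightarrow> norm (u t) \<le> M"
    by (rule bounded_Icc[OF ab]) (rule that)
  \<comment> \<open>From the energy inequality started at a good time: the initial energy is at most
    M^2 / 2, the work of f at most C M (b - a), and \<nu> is divided out.\<close>
  define B where "B = (M\<^sup>2 / 2 + C * M * (b - a)) / \<nu>"
  have bound: "(LINT t:{c..d}|lebesgue. (norm_V S (u t))\<^sup>2) \<le> B" if cd: "a < c" "c \<le> d" "d < b" for c d
  proof -
    have aI: "a \<in> I" "b \<in> I" using ab True by auto
    have sub: "{a<..<c} \<subseteq> interior I" using Ioo_interior[OF aI] cd by auto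
    obtain s where s: "a < s" "s < c" "good s" by (rule good_between[OF cd(1) sub]) (rule that)
    have sd: "{s..d} \<subseteq> interior I" using s cd by (intro Icc_interior[OF ab])
    then have d: "d \<in> interior I" using s cd by auto
    have sdI: "{s..d} \<subseteq> I" using sd interior_subset by blast
    have "energy_inequality \<nu> S f u s d" using s cd d by (auto simp: good_def)
    then have "\<nu> * (LINT t:{s..d}|lebesgue. (norm_V S (u t))\<^sup>2)
        \<le> 1/2 * (norm (u s))\<^sup>2 + (LINT t:{s..d}|lebesgue. f t \<bullet> u t)"
      unfolding energy_inequality_def using zero_le_power2[of "norm (u d)"] by linarith
    also have "\<dots> \<le> 1/2 * M\<^sup>2 + C * M * (d - s)"
      using s cd M by (intro add_mono mult_left_mono power_mono fu_integrable(2)[OF sdI C]) auto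
    also have "\<dots> \<le> M\<^sup>2 / 2 + C * M * (b - a)"
      using s cd C(1) M(1) by (simp add: mult_left_mono)
    finally have "(LINT t:{s..d}|lebesgue. (norm_V S (u t))\<^sup>2) \<le> B"
      using nu by (simp add: B_def pos_le_divide_eq mult.commute)
    moreover have "(LINT t:{c..d}|lebesgue. (norm_V S (u t))\<^sup>2) \<le> (LINT t:{s..d}|lebesgue. (norm_V S (u t))\<^sup>2)"
    proof -
      have cdI: "{c..d} \<subseteq> interior I" using sd s by auto
      show ?thesis
        unfolding set_lebesgue_integral_def
        using norm_V_integrable_interior[OF cdI] norm_V_integrable_interior[OF sd] s
        by (intro integral_mono) (auto simp: set_integrable_def indicator_def)
    qed
    ultimately show ?thesis by linarith
  qed
  let ?h = "\<lambda>t. ennreal ((norm_V S (u t))\<^sup>2)"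
  define e where "e n = (b - a) / real (n + 3)" for n
  have e: "0 < e n" "e n \<le> (b - a) / 3" for n
    using True divide_left_mono[of 3 "real (n + 3)" "b - a"] by (simp_all add: e_def)
  have e0: "e \<longlonglongrightarrow> 0" unfolding e_def by (rule LIMSEQ_ignore_initial_segment[OF lim_const_over_n])
  define D where "D n = {a + e n..b - e n}" for n
  have DI: "D n \<subseteq> interior I" for n
    unfolding D_def using e(1)[of n] by (intro Icc_interior[OF ab]) auto
  have Dh: "(\<integral>\<^sup>+t. ennreal (indicator (D n) t * (norm_V S (u t))\<^sup>2) \<partial>lebesgue) \<le> ennreal B" for n
  proof -
    have "set_integrable lebesgue (D n) (\<lambda>t. (norm_V S (u t))\<^sup>2)"
      using DI[of n] unfolding D_def by (rule norm_V_integrable_interior)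
    then have "(\<integral>\<^sup>+t. ennreal (indicator (D n) t * (norm_V S (u t))\<^sup>2) \<partial>lebesgue)
        = ennreal (LINT t:D n|lebesgue. (norm_V S (u t))\<^sup>2)"
      unfolding set_integrable_def set_lebesgue_integral_def
      by (subst nn_integral_eq_integral) auto
    also have "\<dots> \<le> ennreal B"
      unfolding D_def using e[of n] True by (intro ennreal_leI bound) (auto simp: field_simps)
    finally show ?thesis .
  qed
  have m: "(\<lambda>t. indicator {a..b} t * (norm_V S (u t))\<^sup>2) \<in> borel_measurable lebesgue" by (rule norm_V_measurable[OF ab])
  have mD: "(\<lambda>t. indicator (D n) t * (norm_V S (u t))\<^sup>2) \<in> borel_measurable lebesgue" for n
    unfolding D_def by (rule norm_V_measurable) (use DI[of n] interior_subset in \<open>auto simp: D_def\<close>)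
  have "AE t in lebesgue. ennreal (indicator {a..b} t * (norm_V S (u t))\<^sup>2) = liminf (\<lambda>n. ennreal (indicator (D n) t * (norm_V S (u t))\<^sup>2))"
  proof -
    have "{a, b} \<in> null_sets lebesgue" using negligible_finite[of "{a, b}"] negligible_iff_null_sets by blast
    then have "AE t in lebesgue. t \<notin> {a, b}" by (rule AE_not_in)
    then show ?thesis
    proof eventually_elim
      case (elim t)
      have "eventually (\<lambda>n. indicator {a..b} t * (norm_V S (u t))\<^sup>2 = indicator (D n) t * (norm_V S (u t))\<^sup>2) sequentially"
      proof (cases "t \<in> {a..b}")
        case True
        then have "0 < min (t - a) (b - t)" using elim by auto
        from order_tendstoD(2)[OF e0 this] show ?thesis
          by eventually_elim (use True in \<open>auto simp: D_def\<close>)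
      next
        case False
        then have "t \<notin> D n" for n using e(1)[of n] by (auto simp: D_def)
        then show ?thesis using False by simp
      qed
      then have "(\<lambda>n. indicator (D n) t * (norm_V S (u t))\<^sup>2) \<longlonglongrightarrow> indicator {a..b} t * (norm_V S (u t))\<^sup>2"
        by (rule Lim_transform_eventually[OF tendsto_const])
      then have "(\<lambda>n. ennreal (indicator (D n) t * (norm_V S (u t))\<^sup>2)) \<longlonglongrightarrow> ennreal (indicator {a..b} t * (norm_V S (u t))\<^sup>2)"
        by (rule tendsto_ennrealI)
      then show ?case by (rule lim_imp_Liminf[symmetric, rotated]) simp
    qed
  qed
  then have "(\<integral>\<^sup>+t. ennreal (indicator {a..b} t * (norm_V S (u t))\<^sup>2) \<partial>lebesgue)
      = (\<integral>\<^sup>+t. liminf (\<lambda>n. ennreal (indicator (D n) t * (norm_V S (u t))\<^sup>2)) \<partial>lebesgue)"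
    by (rule nn_integral_cong_AE)
  also have "\<dots> \<le> liminf (\<lambda>n. \<integral>\<^sup>+t. ennreal (indicator (D n) t * (norm_V S (u t))\<^sup>2) \<partial>lebesgue)"
    by (intro nn_integral_liminf measurable_compose[OF mD measurable_ennreal])
  also have "\<dots> \<le> liminf (\<lambda>n. ennreal B)"
    by (intro Liminf_mono always_eventually allI Dh)
  also have "\<dots> = ennreal B" by (simp add: Liminf_const)
  also have "\<dots> < \<infinity>" by simp
  finally show ?thesis
    unfolding set_integrable_def using m by (intro integrableI_bounded) auto
qed

lemma in_L_infinity:
  assumes ab: "{a..b} \<subseteq> I"
  shows "u \<in> L_infinity (space_H S) norm {a..b}"
proof -
  obtain M where M: "0 \<le> M" "\<And>t. t \<in> {a..b} \<Longrightarrow> norm (u t) \<le> M"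
    by (rule bounded_Icc[OF ab]) (rule that)
  then have "AE t in lebesgue_on {a..b}. norm (u t) \<le> M"
    by (simp add: AE_lebesgue_on_iff)
  then show ?thesis using bochner_H[OF ab] unfolding L_infinity_def by blast
qed

lemma in_L_2:
  assumes ab: "{a..b} \<subseteq> I"
  shows "u \<in> L_p 2 (space_V S) (norm_V S) {a..b}"
proof -
  have "(\<integral>\<^sup>+t. ennreal (norm_V S (u t) powr 2) \<partial>lebesgue_on {a..b})
      = (\<integral>\<^sup>+t. ennreal (norm_V S (u t) powr 2) * indicator {a..b} t \<partial>lebesgue)"
    by (subst nn_integral_restrict_space) auto
  also have "\<dots> = (\<integral>\<^sup>+t. ennreal (norm (indicator {a..b} t *\<^sub>R (norm_V S (u t))\<^sup>2)) \<partial>lebesgue)"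
    by (intro nn_integral_cong) (auto simp: indicator_def powr_numeral)
  also have "\<dots> < \<infinity>"
    using norm_V_integrable[OF ab] by (auto simp: set_integrable_def integrable_iff_bounded)
  finally show ?thesis using bochner_V[OF ab] by (simp add: L_p_def)
qed

text \<open>The inequality is taken at times r n approaching t from the left. There |u (r n)|^2 / 2
  is replaced by the smaller expression u (r n) \<bullet> u t - |u t|^2 / 2, which converges to |u
  t|^2 / 2 by weak continuity, while the integrals converge by integrability up to t.\<close>

lemma energy_right_endpoint:
  assumes s: "good s" and t: "t \<in> I" and st: "s < t"
  shows "energy_inequality \<nu> S f u s t"
proof -
  have sI: "s \<in> I" using s interior_subset by (auto simp: good_def)
  have stI: "{s..t} \<subseteq> I" using I sI t unfolding is_interval_1 by (meson atLeastAtMost_iff subsetI)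
  have Ioo: "{s<..<t} \<subseteq> interior I" by (rule Ioo_interior[OF sI t])
  \<comment> \<open>The offset n + 2 keeps every r n strictly above s.\<close>
  define r where "r n = t - (t - s) / real (n + 2)" for n
  have r: "s < r n" "r n < t" for n
  proof -
    have "(t - s) / real (n + 2) < t - s"
      using st by (simp add: pos_divide_less_eq)
    then show "s < r n" "r n < t" using st by (simp_all add: r_def)
  qed
  have rt: "r \<longlonglongrightarrow> t"
  proof -
    have "r \<longlonglongrightarrow> t - 0" unfolding r_def
      by (intro tendsto_diff tendsto_const LIMSEQ_ignore_initial_segment[OF lim_const_over_n])
    then show ?thesis by simp
  qed
  have uH: "u t \<in> space_H S" by (rule weak_continuous_in_H[OF cont t])
  have w: "(\<lambda>n. u (r n) \<bullet> u t) \<longlonglongrightarrow> u t \<bullet> u t"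
  proof -
    have "((\<lambda>s. u s \<bullet> u t) \<longlongrightarrow> u t \<bullet> u t) (at t within I)"
      using weak_continuous_inner[OF cont uH] t by (simp add: continuous_on_def)
    moreover have "filterlim r (at t within I) sequentially"
    proof -
      have "r n \<in> I \<and> r n \<noteq> t" for n using r[of n] stI by auto
      then show ?thesis using rt unfolding filterlim_at by (auto intro!: always_eventually)
    qed
    ultimately show ?thesis by (rule filterlim_compose)
  qed
  obtain C where C: "0 \<le> C" "AE t in lebesgue. t \<in> I \<longrightarrow> norm (f t) \<le> C" by (rule f_bound)
  obtain M where M: "0 \<le> M" "\<And>q. q \<in> {s..t} \<Longrightarrow> norm (u q) \<le> M"
    by (rule bounded_Icc[OF stI]) (rule that)
  let ?A = "\<lambda>q. LINT p:{s..q}|lebesgue. (norm_V S (u p))\<^sup>2" and ?F = "\<lambda>q. LINT p:{s..q}|lebesgue. f p \<bullet> u p"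
  have A: "(\<lambda>n. ?A (r n)) \<longlonglongrightarrow> ?A t" by (rule tendsto_set_integral_Icc[OF norm_V_integrable[OF stI] rt r(2)])
  have F: "(\<lambda>n. ?F (r n)) \<longlonglongrightarrow> ?F t" by (rule tendsto_set_integral_Icc[OF fu_integrable(1)[OF stI C M(2)] rt r(2)])
  have le: "u (r n) \<bullet> u t - 1/2 * (norm (u t))\<^sup>2 + \<nu> * ?A (r n) \<le> 1/2 * (norm (u s))\<^sup>2 + ?F (r n)" for n
  proof -
    have "r n \<in> interior I" using Ioo r[of n] by auto
    then have "1/2 * (norm (u (r n)))\<^sup>2 + \<nu> * ?A (r n) \<le> 1/2 * (norm (u s))\<^sup>2 + ?F (r n)"
      using s r(1)[of n] by (simp add: good_def energy_inequality_def)
    moreover have "u (r n) \<bullet> u t \<le> norm (u (r n)) * norm (u t)" by (rule norm_cauchy_schwarz)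
    moreover have "2 * norm (u (r n)) * norm (u t) \<le> (norm (u (r n)))\<^sup>2 + (norm (u t))\<^sup>2" by (rule sum_squares_bound)
    ultimately show ?thesis by (simp add: mult.assoc)
  qed
  have "u t \<bullet> u t - 1/2 * (norm (u t))\<^sup>2 + \<nu> * ?A t \<le> 1/2 * (norm (u s))\<^sup>2 + ?F t"
    by (rule LIMSEQ_le[where X="\<lambda>n. u (r n) \<bullet> u t - 1/2 * (norm (u t))\<^sup>2 + \<nu> * ?A (r n)"
          and Y="\<lambda>n. 1/2 * (norm (u s))\<^sup>2 + ?F (r n)"])
      (use le in \<open>auto intro!: tendsto_intros w A F\<close>)
  then show ?thesis by (simp add: energy_inequality_def power2_norm_eq_inner)
qed

text \<open>The end points of I form a null set, so almost every time of I is good.\<close>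

lemma AE_energy: "AE s in lebesgue_on I. \<forall>t\<in>I. s < t \<longrightarrow> energy_inequality \<nu> S f u s t"
proof -
  have "negligible (frontier I)"
    by (rule negligible_convex_frontier) (use I is_interval_convex_1 in blast)
  then have "AE s in lebesgue. s \<notin> frontier I" by (simp add: negligible_iff_null_sets AE_not_in)
  moreover have "AE s in lebesgue. s \<in> interior I \<longrightarrow> good s"
    using AE_good by (simp add: AE_lebesgue_on_iff[OF I_lebesgue(2)])
  ultimately have "AE s in lebesgue. s \<in> I \<longrightarrow> (\<forall>t\<in>I. s < t \<longrightarrow> energy_inequality \<nu> S f u s t)"
  proof eventually_elim
    case (elim s)
    show ?case
    proof (intro impI ballI)
      fix t assume "s \<in> I" "t \<in> I" "s < t"
      then have "s \<in> interior I" using elim closure_subset by (auto simp: frontier_def)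
      then show "energy_inequality \<nu> S f u s t"
        using elim \<open>t \<in> I\<close> \<open>s < t\<close> by (blast intro: energy_right_endpoint)
    qed
  qed
  then show ?thesis by (simp add: AE_lebesgue_on_iff[OF I_lebesgue(1)])
qed

end

text \<open>Each of 1, x and x^(3/2) is at most X = (1 + x^2)^(3/4), whose power 4/3 is 1 + x^2.
  Here x stands for \<open>norm_V\<close>: 4/3 is the exponent that turns x^(3/2) into x^2.\<close>

lemma growth_powr_bound:
  fixes \<alpha> \<beta> \<gamma> x :: real
  assumes "0 \<le> \<alpha>" "0 \<le> \<beta>" "0 \<le> \<gamma>" "0 \<le> x"
  shows "(\<alpha> + \<beta> * x + \<gamma> * (sqrt x * x)) powr (4/3) \<le> (\<alpha> + \<beta> + \<gamma>) powr (4/3) * (1 + x\<^sup>2)"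
proof -
  define X where "X = (1 + x\<^sup>2) powr (3/4)"
  have ge: "1 \<le> 1 + x\<^sup>2" by simp
  have X1: "1 \<le> X" unfolding X_def using ge by (intro ge_one_powr_ge_zero) auto
  have "x = sqrt (x\<^sup>2)" using assms by simp
  also have "\<dots> \<le> sqrt (1 + x\<^sup>2)" by (intro real_sqrt_le_mono) simp
  also have "\<dots> = (1 + x\<^sup>2) powr (1/2)" using ge by (simp add: powr_half_sqrt)
  also have "\<dots> \<le> X" unfolding X_def using ge by (intro powr_mono) auto
  finally have X2: "x \<le> X" .
  have X3: "sqrt x * x \<le> X"
  proof (cases "x = 0")
    case True
    then show ?thesis using X1 by simp
  next
    case False
    then have pos: "0 < x" using assms by simp
    have "sqrt x * x = x powr (1/2) * x powr 1" using pos by (simp add: powr_half_sqrt)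
    also have "\<dots> = x powr (2 * (3/4))" by (subst powr_add[symmetric]) simp
    also have "\<dots> = (x powr 2) powr (3/4)" by (simp only: powr_powr)
    also have "\<dots> = (x\<^sup>2) powr (3/4)" using pos by (simp add: powr_numeral)
    also have "\<dots> \<le> X" unfolding X_def by (intro powr_mono2) auto
    finally show ?thesis .
  qed
  have "\<alpha> + \<beta> * x + \<gamma> * (sqrt x * x) \<le> \<alpha> * X + \<beta> * X + \<gamma> * X"
    using assms X1 X2 X3 mult_left_mono[OF X1 assms(1)] by (intro add_mono mult_left_mono) auto
  then have "(\<alpha> + \<beta> * x + \<gamma> * (sqrt x * x)) powr (4/3) \<le> ((\<alpha> + \<beta> + \<gamma>) * X) powr (4/3)"
    using assms by (intro powr_mono2) (auto simp: distrib_right)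
  also have "\<dots> = (\<alpha> + \<beta> + \<gamma>) powr (4/3) * X powr (4/3)"
    using assms X1 by (intro powr_mult)
  also have "X powr (4/3) = 1 + x\<^sup>2"
    unfolding X_def using ge by (simp add: powr_powr)
  finally show ?thesis .
qed

context right_continuous_solution
begin

text \<open>The residual depends continuously on f in H and on u in V, so simple approximations of f
  and u yield simple approximations of the residual. By the growth bound, the power 4/3 of its dual
  norm is at most a multiple of 1 + \<parallel>u\<parallel>^2, which is integrable up to the end
  points.\<close>

lemma residual_in_L_p:
  assumes ab: "{a..b} \<subseteq> I"
  shows "(\<lambda>t. residual_functional \<nu> S (f t) (u t)) \<in> L_p (4/3) (dual_V S) (norm_dual S) {a..b}"
proof -
  let ?G = "\<lambda>t. residual_functional \<nu> S (f t) (u t)"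
  obtain C K where CK: "0 \<le> C" "0 \<le> K"
    and R1: "\<And>f u. u \<in> space_V S \<Longrightarrow> residual_functional \<nu> S f u \<in> dual_V S"
    and R2: "\<And>f u. u \<in> space_V S \<Longrightarrow> norm_dual S (residual_functional \<nu> S f u)
      \<le> C * norm f + \<nu> * norm_V S u + K * sqrt (norm u * norm_V S u) * norm_V S u"
    and R3: "\<And>f u. u \<in> space_V S \<Longrightarrow> 0 \<le> norm_dual S (residual_functional \<nu> S f u)"
    and R4: "\<And>f f' u u'. u \<in> space_V S \<Longrightarrow> u' \<in> space_V S \<Longrightarrow>
      0 \<le> norm_dual S (residual_functional \<nu> S f' u' - residual_functional \<nu> S f u) \<and>
      norm_dual S (residual_functional \<nu> S f' u' - residual_functional \<nu> S f u)
        \<le> C * norm (f' - f) + \<nu> * norm_V S (u' - u) + K * sqrt C * norm_V S (u' - u) * (norm_V S u' + norm_V S u)"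
    by (rule residual_functional_estimates[OF S nu]) (rule that)
  have sets: "{a..b} \<in> sets lebesgue" by simp
  have inV: "AE t in lebesgue_on {a..b}. u t \<in> space_V S" using bochner_V[OF ab] by (simp add: bochner_measurable_on_def)
  obtain sf where sf: "\<And>n. simple_function (lebesgue_on {a..b}) (sf n)"
    "AE t in lebesgue_on {a..b}. (\<lambda>n. norm (sf n t - f t)) \<longlonglongrightarrow> 0"
    using bochner_f[OF ab sets] unfolding bochner_measurable_on_def by blast
  obtain su where su: "\<And>n. simple_function (lebesgue_on {a..b}) (su n)" "\<And>n. su n ` {a..b} \<subseteq> space_V S"
    "AE t in lebesgue_on {a..b}. (\<lambda>n. norm_V S (su n t - u t)) \<longlonglongrightarrow> 0"
    using bochner_V[OF ab] unfolding bochner_measurable_on_def by blast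
  have "bochner_measurable_on (dual_V S) (norm_dual S) {a..b} ?G"
    unfolding bochner_measurable_on_def
  proof (intro conjI exI allI)
    show "AE t in lebesgue_on {a..b}. ?G t \<in> dual_V S"
      using inV by eventually_elim (rule R1)
    show "simple_function (lebesgue_on {a..b}) (\<lambda>t. residual_functional \<nu> S (sf n t) (su n t))" for n
      by (rule simple_function_compose2[OF sf(1) su(1)])
    show "(\<lambda>t. residual_functional \<nu> S (sf n t) (su n t)) ` {a..b} \<subseteq> dual_V S" for n
      using su(2)[of n] R1 by blast
    have ae: "AE t in lebesgue_on {a..b}. t \<in> {a..b}"
      using AE_space[of "lebesgue_on {a..b}"] by (simp add: space_restrict_space)
    show "AE t in lebesgue_on {a..b}. (\<lambda>n. norm_dual S (residual_functional \<nu> S (sf n t) (su n t) - ?G t)) \<longlonglongrightarrow> 0"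
      using ae inV sf(2) su(3)
    proof eventually_elim
      case (elim t)
      have sV: "su n t \<in> space_V S" for n using su(2)[of n] elim(1) by blast
      have nt: "(\<lambda>n. norm_V S (su n t)) \<longlonglongrightarrow> norm_V S (u t)" by (rule norm_V_tendsto[OF sV elim(2,4)])
      have lim: "(\<lambda>n. C * norm (sf n t - f t) + \<nu> * norm_V S (su n t - u t)
          + K * sqrt C * norm_V S (su n t - u t) * (norm_V S (su n t) + norm_V S (u t)))
          \<longlonglongrightarrow> C * 0 + \<nu> * 0 + K * sqrt C * 0 * (norm_V S (u t) + norm_V S (u t))"
        by (intro tendsto_intros elim nt)
      show ?case
        by (rule Lim_null_comparison[OF always_eventually])
          (use R4[OF elim(2) sV] lim in auto)
    qed
  qed
  moreover have "(\<integral>\<^sup>+t. ennreal (norm_dual S (?G t) powr (4/3)) \<partial>lebesgue_on {a..b}) < \<infinity>"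
  proof -
    obtain Cf where Cf: "0 \<le> Cf" "AE t in lebesgue. t \<in> I \<longrightarrow> norm (f t) \<le> Cf" by (rule f_bound)
    obtain M where M: "0 \<le> M" "\<And>t. t \<in> {a..b} \<Longrightarrow> norm (u t) \<le> M"
      by (rule bounded_Icc[OF ab]) (rule that)
    \<comment> \<open>The power 4/3 of the sum of the three coefficients in
      \<open>growth_powr_bound\<close>, after inserting |f| \<le> Cf and |u| \<le> M.\<close>
    define \<kappa> where "\<kappa> = (C * Cf + \<nu> + K * sqrt M) powr (4/3)"
    have le: "norm_dual S (?G t) powr (4/3) \<le> \<kappa> * (1 + (norm_V S (u t))\<^sup>2)"
      if t: "t \<in> {a..b}" "u t \<in> space_V S" "norm (f t) \<le> Cf" for t
    proof -
      have "norm_dual S (?G t) \<le> C * norm (f t) + \<nu> * norm_V S (u t) + K * sqrt (norm (u t) * norm_V S (u t)) * norm_V S (u t)"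
        by (rule R2[OF t(2)])
      also have "\<dots> \<le> C * Cf + \<nu> * norm_V S (u t) + K * sqrt (M * norm_V S (u t)) * norm_V S (u t)"
        using CK t(3) M(2)[OF t(1)]
        by (intro add_mono mult_left_mono mult_right_mono real_sqrt_le_mono order_refl) auto
      also have "\<dots> = C * Cf + \<nu> * norm_V S (u t) + (K * sqrt M) * (sqrt (norm_V S (u t)) * norm_V S (u t))"
        by (simp add: real_sqrt_mult)
      finally have "norm_dual S (?G t) powr (4/3)
          \<le> (C * Cf + \<nu> * norm_V S (u t) + (K * sqrt M) * (sqrt (norm_V S (u t)) * norm_V S (u t))) powr (4/3)"
        using R3[OF t(2)] by (intro powr_mono2) auto
      also have "\<dots> \<le> \<kappa> * (1 + (norm_V S (u t))\<^sup>2)"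
        unfolding \<kappa>_def using CK Cf(1) nu M(1) by (intro growth_powr_bound mult_nonneg_nonneg) auto
      finally show ?thesis .
    qed
    have i: "integrable lebesgue (\<lambda>t. \<kappa> * (indicator {a..b} t + indicator {a..b} t *\<^sub>R (norm_V S (u t))\<^sup>2))"
      using norm_V_integrable[OF ab] unfolding set_integrable_def
      by (intro integrable_mult_right Bochner_Integration.integrable_add integrable_real_indicator)
        (auto simp: emeasure_lborel_Icc_eq)
    have "(\<integral>\<^sup>+t. ennreal (norm_dual S (?G t) powr (4/3)) \<partial>lebesgue_on {a..b})
        = (\<integral>\<^sup>+t. ennreal (norm_dual S (?G t) powr (4/3)) * indicator {a..b} t \<partial>lebesgue)"
      by (subst nn_integral_restrict_space) auto
    also have "\<dots> \<le> (\<integral>\<^sup>+t. ennreal (norm (\<kappa> * (indicator {a..b} t + indicator {a..b} t *\<^sub>R (norm_V S (u t))\<^sup>2))) \<partial>lebesgue)"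
    proof (rule nn_integral_mono_AE)
      show "AE t in lebesgue. ennreal (norm_dual S (?G t) powr (4/3)) * indicator {a..b} t
        \<le> ennreal (norm (\<kappa> * (indicator {a..b} t + indicator {a..b} t *\<^sub>R (norm_V S (u t))\<^sup>2)))"
        using AE_in_V[OF ab] Cf(2)
      proof eventually_elim
        case (elim t)
        show ?case
        proof (cases "t \<in> {a..b}")
          case True
          then have "norm_dual S (?G t) powr (4/3) \<le> \<kappa> * (1 + (norm_V S (u t))\<^sup>2)"
            using elim ab by (intro le) auto
          then show ?thesis using True by (auto intro!: ennreal_leI)
        qed simp
      qed
    qed
    also have "\<dots> < \<infinity>" using i unfolding integrable_iff_bounded by (rule conjunct2)
    finally show ?thesis .
  qed
  ultimately show ?thesis by (simp add: L_p_def)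
qed

lemma set_integrable_quadratic_bound:
  assumes ab: "{a..b} \<subseteq> I"
    and m: "(\<lambda>t. indicator {a..b} t * h t) \<in> borel_measurable lebesgue"
    and B: "AE t in lebesgue. t \<in> {a..b} \<longrightarrow> \<bar>h t\<bar> \<le> B * (1 + (norm_V S (u t))\<^sup>2)"
  shows "set_integrable lebesgue {a..b} h"
  unfolding set_integrable_def
proof (rule Bochner_Integration.integrable_bound)
  show "integrable lebesgue (\<lambda>t. B * (indicator {a..b} t + indicator {a..b} t *\<^sub>R (norm_V S (u t))\<^sup>2))"
    using norm_V_integrable[OF ab] unfolding set_integrable_def
    by (intro integrable_mult_right Bochner_Integration.integrable_add integrable_real_indicator)
      (auto simp: emeasure_lborel_Icc_eq)
  show "(\<lambda>t. indicator {a..b} t *\<^sub>R h t) \<in> borel_measurable lebesgue" using m by simp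
  show "AE t in lebesgue. norm (indicator {a..b} t *\<^sub>R h t)
      \<le> norm (B * (indicator {a..b} t + indicator {a..b} t *\<^sub>R (norm_V S (u t))\<^sup>2))"
    using B
  proof eventually_elim
    case (elim t)
    show ?case
    proof (cases "t \<in> {a..b}")
      case True
      then have "\<bar>h t\<bar> \<le> \<bar>B * (1 + (norm_V S (u t))\<^sup>2)\<bar>" using elim by linarith
      then show ?thesis using True by simp
    qed simp
  qed
qed

text \<open>The interval spanned by the least and the greatest point of the support lies in I by
  convexity, and the test function is bounded.\<close>

lemma set_integrable_test_function:
  fixes h \<phi> :: "real \<Rightarrow> real"
  assumes h: "\<And>a b. {a..b} \<subseteq> I \<Longrightarrow> set_integrable lebesgue {a..b} h"
    and \<phi>: "\<phi> \<in> test_functions (interior I)"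
  shows "integrable lebesgue (\<lambda>t. indicator (interior I) t * (\<phi> t * h t))"
proof -
  define K where "K = closure {t. \<phi> t \<noteq> 0}"
  have K: "compact K" "K \<subseteq> interior I" and c: "continuous_on UNIV \<phi>"
    using \<phi> by (auto simp: test_functions_def K_def intro: smooth_continuous)
  have z: "\<phi> t = 0" if "t \<notin> K" for t
    using that closure_subset[of "{t. \<phi> t \<noteq> 0}"] by (auto simp: K_def)
  show ?thesis
  proof (cases "K = {}")
    case True
    then show ?thesis using z by simp
  next
    case False
    obtain a where a: "a \<in> K" "\<And>t. t \<in> K \<Longrightarrow> a \<le> t" using compact_attains_inf[OF K(1) False] by blast
    obtain b where b: "b \<in> K" "\<And>t. t \<in> K \<Longrightarrow> t \<le> b" using compact_attains_sup[OF K(1) False] by blast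
    have "a \<in> I" "b \<in> I" using a(1) b(1) K(2) interior_subset by blast+
    then have ab: "{a..b} \<subseteq> I" using I unfolding is_interval_1 by (meson atLeastAtMost_iff subsetI)
    have "compact (\<phi> ` K)" using c K(1) by (intro compact_continuous_image) (auto intro: continuous_on_subset)
    then obtain B where B: "\<forall>y\<in>\<phi> ` K. norm y \<le> B" using compact_imp_bounded bounded_iff by metis
    have eq: "indicator (interior I) t * (\<phi> t * h t) = \<phi> t * (indicator {a..b} t *\<^sub>R h t)" for t
    proof (cases "t \<in> K")
      case True
      then have "t \<in> interior I" "t \<in> {a..b}" using a b K(2) by auto
      then show ?thesis by simp
    qed (simp add: z)
    show ?thesis
      unfolding eq
    proof (rule Bochner_Integration.integrable_bound)
      show "integrable lebesgue (\<lambda>t. B * (indicator {a..b} t *\<^sub>R h t))"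
        using h[OF ab] unfolding set_integrable_def by (rule integrable_mult_right)
      have "\<phi> \<in> borel_measurable lebesgue"
        using c by (simp add: borel_measurable_continuous_onI measurable_completion)
      then show "(\<lambda>t. \<phi> t * (indicator {a..b} t *\<^sub>R h t)) \<in> borel_measurable lebesgue"
        using h[OF ab] unfolding set_integrable_def
        by (rule borel_measurable_times[OF _ borel_measurable_integrable])
      show "AE t in lebesgue. norm (\<phi> t * (indicator {a..b} t *\<^sub>R h t)) \<le> norm (B * (indicator {a..b} t *\<^sub>R h t))"
      proof (rule AE_I2)
        fix t
        have "\<bar>\<phi> t\<bar> \<le> \<bar>B\<bar>" using B z[of t] by (cases "t \<in> K") force+
        then show "norm (\<phi> t * (indicator {a..b} t *\<^sub>R h t)) \<le> norm (B * (indicator {a..b} t *\<^sub>R h t))"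
          unfolding real_norm_def abs_mult[of "\<phi> t"] abs_mult[of B] by (intro mult_right_mono) auto
      qed
    qed
  qed
qed

text \<open>The weak equation contains the three terms of the residual as separate integrals. They
  may be merged because each is integrable against \<phi>, which is what \<open>i1\<close>,
  \<open>i2\<close> and \<open>i3\<close> provide.\<close>

lemma residual_distribution:
  assumes \<phi>: "\<phi> \<in> test_functions (interior I)" and v: "v \<in> space_V S"
  shows "dual_distribution_deriv I (\<lambda>t. embed_dual S (u t)) \<phi> v
    = dual_distribution I (\<lambda>t. residual_functional \<nu> S (f t) (u t)) \<phi> v"
proof -
  obtain C K where CK: "0 \<le> C" "0 \<le> K"
    and B1: "\<And>u v. u \<in> space_V S \<Longrightarrow> v \<in> space_V S \<Longrightarrow> \<bar>form_b S u u v\<bar> \<le> K * sqrt C * (norm_V S u)\<^sup>2 * norm_V S v"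
    and B2: "\<And>u u' v. u \<in> space_V S \<Longrightarrow> u' \<in> space_V S \<Longrightarrow> v \<in> space_V S \<Longrightarrow>
      \<bar>form_b S u' u' v - form_b S u u v\<bar> \<le> K * sqrt C * norm_V S (u' - u) * (norm_V S u' + norm_V S u) * norm_V S v"
    by (rule residual_functional_estimates[OF S nu]) (rule that)
  obtain Cf where Cf: "0 \<le> Cf" "AE t in lebesgue. t \<in> I \<longrightarrow> norm (f t) \<le> Cf" by (rule f_bound)
  let ?f = "\<lambda>t. f t \<bullet> v" and ?A = "\<lambda>t. inner_V S (u t) v" and ?B = "\<lambda>t. form_b S (u t) (u t) v"
  have i1: "set_integrable lebesgue {a..b} ?f" if ab: "{a..b} \<subseteq> I" for a b
  proof (rule set_integrable_bounded_Icc(1))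
    show "(\<lambda>t. indicator {a..b} t * (f t \<bullet> v)) \<in> borel_measurable lebesgue"
      by (rule bochner_measurable_compose[where \<Phi>="\<lambda>t y. y \<bullet> v", OF bochner_f[OF ab]])
        (auto intro!: tendsto_inner tendsto_of_norm_diff borel_measurable_times borel_measurable_indicator)
    show "AE t in lebesgue. t \<in> {a..b} \<longrightarrow> \<bar>f t \<bullet> v\<bar> \<le> Cf * norm v"
      using Cf(2)
    proof eventually_elim
      case (elim t)
      show ?case
      proof
        assume "t \<in> {a..b}"
        then have "norm (f t) \<le> Cf" using elim ab by blast
        then have "norm (f t) * norm v \<le> Cf * norm v" by (intro mult_right_mono) auto
        then show "\<bar>f t \<bullet> v\<bar> \<le> Cf * norm v" using Cauchy_Schwarz_ineq2[of "f t" v] by linarith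
      qed
    qed
  qed
  have i2: "set_integrable lebesgue {a..b} ?A" if ab: "{a..b} \<subseteq> I" for a b
  proof (rule set_integrable_quadratic_bound[OF ab])
    show "(\<lambda>t. indicator {a..b} t * inner_V S (u t) v) \<in> borel_measurable lebesgue"
    proof (rule bochner_measurable_compose[where \<Phi>="\<lambda>t y. inner_V S y v", OF bochner_V[OF ab]])
      fix s y assume s: "\<And>n. s n \<in> space_V S" and y: "y \<in> space_V S" and l: "(\<lambda>n. norm_V S (s n - y)) \<longlonglongrightarrow> 0"
      have b: "norm (inner_V S (s n) v - inner_V S y v) \<le> norm_V S (s n - y) * norm_V S v" for n
        using inner_V_le[of S "s n - y" v]
        unfolding inner_V_eq grad_diff[OF S space_V_H1[OF s] space_V_H1[OF y]] inner_diff_left by simp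
      have "(\<lambda>n. norm_V S (s n - y) * norm_V S v) \<longlonglongrightarrow> 0" using tendsto_mult_left_zero[OF l] .
      then have "(\<lambda>n. inner_V S (s n) v - inner_V S y v) \<longlonglongrightarrow> 0"
        by (rule Lim_null_comparison[OF always_eventually[OF allI[OF b]]])
      then show "(\<lambda>n. inner_V S (s n) v) \<longlonglongrightarrow> inner_V S y v" by (rule LIM_zero_cancel)
    qed (auto intro!: borel_measurable_times borel_measurable_indicator)
    have "\<bar>inner_V S y v\<bar> \<le> norm_V S v * (1 + (norm_V S y)\<^sup>2)" for y
    proof -
      have "norm_V S y \<le> 1 + (norm_V S y)\<^sup>2"
        using zero_le_power2[of "norm_V S y - 1/2"] by (simp add: power2_eq_square algebra_simps)
      then have "norm_V S y * norm_V S v \<le> (1 + (norm_V S y)\<^sup>2) * norm_V S v" by (intro mult_right_mono) auto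
      then show ?thesis using inner_V_le[of S y v] by (simp add: mult.commute)
    qed
    then show "AE t in lebesgue. t \<in> {a..b} \<longrightarrow> \<bar>inner_V S (u t) v\<bar> \<le> norm_V S v * (1 + (norm_V S (u t))\<^sup>2)"
      by simp
  qed
  have i3: "set_integrable lebesgue {a..b} ?B" if ab: "{a..b} \<subseteq> I" for a b
  proof (rule set_integrable_quadratic_bound[OF ab])
    show "(\<lambda>t. indicator {a..b} t * form_b S (u t) (u t) v) \<in> borel_measurable lebesgue"
    proof (rule bochner_measurable_compose[where \<Phi>="\<lambda>t y. form_b S y y v", OF bochner_V[OF ab]])
      fix s y assume s: "\<And>n. s n \<in> space_V S" and y: "y \<in> space_V S" and l: "(\<lambda>n. norm_V S (s n - y)) \<longlonglongrightarrow> 0"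
      have "(\<lambda>n. K * sqrt C * norm_V S (s n - y) * (norm_V S (s n) + norm_V S y) * norm_V S v)
          \<longlonglongrightarrow> K * sqrt C * 0 * (norm_V S y + norm_V S y) * norm_V S v"
        by (intro tendsto_intros l norm_V_tendsto[OF s y l])
      then have z: "(\<lambda>n. K * sqrt C * norm_V S (s n - y) * (norm_V S (s n) + norm_V S y) * norm_V S v) \<longlonglongrightarrow> 0"
        by simp
      have b: "norm (form_b S (s n) (s n) v - form_b S y y v)
          \<le> K * sqrt C * norm_V S (s n - y) * (norm_V S (s n) + norm_V S y) * norm_V S v" for n
        using B2[OF y s v] by simp
      from z have "(\<lambda>n. form_b S (s n) (s n) v - form_b S y y v) \<longlonglongrightarrow> 0"
        by (rule Lim_null_comparison[OF always_eventually[OF allI[OF b]]])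
      then show "(\<lambda>n. form_b S (s n) (s n) v) \<longlonglongrightarrow> form_b S y y v" by (rule LIM_zero_cancel)
    qed (auto intro!: borel_measurable_times borel_measurable_indicator)
    show "AE t in lebesgue. t \<in> {a..b} \<longrightarrow> \<bar>form_b S (u t) (u t) v\<bar> \<le> K * sqrt C * norm_V S v * (1 + (norm_V S (u t))\<^sup>2)"
      using AE_in_V[OF ab]
    proof eventually_elim
      case (elim t)
      have "0 \<le> K * sqrt C * norm_V S v" using CK by simp
      then have "K * sqrt C * (norm_V S (u t))\<^sup>2 * norm_V S v \<le> K * sqrt C * norm_V S v * (1 + (norm_V S (u t))\<^sup>2)"
        by (simp add: algebra_simps)
      then show ?case using elim B1[OF _ v, of "u t"] by force
    qed
  qed
  note J = set_integrable_test_function[OF i1 \<phi>] set_integrable_test_function[OF i2 \<phi>] set_integrable_test_function[OF i3 \<phi>]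
  have "dual_distribution I (\<lambda>t. residual_functional \<nu> S (f t) (u t)) \<phi> v
      = (LINT t|lebesgue. indicator (interior I) t * (\<phi> t * ?f t) - \<nu> * (indicator (interior I) t * (\<phi> t * ?A t))
        - indicator (interior I) t * (\<phi> t * ?B t))"
    unfolding dual_distribution_def set_lebesgue_integral_def
    using v by (intro Bochner_Integration.integral_cong) (auto simp: residual_functional_def algebra_simps)
  also have "\<dots> = (LINT t|lebesgue. indicator (interior I) t * (\<phi> t * ?f t))
      - \<nu> * (LINT t|lebesgue. indicator (interior I) t * (\<phi> t * ?A t)) - (LINT t|lebesgue. indicator (interior I) t * (\<phi> t * ?B t))"
    using J by simp
  also have "\<dots> = dual_distribution I (\<lambda>t. embed_dual S (f t)) \<phi> v - \<nu> * dual_distribution I (\<lambda>t. op_A S (u t)) \<phi> v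
      - dual_distribution I (\<lambda>t. op_B S (u t) (u t)) \<phi> v"
    unfolding dual_distribution_def set_lebesgue_integral_def
    using v by (simp add: embed_dual_def op_A_def op_B_def)
  also have "\<dots> = dual_distribution_deriv I (\<lambda>t. embed_dual S (u t)) \<phi> v"
  proof -
    have "dual_distribution_deriv (interior I) (\<lambda>t. embed_dual S (u t)) \<phi> v
          + \<nu> * dual_distribution (interior I) (\<lambda>t. op_A S (u t)) \<phi> v
          + dual_distribution (interior I) (\<lambda>t. op_B S (u t) (u t)) \<phi> v
          = dual_distribution (interior I) (\<lambda>t. embed_dual S (f t)) \<phi> v"
      using sol \<phi> v by (simp add: weak_solution_def)
    then show ?thesis by (simp add: dual_distribution_def dual_distribution_deriv_def)
  qed
  finally show ?thesis by (rule sym)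
qed

text \<open>The time derivative supplied by \<open>sol\<close> is known to be integrable only on
  compact subintervals of the interior. The residual represents the same distribution and is
  integrable up to the end points, so it is taken as the witness; distributions on I see only the
  interior.\<close>

lemma weak_solution_closed: "weak_solution \<nu> S f I u"
  unfolding weak_solution_def
proof (intro conjI)
  show "u \<in> loc (L_infinity (space_H S) norm) I" using in_L_infinity by (simp add: loc_def)
  show "u \<in> loc (L_p 2 (space_V S) (norm_V S)) I" using in_L_2 by (simp add: loc_def)
  show "\<exists>g\<in>loc (L_p (4/3) (dual_V S) (norm_dual S)) I.
       \<forall>\<phi>\<in>test_functions (interior I). \<forall>v\<in>space_V S.
          dual_distribution_deriv I (\<lambda>t. embed_dual S (u t)) \<phi> v = dual_distribution I g \<phi> v"
    by (intro bexI[of _ "\<lambda>t. residual_functional \<nu> S (f t) (u t)"] ballI residual_distribution)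
      (simp_all add: loc_def residual_in_L_p)
  show "continuous_map (top_of_set I) (H_weak S) u" by (rule cont)
  show "\<forall>\<phi>\<in>test_functions (interior I). \<forall>v\<in>space_V S.
        dual_distribution_deriv I (\<lambda>t. embed_dual S (u t)) \<phi> v
          + \<nu> * dual_distribution I (\<lambda>t. op_A S (u t)) \<phi> v
          + dual_distribution I (\<lambda>t. op_B S (u t) (u t)) \<phi> v
          = dual_distribution I (\<lambda>t. embed_dual S (f t)) \<phi> v"
    using sol by (simp add: weak_solution_def dual_distribution_def dual_distribution_deriv_def)
  show "AE t' in lebesgue_on I. \<forall>t\<in>I. t' < t \<longrightarrow> energy_inequality \<nu> S f u t' t" by (rule AE_energy)
  show "\<forall>t0. left_endpoint I t0 \<longrightarrow> (u \<longlongrightarrow> u t0) (at t0 within I)" using right_cont by blast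
qed

end

text \<open>Conditions on compact subintervals and at almost all times are inherited, distributions
  on I and on its interior coincide, and an open set of reals has no left end point, so the
  condition of strong continuity becomes void.\<close>

lemma weak_solution_interior:
  assumes I: "is_interval I" and sol: "weak_solution \<nu> S f I u"
  shows "weak_solution \<nu> S f (interior I) u"
proof -
  have sub: "interior I \<subseteq> I" by (rule interior_subset)
  have no_left: "\<not> left_endpoint (interior I) t0" for t0
  proof
    assume l: "left_endpoint (interior I) t0"
    then obtain e where e: "0 < e" "ball t0 e \<subseteq> interior I"
      using open_contains_ball[of "interior I"] by (auto simp: left_endpoint_def)
    then have "t0 - e / 2 \<in> interior I" by (intro subsetD[OF e(2)]) (simp add: dist_real_def)
    then show False using l e(1) by (auto simp: left_endpoint_def)
  qed
  have mono: "g \<in> loc F (interior I)" if "g \<in> loc F I" for g :: "real \<Rightarrow> 'z" and F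
    using that sub by (auto simp: loc_def)
  have meas: "I \<in> sets lebesgue" "interior I \<in> sets lebesgue" using interval_sets_lebesgue[OF I] by auto
  show ?thesis
    unfolding weak_solution_def
  proof (intro conjI)
    show "u \<in> loc (L_infinity (space_H S) norm) (interior I)" "u \<in> loc (L_p 2 (space_V S) (norm_V S)) (interior I)"
      using sol by (auto simp: weak_solution_def intro: mono)
    obtain g where "g \<in> loc (L_p (4/3) (dual_V S) (norm_dual S)) I"
      "\<forall>\<phi>\<in>test_functions (interior I). \<forall>v\<in>space_V S.
          dual_distribution_deriv I (\<lambda>t. embed_dual S (u t)) \<phi> v = dual_distribution I g \<phi> v"
      using sol by (auto simp: weak_solution_def)
    then show "\<exists>g\<in>loc (L_p (4/3) (dual_V S) (norm_dual S)) (interior I).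
       \<forall>\<phi>\<in>test_functions (interior (interior I)). \<forall>v\<in>space_V S.
          dual_distribution_deriv (interior I) (\<lambda>t. embed_dual S (u t)) \<phi> v = dual_distribution (interior I) g \<phi> v"
      by (intro bexI[of _ g] mono) (simp_all add: dual_distribution_def dual_distribution_deriv_def)
    show "continuous_map (top_of_set (interior I)) (H_weak S) u"
      using sol sub by (auto simp: weak_solution_def intro: continuous_map_from_subtopology_mono)
    show "\<forall>\<phi>\<in>test_functions (interior (interior I)). \<forall>v\<in>space_V S.
        dual_distribution_deriv (interior I) (\<lambda>t. embed_dual S (u t)) \<phi> v
          + \<nu> * dual_distribution (interior I) (\<lambda>t. op_A S (u t)) \<phi> v
          + dual_distribution (interior I) (\<lambda>t. op_B S (u t) (u t)) \<phi> v
          = dual_distribution (interior I) (\<lambda>t. embed_dual S (f t)) \<phi> v"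
      using sol by (simp add: weak_solution_def dual_distribution_def dual_distribution_deriv_def)
    have "AE t' in lebesgue_on I. \<forall>t\<in>I. t' < t \<longrightarrow> energy_inequality \<nu> S f u t' t"
      using sol by (simp add: weak_solution_def)
    then have "AE t' in lebesgue_on (interior I). \<forall>t\<in>I. t' < t \<longrightarrow> energy_inequality \<nu> S f u t' t"
      by (rule AE_lebesgue_on_subset[OF meas sub])
    then show "AE t' in lebesgue_on (interior I). \<forall>t\<in>interior I. t' < t \<longrightarrow> energy_inequality \<nu> S f u t' t"
      by eventually_elim (use sub in blast)
    show "\<forall>t0. left_endpoint (interior I) t0 \<longrightarrow> (u \<longlongrightarrow> u t0) (at t0 within interior I)"
      using no_left by blast
  qed
qed

section \<open>Measurability on the path space\<close>

lemma space_H_add: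
  assumes S: "valid_setting S" and x: "x \<in> space_H S" and y: "y \<in> space_H S"
  shows "x + y \<in> space_H S"
proof -
  let ?X = "class_on (flow_domain S) ` smooth_fields S"
  obtain a where a: "\<forall>n. a n \<in> ?X" "a \<longlonglongrightarrow> x"
    using x unfolding space_H_def closure_sequential by blast
  obtain b where b: "\<forall>n. b n \<in> ?X" "b \<longlonglongrightarrow> y"
    using y unfolding space_H_def closure_sequential by blast
  have "a n + b n \<in> ?X" for n
  proof -
    obtain v where v: "v \<in> smooth_fields S" "a n = class_on (flow_domain S) v"
      using a(1) by blast
    obtain w where w: "w \<in> smooth_fields S" "b n = class_on (flow_domain S) w"
      using b(1) by blast
    have "class_on (flow_domain S) (\<lambda>x. v x + w x) = a n + b n"
      unfolding v(2) w(2)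
      by (rule class_on_add[OF cut_square_integrable_smooth(1)[OF S smooth_fields_smooth[OF v(1)]]
        cut_square_integrable_smooth(1)[OF S smooth_fields_smooth[OF w(1)]]])
    then show ?thesis using imageI[OF smooth_fields_add[OF S v(1) w(1)], of "class_on (flow_domain S)"] by simp
  qed
  note X = this
  have "(\<lambda>n. a n + b n) \<longlonglongrightarrow> x + y" using a(2) b(2) by (rule tendsto_add)
  then show ?thesis unfolding space_H_def closure_sequential
    by (intro exI[of _ "\<lambda>n. a n + b n"] conjI allI X)
qed

lemma space_H_scaleR:
  assumes S: "valid_setting S" and x: "x \<in> space_H S"
  shows "c *\<^sub>R x \<in> space_H S"
proof -
  let ?X = "class_on (flow_domain S) ` smooth_fields S"
  obtain a where a: "\<forall>n. a n \<in> ?X" "a \<longlonglongrightarrow> x"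
    using x unfolding space_H_def closure_sequential by blast
  have "c *\<^sub>R a n \<in> ?X" for n
  proof -
    obtain v where v: "v \<in> smooth_fields S" "a n = class_on (flow_domain S) v"
      using a(1) by blast
    have "class_on (flow_domain S) (\<lambda>x. c *\<^sub>R v x) = c *\<^sub>R a n"
      unfolding v(2)
      by (rule class_on_scaleR) (intro cut_square_integrable_smooth(1)[OF S] smooth_fields_smooth[OF v(1)])
    then show ?thesis using imageI[OF smooth_fields_scaleR[OF S v(1), of c], of "class_on (flow_domain S)"] by simp
  qed
  note X = this
  have "(\<lambda>n. c *\<^sub>R a n) \<longlonglongrightarrow> c *\<^sub>R x" using a(2) by (intro tendsto_intros)
  then show ?thesis unfolding space_H_def closure_sequential
    by (intro exI[of _ "\<lambda>n. c *\<^sub>R a n"] conjI allI X)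
qed

lemma zero_space_H: "0 \<in> space_H S"
proof -
  have "class_on (flow_domain S) (\<lambda>x. 0) = 0"
    by (simp add: class_on_def abs_L2_zero)
  then show ?thesis
    unfolding space_H_def using zero_smooth_fields[of S] closure_subset by (metis image_eqI subsetD)
qed

lemma paths_in_H: "v \<in> paths S I \<Longrightarrow> t \<in> I \<Longrightarrow> v t \<in> space_H S"
  by (auto simp: paths_def intro: weak_continuous_in_H)

text \<open>The degenerate interval [t, t] turns uniform closeness into closeness at the single time
  t.\<close>

lemma openin_path_basic:
  assumes "u \<in> paths S I" "t \<in> I" "w \<in> space_H S" "0 < \<epsilon>"
  shows "openin (path_topology S I) {v \<in> paths S I. \<bar>(v t - u t) \<bullet> w\<bar> < \<epsilon>}"
proof -
  have "\<exists>u' a b w' \<epsilon>'. {v \<in> paths S I. \<bar>(v t - u t) \<bullet> w\<bar> < \<epsilon>} = {v \<in> paths S I. \<forall>t\<in>{a..b}. \<bar>(v t - u' t) \<bullet> w'\<bar> < \<epsilon>'} \<and>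
      u' \<in> paths S I \<and> {a..b} \<subseteq> I \<and> w' \<in> space_H S \<and> \<epsilon>' > 0"
    by (rule exI[of _ u], rule exI[of _ t], rule exI[of _ t], rule exI[of _ w], rule exI[of _ \<epsilon>]) (use assms in auto)
  then show ?thesis
    unfolding path_topology_def openin_topology_generated_by_iff by (intro generate_topology_on.Basis) blast
qed

lemma topspace_path_topology: "topspace (path_topology S I) = paths S I"
proof
  show "topspace (path_topology S I) \<subseteq> paths S I"
    unfolding path_topology_def topology_generated_by_topspace by blast
  show "paths S I \<subseteq> topspace (path_topology S I)"
  proof
    fix u assume u: "u \<in> paths S I"
    \<comment> \<open>The interval from 1 to 0 is empty, hence contained in every I; the subbasic
      set that it defines is the whole path space.\<close>
    have "{v \<in> paths S I. \<forall>t\<in>{1..0::real}. \<bar>(v t - u t) \<bullet> 0\<bar> < 1} \<in>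
      {{v \<in> paths S I. \<forall>t\<in>{a..b}. \<bar>(v t - u t) \<bullet> w\<bar> < \<epsilon>} | u a b w \<epsilon>.
        u \<in> paths S I \<and> {a..b} \<subseteq> I \<and> w \<in> space_H S \<and> \<epsilon> > 0}"
      by (intro CollectI exI[of _ u] exI[of _ "1::real"] exI[of _ "0::real"] exI[of _ "0::L2_field"] conjI refl u zero_space_H) auto
    moreover have "u \<in> {v \<in> paths S I. \<forall>t\<in>{1..0::real}. \<bar>(v t - u t) \<bullet> 0\<bar> < 1}" using u by simp
    ultimately show "u \<in> topspace (path_topology S I)"
      unfolding path_topology_def topology_generated_by_topspace by blast
  qed
qed

text \<open>With k = 0 this leads to the norm at one time, with k = 1 and k = -1 to inner products
  of values at two times by polarisation.\<close>

lemma openin_path_combination: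
  assumes t: "t \<in> I" "s \<in> I" and w: "w \<in> space_H S" and k: "\<bar>k\<bar> \<le> 1"
  shows "openin (path_topology S I) {v \<in> paths S I. c < (v t + k *\<^sub>R v s) \<bullet> w}" (is "openin _ ?U")
proof (subst openin_subopen, intro ballI)
  fix u assume u: "u \<in> ?U"
  \<comment> \<open>Half of the gap: since |k| \<le> 1, the two perturbations together stay below 2
    e.\<close>
  define e where "e = ((u t + k *\<^sub>R u s) \<bullet> w - c) / 2"
  have e: "0 < e" using u by (simp add: e_def)
  have uP: "u \<in> paths S I" using u by simp
  let ?T = "{v \<in> paths S I. \<bar>(v t - u t) \<bullet> w\<bar> < e} \<inter> {v \<in> paths S I. \<bar>(v s - u s) \<bullet> w\<bar> < e}"
  have "openin (path_topology S I) ?T"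
    by (intro openin_Int openin_path_basic uP t w e)
  moreover have "u \<in> ?T" using uP e by simp
  moreover have "?T \<subseteq> ?U"
  proof
    fix v assume v: "v \<in> ?T"
    have "\<bar>k * ((v s - u s) \<bullet> w)\<bar> \<le> 1 * \<bar>(v s - u s) \<bullet> w\<bar>"
      unfolding abs_mult using k by (intro mult_right_mono) auto
    moreover have "(v t + k *\<^sub>R v s) \<bullet> w = (u t + k *\<^sub>R u s) \<bullet> w + (v t - u t) \<bullet> w + k * ((v s - u s) \<bullet> w)"
      by (simp add: inner_add_left inner_diff_left algebra_simps)
    moreover have "\<bar>(v t - u t) \<bullet> w\<bar> < e" "\<bar>(v s - u s) \<bullet> w\<bar> < e" using v by auto
    moreover have "2 * e = (u t + k *\<^sub>R u s) \<bullet> w - c" unfolding e_def by simp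
    ultimately have "c < (v t + k *\<^sub>R v s) \<bullet> w" by linarith
    then show "v \<in> ?U" using v by simp
  qed
  ultimately show "\<exists>T. openin (path_topology S I) T \<and> u \<in> T \<and> T \<subseteq> ?U" by blast
qed

locale path_measure =
  fixes S :: setting and I :: "real set" and \<rho> :: "(real \<Rightarrow> L2_field) measure"
  assumes S: "valid_setting S" and borel: "borel_probability (path_topology S I) \<rho>"
begin

sublocale prob_space \<rho>
  using borel by (simp add: borel_probability_def)

lemma space_rho: "space \<rho> = paths S I"
  using borel by (simp add: borel_probability_def topspace_path_topology)

lemma open_sets_rho: "openin (path_topology S I) U \<Longrightarrow> U \<in> sets \<rho>"
  using borel by (auto simp: borel_probability_def)

text \<open>The norm is the supremum of the inner products with the unit ball of H, so a superlevel
  set is a union of open sets of paths. The union is uncountable, but it is open and therefore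
  measurable.\<close>

lemma norm_combination_measurable:
  assumes t: "t \<in> I" "s \<in> I" and k: "\<bar>k\<bar> \<le> 1"
  shows "(\<lambda>v. norm (v t + k *\<^sub>R v s)) \<in> borel_measurable \<rho>"
  unfolding borel_measurable_iff_greater
proof
  fix c :: real
  show "{v \<in> space \<rho>. c < norm (v t + k *\<^sub>R v s)} \<in> sets \<rho>"
  proof (cases "c < 0")
    case True
    then have "{v \<in> space \<rho>. c < norm (v t + k *\<^sub>R v s)} = space \<rho>"
      by (auto intro: less_le_trans)
    then show ?thesis by simp
  next
    case False
    have "{v \<in> space \<rho>. c < norm (v t + k *\<^sub>R v s)}
      = (\<Union>w\<in>{w \<in> space_H S. norm w \<le> 1}. {v \<in> paths S I. c < (v t + k *\<^sub>R v s) \<bullet> w})"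
    proof (intro set_eqI iffI)
      fix v assume v: "v \<in> {v \<in> space \<rho>. c < norm (v t + k *\<^sub>R v s)}"
      let ?x = "v t + k *\<^sub>R v s"
      have x: "0 < norm ?x" "c < norm ?x" using v False by auto
      have "inverse (norm ?x) *\<^sub>R ?x \<in> space_H S"
        using v t by (intro space_H_scaleR[OF S] space_H_add[OF S] paths_in_H) (auto simp: space_rho)
      moreover have "norm (inverse (norm ?x) *\<^sub>R ?x) \<le> 1" using x(1) by simp
      moreover have "?x \<bullet> (inverse (norm ?x) *\<^sub>R ?x) = norm ?x"
        using x(1) by (simp add: dot_square_norm power2_eq_square)
      ultimately show "v \<in> (\<Union>w\<in>{w \<in> space_H S. norm w \<le> 1}. {v \<in> paths S I. c < (v t + k *\<^sub>R v s) \<bullet> w})"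
        using v x(2) by (intro UN_I[of "inverse (norm ?x) *\<^sub>R ?x"]) (auto simp: space_rho)
    next
      fix v assume "v \<in> (\<Union>w\<in>{w \<in> space_H S. norm w \<le> 1}. {v \<in> paths S I. c < (v t + k *\<^sub>R v s) \<bullet> w})"
      then obtain w where w: "norm w \<le> 1" "v \<in> paths S I" "c < (v t + k *\<^sub>R v s) \<bullet> w" by blast
      have "(v t + k *\<^sub>R v s) \<bullet> w \<le> norm (v t + k *\<^sub>R v s) * norm w" by (rule norm_cauchy_schwarz)
      also have "\<dots> \<le> norm (v t + k *\<^sub>R v s)" using w(1) by (simp add: mult_left_le)
      finally show "v \<in> {v \<in> space \<rho>. c < norm (v t + k *\<^sub>R v s)}" using w by (simp add: space_rho)
    qed
    moreover have "openin (path_topology S I) (\<Union>w\<in>{w \<in> space_H S. norm w \<le> 1}. {v \<in> paths S I. c < (v t + k *\<^sub>R v s) \<bullet> w})"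
      by (rule openin_Union) (use openin_path_combination[OF t _ k] in blast)
    ultimately show ?thesis by (simp only: open_sets_rho)
  qed
qed

lemma norm_measurable: "t \<in> I \<Longrightarrow> (\<lambda>v. norm (v t)) \<in> borel_measurable \<rho>"
  using norm_combination_measurable[of t t 0] by simp

lemma inner_measurable:
  assumes "t \<in> I" "s \<in> I"
  shows "(\<lambda>v. v t \<bullet> v s) \<in> borel_measurable \<rho>"
proof -
  have eq: "(\<lambda>v. v t \<bullet> v s) = (\<lambda>v. ((norm (v t + 1 *\<^sub>R v s))\<^sup>2 - (norm (v t + (- 1) *\<^sub>R v s))\<^sup>2) / 4)"
    by (simp add: fun_eq_iff power2_norm_eq_inner inner_add_left inner_add_right inner_diff_left inner_diff_right inner_commute)
  show ?thesis
    unfolding eq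
    by (intro borel_measurable_divide borel_measurable_diff borel_measurable_power borel_measurable_const
        norm_combination_measurable[OF assms]) simp_all
qed

end

text \<open>The fallback t0 keeps every grid point in I, whatever the index, so that evaluation at
  it is always covered by \<open>inner_measurable\<close>.\<close>

definition grid_point :: "real set \<Rightarrow> real \<Rightarrow> nat \<Rightarrow> int \<Rightarrow> real" where
  "grid_point I t0 m k = (if t0 + real_of_int k / real (Suc m) \<in> I then t0 + real_of_int k / real (Suc m) else t0)"

definition grid_index :: "real \<Rightarrow> nat \<Rightarrow> real \<Rightarrow> int" where
  "grid_index t0 m t = \<lfloor>real (Suc m) * (t - t0)\<rfloor>"

text \<open>Rounding t - t0 down to a multiple of 1 / (m + 1) gives a point between t0 and t, hence
  in I, at distance at most 1 / (m + 1) from t.\<close>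

lemma grid_tendsto:
  assumes I: "is_interval I" and t: "t0 \<in> I" "t \<in> I" "t0 \<le> t"
  shows "(\<lambda>m. grid_point I t0 m (grid_index t0 m t)) \<longlonglongrightarrow> t"
    and "grid_point I t0 m k \<in> I"
proof -
  show "grid_point I t0 m k \<in> I" for m k using t(1) by (simp add: grid_point_def)
  have le: "t0 + real_of_int (grid_index t0 m t) / real (Suc m) \<le> t"
    and ge: "t - inverse (real (Suc m)) \<le> t0 + real_of_int (grid_index t0 m t) / real (Suc m)"
    and ge0: "t0 \<le> t0 + real_of_int (grid_index t0 m t) / real (Suc m)" for m
  proof -
    have p: "0 < real (Suc m)" by simp
    have "real_of_int (grid_index t0 m t) \<le> real (Suc m) * (t - t0)" unfolding grid_index_def by (rule of_int_floor_le)
    then have "real_of_int (grid_index t0 m t) / real (Suc m) \<le> t - t0" by (subst pos_divide_le_eq[OF p]) (simp only: mult.commute)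
    then show "t0 + real_of_int (grid_index t0 m t) / real (Suc m) \<le> t" by simp
    have "real (Suc m) * (t - t0) - 1 \<le> real_of_int (grid_index t0 m t)" unfolding grid_index_def by linarith
    then have "(real (Suc m) * (t - t0) - 1) / real (Suc m) \<le> real_of_int (grid_index t0 m t) / real (Suc m)"
      by (intro divide_right_mono) auto
    moreover have "(real (Suc m) * (t - t0) - 1) / real (Suc m) = (t - t0) - inverse (real (Suc m))"
      by (simp add: diff_divide_distrib inverse_eq_divide)
    ultimately show "t - inverse (real (Suc m)) \<le> t0 + real_of_int (grid_index t0 m t) / real (Suc m)" by linarith
    have "0 \<le> grid_index t0 m t" unfolding grid_index_def using t(3) by simp
    then show "t0 \<le> t0 + real_of_int (grid_index t0 m t) / real (Suc m)" by simp
  qed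
  have eq: "grid_point I t0 m (grid_index t0 m t) = t0 + real_of_int (grid_index t0 m t) / real (Suc m)" for m
  proof -
    have "t0 + real_of_int (grid_index t0 m t) / real (Suc m) \<in> I"
      using I t(1,2) ge0 le unfolding is_interval_1 by blast
    then show ?thesis by (simp add: grid_point_def)
  qed
  show "(\<lambda>m. grid_point I t0 m (grid_index t0 m t)) \<longlonglongrightarrow> t"
  proof (rule tendsto_sandwich[OF always_eventually always_eventually])
    show "\<forall>m. t - inverse (real (Suc m)) \<le> grid_point I t0 m (grid_index t0 m t)" using ge by (simp add: eq)
    show "\<forall>m. grid_point I t0 m (grid_index t0 m t) \<le> t" using le by (simp add: eq)
    have "(\<lambda>m. t - inverse (real (Suc m))) \<longlonglongrightarrow> t - 0"
      by (intro tendsto_diff tendsto_const LIMSEQ_inverse_real_of_nat)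
    then show "(\<lambda>m. t - inverse (real (Suc m))) \<longlonglongrightarrow> t" by simp
  qed simp
qed

context path_measure
begin

text \<open>No separability of \<open>H\<close> is needed: \<open>|v(t)|\<^sup>2\<close> is a double limit of products of values on grids.\<close>

lemma norm_square_jointly_measurable:
  assumes I: "is_interval I" and t0: "t0 \<in> I"
  obtains F where "F \<in> borel_measurable (lborel \<Otimes>\<^sub>M \<rho>)"
    "\<And>t v. t \<in> I \<Longrightarrow> t0 \<le> t \<Longrightarrow> v \<in> paths S I \<Longrightarrow> F (t, v) = (norm (v t))\<^sup>2"
proof -
  let ?g = "\<lambda>m t. grid_point I t0 m (grid_index t0 m t)"
  define Q where "Q m n = (\<lambda>(t, v :: real \<Rightarrow> L2_field). v (?g m t) \<bullet> v (?g n t))" for m n :: nat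
  define F where "F p = lim (\<lambda>n. lim (\<lambda>m. Q m n p))" for p
  have idx: "(\<lambda>p. grid_index t0 m (fst p)) \<in> measurable (lborel \<Otimes>\<^sub>M \<rho>) (count_space UNIV)" for m
    unfolding grid_index_def by measurable
  have gI: "grid_point I t0 m k \<in> I" for m k
    using t0 by (simp add: grid_point_def)
  have Q: "Q m n \<in> borel_measurable (lborel \<Otimes>\<^sub>M \<rho>)" for m n
  proof -
    \<comment> \<open>For fixed indices the inner product is a measurable function of the path
      alone. The indices depend measurably on time and have countable range, so they can be inserted
      one after the other.\<close>
    have "(\<lambda>p. snd p (grid_point I t0 m k) \<bullet> snd p (grid_point I t0 n l)) \<in> borel_measurable (lborel \<Otimes>\<^sub>M \<rho>)" for k l
      by (rule measurable_compose[OF measurable_snd inner_measurable[OF gI gI]])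
    then have "(\<lambda>p. snd p (grid_point I t0 m k) \<bullet> snd p (?g n (fst p))) \<in> borel_measurable (lborel \<Otimes>\<^sub>M \<rho>)" for k
      by (rule measurable_compose_countable[OF _ idx])
    then have "(\<lambda>p. snd p (?g m (fst p)) \<bullet> snd p (?g n (fst p))) \<in> borel_measurable (lborel \<Otimes>\<^sub>M \<rho>)"
      by (rule measurable_compose_countable[OF _ idx])
    then show ?thesis by (simp add: Q_def case_prod_beta)
  qed
  have "F \<in> borel_measurable (lborel \<Otimes>\<^sub>M \<rho>)"
    unfolding F_def[abs_def] by (intro borel_measurable_lim_metric Q)
  moreover have "F (t, v) = (norm (v t))\<^sup>2" if t: "t \<in> I" "t0 \<le> t" and v: "v \<in> paths S I" for t v
  proof -
    have vc: "continuous_map (top_of_set I) (H_weak S) v" using v by (simp add: paths_def)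
    \<comment> \<open>Weak continuity moves one factor at a time: first m tends to infinity while
      the other factor, at the grid of index n, is held fixed as w; then n does, against v t. The
      diagonal m = n would require convergence of the norms.\<close>
    have "(\<lambda>m. v (?g m t) \<bullet> w) \<longlonglongrightarrow> v t \<bullet> w" if "w \<in> space_H S" for w
      using continuous_on_tendsto_compose[OF weak_continuous_inner[OF vc that] grid_tendsto(1)[OF I t0 t] t(1)]
      by (simp add: gI)
    note l = this
    have H: "v s \<in> space_H S" if "s \<in> I" for s using v that by (rule paths_in_H)
    have "lim (\<lambda>m. Q m n (t, v)) = v t \<bullet> v (?g n t)" for n
      unfolding Q_def prod.case by (intro limI l H gI)
    then have "F (t, v) = lim (\<lambda>n. v (?g n t) \<bullet> v t)" by (simp add: F_def inner_commute)
    also have "\<dots> = v t \<bullet> v t" by (intro limI l H t)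
    finally show ?thesis by (simp add: power2_norm_eq_inner)
  qed
  ultimately show ?thesis by (rule that)
qed

text \<open>Upper semicontinuity of the norm at t0 from the right, tested at rational times and with
  tolerances 1 / (k + 1) only: these are countably many conditions, so the set is
  measurable.\<close>

definition right_norm_bounded :: "real \<Rightarrow> (real \<Rightarrow> L2_field) set" where
  "right_norm_bounded t0 = {v \<in> space \<rho>. \<forall>k::nat. \<exists>n::nat. \<forall>q\<in>\<rat>. q \<in> I \<and> t0 < q \<and> q < t0 + inverse (real (Suc n))
      \<longrightarrow> norm (v q) \<le> norm (v t0) + inverse (real (Suc k))}"

lemma right_norm_bounded_sets:
  assumes t0: "t0 \<in> I"
  shows "right_norm_bounded t0 \<in> sets \<rho>"
proof -
  have c: "countable (\<rat> :: real set)" by (rule countable_rat)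
  have "{v \<in> space \<rho>. q \<in> I \<and> t0 < q \<and> q < t0 + inverse (real (Suc n)) \<longrightarrow> norm (v q) \<le> norm (v t0) + inverse (real (Suc k))} \<in> sets \<rho>"
    for q n k
  proof (cases "q \<in> I \<and> t0 < q \<and> q < t0 + inverse (real (Suc n))")
    case True
    then have [measurable]: "(\<lambda>v. norm (v q)) \<in> borel_measurable \<rho>" "(\<lambda>v. norm (v t0)) \<in> borel_measurable \<rho>"
      using norm_measurable t0 by auto
    have "{v \<in> space \<rho>. norm (v q) \<le> norm (v t0) + inverse (real (Suc k))} \<in> sets \<rho>" by measurable
    then show ?thesis using True by simp
  next
    case False
    then have "{v \<in> space \<rho>. q \<in> I \<and> t0 < q \<and> q < t0 + inverse (real (Suc n)) \<longrightarrow> norm (v q) \<le> norm (v t0) + inverse (real (Suc k))} = space \<rho>"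
      by blast
    then show ?thesis by (metis sets.top)
  qed
  then show ?thesis unfolding right_norm_bounded_def
    by (intro sets.sets_Collect_countable_All sets.sets_Collect_countable_Ex sets.sets_Collect_countable_All' c)
qed

end

text \<open>Weak convergence together with convergence of the norms is strong convergence: |v t - v
  t0|^2 = |v t|^2 - 2 v t \<bullet> v t0 + |v t0|^2. The lower bound for the norms comes from weak
  continuity, so only the upper one is assumed.\<close>

lemma norm_tendsto_imp_tendsto:
  assumes c: "continuous_map (top_of_set I) (H_weak S) v" and t0: "t0 \<in> I"
    and up: "\<And>\<epsilon>. 0 < \<epsilon> \<Longrightarrow> eventually (\<lambda>t. norm (v t) < norm (v t0) + \<epsilon>) (at t0 within I)"
  shows "(v \<longlongrightarrow> v t0) (at t0 within I)"
proof -
  have H: "v t0 \<in> space_H S" by (rule weak_continuous_in_H[OF c t0])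
  have n: "((\<lambda>t. norm (v t)) \<longlongrightarrow> norm (v t0)) (at t0 within I)"
  proof (rule order_tendstoI)
    show "eventually (\<lambda>t. a < norm (v t)) (at t0 within I)" if "a < norm (v t0)" for a
      by (rule weak_continuous_norm_lower[OF c t0 that])
    show "eventually (\<lambda>t. norm (v t) < a) (at t0 within I)" if "norm (v t0) < a" for a
      using up[of "a - norm (v t0)"] that by simp
  qed
  have w: "((\<lambda>t. v t \<bullet> v t0) \<longlongrightarrow> v t0 \<bullet> v t0) (at t0 within I)"
    using weak_continuous_inner[OF c H] t0 by (simp add: continuous_on_def)
  have "((\<lambda>t. sqrt ((norm (v t))\<^sup>2 - 2 * (v t \<bullet> v t0) + (norm (v t0))\<^sup>2))
      \<longlongrightarrow> sqrt ((norm (v t0))\<^sup>2 - 2 * (v t0 \<bullet> v t0) + (norm (v t0))\<^sup>2)) (at t0 within I)"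
    by (intro tendsto_intros n w)
  moreover have "sqrt ((norm (v t))\<^sup>2 - 2 * (v t \<bullet> v t0) + (norm (v t0))\<^sup>2) = norm (v t - v t0)" for t
    by (simp add: norm_eq_sqrt_inner[of "v t - v t0"] power2_norm_eq_inner inner_diff_left inner_diff_right inner_commute algebra_simps)
  ultimately have "((\<lambda>t. norm (v t - v t0)) \<longlongrightarrow> 0) (at t0 within I)"
    by (simp add: power2_norm_eq_inner)
  then show ?thesis by (simp add: tendsto_norm_zero_iff LIM_zero_iff)
qed

context path_measure
begin

text \<open>Rational times suffice because of weak lower semicontinuity: a bound on the norm at
  rational times arbitrarily close to t holds at t.\<close>

lemma right_norm_bounded_iff:
  assumes I: "is_interval I" and l: "left_endpoint I t0" and v: "v \<in> paths S I"
  shows "v \<in> right_norm_bounded t0 \<longleftrightarrow> (v \<longlongrightarrow> v t0) (at t0 within I)"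
proof
  have c: "continuous_map (top_of_set I) (H_weak S) v" using v by (simp add: paths_def)
  have t0: "t0 \<in> I" and ge: "\<And>t. t \<in> I \<Longrightarrow> t0 \<le> t" using l by (auto simp: left_endpoint_def)
  {
    assume "(v \<longlongrightarrow> v t0) (at t0 within I)"
    then have n: "((\<lambda>t. norm (v t)) \<longlongrightarrow> norm (v t0)) (at t0 within I)" by (rule tendsto_norm)
    have "\<exists>n::nat. \<forall>q\<in>\<rat>. q \<in> I \<and> t0 < q \<and> q < t0 + inverse (real (Suc n)) \<longrightarrow> norm (v q) \<le> norm (v t0) + inverse (real (Suc k))" for k :: nat
    proof -
      have "eventually (\<lambda>t. norm (v t) < norm (v t0) + inverse (real (Suc k))) (at t0 within I)"
        by (rule order_tendstoD(2)[OF n]) simp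
      then obtain d where d: "0 < d" "\<And>t. t \<in> I \<Longrightarrow> t \<noteq> t0 \<Longrightarrow> dist t t0 < d \<Longrightarrow> norm (v t) < norm (v t0) + inverse (real (Suc k))"
        unfolding eventually_at by blast
      obtain n where n: "inverse (real (Suc n)) < d" using reals_Archimedean[OF d(1)] by blast
      have "norm (v q) \<le> norm (v t0) + inverse (real (Suc k))" if "q \<in> I" "t0 < q" "q < t0 + inverse (real (Suc n))" for q
        using d(2)[of q] that n by (simp add: dist_real_def less_imp_le)
      then show ?thesis by blast
    qed
    then show "v \<in> right_norm_bounded t0" using v by (simp add: right_norm_bounded_def space_rho)
  next
    assume r: "v \<in> right_norm_bounded t0"
    show "(v \<longlongrightarrow> v t0) (at t0 within I)"
    proof (rule norm_tendsto_imp_tendsto[OF c t0])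
      fix \<epsilon> :: real assume "0 < \<epsilon>"
      then obtain k :: nat where k: "inverse (real (Suc k)) < \<epsilon>" using reals_Archimedean by blast
      obtain n :: nat where n: "\<And>q. q \<in> \<rat> \<Longrightarrow> q \<in> I \<Longrightarrow> t0 < q \<Longrightarrow> q < t0 + inverse (real (Suc n))
          \<Longrightarrow> norm (v q) \<le> norm (v t0) + inverse (real (Suc k))"
        using r unfolding right_norm_bounded_def by blast
      have "norm (v t) < norm (v t0) + \<epsilon>" if t: "t \<in> I" "t \<noteq> t0" "dist t t0 < inverse (real (Suc n))" for t
      proof -
        have tt: "t0 < t" "t < t0 + inverse (real (Suc n))" using t ge[of t] by (auto simp: dist_real_def)
        have "norm (v t) \<le> norm (v t0) + inverse (real (Suc k))"
        proof (rule weak_norm_le_of_frequently[OF c t(1)])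
          show "frequently (\<lambda>s. norm (v s) \<le> norm (v t0) + inverse (real (Suc k))) (at t within I)"
            unfolding frequently_def eventually_at
          proof clarify
            fix d :: real assume d: "0 < d" "\<forall>x\<in>I. x \<noteq> t \<and> dist x t < d \<longrightarrow> \<not> norm (v x) \<le> norm (v t0) + inverse (real (Suc k))"
            have "max t0 (t - d) < t" using tt d(1) by simp
            then obtain q where q: "q \<in> \<rat>" "max t0 (t - d) < q" "q < t" using Rats_dense_in_real by blast
            have qI: "q \<in> I" using I t0 t(1) q unfolding is_interval_1 by (meson less_imp_le max_less_iff_conj)
            have "norm (v q) \<le> norm (v t0) + inverse (real (Suc k))"
              using q qI tt by (intro n) auto
            moreover have "q \<noteq> t \<and> dist q t < d" using q by (auto simp: dist_real_def)
            ultimately show False using d(2) qI by blast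
          qed
        qed
        then show ?thesis using k by linarith
      qed
      then show "eventually (\<lambda>t. norm (v t) < norm (v t0) + \<epsilon>) (at t0 within I)"
        unfolding eventually_at by (intro exI[of _ "inverse (real (Suc n))"]) auto
    qed
  }
qed

end

section \<open>Right continuity almost surely\<close>

text \<open>Bounded, so that its integral against a probability measure is finite, and strictly
  increasing, so that inequalities between its values can be read back as inequalities between
  norms.\<close>

definition saturation :: "real \<Rightarrow> real" where
  "saturation x = x / (1 + x)"

lemma saturation_strict_mono: "0 \<le> x \<Longrightarrow> x < y \<Longrightarrow> saturation x < saturation y"
  by (simp add: saturation_def field_simps)

lemma saturation_mono: "0 \<le> x \<Longrightarrow> x \<le> y \<Longrightarrow> saturation x \<le> saturation y"
  using saturation_strict_mono[of x y] by (cases "x = y") auto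

lemma saturation_bounds: "0 \<le> x \<Longrightarrow> 0 \<le> saturation x \<and> saturation x < 1"
  by (simp add: saturation_def)

lemma admissible_saturation: "admissible_psi saturation"
  unfolding admissible_psi_def
proof (intro conjI exI[of _ "\<lambda>x. 1 / (1 + x)\<^sup>2"])
  show "\<forall>x\<ge>0. 0 \<le> saturation x" using saturation_bounds by blast
  show "mono_on {0..} saturation" by (intro mono_onI saturation_mono) auto
  show "\<forall>x\<ge>0. (saturation has_real_derivative 1 / (1 + x)\<^sup>2) (at x within {0..})"
  proof (intro allI impI)
    fix x :: real assume "0 \<le> x"
    then have "((\<lambda>x. x / (1 + x)) has_real_derivative 1 / (1 + x)\<^sup>2) (at x)"
      by (auto intro!: derivative_eq_intros simp: power2_eq_square)
    then show "(saturation has_real_derivative 1 / (1 + x)\<^sup>2) (at x within {0..})"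
      unfolding saturation_def[abs_def] by (rule has_field_derivative_at_within)
  qed
  show "continuous_on {0..} (\<lambda>x::real. 1 / (1 + x)\<^sup>2)"
    by (intro continuous_intros) auto
  show "bounded ((\<lambda>x::real. 1 / (1 + x)\<^sup>2) ` {0..})"
    unfolding bounded_iff by (intro exI[of _ 1]) (auto simp: divide_le_eq_1)
qed

lemma (in path_measure) AE_carried:
  assumes "carried_by \<rho> E"
  shows "AE v in \<rho>. v \<in> E"
proof -
  have "E \<in> sets \<rho>" "emeasure \<rho> (space \<rho> - E) = 0" using assms by (auto simp: carried_by_def)
  then show ?thesis by (intro AE_I[of _ _ "space \<rho> - E"]) auto
qed

text \<open>\<open>G\<close>, the lower limit of the averages \<open>A n\<close>, is never below the
  value of \<open>g\<close> at t0, while Fatou's lemma and the limit hypothesis keep its integral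
  from exceeding that of \<open>g\<close>; so the two agree almost surely. For such a path, good
  times with norm below |v t0| + \<epsilon>/2 exist arbitrarily close to t0, and
  \<open>norm_growth\<close> carries their bound to the later times.\<close>

lemma (in path_measure) AE_right_continuous:
  fixes \<nu> :: real
  assumes nu: "0 < \<nu>" and I: "is_interval I" and f: "f \<in> L_infinity (space_H S) norm I"
    and l: "left_endpoint I t0" and carried: "carried_by \<rho> (solutions_sharp \<nu> S f I)"
    and lim: "((\<lambda>t. \<integral>\<^sup>+ u \<in> solutions_sharp \<nu> S f I. ennreal (saturation ((norm (u t))\<^sup>2)) \<partial>\<rho>)
      \<longlongrightarrow> (\<integral>\<^sup>+ u \<in> solutions_sharp \<nu> S f I. ennreal (saturation ((norm (u t0))\<^sup>2)) \<partial>\<rho>)) (at t0 within I)"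
  shows "AE v in \<rho>. (v \<longlongrightarrow> v t0) (at t0 within I)"
proof (cases "\<exists>t1\<in>I. t0 < t1")
  case False
  \<comment> \<open>I reduces to the point t0, where the limit within I is trivial.\<close>
  then have "I \<subseteq> {t0}" using l by (fastforce simp: left_endpoint_def)
  then have "(v \<longlongrightarrow> v t0) (at t0 within I)" for v :: "real \<Rightarrow> L2_field"
    unfolding tendsto_iff eventually_at by (intro allI impI exI[of _ 1]) auto
  then show ?thesis by simp
next
  case True
  then obtain t1 where t1: "t1 \<in> I" "t0 < t1" by blast
  have t0: "t0 \<in> I" and ge: "\<And>t. t \<in> I \<Longrightarrow> t0 \<le> t" using l by (auto simp: left_endpoint_def)
  let ?sharp = "solutions_sharp \<nu> S f I"
  define h where "h n = (t1 - t0) / real (Suc n)" for n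
  have h: "0 < h n" "h n \<le> t1 - t0" for n
    using t1(2) divide_left_mono[of 1 "real (Suc n)" "t1 - t0"] by (simp_all add: h_def)
  have h0: "h \<longlonglongrightarrow> 0" unfolding h_def by (rule LIMSEQ_Suc[OF lim_const_over_n])
  define J where "J n = {t0<..<t0 + h n}" for n
  have JI: "J n \<subseteq> I" for n
  proof
    fix t assume t: "t \<in> J n"
    then have "t0 \<le> t" "t \<le> t1" using h(2)[of n] by (auto simp: J_def)
    then show "t \<in> I" using I t0 t1(1) unfolding is_interval_1 by blast
  qed
  have Jev: "eventually (\<lambda>n. \<forall>t\<in>J n. P t) sequentially" if ev: "eventually P (at t0 within I)" for P
  proof -
    obtain d where d: "0 < d" "\<And>t. t \<in> I \<Longrightarrow> t \<noteq> t0 \<Longrightarrow> dist t t0 < d \<Longrightarrow> P t"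
      using ev unfolding eventually_at by blast
    from order_tendstoD(2)[OF h0 d(1)] show ?thesis
    proof eventually_elim
      case (elim n)
      show ?case
      proof
        fix t assume t: "t \<in> J n"
        then have "t0 < t" "t < t0 + h n" by (auto simp: J_def)
        then have "t \<noteq> t0" "dist t t0 < d" using elim by (auto simp: dist_real_def)
        then show "P t" using d(2) JI t by blast
      qed
    qed
  qed
  have emJ: "emeasure lborel (J n) = ennreal (h n)" for n
    unfolding J_def using h(1)[of n] by simp
  define c where "c n = ennreal (1 / h n)" for n
  have ch: "c n * ennreal (h n) = 1" for n
    unfolding c_def using h(1)[of n] by (simp flip: ennreal_mult)
  \<comment> \<open>Tonelli's theorem needs a function measurable in time and path together.
    \<open>F\<close> is one on the whole product and equals the squared norm at times of I, which is
    why the averages run over \<open>J n\<close>, inside I.\<close>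
  obtain F where F[measurable]: "F \<in> borel_measurable (lborel \<Otimes>\<^sub>M \<rho>)"
    and Feq: "\<And>t v. t \<in> I \<Longrightarrow> t0 \<le> t \<Longrightarrow> v \<in> paths S I \<Longrightarrow> F (t, v) = (norm (v t))\<^sup>2"
    by (rule norm_square_jointly_measurable[OF I t0]) (rule that)
  define g where "g p = ennreal (saturation (F p))" for p
  have g[measurable]: "g \<in> borel_measurable (lborel \<Otimes>\<^sub>M \<rho>)"
    unfolding g_def[abs_def] saturation_def by measurable
  have geq: "g (t, v) = ennreal (saturation ((norm (v t))\<^sup>2))" if "t \<in> I" "v \<in> paths S I" for t v
    using Feq[OF that(1) ge[OF that(1)] that(2)] by (simp add: g_def)
  interpret P: pair_sigma_finite lborel \<rho> ..
  have sharp: "AE v in \<rho>. v \<in> ?sharp" by (rule AE_carried[OF carried])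
  have sharp_paths: "?sharp \<subseteq> paths S I" by (auto simp: solutions_sharp_def)
  define E where "E t = (\<integral>\<^sup>+ u \<in> ?sharp. ennreal (saturation ((norm (u t))\<^sup>2)) \<partial>\<rho>)" for t
  have Eeq: "(\<integral>\<^sup>+v. g (t, v) \<partial>\<rho>) = E t" if "t \<in> I" for t
    unfolding E_def
  proof (rule nn_integral_cong_AE)
    show "AE v in \<rho>. g (t, v) = ennreal (saturation ((norm (v t))\<^sup>2)) * indicator ?sharp v"
      using sharp
    proof eventually_elim
      case (elim v)
      then have "v \<in> paths S I" using sharp_paths by blast
      then show ?case using geq[OF that] elim by simp
    qed
  qed
  define A where "A n v = c n * (\<integral>\<^sup>+t. indicator (J n) t * g (t, v) \<partial>lborel)" for n v
  have J_sets[measurable]: "J n \<in> sets borel" for n by (simp add: J_def)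
  have A_meas[measurable]: "A n \<in> borel_measurable \<rho>" for n
    unfolding A_def[abs_def] by measurable
  define G where "G v = liminf (\<lambda>n. A n v)" for v
  have G_meas[measurable]: "G \<in> borel_measurable \<rho>" unfolding G_def[abs_def] by measurable
  have A_lower: "y \<le> A n v" if "AE t in lborel. t \<in> J n \<longrightarrow> y \<le> g (t, v)" for y n v
  proof -
    have "y = c n * (\<integral>\<^sup>+t. y * indicator (J n) t \<partial>lborel)"
      using ch[of n] by (simp add: emJ mult.left_commute[of y] mult.assoc[symmetric] nn_integral_cmult_indicator)
        (metis ch mult.assoc mult.commute mult.right_neutral)
    also have "\<dots> \<le> A n v"
      unfolding A_def
    proof (intro mult_left_mono nn_integral_mono_AE)
      show "AE t in lborel. y * indicator (J n) t \<le> indicator (J n) t * g (t, v)"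
        using that by eventually_elim (simp add: indicator_def)
    qed simp
    finally show ?thesis .
  qed
  \<comment> \<open>By Tonelli's theorem the expectation of the time average is the time average of
    the expectation \<open>E t\<close>, about which the limit hypothesis speaks.\<close>
  have int_A: "(\<integral>\<^sup>+v. A n v \<partial>\<rho>) = c n * (\<integral>\<^sup>+t. indicator (J n) t * E t \<partial>lborel)" for n
  proof -
    have "(\<integral>\<^sup>+v. A n v \<partial>\<rho>) = c n * (\<integral>\<^sup>+v. \<integral>\<^sup>+t. indicator (J n) t * g (t, v) \<partial>lborel \<partial>\<rho>)"
      unfolding A_def by (rule nn_integral_cmult) measurable
    also have "(\<integral>\<^sup>+v. \<integral>\<^sup>+t. indicator (J n) t * g (t, v) \<partial>lborel \<partial>\<rho>)
        = (\<integral>\<^sup>+t. \<integral>\<^sup>+v. indicator (J n) t * g (t, v) \<partial>\<rho> \<partial>lborel)"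
      by (rule P.Fubini') measurable
    also have "\<dots> = (\<integral>\<^sup>+t. indicator (J n) t * E t \<partial>lborel)"
    proof (rule nn_integral_cong)
      fix t
      have "(\<integral>\<^sup>+v. indicator (J n) t * g (t, v) \<partial>\<rho>) = indicator (J n) t * (\<integral>\<^sup>+v. g (t, v) \<partial>\<rho>)"
        by (rule nn_integral_cmult) measurable
      then show "(\<integral>\<^sup>+v. indicator (J n) t * g (t, v) \<partial>\<rho>) = indicator (J n) t * E t"
        using Eeq[of t] JI[of n] by (cases "t \<in> J n") auto
    qed
    finally show ?thesis .
  qed
  have "(\<integral>\<^sup>+v. G v \<partial>\<rho>) \<le> liminf (\<lambda>n. \<integral>\<^sup>+v. A n v \<partial>\<rho>)"
    unfolding G_def by (rule nn_integral_liminf) measurable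
  also have "\<dots> \<le> E t0"
  proof (rule ccontr)
    assume "\<not> liminf (\<lambda>n. \<integral>\<^sup>+v. A n v \<partial>\<rho>) \<le> E t0"
    then obtain a where a: "E t0 < a" "a < liminf (\<lambda>n. \<integral>\<^sup>+v. A n v \<partial>\<rho>)"
      using dense not_le by metis
    have "eventually (\<lambda>t. E t < a) (at t0 within I)"
      using lim a(1) unfolding E_def by (rule order_tendstoD(2))
    from Jev[OF this] have "eventually (\<lambda>n. (\<integral>\<^sup>+v. A n v \<partial>\<rho>) \<le> a) sequentially"
    proof eventually_elim
      case (elim n)
      have "(\<integral>\<^sup>+v. A n v \<partial>\<rho>) \<le> c n * (\<integral>\<^sup>+t. a * indicator (J n) t \<partial>lborel)"
        unfolding int_A using elim
        by (intro mult_left_mono nn_integral_mono) (auto simp: indicator_def less_imp_le)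
      also have "\<dots> = c n * (a * ennreal (h n))" by (simp add: emJ nn_integral_cmult_indicator)
      also have "\<dots> = a" using ch[of n] by (metis mult.assoc mult.commute mult.right_neutral)
      finally show ?case .
    qed
    then have "liminf (\<lambda>n. \<integral>\<^sup>+v. A n v \<partial>\<rho>) \<le> liminf (\<lambda>n. a)" by (rule Liminf_mono)
    also have "liminf (\<lambda>n. a) = a" by (rule Liminf_const) simp
    finally show False using a(2) by simp
  qed
  finally have GE: "(\<integral>\<^sup>+v. G v \<partial>\<rho>) \<le> (\<integral>\<^sup>+v. g (t0, v) \<partial>\<rho>)" using Eeq[OF t0] by simp
  have HG: "g (t0, v) \<le> G v" if v: "v \<in> paths S I" for v
  proof (rule dense_le)
    fix y assume y: "y < g (t0, v)"
    define N0 where "N0 = norm (v t0)"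
    have "y < ennreal (saturation (N0\<^sup>2))" using y geq[OF t0 v] by (simp add: N0_def)
    then obtain y' where y': "y = ennreal y'" "0 \<le> y'" "y' < saturation (N0\<^sup>2)"
      by (cases y) (auto simp: ennreal_less_iff)
    have y1: "y' < 1" using y'(3) saturation_bounds[of "N0\<^sup>2"] by simp
    \<comment> \<open>The square root of the inverse of \<open>saturation\<close> at y', so that
      \<open>saturation\<close> takes the value y' at r^2; it exists because y' < 1.\<close>
    define r where "r = sqrt (y' / (1 - y'))"
    have r2: "r\<^sup>2 = y' / (1 - y')" and r0: "0 \<le> r" using y'(2) y1 by (auto simp: r_def)
    have sr: "saturation (r\<^sup>2) = y'" unfolding r2 saturation_def using y1 by (simp add: field_simps)
    have "r < N0"
    proof (rule ccontr)
      assume "\<not> r < N0"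
      then have "N0\<^sup>2 \<le> r\<^sup>2" using norm_ge_zero[of "v t0"] by (intro power_mono) (auto simp: N0_def)
      then show False using saturation_mono[of "N0\<^sup>2" "r\<^sup>2"] sr y'(3) by simp
    qed
    then have "eventually (\<lambda>t. r < norm (v t)) (at t0 within I)"
      using v t0 by (intro weak_continuous_norm_lower[where S=S]) (auto simp: N0_def paths_def)
    from Jev[OF this] have "eventually (\<lambda>n. y \<le> A n v) sequentially"
    proof eventually_elim
      case (elim n)
      have "y \<le> g (t, v)" if t: "t \<in> J n" for t
      proof -
        have "r\<^sup>2 \<le> (norm (v t))\<^sup>2" using elim t r0 by (intro power_mono) (auto intro: less_imp_le)
        then have "y' \<le> saturation ((norm (v t))\<^sup>2)" using saturation_mono[of "r\<^sup>2"] sr by simp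
        moreover have "t \<in> I" using JI t by blast
        ultimately show ?thesis using geq[of t v] v y'(1) by (simp add: ennreal_leI)
      qed
      then show ?case by (intro A_lower) simp
    qed
    then show "y \<le> G v" unfolding G_def by (rule Liminf_bounded)
  qed
  have "AE v in \<rho>. G v \<le> g (t0, v)"
  proof -
    have gm: "(\<lambda>v. g (t0, v)) \<in> borel_measurable \<rho>" by measurable
    have gfin: "(\<integral>\<^sup>+v. g (t0, v) \<partial>\<rho>) \<noteq> \<infinity>"
    proof -
      have "(\<integral>\<^sup>+v. g (t0, v) \<partial>\<rho>) \<le> (\<integral>\<^sup>+v. 1 \<partial>\<rho>)"
      proof (rule nn_integral_mono)
        fix v assume "v \<in> space \<rho>"
        then have "g (t0, v) = ennreal (saturation ((norm (v t0))\<^sup>2))" using geq[OF t0] by (simp add: space_rho)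
        also have "\<dots> \<le> ennreal 1" using saturation_bounds[of "(norm (v t0))\<^sup>2"] by (intro ennreal_leI) simp
        finally show "g (t0, v) \<le> 1" by simp
      qed
      also have "\<dots> = 1" by (simp add: emeasure_space_1)
      finally show ?thesis by (auto simp: top_unique)
    qed
    \<comment> \<open>A nonnegative function with integral 0 vanishes almost everywhere. Subtracting
      the integrals in \<open>ennreal\<close> is legitimate because that of \<open>g\<close> at t0
      is finite.\<close>
    have "(\<integral>\<^sup>+v. (G v - g (t0, v)) \<partial>\<rho>) = (\<integral>\<^sup>+v. G v \<partial>\<rho>) - (\<integral>\<^sup>+v. g (t0, v) \<partial>\<rho>)"
      using HG by (intro nn_integral_diff G_meas gm gfin AE_I2) (simp add: space_rho)
    also have "\<dots> = 0"
    proof -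
      have "(\<integral>\<^sup>+v. G v \<partial>\<rho>) < \<infinity>" using GE gfin by (simp add: less_top le_less_trans)
      then show ?thesis using GE by (simp add: diff_eq_0_iff_ennreal)
    qed
    finally have "AE v in \<rho>. G v - g (t0, v) = 0"
      by (subst (asm) nn_integral_0_iff_AE) (auto intro!: borel_measurable_minus_ennreal G_meas gm)
    then show ?thesis
    proof eventually_elim
      case (elim v)
      then show ?case by (rule ennreal_minus_eq_0)
    qed
  qed
  with sharp show ?thesis
  proof eventually_elim
    case (elim v)
    have v: "v \<in> paths S I" using elim sharp_paths by blast
    interpret interior_solution \<nu> S I f v
      using elim(1) nu S I f by unfold_locales (auto simp: solutions_sharp_def)
    obtain C where C: "0 \<le> C" "AE t in lebesgue. t \<in> I \<longrightarrow> norm (f t) \<le> C" by (rule f_bound)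
    show ?case
    proof (rule norm_tendsto_imp_tendsto[OF cont t0])
      fix \<epsilon> :: real assume e: "0 < \<epsilon>"
      define N1 where "N1 = norm (v t0) + \<epsilon> / 2"
      \<comment> \<open>Half of \<epsilon> is spent on the norm at the starting time, in
        \<open>N1\<close>, the other half on the growth 2 C \<eta>. The denominator 4 C + 4 is
        positive also for C = 0.\<close>
      define \<eta> where "\<eta> = \<epsilon> / (4 * C + 4)"
      have eta: "0 < \<eta>" "2 * C * \<eta> < \<epsilon> / 2"
        using e C(1) by (auto simp: \<eta>_def field_simps add_pos_nonneg)
      have "norm (v t) < norm (v t0) + \<epsilon>" if t: "t \<in> I" "t \<noteq> t0" "dist t t0 < min \<eta> (t1 - t0)" for t
      proof -
        have tt: "t0 < t" "t < t0 + \<eta>" "t < t1" using t ge[of t] by (auto simp: dist_real_def)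
        have tI: "t \<in> interior I" using Ioo_interior[OF t0 t1(1)] tt by auto
        \<comment> \<open>Otherwise almost every time between t0 and t has norm at least
          \<open>N1\<close>, the averages are eventually at least the saturation of N1^2, and
          \<open>G\<close> exceeds the value of \<open>g\<close> at t0.\<close>
        have "\<exists>s. t0 < s \<and> s < t \<and> good s \<and> norm (v s) < N1"
        proof (rule ccontr)
          assume n: "\<nexists>s. t0 < s \<and> s < t \<and> good s \<and> norm (v s) < N1"
          have "0 < t - t0" using tt by simp
          from order_tendstoD(2)[OF h0 this]
          have "eventually (\<lambda>n. ennreal (saturation (N1\<^sup>2)) \<le> A n v) sequentially"
          proof eventually_elim
            case (elim n)
            have "AE s in lebesgue. s \<in> interior I \<longrightarrow> good s"
              using AE_good by (simp add: AE_lebesgue_on_iff[OF I_lebesgue(2)])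
            then have "AE s in lborel. s \<in> interior I \<longrightarrow> good s" by (simp add: AE_completion_iff)
            then have "AE s in lborel. s \<in> J n \<longrightarrow> ennreal (saturation (N1\<^sup>2)) \<le> g (s, v)"
            proof eventually_elim
              case (elim s)
              show ?case
              proof
                assume s: "s \<in> J n"
                then have st: "t0 < s" "s < t" using \<open>h n < t - t0\<close> by (auto simp: J_def)
                then have "s \<in> interior I" using Ioo_interior[OF t0 t1(1)] tt by auto
                then have "N1 \<le> norm (v s)" using elim st n by (auto simp: not_less)
                then have "N1\<^sup>2 \<le> (norm (v s))\<^sup>2" using e by (intro power_mono) (auto simp: N1_def)
                then have "saturation (N1\<^sup>2) \<le> saturation ((norm (v s))\<^sup>2)" by (intro saturation_mono) auto
                moreover have "s \<in> I" using JI s by blast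
                ultimately show "ennreal (saturation (N1\<^sup>2)) \<le> g (s, v)"
                  using geq[of s v] v by (simp add: ennreal_leI)
              qed
            qed
            then show ?case by (rule A_lower)
          qed
          then have "ennreal (saturation (N1\<^sup>2)) \<le> G v" unfolding G_def by (rule Liminf_bounded)
          also have "G v \<le> g (t0, v)" by (rule elim(2))
          also have "g (t0, v) = ennreal (saturation ((norm (v t0))\<^sup>2))" by (rule geq[OF t0 v])
          finally have "saturation (N1\<^sup>2) \<le> saturation ((norm (v t0))\<^sup>2)"
            using saturation_bounds[of "(norm (v t0))\<^sup>2"] by simp
          moreover have "(norm (v t0))\<^sup>2 < N1\<^sup>2"
            using e by (intro power_strict_mono) (auto simp: N1_def)
          then have "saturation ((norm (v t0))\<^sup>2) < saturation (N1\<^sup>2)" by (intro saturation_strict_mono) auto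
          ultimately show False by simp
        qed
        then obtain s where s: "t0 < s" "s < t" "good s" "norm (v s) < N1" by blast
        have "norm (v t) \<le> norm (v s) + 2 * C * (t - s)" by (rule norm_growth[OF s(3) tI s(2) C])
        also have "2 * C * (t - s) \<le> 2 * C * \<eta>" using C(1) s tt by (intro mult_left_mono) auto
        finally show ?thesis using s(4) eta(2) by (simp add: N1_def)
      qed
      then show "eventually (\<lambda>t. norm (v t) < norm (v t0) + \<epsilon>) (at t0 within I)"
        unfolding eventually_at using eta(1) t1(2) by (intro exI[of _ "min \<eta> (t1 - t0)"]) auto
    qed
  qed
qed

section \<open>Comparison of the two solution sets and conclusion\<close>

lemma solutions_iff:
  assumes nu: "0 < \<nu>" and S: "valid_setting S" and I: "is_interval I" and f: "f \<in> L_infinity (space_H S) norm I"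
  shows "v \<in> solutions \<nu> S f I \<longleftrightarrow>
    v \<in> solutions_sharp \<nu> S f I \<and> (\<forall>t0. left_endpoint I t0 \<longrightarrow> (v \<longlongrightarrow> v t0) (at t0 within I))"
proof
  assume v: "v \<in> solutions \<nu> S f I"
  then have "weak_solution \<nu> S f (interior I) v"
    by (auto simp: solutions_def intro: weak_solution_interior[OF I])
  then show "v \<in> solutions_sharp \<nu> S f I \<and> (\<forall>t0. left_endpoint I t0 \<longrightarrow> (v \<longlongrightarrow> v t0) (at t0 within I))"
    using v by (simp add: solutions_def solutions_sharp_def weak_solution_def)
next
  assume v: "v \<in> solutions_sharp \<nu> S f I \<and> (\<forall>t0. left_endpoint I t0 \<longrightarrow> (v \<longlongrightarrow> v t0) (at t0 within I))"
  then interpret right_continuous_solution \<nu> S I f v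
    using nu S I f by unfold_locales (auto simp: solutions_sharp_def)
  show "v \<in> solutions \<nu> S f I" using weak_solution_closed u by (simp add: solutions_def)
qed

theorem theorem4p1:
  fixes \<nu> :: real and S :: setting and I :: "real set"
    and f :: "real \<Rightarrow> L2_field" and \<rho> :: "(real \<Rightarrow> L2_field) measure"
  assumes "\<nu> > 0" and "valid_setting S"
    and "is_interval I"
    and "f \<in> L_infinity (space_H S) norm I"
    and "Vishik_Fursikov_measure \<nu> S f I \<rho>"
  shows "carried_by \<rho> (solutions \<nu> S f I)"
proof -
  have carried: "carried_by \<rho> (solutions_sharp \<nu> S f I)"
    using assms(5) unfolding Vishik_Fursikov_measure_def by (elim conjE)
  have borel: "borel_probability (path_topology S I) \<rho>"
    using assms(5) unfolding Vishik_Fursikov_measure_def by (elim conjE)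
  interpret path_measure S I \<rho>
    by (rule path_measure.intro[OF assms(2) borel])
  note iff = solutions_iff[OF assms(1-4)]
  show ?thesis
  proof (cases "\<exists>t0. left_endpoint I t0")
    case False
    then have "solutions \<nu> S f I = solutions_sharp \<nu> S f I" using iff by blast
    then show ?thesis using carried by simp
  next
    case True
    then obtain t0 where l: "left_endpoint I t0" by blast
    then have t0: "t0 \<in> I" by (simp add: left_endpoint_def)
    have unique: "t = t0" if "left_endpoint I t" for t
      using that l unfolding left_endpoint_def by (intro antisym) blast+
    \<comment> \<open>\<open>carried_by\<close> includes measurability of \<open>solutions\<close>,
      which its definition does not show; the intersection with the countably encoded set supplies
      it.\<close>
    have eq: "solutions \<nu> S f I = solutions_sharp \<nu> S f I \<inter> right_norm_bounded t0"
    proof (intro set_eqI)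
      fix v
      show "v \<in> solutions \<nu> S f I \<longleftrightarrow> v \<in> solutions_sharp \<nu> S f I \<inter> right_norm_bounded t0"
      proof (cases "v \<in> paths S I")
        case True
        have "(\<forall>t. left_endpoint I t \<longrightarrow> (v \<longlongrightarrow> v t) (at t within I)) \<longleftrightarrow> (v \<longlongrightarrow> v t0) (at t0 within I)"
          using l unique by blast
        then show ?thesis
          unfolding iff right_norm_bounded_iff[OF assms(3) l True] Int_iff by simp
      next
        case False
        then show ?thesis by (simp add: solutions_def solutions_sharp_def)
      qed
    qed
    have sets: "solutions \<nu> S f I \<in> sets \<rho>"
      unfolding eq using carried right_norm_bounded_sets[OF t0] by (auto simp: carried_by_def)
    have "AE v in \<rho>. (v \<longlongrightarrow> v t0) (at t0 within I)"
    proof (rule AE_right_continuous[OF assms(1,3,4) l carried])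
      show "((\<lambda>t. \<integral>\<^sup>+ u \<in> solutions_sharp \<nu> S f I. ennreal (saturation ((norm (u t))\<^sup>2)) \<partial>\<rho>)
          \<longlongrightarrow> (\<integral>\<^sup>+ u \<in> solutions_sharp \<nu> S f I. ennreal (saturation ((norm (u t0))\<^sup>2)) \<partial>\<rho>)) (at t0 within I)"
        using assms(5) l admissible_saturation unfolding Vishik_Fursikov_measure_def Let_def by blast
    qed
    with AE_carried[OF carried] have "AE v in \<rho>. v \<in> solutions \<nu> S f I"
    proof eventually_elim
      case (elim v)
      then show ?case using iff unique by blast
    qed
    then have "emeasure \<rho> (space \<rho> - solutions \<nu> S f I) = 0"
      using sets by (subst AE_iff_measurable[symmetric, where P="\<lambda>v. v \<in> solutions \<nu> S f I"]) auto
    then show ?thesis using sets by (simp add: carried_by_def)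
  qed
qed

end
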